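(* Let $\mathcal{O}\subset\mathbb{R}^3$ be a Poincaré domain as in the context, $\chi\ge0$, $v_0\in\mathbb{H}$, $f\in\mathbb{H}^{-1}(\mathcal{O})$ and $Z\in L^2_{\rm loc}([0,\infty);\mathbb{H}\cap\mathbb{L}^4(\mathcal{O}))$. Then there exists a unique weak solution $v$ of $$\frac{dv}{dt}=-\nu Av-B_N(v+Z)+\chi Z+\mathcal{P}f,\qquad v(0)=v_0,$$ that is, a unique function $v\in C([0,\infty);\mathbb{H})\cap L^2_{\rm loc}(0,\infty;\mathbb{V})$ with $\frac{dv}{dt}\in L^2_{\rm loc}(0,\infty;\mathbb{V}')$, $v(0)=v_0$ in $\mathbb{H}$, and, for every $\psi\in\mathbb{V}$, $$\Big\langle\frac{dv(t)}{dt},\psi\Big\rangle=-\langle\nu Av(t)+B_N(v(t)+Z(t))-\chi Z(t)-f,\psi\rangle\quad\text{for a.e. }t\in[0,\infty).$$ Moreover, for every $0<T<\infty$ and all $t\in[0,T]$, the energy equality holds: $$\|v(t)\|_{\mathbb{H}}^2+2\nu\int_0^t\|v(s)\|_{\mathbb{V}}^2ds+2\int_0^t\langle B_N(v(s)+Z(s)),v(s)\rangle ds=\|v_0\|_{\mathbb{H}}^2+2\int_0^t\langle f,v(s)\rangle ds+2\chi\int_0^t(Z(s),v(s))ds.$$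
   Context: $\mathcal{O}\subset\mathbb{R}^3$ is open, connected and unbounded, with boundary uniformly of class $\mathrm{C}^3$, and there is $\lambda>0$ with $\lambda\int_{\mathcal{O}}|\psi|^2dx\le\int_{\mathcal{O}}|\nabla\psi|^2dx$ for all $\psi\in\mathbb{H}^1_0(\mathcal{O})$. The constants $\nu>0$, $N>0$ are fixed. $\mathbb{L}^p(\mathcal{O})=L^p(\mathcal{O};\mathbb{R}^3)$, $\mathbb{H}^1_0(\mathcal{O})=H^1_0(\mathcal{O};\mathbb{R}^3)$ with dual $\mathbb{H}^{-1}(\mathcal{O})$. $\mathbb{H}$ and $\mathbb{V}$ are the closures of $\{u\in C_0^\infty(\mathcal{O};\mathbb{R}^3):\nabla\cdot u=0\}$ in $\mathbb{L}^2(\mathcal{O})$ and $\mathbb{H}^1_0(\mathcal{O})$, with norms $\|u\|_{\mathbb{H}}=\|u\|_{\mathbb{L}^2}$, $\|u\|_{\mathbb{V}}=\|\nabla u\|_{\mathbb{L}^2}$; $\mathbb{V}\subset\mathbb{H}\cong\mathbb{H}'\subset\mathbb{V}'$ with duality $\langle\cdot,\cdot\rangle$ and $\mathbb{H}$-inner product $(\cdot,\cdot)$. For $f\in\mathbb{H}^{-1}(\mathcal{O})$, $\mathcal{P}f\in\mathbb{V}'$ denotes the restriction of $f$ to $\mathbb{V}$. $A:\mathbb{V}\to\mathbb{V}'$ is the Stokes operator, $\langle Au,v\rangle=\int_{\mathcal{O}}\nabla u:\nabla v\,dx$. $b(u,v,w)=\sum_{i,j=1}^3\int_{\mathcal{O}}u_i\,\partial_{x_i}v_j\,w_j\,dx$;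 $F_N(r)=\min\{1,N/r\}$ for $r>0$, $F_N(0)=1$. For $u\in\mathbb{H}\cap\mathbb{L}^4(\mathcal{O})$, $B_N(u)\in\mathbb{V}'$ is given by $\langle B_N(u),\psi\rangle=-F_N(\|u\|_{\mathbb{L}^4(\mathcal{O})})\,b(u,\psi,u)$ for $\psi\in\mathbb{V}$ (which equals $F_N(\|u\|_{\mathbb{L}^4(\mathcal{O})})\,b(u,u,\psi)$ for $u\in\mathbb{V}$). *)

theory Defs
  imports "HOL-Analysis.Analysis"
begin

text \<open>
  Elements of the function spaces below are represented by functions on the whole of
  \<open>real ^ 3\<close>, of which only the values on the domain \<open>\<Omega>\<close> matter; two of them denote the same
  element iff they agree almost everywhere on \<open>\<Omega>\<close>.
\<close>

section \<open>Classical smoothness, test functions, boundary regularity\<close>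

definition dir_deriv :: "'a::euclidean_space \<Rightarrow> ('a \<Rightarrow> 'b::real_normed_vector) \<Rightarrow> 'a \<Rightarrow> 'b" where
  "dir_deriv e f x = frechet_derivative f (at x) e"

primrec iter_partial ::
    "'a::euclidean_space list \<Rightarrow> ('a \<Rightarrow> 'b::real_normed_vector) \<Rightarrow> 'a \<Rightarrow> 'b" where
  "iter_partial [] f = f"
| "iter_partial (e # es) f = dir_deriv e (iter_partial es f)"

text \<open>To be used for open sets \<open>S\<close> only.\<close>

definition Ck_on :: "nat \<Rightarrow> 'a::euclidean_space set \<Rightarrow> ('a \<Rightarrow> 'b::real_normed_vector) \<Rightarrow> bool" where
  "Ck_on k S f \<longleftrightarrow>
     (\<forall>es \<in> lists Basis.
        (length es < k \<longrightarrow> iter_partial es f differentiable_on S) \<and>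
        (length es \<le> k \<longrightarrow> continuous_on S (iter_partial es f)))"

definition Cc_infinity ::
    "'a::euclidean_space set \<Rightarrow> ('a \<Rightarrow> 'b::real_normed_vector) set" where
  "Cc_infinity S = {\<phi>. (\<forall>k. Ck_on k UNIV \<phi>) \<and>
                       (\<exists>K. compact K \<and> K \<subseteq> S \<and> (\<forall>x. x \<notin> K \<longrightarrow> \<phi> x = 0))}"

text \<open>
  Boundary uniformly of class \<open>C\<^sup>k\<close>: in a Cartesian coordinate system \<open>y\<close> centred at any boundary
  point \<open>x0\<close> (\<open>x = x0 + Q y\<close>), the set lies strictly below, and its boundary is, the graph of a
  \<open>C\<^sup>k\<close> function \<open>h\<close>, inside a neighbourhood whose size, together with a bound for all derivatives
  of \<open>h\<close> up to order \<open>k\<close>, does not depend on \<open>x0\<close>.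
\<close>

definition uniformly_Ck_boundary :: "nat \<Rightarrow> (real ^ 3) set \<Rightarrow> bool" where
  "uniformly_Ck_boundary k S \<longleftrightarrow>
     (\<exists>a>0. \<exists>b>0. \<exists>K. \<forall>x0 \<in> frontier S.
        \<exists>(Q :: real ^ 3 \<Rightarrow> real ^ 3) (h :: real ^ 2 \<Rightarrow> real).
          orthogonal_transformation Q \<and> h 0 = 0 \<and> Ck_on k (ball 0 a) h \<and>
          (\<forall>es \<in> lists Basis. length es \<le> k \<longrightarrow>
             (\<forall>z \<in> ball 0 a. \<bar>iter_partial es h z\<bar> \<le> K)) \<and>
          (\<forall>y z. z = vector [y $ 1, y $ 2] \<and> norm z < a \<and> \<bar>y $ 3 - h z\<bar> < b \<longrightarrow>
             (x0 + Q y \<in> S \<longleftrightarrow> y $ 3 < h z) \<and>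
             (x0 + Q y \<in> frontier S \<longleftrightarrow> y $ 3 = h z)))"

section \<open>Lebesgue and Sobolev spaces\<close>

definition Lp_space ::
    "real \<Rightarrow> 'a::euclidean_space set \<Rightarrow> ('a \<Rightarrow> 'b::euclidean_space) set" where
  "Lp_space p S = {u \<in> borel_measurable (lebesgue_on S).
                     integrable (lebesgue_on S) (\<lambda>x. norm (u x) powr p)}"

definition Lp_norm ::
    "real \<Rightarrow> 'a::euclidean_space set \<Rightarrow> ('a \<Rightarrow> 'b::euclidean_space) \<Rightarrow> real" where
  "Lp_norm p S u = (LINT x|lebesgue_on S. norm (u x) powr p) powr (1 / p)"

definition L2_inner ::
    "'a::euclidean_space set \<Rightarrow> ('a \<Rightarrow> 'b::euclidean_space) \<Rightarrow> ('a \<Rightarrow> 'b) \<Rightarrow> real" where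
  "L2_inner S u w = (LINT x|lebesgue_on S. u x \<bullet> w x)"

definition loc_integrable :: "'a::euclidean_space set \<Rightarrow> ('a \<Rightarrow> real) \<Rightarrow> bool" where
  "loc_integrable S g \<longleftrightarrow> (\<forall>K. compact K \<and> K \<subseteq> S \<longrightarrow> set_integrable lebesgue K g)"

definition has_weak_partial :: "(real ^ 3) set \<Rightarrow> 3 \<Rightarrow> (real ^ 3 \<Rightarrow> real) \<Rightarrow> (real ^ 3 \<Rightarrow> real) \<Rightarrow> bool"
  where
  "has_weak_partial \<Omega> i g h \<longleftrightarrow>
     loc_integrable \<Omega> g \<and> loc_integrable \<Omega> h \<and>
     (\<forall>\<phi> \<in> Cc_infinity \<Omega>.
        (LINT x|lebesgue_on \<Omega>. g x * dir_deriv (axis i 1) \<phi> x) = - (LINT x|lebesgue_on \<Omega>. h x * \<phi> x))"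

text \<open>If a weak partial derivative exists, it is determined up to a null subset of \<open>\<Omega>\<close>.\<close>

definition weak_partial :: "(real ^ 3) set \<Rightarrow> 3 \<Rightarrow> (real ^ 3 \<Rightarrow> real) \<Rightarrow> real ^ 3 \<Rightarrow> real" where
  "weak_partial \<Omega> i g = (SOME h. has_weak_partial \<Omega> i g h)"

text \<open>
  The entry \<open>$ i $ j\<close> of the weak gradient is the \<open>i\<close>-th partial derivative of the \<open>j\<close>-th component.
  The norm and the inner product of \<open>real ^ 3 ^ 3\<close> are those of Frobenius.
\<close>

definition weak_grad :: "(real ^ 3) set \<Rightarrow> (real ^ 3 \<Rightarrow> real ^ 3) \<Rightarrow> real ^ 3 \<Rightarrow> real ^ 3 ^ 3" where
  "weak_grad \<Omega> u x = (\<chi> i j. weak_partial \<Omega> i (\<lambda>y. u y $ j) x)"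

definition H1_space :: "(real ^ 3) set \<Rightarrow> (real ^ 3 \<Rightarrow> real ^ 3) set" where
  "H1_space \<Omega> = {u \<in> Lp_space 2 \<Omega>.
                   \<forall>i j. \<exists>h \<in> Lp_space 2 \<Omega>. has_weak_partial \<Omega> i (\<lambda>x. u x $ j) h}"

definition H1_norm :: "(real ^ 3) set \<Rightarrow> (real ^ 3 \<Rightarrow> real ^ 3) \<Rightarrow> real" where
  "H1_norm \<Omega> u = sqrt ((Lp_norm 2 \<Omega> u)\<^sup>2 + (Lp_norm 2 \<Omega> (weak_grad \<Omega> u))\<^sup>2)"

definition H10_space :: "(real ^ 3) set \<Rightarrow> (real ^ 3 \<Rightarrow> real ^ 3) set" where
  "H10_space \<Omega> = {u \<in> H1_space \<Omega>.
                    \<forall>\<epsilon>>0. \<exists>\<phi> \<in> Cc_infinity \<Omega>. H1_norm \<Omega> (\<lambda>x. u x - \<phi> x) < \<epsilon>}"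

section \<open>Solenoidal spaces\<close>

definition solenoidal_test :: "(real ^ 3) set \<Rightarrow> (real ^ 3 \<Rightarrow> real ^ 3) set" where
  "solenoidal_test \<Omega> =
     {\<phi> \<in> Cc_infinity \<Omega>. \<forall>x. (\<Sum>i\<in>UNIV. dir_deriv (axis i 1) (\<lambda>y. \<phi> y $ i) x) = 0}"

definition H_space :: "(real ^ 3) set \<Rightarrow> (real ^ 3 \<Rightarrow> real ^ 3) set" where
  "H_space \<Omega> = {u \<in> Lp_space 2 \<Omega>.
                  \<forall>\<epsilon>>0. \<exists>\<phi> \<in> solenoidal_test \<Omega>. Lp_norm 2 \<Omega> (\<lambda>x. u x - \<phi> x) < \<epsilon>}"

definition V_space :: "(real ^ 3) set \<Rightarrow> (real ^ 3 \<Rightarrow> real ^ 3) set" where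
  "V_space \<Omega> = {u \<in> H10_space \<Omega>.
                  \<forall>\<epsilon>>0. \<exists>\<phi> \<in> solenoidal_test \<Omega>. H1_norm \<Omega> (\<lambda>x. u x - \<phi> x) < \<epsilon>}"

abbreviation H_norm :: "(real ^ 3) set \<Rightarrow> (real ^ 3 \<Rightarrow> real ^ 3) \<Rightarrow> real" where
  "H_norm \<Omega> u \<equiv> Lp_norm 2 \<Omega> u"

definition V_norm :: "(real ^ 3) set \<Rightarrow> (real ^ 3 \<Rightarrow> real ^ 3) \<Rightarrow> real" where
  "V_norm \<Omega> u = Lp_norm 2 \<Omega> (weak_grad \<Omega> u)"

definition HL4_norm :: "(real ^ 3) set \<Rightarrow> (real ^ 3 \<Rightarrow> real ^ 3) \<Rightarrow> real" where
  "HL4_norm \<Omega> u = Lp_norm 2 \<Omega> u + Lp_norm 4 \<Omega> u"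

section \<open>Dual spaces\<close>

text \<open>
  Continuous linear functionals on a space \<open>X\<close> of functions (mod a.e. equality) with norm \<open>N\<close>.
  Only the values on \<open>X\<close> matter. Linearity and boundedness force a functional to respect a.e. equality.
\<close>

definition dual_space ::
    "('a \<Rightarrow> 'b::real_vector) set \<Rightarrow> (('a \<Rightarrow> 'b) \<Rightarrow> real) \<Rightarrow> (('a \<Rightarrow> 'b) \<Rightarrow> real) set" where
  "dual_space X N =
     {f. (\<forall>u\<in>X. \<forall>w\<in>X. \<forall>a b. f (\<lambda>x. a *\<^sub>R u x + b *\<^sub>R w x) = a * f u + b * f w) \<and>
         (\<exists>C. \<forall>u\<in>X. \<bar>f u\<bar> \<le> C * N u)}"

definition dual_norm ::
    "('a \<Rightarrow> 'b::real_vector) set \<Rightarrow> (('a \<Rightarrow> 'b) \<Rightarrow> real) \<Rightarrow> (('a \<Rightarrow> 'b) \<Rightarrow> real) \<Rightarrow> real" where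
  "dual_norm X N f = (SUP u\<in>{u\<in>X. N u \<le> 1}. \<bar>f u\<bar>)"

abbreviation Hm1_space :: "(real ^ 3) set \<Rightarrow> ((real ^ 3 \<Rightarrow> real ^ 3) \<Rightarrow> real) set" where
  "Hm1_space \<Omega> \<equiv> dual_space (H10_space \<Omega>) (H1_norm \<Omega>)"

abbreviation V_dual :: "(real ^ 3) set \<Rightarrow> ((real ^ 3 \<Rightarrow> real ^ 3) \<Rightarrow> real) set" where
  "V_dual \<Omega> \<equiv> dual_space (V_space \<Omega>) (V_norm \<Omega>)"

abbreviation V_dual_norm :: "(real ^ 3) set \<Rightarrow> ((real ^ 3 \<Rightarrow> real ^ 3) \<Rightarrow> real) \<Rightarrow> real" where
  "V_dual_norm \<Omega> \<equiv> dual_norm (V_space \<Omega>) (V_norm \<Omega>)"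

section \<open>The operators\<close>

definition stokes ::
    "(real ^ 3) set \<Rightarrow> (real ^ 3 \<Rightarrow> real ^ 3) \<Rightarrow> (real ^ 3 \<Rightarrow> real ^ 3) \<Rightarrow> real" where
  "stokes \<Omega> u w = (LINT x|lebesgue_on \<Omega>. weak_grad \<Omega> u x \<bullet> weak_grad \<Omega> w x)"

definition trilinear ::
    "(real ^ 3) set \<Rightarrow> (real ^ 3 \<Rightarrow> real ^ 3) \<Rightarrow> (real ^ 3 \<Rightarrow> real ^ 3) \<Rightarrow> (real ^ 3 \<Rightarrow> real ^ 3) \<Rightarrow> real"
  where
  "trilinear \<Omega> u v w =
     (\<Sum>i\<in>UNIV. \<Sum>j\<in>UNIV. LINT x|lebesgue_on \<Omega>. u x $ i * weak_grad \<Omega> v x $ i $ j * w x $ j)"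

definition F_trunc :: "real \<Rightarrow> real \<Rightarrow> real" where
  "F_trunc N r = (if r > 0 then min 1 (N / r) else 1)"

definition B_trunc ::
    "(real ^ 3) set \<Rightarrow> real \<Rightarrow> (real ^ 3 \<Rightarrow> real ^ 3) \<Rightarrow> (real ^ 3 \<Rightarrow> real ^ 3) \<Rightarrow> real" where
  "B_trunc \<Omega> N u \<psi> = - F_trunc N (Lp_norm 4 \<Omega> u) * trilinear \<Omega> u \<psi> u"

section \<open>Functions of time with values in a function space\<close>

text \<open>
  Strong (Bochner) measurability on \<open>I\<close> with respect to a space \<open>X\<close> with norm \<open>N\<close>:
  almost everywhere limit, in \<open>N\<close>, of \<open>X\<close>-valued simple functions.
\<close>

definition strongly_measurable ::
    "('a \<Rightarrow> 'b::real_vector) set \<Rightarrow> (('a \<Rightarrow> 'b) \<Rightarrow> real) \<Rightarrow> real set \<Rightarrow> (real \<Rightarrow> 'a \<Rightarrow> 'b) \<Rightarrow> bool" where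
  "strongly_measurable X N I u \<longleftrightarrow>
     (AE t in lebesgue_on I. u t \<in> X) \<and>
     (\<exists>s :: nat \<Rightarrow> real \<Rightarrow> 'a \<Rightarrow> 'b.
        (\<forall>n. simple_function (lebesgue_on I) (s n) \<and> s n ` I \<subseteq> X) \<and>
        (AE t in lebesgue_on I. (\<lambda>n. N (\<lambda>x. s n t x - u t x)) \<longlonglongrightarrow> 0))"

text \<open>\<open>L\<^sup>2\<close> on every interval \<open>(0,T)\<close>, i.e. including integrability up to \<open>t = 0\<close>.\<close>

definition L2_loc ::
    "('a \<Rightarrow> 'b::real_vector) set \<Rightarrow> (('a \<Rightarrow> 'b) \<Rightarrow> real) \<Rightarrow> (real \<Rightarrow> 'a \<Rightarrow> 'b) set" where
  "L2_loc X N = {u. \<forall>T>0. strongly_measurable X N {0..T} u \<and>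
                         integrable (lebesgue_on {0..T}) (\<lambda>t. (N (u t))\<^sup>2)}"

definition C_space ::
    "('a \<Rightarrow> 'b::real_vector) set \<Rightarrow> (('a \<Rightarrow> 'b) \<Rightarrow> real) \<Rightarrow> (real \<Rightarrow> 'a \<Rightarrow> 'b) set" where
  "C_space X N = {u. \<forall>t\<ge>0. u t \<in> X \<and> ((\<lambda>s. N (\<lambda>x. u s x - u t x)) \<longlongrightarrow> 0) (at t within {0..})}"

text \<open>
  \<open>g\<close> is the distributional derivative of \<open>v\<close> on \<open>(0,\<infinity>)\<close> as a function with values in \<open>V'\<close>, where
  \<open>v t\<close> acts on \<open>V\<close> through the inner product of \<open>H\<close>. The two \<open>V'\<close>-valued integrals are compared
  as functionals, by their values at each \<open>\<psi>\<close>.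
\<close>

definition has_time_deriv ::
    "(real ^ 3) set \<Rightarrow> (real \<Rightarrow> real ^ 3 \<Rightarrow> real ^ 3) \<Rightarrow> (real \<Rightarrow> (real ^ 3 \<Rightarrow> real ^ 3) \<Rightarrow> real) \<Rightarrow> bool" where
  "has_time_deriv \<Omega> v g \<longleftrightarrow>
     (\<forall>\<eta> \<in> Cc_infinity {0<..}. \<forall>\<psi> \<in> V_space \<Omega>.
        (LINT t|lebesgue_on {0<..}. deriv \<eta> t * L2_inner \<Omega> (v t) \<psi>) =
        - (LINT t|lebesgue_on {0<..}. \<eta> t * g t \<psi>))"

text \<open>
  \<open>dv\<close> is the time derivative. The right-hand side is tested with \<open>\<psi> \<in> V\<close> only, so \<open>f\<close> enters through
  its restriction to \<open>V\<close>; \<open>Z t\<close> is an element of \<open>V'\<close> via the inner product of \<open>H\<close>.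
\<close>

definition weak_solution ::
    "(real ^ 3) set \<Rightarrow> real \<Rightarrow> real \<Rightarrow> real \<Rightarrow> ((real ^ 3 \<Rightarrow> real ^ 3) \<Rightarrow> real) \<Rightarrow>
     (real \<Rightarrow> real ^ 3 \<Rightarrow> real ^ 3) \<Rightarrow> (real ^ 3 \<Rightarrow> real ^ 3) \<Rightarrow> (real \<Rightarrow> real ^ 3 \<Rightarrow> real ^ 3) \<Rightarrow> bool" where
  "weak_solution \<Omega> \<nu> N c f Z v0 v \<longleftrightarrow>
     v \<in> C_space (H_space \<Omega>) (H_norm \<Omega>) \<and>
     v \<in> L2_loc (V_space \<Omega>) (V_norm \<Omega>) \<and>
     (AE x in lebesgue_on \<Omega>. v 0 x = v0 x) \<and>
     (\<exists>dv \<in> L2_loc (V_dual \<Omega>) (V_dual_norm \<Omega>).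
        has_time_deriv \<Omega> v dv \<and>
        (\<forall>\<psi> \<in> V_space \<Omega>. AE t in lebesgue_on {0..}.
           dv t \<psi> = - (\<nu> * stokes \<Omega> (v t) \<psi> + B_trunc \<Omega> N (\<lambda>x. v t x + Z t x) \<psi>
                       - c * L2_inner \<Omega> (Z t) \<psi> - f \<psi>)))"

end

theory Submission
  imports Defs
begin

text \<open>
  The truncated convection term is a small Lipschitz perturbation of the linear Stokes evolution, so
  the solution is found by a contraction argument rather than by compactness.

  Two estimates carry this. The truncation makes \<open>u \<mapsto> F\<^sub>N(\<parallel>u\<parallel>\<^sub>4) u \<otimes> u\<close> globally Lipschitz from \<open>L\<^sup>4\<close>
  to \<open>L\<^sup>2\<close>, with a constant that depends on \<open>N\<close> only (\<open>conv_Lipschitz\<close>). Ladyzhenskaya's inequality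
  \<open>\<parallel>u\<parallel>\<^sub>4\<^sup>4 \<le> 8 \<parallel>u\<parallel>\<^sub>2 \<parallel>\<nabla>u\<parallel>\<^sub>2\<^sup>3\<close> on \<open>V\<close> gives \<open>\<parallel>u\<parallel>\<^sub>4 \<le> e \<parallel>\<nabla>u\<parallel>\<^sub>2 + C\<^sub>e \<parallel>u\<parallel>\<^sub>2\<close> for every \<open>e > 0\<close>
  (\<open>n4_interpolation\<close>). Hence the difference of two values of the nonlinearity is bounded in \<open>V'\<close> by an
  arbitrarily small multiple of the distance in \<open>V\<close> plus a multiple of the distance in \<open>H\<close>; viscosity
  absorbs the first part and an exponential weight in time the second (\<open>contraction\<close>).

  The abstract part takes place in separable Hilbert spaces. Elements of \<open>V\<close> are represented by their
  gradients, which by the Poincare inequality form a closed subspace \<open>W\<close> of \<open>L\<^sup>2\<close> (\<open>closed_W\<close>), and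
  functionals on \<open>V\<close> by elements of \<open>W\<close> through the Riesz representation. The embedding of \<open>V\<close> into \<open>H\<close>
  becomes a bounded linear map \<open>i\<close>, and the equation becomes \<open>(i u)' = g - \<nu> u\<close>, tested with all
  \<open>i c\<close>. With \<open>T = i\<^sup>* i\<close> the functions \<open>b + \<integral>\<^sub>0\<^sup>t a\<close> solve it for the right-hand sides
  \<open>T a + \<nu> (b + \<integral>\<^sub>0\<^sup>t a)\<close>; the energy equality is then the product rule. Such right-hand sides are
  dense in mean square (\<open>dense_range_T_vint\<close>), and the energy estimate lets existence together with
  the energy equality pass to the limit (\<open>lin_sol_exists\<close>). Picard iteration yields the nonlinear
  equation (\<open>sol_exists\<close>, \<open>sol_unique\<close>); its energy equality is the linear one for the right-hand side
  that contains the solution itself.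

  It remains to identify the weak solutions with the solutions of the abstract equation. In one
  direction one chooses velocity fields with the given gradients (\<open>realisation_weak_solution\<close>); in
  the other the distributional time derivative is integrated (\<open>weak_solution_imp_sol\<close>).
\<close>

section \<open>Orthogonal projection, Riesz representation and adjoints in Hilbert space\<close>

lemma norm_parallelogram:
  fixes x y :: "'a::real_inner"
  shows "(norm (x + y))\<^sup>2 + (norm (x - y))\<^sup>2 = 2 * (norm x)\<^sup>2 + 2 * (norm y)\<^sup>2"
  by (simp add: power2_norm_eq_inner inner_simps inner_commute)

text \<open>By the parallelogram law a minimizing sequence for the distance to \<open>S\<close> is Cauchy. The error \<open>x - p\<close> of
  its limit is orthogonal to \<open>S\<close>, since otherwise a step along \<open>S\<close> would decrease the distance.\<close>

lemma exists_orthogonal_projection: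
  fixes S :: "'a::{real_inner,banach} set"
  assumes "subspace S" "closed S"
  shows "\<exists>p\<in>S. \<forall>s\<in>S. (x - p) \<bullet> s = 0"
proof -
  define D where "D = (\<lambda>s. (norm (x - s))\<^sup>2) ` S"
  define d where "d = Inf D"
  have S0: "0 \<in> S" using assms subspace_0 by blast
  have bdd: "bdd_below D" unfolding D_def by (rule bdd_belowI2[where m=0]) simp
  have ne: "D \<noteq> {}" using S0 by (auto simp: D_def)
  have dle: "d \<le> (norm (x - s))\<^sup>2" if "s \<in> S" for s
    unfolding d_def by (rule cInf_lower[OF _ bdd]) (use that in \<open>auto simp: D_def\<close>)
  have "\<exists>s\<in>S. (norm (x - s))\<^sup>2 < d + inverse (real (Suc n))" for n
    using cInf_lessD[OF ne, of "d + inverse (real (Suc n))"] unfolding d_def[symmetric]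
    by (auto simp: D_def)
  then obtain s where s: "\<And>n. s n \<in> S" "\<And>n. (norm (x - s n))\<^sup>2 < d + inverse (real (Suc n))"
    by metis
  have key: "(norm (s m - s n))\<^sup>2 \<le> 2 * inverse (real (Suc m)) + 2 * inverse (real (Suc n))" for m n
  proof -
    have mid: "(1/2) *\<^sub>R (s m + s n) \<in> S"
      using s assms(1) by (simp add: subspace_add subspace_scale)
    have "(norm ((x - s m) + (x - s n)))\<^sup>2 + (norm ((x - s m) - (x - s n)))\<^sup>2
        = 2 * (norm (x - s m))\<^sup>2 + 2 * (norm (x - s n))\<^sup>2"
      by (rule norm_parallelogram)
    moreover have "(x - s m) + (x - s n) = 2 *\<^sub>R (x - (1/2) *\<^sub>R (s m + s n))"
      by (simp add: scaleR_2 algebra_simps)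
    hence "(norm ((x - s m) + (x - s n)))\<^sup>2 = 4 * (norm (x - (1/2) *\<^sub>R (s m + s n)))\<^sup>2"
      by (simp add: power_mult_distrib)
    moreover have "norm ((x - s m) - (x - s n)) = norm (s m - s n)"
      by (simp add: norm_minus_commute)
    ultimately show ?thesis using dle[OF mid] s(2)[of m] s(2)[of n] by simp
  qed
  have "Cauchy s"
  proof (rule metric_CauchyI)
    fix e :: real assume "e > 0"
    then obtain M where M: "inverse (real (Suc M)) < e\<^sup>2 / 4"
      using reals_Archimedean[of "e\<^sup>2/4"] by auto
    show "\<exists>M. \<forall>m\<ge>M. \<forall>n\<ge>M. dist (s m) (s n) < e"
    proof (intro exI[of _ M] allI impI)
      fix m n assume "M \<le> m" "M \<le> n"
      then have "inverse (real (Suc m)) \<le> inverse (real (Suc M))" "inverse (real (Suc n)) \<le> inverse (real (Suc M))"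
        by (auto intro!: le_imp_inverse_le)
      with key[of m n] M have "(norm (s m - s n))\<^sup>2 < e\<^sup>2" by linarith
      then show "dist (s m) (s n) < e"
        using \<open>e > 0\<close> by (simp add: dist_norm power_less_imp_less_base)
    qed
  qed
  then obtain p where p: "s \<longlonglongrightarrow> p" using Cauchy_convergent convergent_def by blast
  have pS: "p \<in> S" using closed_sequentially[OF assms(2)] s(1) p by blast
  have "(\<lambda>n. (norm (x - s n))\<^sup>2) \<longlonglongrightarrow> (norm (x - p))\<^sup>2" by (intro tendsto_intros p)
  moreover have "(\<lambda>n. d + inverse (real (Suc n))) \<longlonglongrightarrow> d + 0"
    by (intro tendsto_intros LIMSEQ_inverse_real_of_nat)
  ultimately have "(norm (x - p))\<^sup>2 \<le> d + 0"
    by (rule LIMSEQ_le) (use s(2) less_imp_le in blast)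
  then have pd: "(norm (x - p))\<^sup>2 \<le> d" by simp
  have "(x - p) \<bullet> t = 0" if "t \<in> S" for t
  proof (rule ccontr)
    assume nz: "(x - p) \<bullet> t \<noteq> 0"
    then have tt: "t \<bullet> t > 0" by auto
    define a where "a = ((x - p) \<bullet> t) / (t \<bullet> t)"
    have "p + a *\<^sub>R t \<in> S" using pS that assms(1) by (simp add: subspace_add subspace_scale)
    from order_trans[OF pd dle[OF this]] have "(norm (x - p))\<^sup>2 \<le> (norm (x - p - a *\<^sub>R t))\<^sup>2"
      by (simp add: diff_diff_eq)
    also have "\<dots> = (norm (x - p))\<^sup>2 - 2 * a * ((x - p) \<bullet> t) + a * a * (t \<bullet> t)"
      by (simp add: power2_norm_eq_inner inner_simps inner_commute)
    also have "\<dots> = (norm (x - p))\<^sup>2 - ((x - p) \<bullet> t)\<^sup>2 / (t \<bullet> t)"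
      using tt by (simp add: a_def field_simps power2_eq_square)
    finally have "((x - p) \<bullet> t)\<^sup>2 / (t \<bullet> t) \<le> 0" by simp
    moreover have "((x - p) \<bullet> t)\<^sup>2 / (t \<bullet> t) > 0" using nz tt by simp
    ultimately show False by simp
  qed
  with pS show ?thesis by blast
qed

lemma subspace_closure:
  fixes S :: "'a::real_normed_vector set"
  assumes "subspace S"
  shows "subspace (closure S)"
proof (rule subspaceI)
  show "0 \<in> closure S" using subspace_0[OF assms] closure_subset by blast
  show "x + y \<in> closure S" if xy: "x \<in> closure S" "y \<in> closure S" for x y
  proof -
    obtain f where "\<And>n. f n \<in> S" "f \<longlonglongrightarrow> x" using xy(1) unfolding closure_sequential by blast
    moreover obtain g where "\<And>n. g n \<in> S" "g \<longlonglongrightarrow> y" using xy(2) unfolding closure_sequential by blast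
    ultimately show ?thesis unfolding closure_sequential
      by (intro exI[of _ "\<lambda>n. f n + g n"]) (auto intro: subspace_add[OF assms] tendsto_intros)
  qed
  show "r *\<^sub>R x \<in> closure S" if x: "x \<in> closure S" for r x
  proof -
    obtain f where "\<And>n. f n \<in> S" "f \<longlonglongrightarrow> x" using x unfolding closure_sequential by blast
    then show ?thesis unfolding closure_sequential
      by (intro exI[of _ "\<lambda>n. r *\<^sub>R f n"]) (auto intro: subspace_scale[OF assms] tendsto_intros)
  qed
qed

text \<open>The error of the projection to the closure of \<open>S\<close> is orthogonal to \<open>S\<close>.\<close>

lemma dense_subspace_if_orthogonal_trivial:
  fixes S :: "'a::{real_inner,banach} set"
  assumes "subspace S" and triv: "\<And>z. (\<And>s. s \<in> S \<Longrightarrow> z \<bullet> s = 0) \<Longrightarrow> z = 0"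
  shows "closure S = UNIV"
proof -
  have "x \<in> closure S" for x
  proof -
    obtain p where p: "p \<in> closure S" "\<forall>s\<in>closure S. (x - p) \<bullet> s = 0"
      using exists_orthogonal_projection[of "closure S" x] subspace_closure[OF assms(1)] by auto
    have "x - p = 0" by (rule triv) (use p closure_subset in blast)
    with p show ?thesis by simp
  qed
  then show ?thesis by auto
qed

text \<open>The orthogonal complement of the kernel of \<open>L\<close> is spanned by one vector \<open>q\<close>, and \<open>L\<close> is the inner product
  with a multiple of \<open>q\<close>.\<close>

lemma riesz_representation:
  fixes L :: "'a::{real_inner,banach} \<Rightarrow> real"
  assumes "bounded_linear L"
  shows "\<exists>z. \<forall>x. L x = z \<bullet> x"
proof (cases "\<forall>x. L x = 0")
  case True then show ?thesis by (intro exI[of _ 0]) simp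
next
  case False
  then obtain y where y: "L y \<noteq> 0" by blast
  interpret L: bounded_linear L by fact
  define K where "K = {x. L x = 0}"
  have "subspace K" unfolding K_def by (auto simp: subspace_def L.add L.scaleR)
  moreover have "closed K" unfolding K_def
    by (rule closed_Collect_eq) (auto intro!: continuous_intros L.continuous_on)
  ultimately obtain p where p: "p \<in> K" "\<And>s. s \<in> K \<Longrightarrow> (y - p) \<bullet> s = 0"
    using exists_orthogonal_projection[of K y] by blast
  define q where "q = y - p"
  have Lq: "L q = L y" using p by (simp add: q_def L.diff K_def)
  have "q \<noteq> 0" using Lq y by (auto simp: L.zero)
  then have qq: "q \<bullet> q \<noteq> 0" by simp
  have "L x = ((L y / (q \<bullet> q)) *\<^sub>R q) \<bullet> x" for x
  proof -
    have "x - (L x / L y) *\<^sub>R q \<in> K" using y by (simp add: K_def L.diff L.scaleR Lq)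
    from p(2)[OF this] have "q \<bullet> x = (L x / L y) * (q \<bullet> q)" by (simp add: q_def[symmetric] inner_simps)
    then show ?thesis using y qq by (simp add: field_simps)
  qed
  then show ?thesis by blast
qed

lemma bounded_linear_adjoint_works:
  fixes f :: "'a::{real_inner,banach} \<Rightarrow> 'b::real_inner"
  assumes "bounded_linear f"
  shows "x \<bullet> f y = adjoint f x \<bullet> y"
proof -
  have "\<forall>x. \<exists>z. \<forall>y. x \<bullet> f y = z \<bullet> y"
  proof
    fix x
    have "bounded_linear (\<lambda>y. x \<bullet> f y)"
      using bounded_linear_compose[OF bounded_linear_inner_right assms] .
    then show "\<exists>z. \<forall>y. x \<bullet> f y = z \<bullet> y" by (rule riesz_representation)
  qed
  then obtain g where "\<forall>x y. x \<bullet> f y = g x \<bullet> y" by metis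
  then have "\<exists>g. \<forall>x y. f x \<bullet> y = x \<bullet> g y" by (metis inner_commute)
  then have "\<forall>x y. f x \<bullet> y = x \<bullet> adjoint f y"
    unfolding adjoint_def by (rule someI_ex)
  then show ?thesis by (metis inner_commute)
qed

lemma inner_ext: "(\<And>y. x \<bullet> y = z \<bullet> y) \<Longrightarrow> x = (z::'a::real_inner)"
  by (metis inner_eq_zero_iff inner_diff_left right_minus_eq)

lemma bounded_linear_adjoint:
  fixes f :: "'a::{real_inner,banach} \<Rightarrow> 'b::real_inner"
  assumes "bounded_linear f"
  shows "bounded_linear (adjoint f)"
proof -
  note ad = bounded_linear_adjoint_works[OF assms, symmetric]
  obtain K where K: "K > 0" "\<And>x. norm (f x) \<le> norm x * K"
    using bounded_linear.pos_bounded[OF assms] by blast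
  show ?thesis
  proof (rule bounded_linear_intro[where K=K])
    show "adjoint f (x + y) = adjoint f x + adjoint f y" for x y
      by (rule inner_ext) (simp add: ad inner_simps)
    show "adjoint f (r *\<^sub>R x) = r *\<^sub>R adjoint f x" for r x
      by (rule inner_ext) (simp add: ad inner_simps)
    show "norm (adjoint f x) \<le> norm x * K" for x
    proof -
      have "(norm (adjoint f x))\<^sup>2 = x \<bullet> f (adjoint f x)" by (simp add: power2_norm_eq_inner ad)
      also have "\<dots> \<le> norm x * norm (f (adjoint f x))" by (rule norm_cauchy_schwarz)
      also have "\<dots> \<le> norm x * (norm (adjoint f x) * K)" by (intro mult_left_mono K) simp
      finally have "norm (adjoint f x) * norm (adjoint f x) \<le> norm (adjoint f x) * (norm x * K)"
        by (simp add: power2_eq_square mult_ac)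
      then show ?thesis using K(1) by (cases "adjoint f x = 0") auto
    qed
  qed
qed

definition proj :: "'a::real_inner set \<Rightarrow> 'a \<Rightarrow> 'a" where
  "proj S x = (SOME p. p \<in> S \<and> (\<forall>s\<in>S. (x - p) \<bullet> s = 0))"

context
  fixes S :: "'a::{real_inner,banach} set"
  assumes sub: "subspace S" and clo: "closed S"
begin

lemma proj_in: "proj S x \<in> S" and proj_orth: "s \<in> S \<Longrightarrow> x \<bullet> s = proj S x \<bullet> s"
proof -
  have "proj S x \<in> S \<and> (\<forall>s\<in>S. (x - proj S x) \<bullet> s = 0)"
    unfolding proj_def by (rule someI_ex) (use exists_orthogonal_projection[OF sub clo] in blast)
  then show "proj S x \<in> S" "s \<in> S \<Longrightarrow> x \<bullet> s = proj S x \<bullet> s" by (auto simp: inner_simps)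
qed

lemma proj_eqI:
  assumes "p \<in> S" "\<And>s. s \<in> S \<Longrightarrow> x \<bullet> s = p \<bullet> s" shows "proj S x = p"
proof -
  have d: "proj S x - p \<in> S" using proj_in assms sub by (simp add: subspace_diff)
  have "(proj S x - p) \<bullet> (proj S x - p) = 0"
    using proj_orth[OF d, of x] assms(2)[OF d] by (simp add: inner_simps)
  then show ?thesis by simp
qed

lemma proj_id: "p \<in> S \<Longrightarrow> proj S p = p" by (rule proj_eqI) auto

lemma proj_symmetric: "proj S x \<bullet> y = x \<bullet> proj S y"
  by (metis proj_in proj_orth inner_commute)

lemma norm_proj_le: "norm (proj S x) \<le> norm x"
proof -
  have "(norm (proj S x))\<^sup>2 = x \<bullet> proj S x"
    using proj_orth[OF proj_in] by (simp add: power2_norm_eq_inner)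
  also have "\<dots> \<le> norm x * norm (proj S x)" by (rule norm_cauchy_schwarz)
  finally show ?thesis by (cases "proj S x = 0") (auto simp: power2_eq_square)
qed

lemma bounded_linear_proj: "bounded_linear (proj S)"
proof (rule bounded_linear_intro[where K=1])
  show "proj S (x + y) = proj S x + proj S y" for x y
    by (rule proj_eqI) (auto simp: proj_in sub subspace_add inner_simps proj_orth[symmetric])
  show "proj S (r *\<^sub>R x) = r *\<^sub>R proj S x" for r x
    by (rule proj_eqI) (auto simp: proj_in sub subspace_scale inner_simps proj_orth[symmetric])
qed (simp add: norm_proj_le)

end

text \<open>Rational combinations of a countable total set are countable and dense. Separability is needed
  because the Bochner integral is used for functions of time with values in a space of square
  integrable functions of the position.\<close>

lemma second_countable_if_countable_total:
  fixes C :: "'a::{real_inner,banach} set"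
  assumes "countable C" and triv: "\<And>z. (\<And>c. c \<in> C \<Longrightarrow> z \<bullet> c = 0) \<Longrightarrow> z = 0"
  shows "\<exists>B::'a set set. countable B \<and> open = generate_topology B"
proof -
  define comb :: "(rat \<times> 'a) list \<Rightarrow> 'a" where "comb xs = (\<Sum>(q,c)\<leftarrow>xs. of_rat q *\<^sub>R c)" for xs
  define D where "D = comb ` lists (UNIV \<times> C)"
  have cD: "countable D" unfolding D_def
    by (intro countable_image countable_lists countable_SIGMA) (auto simp: assms)
  have D0: "0 \<in> D" unfolding D_def by (rule image_eqI[of _ _ "[]"]) (auto simp: comb_def)
  have Dadd: "x + y \<in> D" if xy: "x \<in> D" "y \<in> D" for x y
  proof -
    from xy obtain xs ys where "x = comb xs" "xs \<in> lists (UNIV \<times> C)" "y = comb ys" "ys \<in> lists (UNIV \<times> C)"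
      unfolding D_def by auto
    then have "x + y = comb (xs @ ys)" "xs @ ys \<in> lists (UNIV \<times> C)" by (auto simp: comb_def)
    then show ?thesis unfolding D_def by blast
  qed
  have Dsc: "of_rat r *\<^sub>R x \<in> D" if x: "x \<in> D" for x r
  proof -
    from x obtain xs where xs: "x = comb xs" "xs \<in> lists (UNIV \<times> C)" unfolding D_def by auto
    have "of_rat r *\<^sub>R comb xs = comb (map (\<lambda>(q,c). (r * q, c)) xs)"
      unfolding comb_def
      by (induction xs) (auto simp: scaleR_add_right of_rat_mult)
    moreover have "map (\<lambda>(q,c). (r * q, c)) xs \<in> lists (UNIV \<times> C)" using xs(2) by auto
    ultimately show ?thesis unfolding D_def xs(1) by blast
  qed
  have CD: "C \<subseteq> D"
  proof
    fix c assume "c \<in> C"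
    then have "c = comb [(1,c)]" "[(1,c)] \<in> lists (UNIV \<times> C)" by (auto simp: comb_def)
    then show "c \<in> D" unfolding D_def by blast
  qed
  have sub: "subspace (closure D)"
  proof (rule subspaceI)
    show "0 \<in> closure D" using D0 closure_subset by blast
    show "x + y \<in> closure D" if xy: "x \<in> closure D" "y \<in> closure D" for x y
    proof -
      obtain f where "\<And>n. f n \<in> D" "f \<longlonglongrightarrow> x" using xy(1) unfolding closure_sequential by blast
      moreover obtain g where "\<And>n. g n \<in> D" "g \<longlonglongrightarrow> y" using xy(2) unfolding closure_sequential by blast
      ultimately show ?thesis unfolding closure_sequential
        by (intro exI[of _ "\<lambda>n. f n + g n"]) (auto intro: Dadd tendsto_intros)
    qed
    show "r *\<^sub>R x \<in> closure D" if x: "x \<in> closure D" for r x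
    proof -
      obtain f where f: "\<And>n. f n \<in> D" "f \<longlonglongrightarrow> x" using x unfolding closure_sequential by blast
      have "r \<in> closure \<rat>" by (simp add: Rats_closure_real)
      then obtain q where q: "\<And>n. q n \<in> \<rat>" "q \<longlonglongrightarrow> r" unfolding closure_sequential by blast
      have "q n *\<^sub>R f n \<in> D" for n using q(1)[of n] Dsc[OF f(1)] by (metis Rats_cases)
      then show ?thesis unfolding closure_sequential
        by (intro exI[of _ "\<lambda>n. q n *\<^sub>R f n"]) (auto intro: tendsto_intros f q)
    qed
  qed
  have "closure (closure D) = UNIV"
    by (rule dense_subspace_if_orthogonal_trivial[OF sub])
       (metis CD closure_subset subset_eq triv)
  then have dense: "closure D = UNIV" by simp
  define B where "B = (\<lambda>(d,n). ball d (inverse (real (Suc n)))) ` (D \<times> UNIV)"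
  have "countable B" unfolding B_def by (intro countable_image countable_SIGMA cD) auto
  moreover have "topological_basis B"
  proof (rule topological_basisI)
    show "open b" if "b \<in> B" for b using that by (auto simp: B_def)
    show "\<exists>b\<in>B. x \<in> b \<and> b \<subseteq> O'" if "open O'" "x \<in> O'" for O' x
    proof -
      obtain e where e: "e > 0" "ball x e \<subseteq> O'" using \<open>open O'\<close> \<open>x \<in> O'\<close> open_contains_ball by blast
      obtain n where n: "inverse (real (Suc n)) < e / 2" using reals_Archimedean[of "e/2"] e by auto
      have "x \<in> closure D" using dense by simp
      then obtain d where d: "d \<in> D" "dist d x < inverse (real (Suc n))"
        unfolding closure_approachable by (meson inverse_positive_iff_positive of_nat_0_less_iff zero_less_Suc)
      have "ball d (inverse (real (Suc n))) \<subseteq> ball x e"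
      proof
        fix y assume "y \<in> ball d (inverse (real (Suc n)))"
        then have "dist d y < inverse (real (Suc n))" by simp
        moreover have "dist x y \<le> dist d x + dist d y" by (metis dist_commute dist_triangle)
        ultimately show "y \<in> ball x e" using d n by simp
      qed
      then show ?thesis using d e by (intro bexI[of _ "ball d (inverse (real (Suc n)))"]) (auto simp: B_def)
    qed
  qed
  ultimately show ?thesis using topological_basis_imp_subbasis by blast
qed

section \<open>Square integrable functions\<close>

definition sq_int :: "'a measure \<Rightarrow> ('a \<Rightarrow> 'b::{real_inner,banach,second_countable_topology}) \<Rightarrow> bool" where
  "sq_int M f \<longleftrightarrow> f \<in> borel_measurable M \<and> integrable M (\<lambda>x. (norm (f x))\<^sup>2)"

lemma sq_int_measurable: "sq_int M f \<Longrightarrow> f \<in> borel_measurable M"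
  and sq_int_norm2: "sq_int M f \<Longrightarrow> integrable M (\<lambda>x. (norm (f x))\<^sup>2)"
  by (auto simp: sq_int_def)

lemma sq_int_bound:
  assumes "f \<in> borel_measurable M" "integrable M g" "\<And>x. x \<in> space M \<Longrightarrow> (norm (f x))\<^sup>2 \<le> g x"
  shows "sq_int M f"
  unfolding sq_int_def
proof
  have [measurable]: "f \<in> borel_measurable M" by fact
  show "integrable M (\<lambda>x. (norm (f x))\<^sup>2)"
    by (rule Bochner_Integration.integrable_bound[OF assms(2)], measurable, rule AE_I2) (use assms(3) in \<open>simp add: order_trans[OF _ abs_ge_self]\<close>)
qed fact

lemma sq_int_zero [simp]: "sq_int M (\<lambda>x. 0)" by (simp add: sq_int_def)

lemma sq_int_add:
  assumes "sq_int M f" "sq_int M g" shows "sq_int M (\<lambda>x. f x + g x)"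
proof (rule sq_int_bound)
  have [measurable]: "f \<in> borel_measurable M" "g \<in> borel_measurable M" using assms by (auto simp: sq_int_def)
  show "(\<lambda>x. f x + g x) \<in> borel_measurable M" by measurable
  show "integrable M (\<lambda>x. 2 * (norm (f x))\<^sup>2 + 2 * (norm (g x))\<^sup>2)"
    using assms by (auto simp: sq_int_def)
  show "(norm (f x + g x))\<^sup>2 \<le> 2 * (norm (f x))\<^sup>2 + 2 * (norm (g x))\<^sup>2" for x
    using norm_parallelogram[of "f x" "g x"] zero_le_power2[of "norm (f x - g x)"] by linarith
qed

lemma sq_int_bounded_linear:
  assumes "bounded_linear L" "sq_int M f" shows "sq_int M (\<lambda>x. L (f x))"
proof -
  obtain K where K: "\<And>x. norm (L x) \<le> norm x * K" "K \<ge> 0"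
    using bounded_linear.nonneg_bounded[OF assms(1)] by blast
  show ?thesis
  proof (rule sq_int_bound)
    show "(\<lambda>x. L (f x)) \<in> borel_measurable M"
      using borel_measurable_continuous_onI[OF linear_continuous_on[OF assms(1)]] sq_int_measurable[OF assms(2)]
      by (rule measurable_compose_rev)
    show "integrable M (\<lambda>x. K\<^sup>2 * (norm (f x))\<^sup>2)" using assms by (auto simp: sq_int_def)
    show "(norm (L (f x)))\<^sup>2 \<le> K\<^sup>2 * (norm (f x))\<^sup>2" for x
      using power_mono[OF K(1)[of "f x"], of 2] by (simp add: power_mult_distrib mult.commute)
  qed
qed

lemma sq_int_scaleR: "sq_int M f \<Longrightarrow> sq_int M (\<lambda>x. r *\<^sub>R f x)"
  using sq_int_bounded_linear[OF bounded_linear_scaleR_right] .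

lemma sq_int_minus: "sq_int M f \<Longrightarrow> sq_int M (\<lambda>x. - f x)"
  using sq_int_scaleR[of M f "-1"] by simp

lemma sq_int_diff: "sq_int M f \<Longrightarrow> sq_int M g \<Longrightarrow> sq_int M (\<lambda>x. f x - g x)"
  using sq_int_add[OF _ sq_int_minus] by fastforce

lemma sq_int_norm: "sq_int M f \<Longrightarrow> sq_int M (\<lambda>x. norm (f x))"
  by (auto simp: sq_int_def)

lemma sq_int_AE_cong:
  assumes "sq_int M f" "g \<in> borel_measurable M" "AE x in M. f x = g x" shows "sq_int M g"
proof -
  have [measurable]: "f \<in> borel_measurable M" "g \<in> borel_measurable M" using assms by (auto simp: sq_int_def)
  have "integrable M (\<lambda>x. (norm (f x))\<^sup>2) \<longleftrightarrow> integrable M (\<lambda>x. (norm (g x))\<^sup>2)"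
    by (rule integrable_cong_AE) (use assms(3) in auto)
  then show ?thesis using assms by (simp add: sq_int_def)
qed

lemma integrable_inner_sq_int:
  assumes "sq_int M f" "sq_int M g" shows "integrable M (\<lambda>x. f x \<bullet> g x)"
proof (rule Bochner_Integration.integrable_bound)
  have [measurable]: "f \<in> borel_measurable M" "g \<in> borel_measurable M" using assms by (auto simp: sq_int_def)
  show "(\<lambda>x. f x \<bullet> g x) \<in> borel_measurable M" by measurable
  show "integrable M (\<lambda>x. (norm (f x))\<^sup>2 + (norm (g x))\<^sup>2)" using assms by (auto simp: sq_int_def)
  have "\<bar>f x \<bullet> g x\<bar> \<le> (norm (f x))\<^sup>2 + (norm (g x))\<^sup>2" for x
  proof -
    have "\<bar>f x \<bullet> g x\<bar> \<le> norm (f x) * norm (g x)" by (rule Cauchy_Schwarz_ineq2)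
    also have "\<dots> \<le> 2 * norm (f x) * norm (g x)" by simp
    also have "\<dots> \<le> (norm (f x))\<^sup>2 + (norm (g x))\<^sup>2" by (rule sum_squares_bound)
    finally show ?thesis .
  qed
  then show "AE x in M. norm (f x \<bullet> g x) \<le> norm ((norm (f x))\<^sup>2 + (norm (g x))\<^sup>2)" by auto
qed

lemma integrable_mult_sq_int:
  "sq_int M f \<Longrightarrow> sq_int M g \<Longrightarrow> integrable M (\<lambda>x. f x * g x :: real)"
  using integrable_inner_sq_int[of M f g] by simp

text \<open>The quadratic polynomial \<open>t \<mapsto> \<integral> \<bar>f - t g\<bar>\<^sup>2\<close> has no negative values, so its discriminant is not
  positive.\<close>

lemma Cauchy_Schwarz_integral:
  assumes "sq_int M f" "sq_int M g"
  shows "\<bar>LINT x|M. f x \<bullet> g x\<bar> \<le> sqrt (LINT x|M. (norm (f x))\<^sup>2) * sqrt (LINT x|M. (norm (g x))\<^sup>2)"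
proof -
  define A where "A = (LINT x|M. (norm (f x))\<^sup>2)"
  define B where "B = (LINT x|M. f x \<bullet> g x)"
  define C where "C = (LINT x|M. (norm (g x))\<^sup>2)"
  have C0: "C \<ge> 0" and A0: "A \<ge> 0" by (auto simp: A_def C_def)
  have i: "integrable M (\<lambda>x. (norm (f x))\<^sup>2)" "integrable M (\<lambda>x. f x \<bullet> g x)" "integrable M (\<lambda>x. (norm (g x))\<^sup>2)"
    using assms integrable_inner_sq_int by (auto simp: sq_int_def)
  have q: "A - 2 * t * B + t\<^sup>2 * C \<ge> 0" for t
  proof -
    have "0 \<le> (LINT x|M. (norm (f x - t *\<^sub>R g x))\<^sup>2)" by simp
    also have "\<dots> = (LINT x|M. (norm (f x))\<^sup>2 - 2 * t * (f x \<bullet> g x) + t\<^sup>2 * (norm (g x))\<^sup>2)"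
      unfolding power2_norm_eq_inner
      by (rule Bochner_Integration.integral_cong)
        (auto simp: inner_simps inner_commute power2_eq_square algebra_simps)
    also have "\<dots> = A - 2 * t * B + t\<^sup>2 * C"
      using i by (simp add: A_def B_def C_def)
    finally show ?thesis .
  qed
  have "B\<^sup>2 \<le> A * C"
  proof (cases "C = 0")
    case True
    have "B = 0"
    proof (rule ccontr)
      assume "B \<noteq> 0"
      then have "2 * ((A + 1) / (2 * B)) * B = A + 1" by simp
      then show False using q[of "(A + 1) / (2 * B)"] True by simp
    qed
    then show ?thesis using True by simp
  next
    case False
    then have "C > 0" using C0 by simp
    then have "2 * (B / C) * B = 2 * (B\<^sup>2 / C)" "(B / C)\<^sup>2 * C = B\<^sup>2 / C"
      by (simp_all add: power2_eq_square)
    with q[of "B / C"] have "B\<^sup>2 / C \<le> A" by linarith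
    with \<open>C > 0\<close> show ?thesis by (simp add: pos_divide_le_eq)
  qed
  then have "sqrt (B\<^sup>2) \<le> sqrt (A * C)" by (rule real_sqrt_le_mono)
  then show ?thesis by (simp add: A_def B_def C_def real_sqrt_mult)
qed

lemma Cauchy_Schwarz_integral_real:
  fixes f g :: "'a \<Rightarrow> real"
  assumes "sq_int M f" "sq_int M g"
  shows "\<bar>LINT x|M. f x * g x\<bar> \<le> sqrt (LINT x|M. (f x)\<^sup>2) * sqrt (LINT x|M. (g x)\<^sup>2)"
  using Cauchy_Schwarz_integral[OF assms] by simp

text \<open>Riesz--Fischer: a fast subsequence converges almost everywhere, because
  \<open>\<Sum>k. 2\<^sup>k * (norm (g (Suc k) - g k))\<^sup>2\<close> has finite integral; Fatou's lemma then gives convergence in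
  mean square.\<close>

lemma riesz_fischer:
  fixes f :: "nat \<Rightarrow> 'a \<Rightarrow> 'b::{real_inner,banach,second_countable_topology}"
  assumes sq: "\<And>n. sq_int M (f n)"
    and cau: "\<And>e. e > 0 \<Longrightarrow> \<exists>N. \<forall>m\<ge>N. \<forall>n\<ge>N. (LINT x|M. (norm (f m x - f n x))\<^sup>2) < e"
  obtains g where "sq_int M g" "(\<lambda>n. LINT x|M. (norm (f n x - g x))\<^sup>2) \<longlonglongrightarrow> 0"
proof -
  have [measurable]: "f n \<in> borel_measurable M" for n using sq by (auto simp: sq_int_def)
  have "\<exists>N. \<forall>m\<ge>N. \<forall>n\<ge>N. (LINT x|M. (norm (f m x - f n x))\<^sup>2) < (1/4)^k" for k
    by (rule cau) simp
  then obtain N0 where N0: "\<And>k m n. m \<ge> N0 k \<Longrightarrow> n \<ge> N0 k \<Longrightarrow> (LINT x|M. (norm (f m x - f n x))\<^sup>2) < (1/4)^k"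
    by metis
  define r where "r k = Max (N0 ` {..k}) + k" for k
  have rN: "r k \<ge> N0 k" for k unfolding r_def by (intro trans_le_add1 Max_ge) auto
  have rS: "r (Suc k) \<ge> r k" for k
    unfolding r_def by (intro add_mono Max_mono) auto
  have rk: "r k \<ge> k" for k by (simp add: r_def)
  define d where "d k x = norm (f (r (Suc k)) x - f (r k) x)" for k x
  have [measurable]: "d k \<in> borel_measurable M" for k unfolding d_def by measurable
  have di: "integrable M (\<lambda>x. (d k x)\<^sup>2)" for k
    using sq_int_diff[OF sq sq] unfolding d_def sq_int_def by blast
  have dI: "(LINT x|M. (d k x)\<^sup>2) \<le> (1/4)^k" for k
    unfolding d_def using N0[OF order_trans[OF rN rS] rN, of k] by simp
  have "(\<integral>\<^sup>+x. (\<Sum>k. ennreal (2^k * (d k x)\<^sup>2)) \<partial>M) = (\<Sum>k. (\<integral>\<^sup>+x. ennreal (2^k * (d k x)\<^sup>2) \<partial>M))"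
    by (rule nn_integral_suminf) measurable
  also have "\<dots> \<le> (\<Sum>k. ennreal ((1/2)^k))"
  proof (rule suminf_le)
    show "(\<integral>\<^sup>+x. ennreal (2^k * (d k x)\<^sup>2) \<partial>M) \<le> ennreal ((1/2)^k)" for k
    proof -
      have "(\<integral>\<^sup>+x. ennreal (2^k * (d k x)\<^sup>2) \<partial>M) = ennreal (LINT x|M. 2^k * (d k x)\<^sup>2)"
        by (rule nn_integral_eq_integral) (use di in auto)
      also have "\<dots> \<le> ennreal ((1/2)^k)"
      proof (rule ennreal_leI)
        have "(LINT x|M. 2^k * (d k x)\<^sup>2) = 2^k * (LINT x|M. (d k x)\<^sup>2)" by simp
        also have "\<dots> \<le> 2^k * (1/4)^k" by (intro mult_left_mono dI) simp
        also have "\<dots> = (1/2)^k" by (simp add: power_mult_distrib[symmetric])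
        finally show "(LINT x|M. 2^k * (d k x)\<^sup>2) \<le> (1/2)^k" .
      qed
      finally show ?thesis .
    qed
  qed auto
  also have "\<dots> < \<infinity>"
    by (subst suminf_ennreal2) (auto intro!: summable_geometric)
  finally have "AE x in M. (\<Sum>k. ennreal (2^k * (d k x)\<^sup>2)) \<noteq> \<infinity>"
    by (intro nn_integral_PInf_AE) (auto simp: top.not_eq_extremum less_top)
  then have conv: "AE x in M. convergent (\<lambda>k. f (r k) x)"
  proof eventually_elim
    fix x assume fin: "(\<Sum>k. ennreal (2^k * (d k x)\<^sup>2)) \<noteq> \<infinity>"
    have "summable (\<lambda>k. 2^k * (d k x)\<^sup>2)"
      by (rule summable_suminf_not_top) (use fin in auto)
    then have "(\<lambda>k. 2^k * (d k x)\<^sup>2) \<longlonglongrightarrow> 0" by (rule summable_LIMSEQ_zero)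
    then have "Bseq (\<lambda>k. 2^k * (d k x)\<^sup>2)" using convergent_imp_Bseq convergentI by blast
    then obtain K where K: "K > 0" "\<And>k. norm (2^k * (d k x)\<^sup>2) \<le> K" by (auto elim: BseqE)
    define q where "q = sqrt (1/2)"
    have q: "0 < q" "q < 1" unfolding q_def by (auto intro: real_less_lsqrt)
    have dk: "d k x \<le> sqrt K * q^k" for k
    proof -
      have "(d k x)\<^sup>2 \<le> K * (1/2)^k" using K(2)[of k] by (simp add: field_simps power_one_over)
      also have "\<dots> = (sqrt K * q^k)\<^sup>2"
        using K(1) by (simp add: q_def power_mult_distrib real_sqrt_power[symmetric])
      finally show ?thesis by (rule power2_le_imp_le) (use K q in auto)
    qed
    have "summable (\<lambda>k. f (r (Suc k)) x - f (r k) x)"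
      by (rule summable_comparison_test'[where g="\<lambda>k. sqrt K * q^k" and N=0])
        (use q dk in \<open>auto intro!: summable_mult summable_geometric simp: d_def\<close>)
    then have "convergent (\<lambda>n. \<Sum>k<n. f (r (Suc k)) x - f (r k) x)" by (simp add: summable_iff_convergent)
    then have "convergent (\<lambda>n. f (r n) x - f (r 0) x)" by (simp add: sum_lessThan_telescope[where f="\<lambda>k. f (r k) x"])
    then have "convergent (\<lambda>n. (f (r n) x - f (r 0) x) + f (r 0) x)" by (intro convergent_add convergent_const)
    then show "convergent (\<lambda>k. f (r k) x)" by simp
  qed
  define g where "g x = lim (\<lambda>k. f (r k) x)" for x
  have [measurable]: "g \<in> borel_measurable M"
    unfolding g_def by (rule borel_measurable_lim_metric) measurable
  have lim: "AE x in M. (\<lambda>k. f (r k) x) \<longlonglongrightarrow> g x"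
    using conv by eventually_elim (simp add: g_def convergent_LIMSEQ_iff)
  have fat: "(\<integral>\<^sup>+x. ennreal ((norm (f n x - g x))\<^sup>2) \<partial>M) \<le> ennreal e"
    if e: "e > 0" and N: "\<forall>m\<ge>N. \<forall>n\<ge>N. (LINT x|M. (norm (f m x - f n x))\<^sup>2) < e" "n \<ge> N" for e N n
  proof -
    have "(\<integral>\<^sup>+x. ennreal ((norm (f n x - g x))\<^sup>2) \<partial>M)
        = (\<integral>\<^sup>+x. liminf (\<lambda>k. ennreal ((norm (f n x - f (r k) x))\<^sup>2)) \<partial>M)"
    proof (rule nn_integral_cong_AE, use lim in eventually_elim)
      fix x assume "(\<lambda>k. f (r k) x) \<longlonglongrightarrow> g x"
      then have "(\<lambda>k. ennreal ((norm (f n x - f (r k) x))\<^sup>2)) \<longlonglongrightarrow> ennreal ((norm (f n x - g x))\<^sup>2)"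
        by (intro tendsto_intros)
      then show "ennreal ((norm (f n x - g x))\<^sup>2) = liminf (\<lambda>k. ennreal ((norm (f n x - f (r k) x))\<^sup>2))"
        by (metis lim_imp_Liminf trivial_limit_sequentially)
    qed
    also have "\<dots> \<le> liminf (\<lambda>k. \<integral>\<^sup>+x. ennreal ((norm (f n x - f (r k) x))\<^sup>2) \<partial>M)"
      by (rule nn_integral_liminf) measurable
    also have "\<dots> \<le> ennreal e"
    proof (rule Liminf_le)
      show "\<forall>\<^sub>F k in sequentially. (\<integral>\<^sup>+x. ennreal ((norm (f n x - f (r k) x))\<^sup>2) \<partial>M) \<le> ennreal e"
        using eventually_ge_at_top[of N]
      proof eventually_elim
        case (elim k)
        have "(\<integral>\<^sup>+x. ennreal ((norm (f n x - f (r k) x))\<^sup>2) \<partial>M) = ennreal (LINT x|M. (norm (f n x - f (r k) x))\<^sup>2)"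
          by (rule nn_integral_eq_integral) (use sq_int_diff[OF sq sq] in \<open>auto simp: sq_int_def\<close>)
        moreover have "(LINT x|M. (norm (f n x - f (r k) x))\<^sup>2) < e"
          using N elim order_trans[OF elim rk] by blast
        ultimately show ?case by (simp add: ennreal_leI)
      qed
    qed simp
    finally show ?thesis .
  qed
  have sqd: "sq_int M (\<lambda>x. f n x - g x)" if e: "e > 0" and N: "\<forall>m\<ge>N. \<forall>n\<ge>N. (LINT x|M. (norm (f m x - f n x))\<^sup>2) < e" "n \<ge> N" for e N n
    unfolding sq_int_def
    by (intro conjI integrableI_bounded) (use fat[OF that] in \<open>auto simp: less_top[symmetric] top_unique\<close>)
  obtain N1 where N1: "\<forall>m\<ge>N1. \<forall>n\<ge>N1. (LINT x|M. (norm (f m x - f n x))\<^sup>2) < 1" using cau[of 1] by auto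
  have sg: "sq_int M g"
    using sq_int_diff[OF sq[of N1] sqd[OF _ N1, of N1]] by simp
  have "(\<lambda>n. LINT x|M. (norm (f n x - g x))\<^sup>2) \<longlonglongrightarrow> 0"
  proof (rule LIMSEQ_I)
    fix e :: real assume "e > 0"
    then obtain N where N: "\<forall>m\<ge>N. \<forall>n\<ge>N. (LINT x|M. (norm (f m x - f n x))\<^sup>2) < e/2" using cau[of "e/2"] by auto
    show "\<exists>no. \<forall>n\<ge>no. norm ((LINT x|M. (norm (f n x - g x))\<^sup>2) - 0) < e"
    proof (intro exI[of _ N] allI impI)
      fix n assume n: "n \<ge> N"
      have "ennreal (LINT x|M. (norm (f n x - g x))\<^sup>2) \<le> ennreal (e/2)"
        using fat[OF _ N n] \<open>e > 0\<close>
          nn_integral_eq_integral[OF sq_int_norm2[OF sqd[OF _ N n]]] by simp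
      then have "(LINT x|M. (norm (f n x - g x))\<^sup>2) \<le> e/2" using \<open>e > 0\<close> by (subst (asm) ennreal_le_iff) auto
      then show "norm ((LINT x|M. (norm (f n x - g x))\<^sup>2) - 0) < e" using \<open>e > 0\<close> by simp
    qed
  qed
  with sg that show ?thesis by blast
qed

section \<open>Functions are determined by their integrals over rational boxes\<close>

definition rational_box :: "('a::euclidean_space \<Rightarrow> real \<times> real) \<Rightarrow> 'a set" where
  "rational_box f = box (\<Sum>i\<in>Basis. fst (f i) *\<^sub>R i) (\<Sum>i\<in>Basis. snd (f i) *\<^sub>R i)"

definition rational_boxes :: "'a::euclidean_space set set" where
  "rational_boxes = rational_box ` (Basis \<rightarrow>\<^sub>E \<rat> \<times> \<rat>)"

lemma countable_rational_boxes: "countable rational_boxes"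
  unfolding rational_boxes_def by (intro countable_image countable_PiE) (auto intro: countable_rat)

lemma open_is_Union_rational_boxes:
  fixes M :: "'a::euclidean_space set"
  assumes "open M" shows "M = \<Union>{B \<in> rational_boxes. B \<subseteq> M}"
proof
  show "M \<subseteq> \<Union>{B \<in> rational_boxes. B \<subseteq> M}"
  proof
    fix x assume "x \<in> M"
    then obtain f where "f \<in> Basis \<rightarrow>\<^sub>E \<rat> \<times> \<rat>" "rational_box f \<subseteq> M" "x \<in> rational_box f"
      using open_UNION_box[OF assms] unfolding rational_box_def by blast
    then show "x \<in> \<Union>{B \<in> rational_boxes. B \<subseteq> M}" unfolding rational_boxes_def by blast
  qed
qed auto

lemma Int_stable_rational_boxes: "Int_stable (rational_boxes :: 'a::euclidean_space set set)"
proof (rule Int_stableI)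
  fix A B :: "'a set" assume "A \<in> rational_boxes" "B \<in> rational_boxes"
  then obtain f g where f: "f \<in> Basis \<rightarrow>\<^sub>E \<rat> \<times> \<rat>" "A = rational_box f"
    and g: "g \<in> Basis \<rightarrow>\<^sub>E \<rat> \<times> \<rat>" "B = rational_box g" unfolding rational_boxes_def by auto
  define h where "h = restrict (\<lambda>i::'a. (max (fst (f i)) (fst (g i)), min (snd (f i)) (snd (g i)))) Basis"
  have mem: "f i \<in> \<rat> \<times> \<rat>" "g i \<in> \<rat> \<times> \<rat>" if "i \<in> Basis" for i using f g that by auto
  have "h \<in> Basis \<rightarrow>\<^sub>E \<rat> \<times> \<rat>"
    unfolding h_def using mem by (fastforce simp: max_def min_def mem_Times_iff)
  moreover have "A \<inter> B = rational_box h"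
    unfolding f g rational_box_def h_def
    by (auto simp: mem_box inner_sum_left_Basis)
  ultimately show "A \<inter> B \<in> rational_boxes" unfolding rational_boxes_def by blast
qed

lemma sets_borel_rational_boxes:
  "sets (borel :: 'a::euclidean_space measure) = sigma_sets UNIV rational_boxes"
proof -
  have "(borel :: 'a measure) = sigma UNIV rational_boxes"
  proof (rule borel_eq_sigmaI1[OF borel_def, where F="\<lambda>x. x" and A=rational_boxes, simplified])
    fix M :: "'a set" assume "open M"
    show "M \<in> sigma_sets UNIV rational_boxes"
      by (subst open_is_Union_rational_boxes[OF \<open>open M\<close>])
        (auto intro!: sigma_sets_UNION countable_Collect countable_rational_boxes intro: sigma_sets.Basic
          countable_subset[OF _ countable_rational_boxes])
  next
    show "B \<in> sets borel" if "B \<in> rational_boxes" for B :: "'a set"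
      using that by (auto simp: rational_boxes_def rational_box_def)
  qed
  then show ?thesis by (metis sets_measure_of subset_UNIV Pow_UNIV)
qed

text \<open>The positive and the negative part of \<open>f\<close> are densities of two measures that agree on the rational
  boxes, a countable generator of the Borel sets that is stable under intersection.\<close>

lemma AE_zero_if_box_integrals_zero:
  fixes f :: "'a::euclidean_space \<Rightarrow> real"
  assumes int: "integrable lebesgue f"
    and zero: "\<And>B. B \<in> rational_boxes \<Longrightarrow> (LINT x|lebesgue. indicator B x * f x) = 0"
  shows "AE x in lebesgue. f x = 0"
proof -
  obtain g where g [measurable]: "g \<in> borel_measurable lborel" and fg: "AE x in lborel. f x = g x"
    using completion_ex_borel_measurable_real[of f lborel] int borel_measurable_integrable by blast
  have fg': "AE x in lebesgue. f x = g x" using fg by (rule AE_completion)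
  have gi: "integrable lebesgue g"
    using int by (rule integrable_cong_AE_imp) (use g fg' in \<open>auto intro: measurable_completion\<close>)
  then have gl: "integrable lborel g" using integrable_completion g by blast
  define p where "p x = max 0 (g x)" for x
  define q where "q x = max 0 (- g x)" for x
  have [measurable]: "p \<in> borel_measurable lborel" "q \<in> borel_measurable lborel"
    unfolding p_def q_def by measurable
  have pq: "integrable lborel p" "integrable lborel q" "g = (\<lambda>x. p x - q x)"
    using gl by (auto simp: p_def q_def[abs_def] fun_eq_iff p_def[abs_def])
  have pos: "p x \<ge> 0" "q x \<ge> 0" for x by (auto simp: p_def q_def)
  have rb: "B \<in> sets borel" if "B \<in> rational_boxes" for B :: "'a set"
    using that by (auto simp: rational_boxes_def rational_box_def)
  have em: "emeasure (density lborel (\<lambda>x. ennreal (h x))) B = ennreal (LINT x|lborel. indicator B x * h x)"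
    if "integrable lborel h" "\<And>x. h x \<ge> 0" "B \<in> sets borel" for h :: "'a \<Rightarrow> real" and B
  proof -
    have [measurable]: "h \<in> borel_measurable lborel" "B \<in> sets lborel" using that by auto
    have "emeasure (density lborel (\<lambda>x. ennreal (h x))) B = (\<integral>\<^sup>+x. ennreal (h x) * indicator B x \<partial>lborel)"
      by (rule emeasure_density) measurable
    also have "\<dots> = (\<integral>\<^sup>+x. ennreal (indicator B x * h x) \<partial>lborel)"
      by (intro nn_integral_cong) (auto simp: indicator_def)
    also have "\<dots> = ennreal (LINT x|lborel. indicator B x * h x)"
      by (rule nn_integral_eq_integral)
        (use that integrable_mult_indicator[of B lborel h] in \<open>auto\<close>)
    finally show ?thesis .
  qed
  have "density lborel (\<lambda>x. ennreal (p x)) = density lborel (\<lambda>x. ennreal (q x))"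
  proof (rule measure_eqI_generator_eq_countable[where E=rational_boxes and \<Omega>=UNIV and A=rational_boxes])
    fix B :: "'a set" assume B: "B \<in> rational_boxes"
    note [measurable] = rb[OF B]
    have "0 = (LINT x|lebesgue. indicator B x * g x)"
      unfolding zero[OF B, symmetric]
      by (rule integral_cong_AE)
        (use fg' rb[OF B] int gi in \<open>auto intro!: borel_measurable_times borel_measurable_indicator\<close>)
    also have "\<dots> = (LINT x|lborel. indicator B x * g x)" by (rule integral_completion) measurable
    also have "\<dots> = (LINT x|lborel. indicator B x * p x - indicator B x * q x)"
      by (simp add: pq(3) algebra_simps)
    also have "\<dots> = (LINT x|lborel. indicator B x * p x) - (LINT x|lborel. indicator B x * q x)"
      using integrable_mult_indicator[of B lborel p] integrable_mult_indicator[of B lborel q] pq rb[OF B]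
      by (intro Bochner_Integration.integral_diff) auto
    finally show "emeasure (density lborel (\<lambda>x. ennreal (p x))) B = emeasure (density lborel (\<lambda>x. ennreal (q x))) B"
      by (simp add: em pq pos rb[OF B])
  next
    show "\<Union> rational_boxes = (UNIV :: 'a set)"
      using open_is_Union_rational_boxes[of "UNIV :: 'a set"] by auto
    show "emeasure (density lborel (\<lambda>x. ennreal (p x))) a \<noteq> \<infinity>" if "a \<in> rational_boxes" for a
      using em[OF pq(1) pos(1) rb[OF that]] by simp
  qed (auto simp: Int_stable_rational_boxes sets_borel_rational_boxes countable_rational_boxes)
  then have "AE x in lborel. ennreal (p x) = ennreal (q x)"
    by (subst (asm) sigma_finite_measure.density_unique_iff[OF sigma_finite_lborel]) auto
  then have "AE x in lborel. f x = 0" using fg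
    by eventually_elim (auto simp: p_def q_def max_def split: if_splits)
  then show ?thesis by (rule AE_completion)
qed

text \<open>Countably many test vectors suffice, so that only countably many exceptional null sets occur.\<close>

lemma AE_zero_if_AE_inner_zero:
  fixes f :: "'a \<Rightarrow> 'b::{real_inner,banach,second_countable_topology}"
  assumes D: "countable D" "\<And>X :: 'b set. open X \<Longrightarrow> X \<noteq> {} \<Longrightarrow> \<exists>d\<in>D. d \<in> X"
    and z: "\<And>d. d \<in> D \<Longrightarrow> AE x in M. f x \<bullet> d = 0"
  shows "AE x in M. f x = 0"
proof -
  have "AE x in M. \<forall>d\<in>D. f x \<bullet> d = 0" using z D(1) by (subst AE_ball_countable) auto
  then show ?thesis
  proof eventually_elim
    fix x assume 0: "\<forall>d\<in>D. f x \<bullet> d = 0"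
    show "f x = 0"
    proof (rule ccontr)
      assume nz: "f x \<noteq> 0"
      have "open {y. f x \<bullet> y > 0}" by (intro open_Collect_less continuous_intros)
      moreover have "f x \<in> {y. f x \<bullet> y > 0}" using nz by simp
      ultimately show False using D(2)[of "{y. f x \<bullet> y > 0}"] 0 by (metis empty_iff mem_Collect_eq less_irrefl)
    qed
  qed
qed

section \<open>The Hilbert space of square integrable functions on Euclidean space\<close>

text \<open>Square integrable functions modulo equality almost everywhere, as a type: its class instances allow
  this space to be used in turn as the value space of integrable functions of time.\<close>

quotient_type (overloaded) ('a,'b) lsq = "'a::euclidean_space \<Rightarrow> 'b::{real_inner,banach,second_countable_topology}"
  / partial: "\<lambda>f g. sq_int lebesgue f \<and> sq_int lebesgue g \<and> (AE x in lebesgue. f x = g x)"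
proof (rule part_equivpI)
  show "\<exists>f :: 'a \<Rightarrow> 'b. sq_int lebesgue f \<and> sq_int lebesgue f \<and> (AE x in lebesgue. f x = f x)"
    by (intro exI[of _ "\<lambda>x. 0"]) auto
  show "symp (\<lambda>(f :: 'a \<Rightarrow> 'b) g. sq_int lebesgue f \<and> sq_int lebesgue g \<and> (AE x in lebesgue. f x = g x))"
    by (auto simp: symp_def eq_commute)
  show "transp (\<lambda>(f :: 'a \<Rightarrow> 'b) g. sq_int lebesgue f \<and> sq_int lebesgue g \<and> (AE x in lebesgue. f x = g x))"
    unfolding transp_def by (auto elim: AE_mp)
qed

instantiation lsq :: (euclidean_space, "{real_inner,banach,second_countable_topology}") real_vector
begin

lift_definition zero_lsq :: "('a,'b) lsq" is "\<lambda>x. 0" by simp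
lift_definition plus_lsq :: "('a,'b) lsq \<Rightarrow> ('a,'b) lsq \<Rightarrow> ('a,'b) lsq" is "\<lambda>f g x. f x + g x"
  by (auto intro: sq_int_add)
lift_definition minus_lsq :: "('a,'b) lsq \<Rightarrow> ('a,'b) lsq \<Rightarrow> ('a,'b) lsq" is "\<lambda>f g x. f x - g x"
  by (auto intro: sq_int_diff)
lift_definition uminus_lsq :: "('a,'b) lsq \<Rightarrow> ('a,'b) lsq" is "\<lambda>f x. - f x"
  by (auto intro: sq_int_minus)
lift_definition scaleR_lsq :: "real \<Rightarrow> ('a,'b) lsq \<Rightarrow> ('a,'b) lsq" is "\<lambda>r f x. r *\<^sub>R f x"
  by (auto intro: sq_int_scaleR)
instance
proof
  fix x y z :: "('a,'b) lsq" and r s :: real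
  show "x + y + z = x + (y + z)" by transfer (auto simp: algebra_simps intro: sq_int_add)
  show "x + y = y + x" by transfer (auto simp: algebra_simps intro: sq_int_add)
  show "0 + x = x" by transfer (auto simp: algebra_simps intro: sq_int_add)
  show "- x + x = 0" by transfer (auto simp: algebra_simps intro: sq_int_add)
  show "x - y = x + - y" by transfer (auto intro: sq_int_diff)
  show "r *\<^sub>R (x + y) = r *\<^sub>R x + r *\<^sub>R y"
    by transfer (auto simp: scaleR_add_right intro: sq_int_add sq_int_scaleR)
  show "(r + s) *\<^sub>R x = r *\<^sub>R x + s *\<^sub>R x"
    by transfer (auto simp: scaleR_add_left intro: sq_int_add sq_int_scaleR)
  show "r *\<^sub>R s *\<^sub>R x = (r * s) *\<^sub>R x" by transfer (auto intro: sq_int_scaleR)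
  show "1 *\<^sub>R x = x" by transfer auto
qed

end

instantiation lsq :: (euclidean_space, "{real_inner,banach,second_countable_topology}") real_inner
begin

lift_definition inner_lsq :: "('a,'b) lsq \<Rightarrow> ('a,'b) lsq \<Rightarrow> real" is "\<lambda>f g. LINT x|lebesgue. f x \<bullet> g x"
proof -
  fix f f' g g' :: "'a \<Rightarrow> 'b"
  assume f: "sq_int lebesgue f \<and> sq_int lebesgue f' \<and> (AE x in lebesgue. f x = f' x)"
    and g: "sq_int lebesgue g \<and> sq_int lebesgue g' \<and> (AE x in lebesgue. g x = g' x)"
  have ae: "AE x in lebesgue. f x \<bullet> g x = f' x \<bullet> g' x"
    using conjunct2[OF conjunct2[OF f]] conjunct2[OF conjunct2[OF g]] by eventually_elim simp
  show "(LINT x|lebesgue. f x \<bullet> g x) = (LINT x|lebesgue. f' x \<bullet> g' x)"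
    by (rule integral_cong_AE[OF _ _ ae])
      (use f g integrable_inner_sq_int borel_measurable_integrable in blast)+
qed

definition norm_lsq :: "('a,'b) lsq \<Rightarrow> real" where "norm_lsq x = sqrt (x \<bullet> x)"
definition dist_lsq :: "('a,'b) lsq \<Rightarrow> ('a,'b) lsq \<Rightarrow> real" where "dist_lsq x y = norm (x - y)"
definition sgn_lsq :: "('a,'b) lsq \<Rightarrow> ('a,'b) lsq" where "sgn_lsq x = x /\<^sub>R norm x"
definition uniformity_lsq :: "(('a,'b) lsq \<times> ('a,'b) lsq) filter" where
  "uniformity_lsq = (INF e\<in>{0 <..}. principal {(x, y). dist x y < e})"
definition open_lsq :: "('a,'b) lsq set \<Rightarrow> bool" where
  "open_lsq U = (\<forall>x\<in>U. eventually (\<lambda>(x', y). x' = x \<longrightarrow> y \<in> U) uniformity)"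

instance
proof
  fix x y z :: "('a,'b) lsq" and r :: real
  show "x \<bullet> y = y \<bullet> x" by transfer (simp add: inner_commute)
  show "(x + y) \<bullet> z = x \<bullet> z + y \<bullet> z"
    by transfer (simp add: inner_add_left integrable_inner_sq_int)
  show "r *\<^sub>R x \<bullet> y = r * (x \<bullet> y)" by transfer simp
  show "0 \<le> x \<bullet> x" by transfer simp
  show "(x \<bullet> x = 0) = (x = 0)"
  proof (transfer)
    fix f :: "'a \<Rightarrow> 'b"
    assume f: "sq_int lebesgue f \<and> sq_int lebesgue f \<and> (AE x in lebesgue. f x = f x)"
    then have "integrable lebesgue (\<lambda>x. f x \<bullet> f x)" using integrable_inner_sq_int by blast
    then have "(LINT x|lebesgue. f x \<bullet> f x) = 0 \<longleftrightarrow> (AE x in lebesgue. f x \<bullet> f x = 0)"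
      by (rule integral_nonneg_eq_0_iff_AE) simp
    then show "(LINT x|lebesgue. f x \<bullet> f x) = 0 \<longleftrightarrow>
        sq_int lebesgue f \<and> sq_int lebesgue (\<lambda>x. 0::'b) \<and> (AE x in lebesgue. f x = 0)" using f by auto
  qed
qed (simp_all add: norm_lsq_def dist_lsq_def sgn_lsq_def uniformity_lsq_def open_lsq_def)

end

lemma sq_int_rep [simp]: "sq_int lebesgue (rep_lsq x)"
  and abs_rep_lsq [simp]: "abs_lsq (rep_lsq x) = x"
  using Quotient3_rep_reflp[OF Quotient3_lsq, of x] Quotient3_abs_rep[OF Quotient3_lsq, of x] by auto

lemma abs_lsq_eq_iff:
  "sq_int lebesgue f \<Longrightarrow> sq_int lebesgue g \<Longrightarrow> abs_lsq f = abs_lsq g \<longleftrightarrow> (AE x in lebesgue. f x = g x)"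
  using Quotient3_rel[OF Quotient3_lsq, of f g] by auto

lemma abs_lsq_0: "abs_lsq (\<lambda>x. 0) = 0" by (simp add: zero_lsq_def)

lemma abs_lsq_add:
  "sq_int lebesgue f \<Longrightarrow> sq_int lebesgue g \<Longrightarrow> abs_lsq f + abs_lsq g = abs_lsq (\<lambda>x. f x + g x)"
  by (simp add: plus_lsq.abs_eq)

lemma abs_lsq_diff:
  "sq_int lebesgue f \<Longrightarrow> sq_int lebesgue g \<Longrightarrow> abs_lsq f - abs_lsq g = abs_lsq (\<lambda>x. f x - g x)"
  by (simp add: minus_lsq.abs_eq)

lemma abs_lsq_scaleR: "sq_int lebesgue f \<Longrightarrow> r *\<^sub>R abs_lsq f = abs_lsq (\<lambda>x. r *\<^sub>R f x)"
  by (simp add: scaleR_lsq.abs_eq)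

lemma inner_abs_lsq:
  "sq_int lebesgue f \<Longrightarrow> sq_int lebesgue g \<Longrightarrow> abs_lsq f \<bullet> abs_lsq g = (LINT x|lebesgue. f x \<bullet> g x)"
  by (simp add: inner_lsq.abs_eq)

lemma norm2_abs_lsq:
  "sq_int lebesgue f \<Longrightarrow> (norm (abs_lsq f))\<^sup>2 = (LINT x|lebesgue. (norm (f x))\<^sup>2)"
  by (simp add: power2_norm_eq_inner inner_abs_lsq)

instance lsq :: (euclidean_space, "{real_inner,banach,second_countable_topology}") banach
proof
  fix X :: "nat \<Rightarrow> ('a,'b) lsq" assume "Cauchy X"
  have eq: "(LINT x|lebesgue. (norm (rep_lsq (X m) x - rep_lsq (X n) x))\<^sup>2) = (norm (X m - X n))\<^sup>2" for m n
  proof -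
    have "X m - X n = abs_lsq (\<lambda>x. rep_lsq (X m) x - rep_lsq (X n) x)"
      using abs_lsq_diff[of "rep_lsq (X m)" "rep_lsq (X n)"] by simp
    then show ?thesis by (simp add: norm2_abs_lsq sq_int_diff)
  qed
  obtain g where g: "sq_int lebesgue g" "(\<lambda>n. LINT x|lebesgue. (norm (rep_lsq (X n) x - g x))\<^sup>2) \<longlonglongrightarrow> 0"
  proof (rule riesz_fischer[of lebesgue "\<lambda>n. rep_lsq (X n)"])
    fix e :: real assume "e > 0"
    then obtain N where N: "\<forall>m\<ge>N. \<forall>n\<ge>N. norm (X m - X n) < sqrt e"
      using CauchyD[OF \<open>Cauchy X\<close>, of "sqrt e"] by auto
    have "(norm (X m - X n))\<^sup>2 < e" if "m \<ge> N" "n \<ge> N" for m n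
      using power_strict_mono[of "norm (X m - X n)" "sqrt e" 2] N that \<open>e > 0\<close> by simp
    then show "\<exists>N. \<forall>m\<ge>N. \<forall>n\<ge>N. (LINT x|lebesgue. (norm (rep_lsq (X m) x - rep_lsq (X n) x))\<^sup>2) < e"
      unfolding eq by blast
  qed auto
  have "(norm (X n - abs_lsq g))\<^sup>2 = (LINT x|lebesgue. (norm (rep_lsq (X n) x - g x))\<^sup>2)" for n
  proof -
    have "X n - abs_lsq g = abs_lsq (\<lambda>x. rep_lsq (X n) x - g x)"
      using abs_lsq_diff[of "rep_lsq (X n)" g] g by simp
    then show ?thesis by (simp add: norm2_abs_lsq sq_int_diff g)
  qed
  with g have "(\<lambda>n. sqrt ((norm (X n - abs_lsq g))\<^sup>2)) \<longlonglongrightarrow> sqrt 0" by (intro tendsto_intros) simp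
  then have "X \<longlonglongrightarrow> abs_lsq g" by (simp add: tendsto_norm_zero_iff LIM_zero_iff)
  then show "convergent X" by (rule convergentI)
qed

text \<open>The functions that are constant on a rational box, with a value from a countable dense set, and zero
  outside of it form a total set.\<close>

instance lsq :: (euclidean_space, "{real_inner,banach,second_countable_topology}") second_countable_topology
proof
  obtain D :: "'b set" where D: "countable D" "\<And>X. open X \<Longrightarrow> X \<noteq> {} \<Longrightarrow> \<exists>d\<in>D. d \<in> X"
    by (erule countable_dense_setE)
  define ind where "ind B d x = indicator B x *\<^sub>R d" for B :: "'a set" and d :: 'b and x
  have sq: "sq_int lebesgue (ind B d)" if B: "B \<in> rational_boxes" for B d
    unfolding sq_int_def ind_def
  proof
    have [measurable]: "B \<in> sets lebesgue" using B by (auto simp: rational_boxes_def rational_box_def)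
    show "(\<lambda>x. indicator B x *\<^sub>R d) \<in> borel_measurable lebesgue" by measurable
    have "integrable lebesgue (\<lambda>x. indicator B x * (norm d)\<^sup>2)"
      using B by (auto simp: rational_boxes_def rational_box_def emeasure_lborel_box_eq
          intro!: integrable_mult_left integrable_real_indicator)
    moreover have "(\<lambda>x. (norm (indicator B x *\<^sub>R d))\<^sup>2) = (\<lambda>x. indicator B x * (norm d)\<^sup>2)"
      by (auto simp: indicator_def)
    ultimately show "integrable lebesgue (\<lambda>x. (norm (indicator B x *\<^sub>R d))\<^sup>2)" by simp
  qed
  define C where "C = (\<lambda>(B,d). abs_lsq (ind B d)) ` (rational_boxes \<times> D)"
  show "\<exists>B::('a,'b) lsq set set. countable B \<and> open = generate_topology B"
  proof (rule second_countable_if_countable_total)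
    show "countable C" unfolding C_def by (intro countable_image countable_SIGMA countable_rational_boxes D)
    fix z :: "('a,'b) lsq" assume z: "\<And>c. c \<in> C \<Longrightarrow> z \<bullet> c = 0"
    define f where "f = rep_lsq z"
    have sf: "sq_int lebesgue f" by (simp add: f_def)
    have "AE x in lebesgue. f x \<bullet> d = 0" if d: "d \<in> D" for d
    proof -
      have *: "(LINT x|lebesgue. indicator B x * (f x \<bullet> d)) = 0" if B: "B \<in> rational_boxes" for B
      proof -
        have "0 = abs_lsq f \<bullet> abs_lsq (ind B d)" using z[of "abs_lsq (ind B d)"] B d by (force simp: C_def f_def)
        also have "\<dots> = (LINT x|lebesgue. f x \<bullet> ind B d x)" by (rule inner_abs_lsq[OF sf sq[OF B]])
        also have "\<dots> = (LINT x|lebesgue. indicator B x * (f x \<bullet> d))" by (simp add: ind_def)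
        finally show ?thesis by simp
      qed
      have loc: "AE x in lebesgue. indicator B x * (f x \<bullet> d) = 0" if B: "B \<in> rational_boxes" for B
      proof (rule AE_zero_if_box_integrals_zero)
        have "integrable lebesgue (\<lambda>x. f x \<bullet> ind B d x)" by (rule integrable_inner_sq_int[OF sf sq[OF B]])
        then show "integrable lebesgue (\<lambda>x. indicator B x * (f x \<bullet> d))" by (simp add: ind_def)
        fix B' :: "'a set" assume "B' \<in> rational_boxes"
        then have "B' \<inter> B \<in> rational_boxes" using B Int_stable_rational_boxes by (auto simp: Int_stable_def)
        from *[OF this] show "(LINT x|lebesgue. indicator B' x * (indicator B x * (f x \<bullet> d))) = 0"
          by (simp add: indicator_inter_arith mult.assoc)
      qed
      have "AE x in lebesgue. \<forall>B\<in>rational_boxes. indicator B x * (f x \<bullet> d) = 0"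
        using loc countable_rational_boxes by (subst AE_ball_countable) auto
      then show ?thesis
      proof eventually_elim
        fix x assume a: "\<forall>B\<in>rational_boxes. indicator B x * (f x \<bullet> d) = 0"
        obtain B where "B \<in> rational_boxes" "x \<in> B"
          using open_is_Union_rational_boxes[of "UNIV :: 'a set"] by auto
        then show "f x \<bullet> d = 0" using a by force
      qed
    qed
    then have "AE x in lebesgue. f x = 0" by (intro AE_zero_if_AE_inner_zero[of D]) (use D in blast)+
    then have "abs_lsq f = abs_lsq (\<lambda>x. 0)" by (subst abs_lsq_eq_iff) (auto simp: sf)
    then show "z = 0" by (simp add: f_def abs_lsq_0)
  qed
qed

section \<open>Indefinite integrals of vector-valued functions of time\<close>

abbreviation time :: "real \<Rightarrow> real measure" where
  "time t \<equiv> lebesgue_on {0..t}"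

definition vint :: "(real \<Rightarrow> 'b::{banach,second_countable_topology}) \<Rightarrow> real \<Rightarrow> 'b" where
  "vint p t = (LINT s|time t. p s)"

lemma space_time [simp]: "space (time t) = {0..t}" by simp

lemma finite_measure_time: "finite_measure (time t)"
  by (rule finite_measure_lebesgue_on) auto

lemma integrable_time_iff:
  fixes p :: "real \<Rightarrow> 'b::{banach,second_countable_topology}"
  shows "integrable (time t) p \<longleftrightarrow> integrable lebesgue (\<lambda>s. indicator {0..t} s *\<^sub>R p s)"
  by (rule integrable_restrict_space) auto

lemma integral_time_eq:
  fixes p :: "real \<Rightarrow> 'b::{banach,second_countable_topology}"
  shows "(LINT s|time t. p s) = (LINT s|lebesgue. indicator {0..t} s *\<^sub>R p s)"
  by (rule integral_restrict_space) auto

lemma measurable_time_mono: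
  assumes "p \<in> borel_measurable (time \<tau>)" "t \<le> \<tau>" shows "p \<in> borel_measurable (time t)"
proof -
  have "p \<in> borel_measurable (restrict_space (time \<tau>) {0..t})"
    using assms(1) by (rule measurable_restrict_space1)
  also have "restrict_space (time \<tau>) {0..t} = time t"
    using assms(2) by (subst restrict_restrict_space) (auto simp: min_absorb2)
  finally show ?thesis .
qed

lemma integrable_time_mono:
  fixes p :: "real \<Rightarrow> 'b::{banach,second_countable_topology}"
  assumes "integrable (time \<tau>) p" "t \<le> \<tau>" shows "integrable (time t) p"
proof -
  have "integrable lebesgue (\<lambda>s. indicator {0..t} s *\<^sub>R (indicator {0..\<tau>} s *\<^sub>R p s))"
    using assms(1) unfolding integrable_time_iff by (rule integrable_mult_indicator[rotated]) simp
  moreover have "(\<lambda>s. indicator {0..t} s *\<^sub>R (indicator {0..\<tau>} s *\<^sub>R p s)) = (\<lambda>s. indicator {0..t} s *\<^sub>R p s)"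
    using assms(2) by (auto simp: indicator_def fun_eq_iff)
  ultimately show ?thesis unfolding integrable_time_iff by simp
qed

lemma sq_int_time_mono: "sq_int (time \<tau>) p \<Longrightarrow> t \<le> \<tau> \<Longrightarrow> sq_int (time t) p"
  unfolding sq_int_def using measurable_time_mono integrable_time_mono by blast

lemma integral_time_mono:
  fixes p :: "real \<Rightarrow> real"
  assumes "integrable (time \<tau>) p" "t \<le> \<tau>" "\<And>s. p s \<ge> 0"
  shows "(LINT s|time t. p s) \<le> (LINT s|time \<tau>. p s)"
  unfolding integral_time_eq
  by (rule integral_mono) (use assms integrable_time_mono[OF assms(1,2)] in
    \<open>auto simp: integrable_time_iff indicator_def\<close>)

lemma AE_time_mono:
  assumes "AE s in time \<tau>. P s" "t \<le> \<tau>" shows "AE s in time t. P s"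
  using assms by (auto simp: AE_restrict_space_iff elim!: eventually_mono)

lemma sq_int_integrable_time:
  assumes "sq_int (time \<tau>) p" shows "integrable (time \<tau>) p"
proof (rule Bochner_Integration.integrable_bound)
  show "integrable (time \<tau>) (\<lambda>s. 1 + (norm (p s))\<^sup>2)"
    using assms finite_measure.integrable_const[OF finite_measure_time]
    by (auto simp: sq_int_def)
  have "norm (p s) \<le> 1 + (norm (p s))\<^sup>2" for s
  proof -
    have "2 * norm (p s) \<le> 1 + (norm (p s))\<^sup>2" using sum_squares_bound[of 1 "norm (p s)"] by simp
    then show ?thesis using norm_ge_zero[of "p s"] by linarith
  qed
  then show "AE s in time \<tau>. norm (p s) \<le> norm (1 + (norm (p s))\<^sup>2)" by auto
qed (use assms in \<open>auto simp: sq_int_def\<close>)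

lemma continuous_on_measurable_time:
  fixes p :: "real \<Rightarrow> 'b::{banach,second_countable_topology}"
  assumes "continuous_on {0..\<tau>} p" shows "p \<in> borel_measurable (time \<tau>)"
proof -
  have "p \<in> borel_measurable (restrict_space borel {0..\<tau>})"
    by (rule borel_measurable_continuous_on_restrict[OF assms])
  then have "(\<lambda>s. indicator {0..\<tau>} s *\<^sub>R p s) \<in> borel_measurable borel"
    by (subst (asm) borel_measurable_restrict_space_iff) auto
  then have "(\<lambda>s. indicator {0..\<tau>} s *\<^sub>R p s) \<in> borel_measurable lebesgue"
    by (simp add: measurable_completion)
  then show ?thesis by (subst borel_measurable_restrict_space_iff) auto
qed

lemma bounded_integrable_time:
  fixes p :: "real \<Rightarrow> 'b::{banach,second_countable_topology}"
  assumes "p \<in> borel_measurable (time \<tau>)" "\<And>s. s \<in> {0..\<tau>} \<Longrightarrow> norm (p s) \<le> B"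
  shows "integrable (time \<tau>) p"
  by (rule finite_measure.integrable_const_bound[OF finite_measure_time, where B=B]) (use assms in auto)

lemma continuous_on_sq_int_time:
  assumes "continuous_on {0..\<tau>} p" shows "sq_int (time \<tau>) p"
  unfolding sq_int_def
proof
  show m: "p \<in> borel_measurable (time \<tau>)" by (rule continuous_on_measurable_time[OF assms])
  have "compact (p ` {0..\<tau>})" using assms by (rule compact_continuous_image) auto
  then obtain B where B: "\<And>s. s \<in> {0..\<tau>} \<Longrightarrow> norm (p s) \<le> B"
    using bounded_iff compact_imp_bounded by (metis imageI)
  show "integrable (time \<tau>) (\<lambda>x. (norm (p x))\<^sup>2)"
    by (rule bounded_integrable_time[where B="B\<^sup>2"]) (use m B in \<open>auto intro!: power_mono\<close>)
qed

lemma continuous_vint: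
  assumes p: "integrable (time \<tau>) p" shows "continuous_on {0..\<tau>} (vint p)"
  unfolding continuous_on_sequentially comp_def
proof (intro allI ballI impI)
  fix x a assume a: "a \<in> {0..\<tau>}" and "(\<forall>n. x n \<in> {0..\<tau>}) \<and> x \<longlonglongrightarrow> a"
  then have x: "\<And>n. x n \<in> {0..\<tau>}" "x \<longlonglongrightarrow> a" by auto
  show "(\<lambda>n. vint p (x n)) \<longlonglongrightarrow> vint p a"
    unfolding vint_def integral_time_eq
  proof (rule integral_dominated_convergence[where w="\<lambda>s. norm (indicator {0..\<tau>} s *\<^sub>R p s)"])
    show "(\<lambda>s. indicator {0..a} s *\<^sub>R p s) \<in> borel_measurable lebesgue"
      using integrable_time_mono[OF p, of a] a by (auto simp: integrable_time_iff)
    show "(\<lambda>s. indicator {0..x n} s *\<^sub>R p s) \<in> borel_measurable lebesgue" for n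
      using integrable_time_mono[OF p, of "x n"] x(1)[of n] by (auto simp: integrable_time_iff)
    show "integrable lebesgue (\<lambda>s. norm (indicator {0..\<tau>} s *\<^sub>R p s))"
      using p by (auto simp only: integrable_time_iff intro: integrable_norm)
    show "AE s in lebesgue. norm (indicator {0..x n} s *\<^sub>R p s) \<le> norm (indicator {0..\<tau>} s *\<^sub>R p s)" for n
      using x(1)[of n] by (auto simp: indicator_def)
    have "AE s in lebesgue. s \<noteq> a"
      by (rule AE_I'[of "{a}"]) (auto simp: negligible_iff_null_sets[symmetric])
    then show "AE s in lebesgue. (\<lambda>n. indicator {0..x n} s *\<^sub>R p s) \<longlonglongrightarrow> indicator {0..a} s *\<^sub>R p s"
    proof eventually_elim
      fix s assume "s \<noteq> a"
      then consider "s < a" | "s > a" by linarith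
      then have "\<forall>\<^sub>F n in sequentially. indicator {0..x n} s *\<^sub>R p s = indicator {0..a} s *\<^sub>R p s"
      proof cases
        case 1
        then have "\<forall>\<^sub>F n in sequentially. x n > s" using x(2) order_tendstoD by blast
        then show ?thesis by eventually_elim (use 1 in \<open>auto simp: indicator_def\<close>)
      next
        case 2
        then have "\<forall>\<^sub>F n in sequentially. x n < s" using x(2) order_tendstoD by blast
        then show ?thesis by eventually_elim (use 2 in \<open>auto simp: indicator_def\<close>)
      qed
      then show "(\<lambda>n. indicator {0..x n} s *\<^sub>R p s) \<longlonglongrightarrow> indicator {0..a} s *\<^sub>R p s"
        by (rule tendsto_eventually)
    qed
  qed
qed

lemma vint_0 [simp]: "vint p 0 = 0"
proof -
  have "AE s in lebesgue. s \<noteq> (0::real)"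
    by (rule AE_I'[of "{0}"]) (auto simp: negligible_iff_null_sets[symmetric])
  then have "AE s in lebesgue. indicator {0..0} s *\<^sub>R p s = 0"
    by eventually_elim (auto simp: indicator_def)
  then show ?thesis unfolding vint_def integral_time_eq by (rule integral_eq_zero_AE)
qed

lemma vint_bounded_linear:
  assumes "bounded_linear L" "integrable (time t) p"
  shows "vint (\<lambda>s. L (p s)) t = L (vint p t)"
  unfolding vint_def using assms by (rule integral_bounded_linear)

lemma vint_add:
  "integrable (time t) p \<Longrightarrow> integrable (time t) q \<Longrightarrow> vint (\<lambda>s. p s + q s) t = vint p t + vint q t"
  unfolding vint_def by (rule Bochner_Integration.integral_add)

lemma vint_diff:
  "integrable (time t) p \<Longrightarrow> integrable (time t) q \<Longrightarrow> vint (\<lambda>s. p s - q s) t = vint p t - vint q t"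
  unfolding vint_def by (rule Bochner_Integration.integral_diff)

text \<open>Symmetrizing the double integral of \<open>p r \<bullet> p s\<close> over the triangle \<open>r \<le> s\<close> by Fubini's theorem
  gives half of the integral over the square.\<close>

lemma integral_vint_inner_self:
  fixes p :: "real \<Rightarrow> 'b::{real_inner,banach,second_countable_topology}"
  assumes p: "integrable (time t) p"
  shows "2 * (LINT s|time t. vint p s \<bullet> p s) = (norm (vint p t))\<^sup>2"
proof -
  interpret M: finite_measure "time t" by (rule finite_measure_time)
  interpret MM: pair_sigma_finite "time t" "time t" ..
  have [measurable]: "p \<in> borel_measurable (time t)" using p by auto
  have [measurable]: "(\<lambda>x. x) \<in> borel_measurable (time t)"
    by (rule continuous_on_measurable_time) (intro continuous_intros)
  have fst_m [measurable]: "fst \<in> borel_measurable (time t \<Otimes>\<^sub>M time t)"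
    using measurable_compose[OF measurable_fst, of "\<lambda>x. x" "time t" borel "time t"] by simp
  have snd_m [measurable]: "snd \<in> borel_measurable (time t \<Otimes>\<^sub>M time t)"
    using measurable_compose[OF measurable_snd, of "\<lambda>x. x" "time t" borel "time t"] by simp
  define h where "h r s = (if r \<le> s then p r \<bullet> p s else 0)" for r s
  have hm: "case_prod h \<in> borel_measurable (time t \<Otimes>\<^sub>M time t)"
  proof -
    have "(\<lambda>z. if fst z \<le> snd z then p (fst z) \<bullet> p (snd z) else 0) \<in> borel_measurable (time t \<Otimes>\<^sub>M time t)"
      by measurable
    then show ?thesis by (simp add: h_def case_prod_beta')
  qed
  have bd: "norm (h r s) \<le> norm (p r) * norm (p s)" for r s
    by (auto simp: h_def Cauchy_Schwarz_ineq2)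
  have hi: "integrable (time t) (h r)" for r
  proof (rule Bochner_Integration.integrable_bound)
    show "integrable (time t) (\<lambda>s. norm (p r) * norm (p s))" using p by auto
    show "h r \<in> borel_measurable (time t)" unfolding h_def by measurable
  qed (use bd in auto)
  have "integrable (time t \<Otimes>\<^sub>M time t) (case_prod h)"
  proof (rule MM.Fubini_integrable[OF hm])
    show "integrable (time t) (\<lambda>x. LINT y|time t. norm (case (x, y) of (x, xa) \<Rightarrow> h x xa))"
    proof (rule Bochner_Integration.integrable_bound)
      show "integrable (time t) (\<lambda>r. norm (p r) * (LINT s|time t. norm (p s)))" using p by auto
      show "(\<lambda>x. LINT y|time t. norm (case (x, y) of (x, xa) \<Rightarrow> h x xa)) \<in> borel_measurable (time t)"
        using hm by measurable
      have "norm (LINT s|time t. norm (h r s)) \<le> norm (norm (p r) * (LINT s|time t. norm (p s)))" for r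
      proof -
        have "(LINT s|time t. norm (h r s)) \<le> (LINT s|time t. norm (p r) * norm (p s))"
          by (rule integral_mono) (use hi bd p in auto)
        then show ?thesis by simp
      qed
      then show "AE r in time t. norm (LINT y|time t. norm (case (r, y) of (x, xa) \<Rightarrow> h x xa))
          \<le> norm (norm (p r) * (LINT s|time t. norm (p s)))" by simp
    qed
    show "AE x in time t. integrable (time t) (\<lambda>y. case (x, y) of (x, xa) \<Rightarrow> h x xa)"
      using hi by simp
  qed
  from MM.Fubini_integral[OF this]
  have fub: "(LINT s|time t. LINT r|time t. h r s) = (LINT r|time t. LINT s|time t. h r s)" .
  have in1: "(LINT r|time t. h r s) = vint p s \<bullet> p s" if s: "s \<in> {0..t}" for s
  proof -
    have ips: "integrable (time s) p" using integrable_time_mono[OF p] s by auto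
    have "(LINT r|time t. h r s) = (LINT r|lebesgue. (indicator {0..s} r *\<^sub>R p r) \<bullet> p s)"
      unfolding integral_time_eq h_def
      by (rule Bochner_Integration.integral_cong) (use s in \<open>auto simp: indicator_def\<close>)
    also have "\<dots> = vint p s \<bullet> p s"
      unfolding vint_def integral_time_eq using ips by (subst integral_inner_left) (auto simp: integrable_time_iff)
    finally show ?thesis .
  qed
  have in2: "(LINT s|time t. h r s) = p r \<bullet> vint p t - vint p r \<bullet> p r" if r: "r \<in> {0..t}" for r
  proof -
    have ipr: "integrable (time r) p" using integrable_time_mono[OF p] r by auto
    have ne: "AE s in lebesgue. s \<noteq> r"
      by (rule AE_I'[of "{r}"]) (auto simp: negligible_iff_null_sets[symmetric])
    have "(LINT s|time t. h r s) = (LINT s|lebesgue. (indicator {0..t} s *\<^sub>R p s) \<bullet> p r - (indicator {0..r} s *\<^sub>R p s) \<bullet> p r)"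
      unfolding integral_time_eq
    proof (rule integral_cong_AE)
      show "(\<lambda>s. indicator {0..t} s *\<^sub>R h r s) \<in> borel_measurable lebesgue"
        using hi[of r] unfolding integrable_time_iff by auto
      show "(\<lambda>s. (indicator {0..t} s *\<^sub>R p s) \<bullet> p r - (indicator {0..r} s *\<^sub>R p s) \<bullet> p r) \<in> borel_measurable lebesgue"
        by (intro borel_measurable_diff borel_measurable_inner borel_measurable_const)
          (use p ipr in \<open>auto simp only: integrable_time_iff dest: borel_measurable_integrable\<close>)
      show "AE s in lebesgue. indicator {0..t} s *\<^sub>R h r s =
         (indicator {0..t} s *\<^sub>R p s) \<bullet> p r - (indicator {0..r} s *\<^sub>R p s) \<bullet> p r"
        using ne by eventually_elim (use r in \<open>auto simp: indicator_def h_def inner_commute\<close>)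
    qed
    also have "\<dots> = vint p t \<bullet> p r - vint p r \<bullet> p r"
    proof -
      note i = p[unfolded integrable_time_iff] ipr[unfolded integrable_time_iff]
      show ?thesis
        unfolding Bochner_Integration.integral_diff[OF integrable_inner_left[OF i(1)] integrable_inner_left[OF i(2)]]
          integral_bounded_linear[OF bounded_linear_inner_left i(1)]
          integral_bounded_linear[OF bounded_linear_inner_left i(2)] vint_def integral_time_eq ..
    qed
    finally show ?thesis by (simp add: inner_commute)
  qed
  have vm: "integrable (time t) (\<lambda>r. vint p r \<bullet> p r)"
  proof -
    have c: "continuous_on {0..t} (vint p)" by (rule continuous_vint[OF p])
    then have "compact (vint p ` {0..t})" by (rule compact_continuous_image) auto
    then obtain B where B: "\<And>s. s \<in> {0..t} \<Longrightarrow> norm (vint p s) \<le> B"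
      using bounded_iff compact_imp_bounded by (metis imageI)
    have [measurable]: "vint p \<in> borel_measurable (time t)" by (rule continuous_on_measurable_time[OF c])
    show ?thesis
    proof (rule Bochner_Integration.integrable_bound)
      show "integrable (time t) (\<lambda>r. B * norm (p r))" using p by auto
      show "AE r in time t. norm (vint p r \<bullet> p r) \<le> norm (B * norm (p r))"
      proof (rule AE_I2)
        fix r assume "r \<in> space (time t)"
        then have "norm (vint p r) * norm (p r) \<le> B * norm (p r)" using B by (auto intro!: mult_right_mono)
        then show "norm (vint p r \<bullet> p r) \<le> norm (B * norm (p r))"
          using Cauchy_Schwarz_ineq2[of "vint p r" "p r"] by simp
      qed
    qed measurable
  qed
  have "(LINT s|time t. vint p s \<bullet> p s) = (LINT s|time t. LINT r|time t. h r s)"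
    by (rule Bochner_Integration.integral_cong) (use in1 in auto)
  also have "\<dots> = (LINT r|time t. p r \<bullet> vint p t - vint p r \<bullet> p r)"
    unfolding fub by (rule Bochner_Integration.integral_cong) (use in2 in auto)
  also have "\<dots> = vint p t \<bullet> vint p t - (LINT r|time t. vint p r \<bullet> p r)"
    using p vm by (simp add: vint_def)
  finally show ?thesis by (simp add: power2_norm_eq_inner)
qed

lemma integrable_continuous_inner:
  fixes p q :: "real \<Rightarrow> 'b::{real_inner,banach,second_countable_topology}"
  assumes "continuous_on {0..t} q" "integrable (time t) p"
  shows "integrable (time t) (\<lambda>s. q s \<bullet> p s)" "integrable (time t) (\<lambda>s. p s \<bullet> q s)"
proof -
  have [measurable]: "p \<in> borel_measurable (time t)" using assms by auto
  have [measurable]: "q \<in> borel_measurable (time t)" by (rule continuous_on_measurable_time[OF assms(1)])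
  have "compact (q ` {0..t})" using assms(1) by (rule compact_continuous_image) auto
  then obtain B where B: "\<And>s. s \<in> {0..t} \<Longrightarrow> norm (q s) \<le> B"
    using bounded_iff compact_imp_bounded by (metis imageI)
  show "integrable (time t) (\<lambda>s. q s \<bullet> p s)"
  proof (rule Bochner_Integration.integrable_bound)
    show "integrable (time t) (\<lambda>r. B * norm (p r))" using assms by auto
    show "AE r in time t. norm (q r \<bullet> p r) \<le> norm (B * norm (p r))"
    proof (rule AE_I2)
      fix r assume "r \<in> space (time t)"
      then have "norm (q r) * norm (p r) \<le> B * norm (p r)" using B by (auto intro!: mult_right_mono)
      then show "norm (q r \<bullet> p r) \<le> norm (B * norm (p r))"
        using Cauchy_Schwarz_ineq2[of "q r" "p r"] by simp
    qed
  qed measurable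
  then show "integrable (time t) (\<lambda>s. p s \<bullet> q s)" by (simp add: inner_commute)
qed

lemma norm_square_plus_vint:
  fixes p :: "real \<Rightarrow> 'b::{real_inner,banach,second_countable_topology}"
  assumes p: "integrable (time t) p"
  shows "(norm (x + vint p t))\<^sup>2 = (norm x)\<^sup>2 + 2 * (LINT s|time t. (x + vint p s) \<bullet> p s)"
proof -
  have "(LINT s|time t. (x + vint p s) \<bullet> p s) = (LINT s|time t. x \<bullet> p s + vint p s \<bullet> p s)"
    by (simp add: inner_simps)
  also have "\<dots> = x \<bullet> vint p t + (LINT s|time t. vint p s \<bullet> p s)"
    using p integrable_continuous_inner(1)[OF continuous_vint[OF p] p]
    by (subst Bochner_Integration.integral_add) (auto simp: vint_def)
  finally show ?thesis
    using integral_vint_inner_self[OF p]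
    by (simp add: power2_norm_eq_inner inner_simps inner_commute)
qed

text \<open>Polarization of the identity for the square of an indefinite integral; this is integration by parts
  for absolutely continuous functions with values in a Hilbert space.\<close>

lemma vint_product_rule:
  fixes p q :: "real \<Rightarrow> 'b::{real_inner,banach,second_countable_topology}"
  assumes p: "integrable (time t) p" and q: "integrable (time t) q"
  shows "vint p t \<bullet> vint q t = (LINT s|time t. p s \<bullet> vint q s) + (LINT s|time t. vint p s \<bullet> q s)"
proof -
  have pq: "integrable (time t) (\<lambda>s. p s + q s)" using p q by auto
  note c = continuous_vint[OF p] continuous_vint[OF q]
  have "(norm (vint p t + vint q t))\<^sup>2 = 2 * (LINT s|time t. vint (\<lambda>s. p s + q s) s \<bullet> (p s + q s))"
    using integral_vint_inner_self[OF pq] vint_add[OF p q] by simp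
  also have "(LINT s|time t. vint (\<lambda>s. p s + q s) s \<bullet> (p s + q s))
     = (LINT s|time t. (vint p s \<bullet> p s + vint q s \<bullet> q s) + (p s \<bullet> vint q s + vint p s \<bullet> q s))"
  proof (rule Bochner_Integration.integral_cong)
    fix s assume "s \<in> space (time t)"
    then have "vint (\<lambda>s. p s + q s) s = vint p s + vint q s"
      using integrable_time_mono[OF p] integrable_time_mono[OF q] by (intro vint_add) auto
    then show "vint (\<lambda>s. p s + q s) s \<bullet> (p s + q s) = (vint p s \<bullet> p s + vint q s \<bullet> q s) + (p s \<bullet> vint q s + vint p s \<bullet> q s)"
      by (simp add: inner_simps inner_commute)
  qed simp
  also have "\<dots> = (LINT s|time t. vint p s \<bullet> p s) + (LINT s|time t. vint q s \<bullet> q s)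
      + ((LINT s|time t. p s \<bullet> vint q s) + (LINT s|time t. vint p s \<bullet> q s))"
    using integrable_continuous_inner[OF c(1) p] integrable_continuous_inner[OF c(2) q]
      integrable_continuous_inner[OF c(1) q] integrable_continuous_inner[OF c(2) p] by simp
  finally show ?thesis using integral_vint_inner_self[OF p] integral_vint_inner_self[OF q]
    by (simp add: power2_norm_eq_inner inner_simps inner_commute)
qed

text \<open>After pairing with a fixed vector, the integrals over all boxes, here intervals, vanish.\<close>

lemma AE_zero_if_vint_zero:
  fixes p :: "real \<Rightarrow> 'b::{real_inner,banach,second_countable_topology}"
  assumes p: "integrable (time \<tau>) p" and 0: "\<And>t. t \<in> {0..\<tau>} \<Longrightarrow> vint p t = 0" and \<tau>: "\<tau> \<ge> 0"
  shows "AE s in time \<tau>. p s = 0"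
proof -
  obtain D :: "'b set" where D: "countable D" "\<And>X. open X \<Longrightarrow> X \<noteq> {} \<Longrightarrow> \<exists>d\<in>D. d \<in> X"
    by (erule countable_dense_setE)
  have "AE s in time \<tau>. p s \<bullet> d = 0" for d
  proof -
    define f where "f s = indicator {0..\<tau>} s * (p s \<bullet> d)" for s
    have fi: "integrable lebesgue f"
      using integrable_inner_left[of d "time \<tau>" p] p unfolding integrable_time_iff f_def by simp
    have z: "(LINT s|lebesgue. indicator {0..t} s * f s) = 0" if t: "t \<in> {0..\<tau>}" for t
    proof -
      have "(LINT s|lebesgue. indicator {0..t} s * f s) = vint (\<lambda>s. p s \<bullet> d) t"
        unfolding vint_def integral_time_eq f_def
        by (rule Bochner_Integration.integral_cong) (use t in \<open>auto simp: indicator_def\<close>)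
      also have "\<dots> = vint p t \<bullet> d"
        by (rule vint_bounded_linear[OF bounded_linear_inner_left]) (use integrable_time_mono[OF p] t in auto)
      finally show ?thesis using 0[OF t] by simp
    qed
    have "AE s in lebesgue. f s = 0"
    proof (rule AE_zero_if_box_integrals_zero[OF fi])
      fix B :: "real set" assume "B \<in> rational_boxes"
      then obtain a b where B: "B = {a<..<b}" by (auto simp: rational_boxes_def rational_box_def)
      define a' where "a' = min \<tau> (max 0 a)"
      define b' where "b' = max a' (min \<tau> b)"
      have ab: "a' \<in> {0..\<tau>}" "b' \<in> {0..\<tau>}" "a' \<le> b'" using \<tau> by (auto simp: a'_def b'_def)
      have ne: "AE s in lebesgue. s \<noteq> a' \<and> s \<noteq> b' \<and> s \<noteq> \<tau> \<and> s \<noteq> 0"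
        by (rule AE_I'[of "{a',b',\<tau>,0}"]) (auto simp: negligible_iff_null_sets[symmetric])
      have mi: "integrable lebesgue (\<lambda>s. indicator S s * f s)" if "S \<in> sets lebesgue" for S
        using integrable_mult_indicator[OF that fi] by simp
      have "(LINT s|lebesgue. indicator B s * f s) = (LINT s|lebesgue. indicator {0..b'} s * f s - indicator {0..a'} s * f s)"
      proof (rule integral_cong_AE)
        show "AE s in lebesgue. indicator B s * f s = indicator {0..b'} s * f s - indicator {0..a'} s * f s"
          using ne
        proof eventually_elim
          fix s assume "s \<noteq> a' \<and> s \<noteq> b' \<and> s \<noteq> \<tau> \<and> s \<noteq> 0"
          then show "indicator B s * f s = indicator {0..b'} s * f s - indicator {0..a'} s * f s"
            unfolding f_def B a'_def b'_def
            by (cases "s \<in> {0..\<tau>}") (auto simp: indicator_def min_def max_def split: if_splits)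
        qed
      qed (intro borel_measurable_diff mi[THEN borel_measurable_integrable]; simp add: B)+
      also have "\<dots> = 0" using mi z[OF ab(1)] z[OF ab(2)] by (subst Bochner_Integration.integral_diff) auto
      finally show "(LINT s|lebesgue. indicator B s * f s) = 0" .
    qed
    then show ?thesis unfolding f_def
      by (auto simp: AE_restrict_space_iff elim!: eventually_mono)
  qed
  then show ?thesis by (intro AE_zero_if_AE_inner_zero[of D]) (use D in blast)+
qed

lemma continuous_AE_eq_imp_eq:
  fixes f g :: "real \<Rightarrow> 'b::{real_normed_vector}"
  assumes "continuous_on {0..\<tau>} f" "continuous_on {0..\<tau>} g" "\<tau> > 0"
    and ae: "AE s in time \<tau>. f s = g s" and t: "t \<in> {0..\<tau>}"
  shows "f t = g t"
proof -
  define h where "h s = norm (f s - g s)" for s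
  have c: "continuous_on {0..\<tau>} h" unfolding h_def by (intro continuous_intros assms)
  have "(LINT s|time \<tau>. h s) = 0"
    by (rule integral_eq_zero_AE) (use ae in \<open>eventually_elim, simp add: h_def\<close>)
  moreover have "(LINT s|time \<tau>. h s) = integral {0..\<tau>} h"
    by (rule lebesgue_integral_eq_integral) (use continuous_imp_integrable_real[OF c] in auto)
  ultimately have "integral {0..\<tau>} h = 0" by simp
  then have "\<forall>s\<in>{0..\<tau>}. h s = 0"
    by (subst (asm) integral_eq_0_iff[OF c \<open>\<tau> > 0\<close>]) (auto simp: h_def)
  then show ?thesis using t by (simp add: h_def)
qed

section \<open>Mean square convergence\<close>

lemma square_norm_diff_le:
  fixes x y z :: "'b::real_inner"
  shows "(norm (x - z))\<^sup>2 \<le> 2 * (norm (x - y))\<^sup>2 + 2 * (norm (y - z))\<^sup>2"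
proof -
  have "(norm (x - z))\<^sup>2 + (norm (x - y - (y - z)))\<^sup>2 = 2 * (norm (x - y))\<^sup>2 + 2 * (norm (y - z))\<^sup>2"
    using norm_parallelogram[of "x - y" "y - z"] by simp
  then show ?thesis using zero_le_power2[of "norm (x - y - (y - z))"] by linarith
qed

lemma integral_square_norm_diff_le:
  assumes "sq_int M f" "sq_int M g" "sq_int M h"
  shows "(LINT x|M. (norm (f x - h x))\<^sup>2)
     \<le> 2 * (LINT x|M. (norm (f x - g x))\<^sup>2) + 2 * (LINT x|M. (norm (g x - h x))\<^sup>2)"
proof -
  have i: "integrable M (\<lambda>x. (norm (f x - h x))\<^sup>2)" "integrable M (\<lambda>x. (norm (f x - g x))\<^sup>2)"
     "integrable M (\<lambda>x. (norm (g x - h x))\<^sup>2)"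
    using assms sq_int_diff sq_int_norm2 by blast+
  have "(LINT x|M. (norm (f x - h x))\<^sup>2) \<le> (LINT x|M. 2 * (norm (f x - g x))\<^sup>2 + 2 * (norm (g x - h x))\<^sup>2)"
    by (rule integral_mono) (use i square_norm_diff_le in auto)
  then show ?thesis using i by simp
qed

lemma AE_eq_if_integral_square_zero:
  assumes "sq_int M f" "sq_int M g" "(LINT x|M. (norm (f x - g x))\<^sup>2) = 0"
  shows "AE x in M. f x = g x"
proof -
  have "integrable M (\<lambda>x. (norm (f x - g x))\<^sup>2)" using assms sq_int_diff sq_int_norm2 by blast
  then have "AE x in M. (norm (f x - g x))\<^sup>2 = 0"
    using assms(3) integral_nonneg_eq_0_iff_AE[of M "\<lambda>x. (norm (f x - g x))\<^sup>2"] by simp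
  then show ?thesis by eventually_elim simp
qed

text \<open>The integral of the inner product is jointly continuous with respect to convergence in mean square.\<close>

lemma tendsto_integral_inner:
  assumes sq: "\<And>n. sq_int M (f n)" "sq_int M f'" "\<And>n. sq_int M (g n)" "sq_int M g'"
    and f: "(\<lambda>n. LINT x|M. (norm (f n x - f' x))\<^sup>2) \<longlonglongrightarrow> 0"
    and g: "(\<lambda>n. LINT x|M. (norm (g n x - g' x))\<^sup>2) \<longlonglongrightarrow> 0"
  shows "(\<lambda>n. LINT x|M. f n x \<bullet> g n x) \<longlonglongrightarrow> (LINT x|M. f' x \<bullet> g' x)"
proof -
  define F where "F n = sqrt (LINT x|M. (norm (f n x - f' x))\<^sup>2)" for n
  define G where "G n = sqrt (LINT x|M. (norm (g n x - g' x))\<^sup>2)" for n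
  define A where "A = sqrt (LINT x|M. (norm (f' x))\<^sup>2)"
  define B where "B = sqrt (LINT x|M. (norm (g' x))\<^sup>2)"
  have "F \<longlonglongrightarrow> sqrt 0" "G \<longlonglongrightarrow> sqrt 0" unfolding F_def[abs_def] G_def[abs_def] by (intro tendsto_intros f g)+
  then have FG: "F \<longlonglongrightarrow> 0" "G \<longlonglongrightarrow> 0" by auto
  have le: "norm ((LINT x|M. f n x \<bullet> g n x) - (LINT x|M. f' x \<bullet> g' x)) \<le> F n * G n + F n * B + A * G n" for n
  proof -
    have d: "sq_int M (\<lambda>x. f n x - f' x)" "sq_int M (\<lambda>x. g n x - g' x)" using sq by (auto intro: sq_int_diff)
    have "(LINT x|M. f n x \<bullet> g n x) - (LINT x|M. f' x \<bullet> g' x) = (LINT x|M. f n x \<bullet> g n x - f' x \<bullet> g' x)"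
      by (rule Bochner_Integration.integral_diff[symmetric]) (use sq integrable_inner_sq_int in blast)+
    also have "\<dots> = (LINT x|M. (f n x - f' x) \<bullet> (g n x - g' x) + (f n x - f' x) \<bullet> g' x + f' x \<bullet> (g n x - g' x))"
      by (simp add: inner_simps algebra_simps)
    also have "\<dots> = (LINT x|M. (f n x - f' x) \<bullet> (g n x - g' x)) + (LINT x|M. (f n x - f' x) \<bullet> g' x)
        + (LINT x|M. f' x \<bullet> (g n x - g' x))"
      using integrable_inner_sq_int[OF d] integrable_inner_sq_int[OF d(1) sq(4)] integrable_inner_sq_int[OF sq(2) d(2)]
      by simp
    finally show ?thesis
      using Cauchy_Schwarz_integral[OF d] Cauchy_Schwarz_integral[OF d(1) sq(4)] Cauchy_Schwarz_integral[OF sq(2) d(2)]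
      unfolding F_def G_def A_def B_def real_norm_def by linarith
  qed
  have "(\<lambda>n. F n * G n + F n * B + A * G n) \<longlonglongrightarrow> 0 * 0 + 0 * B + A * 0"
    by (intro tendsto_intros FG)
  then have "(\<lambda>n. F n * G n + F n * B + A * G n) \<longlonglongrightarrow> 0" by simp
  then have "(\<lambda>n. (LINT x|M. f n x \<bullet> g n x) - (LINT x|M. f' x \<bullet> g' x)) \<longlonglongrightarrow> 0"
    by (rule Lim_null_comparison[rotated]) (use le in \<open>auto intro: always_eventually\<close>)
  then show ?thesis by (rule LIM_zero_cancel)
qed

lemma tendsto_integral_time_mono:
  assumes "\<And>n. sq_int (time \<tau>) (f n)" "sq_int (time \<tau>) g" "t \<le> \<tau>"
    and l: "(\<lambda>n. LINT s|time \<tau>. (norm (f n s - g s))\<^sup>2) \<longlonglongrightarrow> 0"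
  shows "(\<lambda>n. LINT s|time t. (norm (f n s - g s))\<^sup>2) \<longlonglongrightarrow> 0"
proof (rule Lim_null_comparison[OF always_eventually l], rule allI)
  fix n
  have "integrable (time \<tau>) (\<lambda>s. (norm (f n s - g s))\<^sup>2)" using assms sq_int_diff sq_int_norm2 by blast
  from integral_time_mono[OF this assms(3)]
  show "norm (LINT s|time t. (norm (f n s - g s))\<^sup>2) \<le> (LINT s|time \<tau>. (norm (f n s - g s))\<^sup>2)" by simp
qed

section \<open>The linear evolution equation\<close>

text \<open>The map \<open>i\<close> stands for the embedding of the energy space into the space of initial values. Since the
  energy space is identified with its dual, the viscous term is just the multiplication by \<open>\<nu>\<close>.\<close>

locale evolution =
  fixes i :: "'v::{real_inner,banach,second_countable_topology} \<Rightarrow> 'h::{real_inner,banach,second_countable_topology}"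
    and \<nu> :: real
  assumes bl: "bounded_linear i" and \<nu>: "\<nu> > 0"
begin

text \<open>The inner product of the space of initial values, as an operator on the energy space.\<close>

definition T :: "'v \<Rightarrow> 'v" where "T a = adjoint i (i a)"

lemma T_inner: "T a \<bullet> b = i a \<bullet> i b"
  unfolding T_def by (rule bounded_linear_adjoint_works[OF bl, symmetric])

lemma T_sym: "a \<bullet> T b = i a \<bullet> i b" by (metis T_inner inner_commute)

lemma bounded_linear_T: "bounded_linear T"
  unfolding T_def[abs_def] by (rule bounded_linear_compose[OF bounded_linear_adjoint[OF bl] bl])

lemma sq_int_i: "sq_int M a \<Longrightarrow> sq_int M (\<lambda>t. i (a t))" by (rule sq_int_bounded_linear[OF bl])
lemma sq_int_T: "sq_int M a \<Longrightarrow> sq_int M (\<lambda>t. T (a t))" by (rule sq_int_bounded_linear[OF bounded_linear_T])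

lemma i_add: "i (x + y) = i x + i y" and i_diff: "i (x - y) = i x - i y"
  and i_scaleR: "i (r *\<^sub>R x) = r *\<^sub>R i x"
  using bl by (simp_all add: linear_simps)

lemma sq_int_vint: "sq_int (time \<tau>) a \<Longrightarrow> sq_int (time \<tau>) (\<lambda>t. vint a t)"
  using continuous_on_sq_int_time[OF continuous_vint[OF sq_int_integrable_time]] by blast

text \<open>The two summands of the integrand contribute \<open>\<integral> \<bar>i z\<bar>\<^sup>2\<close> and \<open>(\<nu> / 2) \<bar>\<integral>\<^sub>0\<^sup>\<tau> z\<bar>\<^sup>2\<close>, which are both
  nonnegative.\<close>

lemma AE_zero_if_Tvint_zero_weak:
  fixes z :: "real \<Rightarrow> 'v"
  assumes z: "sq_int (time \<tau>) z" and "\<tau> \<ge> 0"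
    and 0: "(LINT t|time \<tau>. z t \<bullet> (T (z t) + \<nu> *\<^sub>R vint z t)) = 0"
  shows "AE t in time \<tau>. i (z t) = 0" "vint z \<tau> = 0"
proof -
  note zi = sq_int_integrable_time[OF z]
  have iz: "integrable (time \<tau>) (\<lambda>t. (norm (i (z t)))\<^sup>2)" using sq_int_i[OF z] by (rule sq_int_norm2)
  have "(LINT t|time \<tau>. z t \<bullet> (T (z t) + \<nu> *\<^sub>R vint z t)) = (LINT t|time \<tau>. (norm (i (z t)))\<^sup>2 + \<nu> * (vint z t \<bullet> z t))"
    by (simp add: inner_simps T_sym power2_norm_eq_inner inner_commute)
  also have "\<dots> = (LINT t|time \<tau>. (norm (i (z t)))\<^sup>2) + \<nu> * (LINT t|time \<tau>. vint z t \<bullet> z t)"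
    using iz integrable_continuous_inner(1)[OF continuous_vint[OF zi] zi] by simp
  moreover have "(LINT t|time \<tau>. vint z t \<bullet> z t) = (norm (vint z \<tau>))\<^sup>2 / 2"
    using integral_vint_inner_self[OF zi] by simp
  ultimately have s: "(LINT t|time \<tau>. (norm (i (z t)))\<^sup>2) + \<nu> / 2 * (norm (vint z \<tau>))\<^sup>2 = 0"
    using 0 by simp
  have nn: "(LINT t|time \<tau>. (norm (i (z t)))\<^sup>2) \<ge> 0" "\<nu> / 2 * (norm (vint z \<tau>))\<^sup>2 \<ge> 0" using \<nu> by auto
  with s have "(LINT t|time \<tau>. (norm (i (z t)))\<^sup>2) = 0" "\<nu> / 2 * (norm (vint z \<tau>))\<^sup>2 = 0" by linarith+
  then show "AE t in time \<tau>. i (z t) = 0" "vint z \<tau> = 0"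
    using AE_eq_if_integral_square_zero[OF sq_int_i[OF z] sq_int_zero] \<nu> by auto
qed

text \<open>The operator \<open>a \<mapsto> T a + \<nu> \<integral>\<^sub>0\<^sup>t a\<close> has dense range: if \<open>z\<close> is orthogonal to the range, then testing
  with \<open>a = z\<close> gives \<open>i z = 0\<close> and \<open>\<integral>\<^sub>0\<^sup>\<tau> z = 0\<close>; testing with \<open>a = \<integral>\<^sub>0\<^sup>t z\<close> then gives
  \<open>\<integral>\<^sub>0\<^sup>t z = 0\<close> for all \<open>t\<close> after integration by parts.\<close>

lemma dense_range_T_vint:
  fixes g :: "real \<Rightarrow> 'v"
  assumes g: "sq_int (time \<tau>) g" and \<tau>: "\<tau> > 0" and e: "e > 0"
  shows "\<exists>a. sq_int (time \<tau>) a \<and> (LINT t|time \<tau>. (norm (T (a t) + \<nu> *\<^sub>R vint a t - g t))\<^sup>2) < e"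
proof -
  define N where "N a t = T (a t) + \<nu> *\<^sub>R vint a t" for a t
  have sqN: "sq_int (time \<tau>) (N a)" if "sq_int (time \<tau>) a" for a
    unfolding N_def[abs_def] using that by (intro sq_int_add sq_int_T sq_int_scaleR sq_int_vint)
  \<comment> \<open>The functions in S are arbitrary outside the time interval, so that elements orthogonal to S vanish there.\<close>
  define S where "S = {abs_lsq f | f a. sq_int lebesgue f \<and> sq_int (time \<tau>) a \<and> (AE t in time \<tau>. f t = N a t)}"
  have Nadd: "N (\<lambda>t. a t + b t) t = N a t + N b t" if "sq_int (time \<tau>) a" "sq_int (time \<tau>) b" "t \<in> {0..\<tau>}" for a b t
  proof -
    have "integrable (time t) a" "integrable (time t) b"
      using that integrable_time_mono[OF sq_int_integrable_time] by auto
    then show ?thesis using bounded_linear_T by (simp add: N_def vint_add linear_simps algebra_simps)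
  qed
  have Nsc: "N (\<lambda>t. r *\<^sub>R a t) t = r *\<^sub>R N a t" if "sq_int (time \<tau>) a" "t \<in> {0..\<tau>}" for a r t
  proof -
    have "integrable (time t) a" using that integrable_time_mono[OF sq_int_integrable_time] by auto
    then have "vint (\<lambda>t. r *\<^sub>R a t) t = r *\<^sub>R vint a t"
      by (intro vint_bounded_linear bounded_linear_scaleR_right)
    then show ?thesis using bounded_linear_T by (simp add: N_def linear_simps algebra_simps)
  qed
  have sub: "subspace S"
  proof (rule subspaceI)
    show "0 \<in> S" unfolding S_def
      by (rule CollectI, intro exI[of _ "\<lambda>t. 0"])
         (use bounded_linear_T in \<open>auto simp: abs_lsq_0 N_def vint_def linear_simps\<close>)
    show "x + y \<in> S" if xy: "x \<in> S" "y \<in> S" for x y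
    proof -
      obtain f a f' a' where
        x: "x = abs_lsq f" "sq_int lebesgue f" "sq_int (time \<tau>) a" "AE t in time \<tau>. f t = N a t" and
        y: "y = abs_lsq f'" "sq_int lebesgue f'" "sq_int (time \<tau>) a'" "AE t in time \<tau>. f' t = N a' t"
        using xy unfolding S_def by blast
      have "AE t in time \<tau>. f t + f' t = N (\<lambda>t. a t + a' t) t"
        using x(4) y(4) AE_space by eventually_elim (simp add: Nadd x y)
      then show ?thesis unfolding S_def using x y
        by (intro CollectI exI[of _ "\<lambda>t. f t + f' t"] exI[of _ "\<lambda>t. a t + a' t"]) (auto simp: abs_lsq_add sq_int_add)
    qed
    show "r *\<^sub>R x \<in> S" if x: "x \<in> S" for r x
    proof -
      obtain f a where
        x: "x = abs_lsq f" "sq_int lebesgue f" "sq_int (time \<tau>) a" "AE t in time \<tau>. f t = N a t"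
        using x unfolding S_def by blast
      have "AE t in time \<tau>. r *\<^sub>R f t = N (\<lambda>t. r *\<^sub>R a t) t"
        using x(4) AE_space by eventually_elim (simp add: Nsc x)
      then show ?thesis unfolding S_def using x
        by (intro CollectI exI[of _ "\<lambda>t. r *\<^sub>R f t"] exI[of _ "\<lambda>t. r *\<^sub>R a t"]) (auto simp: abs_lsq_scaleR sq_int_scaleR)
    qed
  qed
  define ext where "ext f t = indicator {0..\<tau>} t *\<^sub>R (f t :: 'v)" for f t
  have ext: "sq_int lebesgue (ext f)" if "sq_int (time \<tau>) f" for f
  proof -
    have "(\<lambda>t. (norm (ext f t))\<^sup>2) = (\<lambda>t. indicator {0..\<tau>} t *\<^sub>R (norm (f t))\<^sup>2)"
      by (auto simp: ext_def indicator_def fun_eq_iff)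
    moreover have "ext f \<in> borel_measurable lebesgue"
      unfolding ext_def using sq_int_measurable[OF that] by (subst (asm) borel_measurable_restrict_space_iff) auto
    ultimately show ?thesis unfolding sq_int_def using sq_int_norm2[OF that] by (simp add: integrable_time_iff)
  qed
  have "closure S = UNIV"
  proof (rule dense_subspace_if_orthogonal_trivial[OF sub])
    fix z :: "(real,'v) lsq" assume z: "\<And>s. s \<in> S \<Longrightarrow> z \<bullet> s = 0"
    define f where "f = rep_lsq z"
    have sf: "sq_int lebesgue f" by (simp add: f_def)
    have sft: "sq_int (time \<tau>) f"
    proof -
      have "f \<in> borel_measurable (time \<tau>)" using sq_int_measurable[OF sf] by (rule measurable_restrict_space1)
      moreover have "integrable (time \<tau>) (\<lambda>t. (norm (f t))\<^sup>2)"
        unfolding integrable_time_iff by (rule integrable_mult_indicator) (use sf sq_int_norm2 in auto)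
      ultimately show ?thesis by (simp add: sq_int_def)
    qed
    have orth: "(LINT t|time \<tau>. f t \<bullet> N a t) = 0" if a: "sq_int (time \<tau>) a" for a
    proof -
      have "abs_lsq (ext (N a)) \<in> S" unfolding S_def
        by (intro CollectI exI[of _ "ext (N a)"] exI[of _ a] conjI refl ext sqN a AE_I2) (simp add: ext_def)
      from z[OF this] have "(LINT t|lebesgue. f t \<bullet> ext (N a) t) = 0"
        using inner_abs_lsq[OF sf ext[OF sqN[OF a]]] by (simp add: f_def)
      then show ?thesis unfolding integral_time_eq by (simp add: ext_def)
    qed
    have out: "AE t in lebesgue. t \<notin> {0..\<tau>} \<longrightarrow> f t = 0"
    proof -
      define h where "h t = indicator (- {0..\<tau>}) t *\<^sub>R f t" for t
      have sh: "sq_int lebesgue h"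
      proof (rule sq_int_bound[OF _ sq_int_norm2[OF sf]])
        have [measurable]: "f \<in> borel_measurable lebesgue" using sf by (rule sq_int_measurable)
        have [measurable]: "- {0..\<tau>} \<in> sets lebesgue" by auto
        show "h \<in> borel_measurable lebesgue" unfolding h_def by measurable
        show "(norm (h t))\<^sup>2 \<le> (norm (f t))\<^sup>2" for t by (auto simp: h_def indicator_def)
      qed
      have "abs_lsq h \<in> S" unfolding S_def
        by (intro CollectI exI[of _ h] exI[of _ "\<lambda>t. 0"] conjI refl sh sq_int_zero AE_I2)
           (use bounded_linear_T in \<open>auto simp: h_def N_def vint_def linear_simps\<close>)
      from z[OF this] have "(LINT t|lebesgue. f t \<bullet> h t) = 0"
        using inner_abs_lsq[OF sf sh] by (simp add: f_def)
      moreover have "(\<lambda>t. f t \<bullet> h t) = (\<lambda>t. (norm (h t - 0))\<^sup>2)"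
        by (auto simp: h_def indicator_def power2_norm_eq_inner fun_eq_iff)
      ultimately have "AE t in lebesgue. h t = 0" using AE_eq_if_integral_square_zero[OF sh sq_int_zero] by simp
      then show ?thesis by eventually_elim (auto simp: h_def)
    qed
    have fz: "AE t in time \<tau>. i (f t) = 0" "vint f \<tau> = 0"
      using AE_zero_if_Tvint_zero_weak[OF sft] orth[OF sft] \<tau> by (auto simp: N_def)
    define y where "y = vint f"
    have sy: "sq_int (time \<tau>) y" unfolding y_def using sq_int_vint[OF sft] by simp
    have cy: "continuous_on {0..\<tau>} y" unfolding y_def by (rule continuous_vint[OF sq_int_integrable_time[OF sft]])
    have "0 = (LINT t|time \<tau>. f t \<bullet> N y t)" using orth[OF sy] by simp
    also have "\<dots> = (LINT t|time \<tau>. \<nu> * (f t \<bullet> vint y t))"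
    proof (rule integral_cong_AE)
      show "AE t in time \<tau>. f t \<bullet> N y t = \<nu> * (f t \<bullet> vint y t)"
        using fz(1) by eventually_elim (simp add: N_def inner_simps T_sym)
    qed (use integrable_inner_sq_int[OF sft sqN[OF sy]] integrable_inner_sq_int[OF sft sq_int_vint[OF sy]] in auto)
    finally have "(LINT t|time \<tau>. f t \<bullet> vint y t) = 0" using \<nu> by simp
    then have "(LINT t|time \<tau>. (norm (y t - 0))\<^sup>2) = 0"
      using vint_product_rule[OF sq_int_integrable_time[OF sft] sq_int_integrable_time[OF sy]] fz(2)
      by (simp add: y_def power2_norm_eq_inner)
    then have "AE t in time \<tau>. y t = 0" by (rule AE_eq_if_integral_square_zero[OF sy sq_int_zero])
    then have "y t = 0" if "t \<in> {0..\<tau>}" for t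
      by (rule continuous_AE_eq_imp_eq[OF cy continuous_on_const \<tau> _ that])
    then have "AE t in time \<tau>. f t = 0"
      by (intro AE_zero_if_vint_zero sq_int_integrable_time[OF sft]) (use \<tau> in \<open>auto simp: y_def\<close>)
    then have "AE t in lebesgue. t \<in> {0..\<tau>} \<longrightarrow> f t = 0" by (simp add: AE_restrict_space_iff)
    with out have "AE t in lebesgue. f t = 0" by eventually_elim blast
    then have "abs_lsq f = abs_lsq (\<lambda>x. 0)" by (subst abs_lsq_eq_iff) (auto simp: sf)
    then show "z = 0" by (simp add: f_def abs_lsq_0)
  qed
  then have "abs_lsq (ext g) \<in> closure S" by simp
  then obtain x where x: "x \<in> S" "dist x (abs_lsq (ext g)) < sqrt e"
    using e unfolding closure_approachable by (meson real_sqrt_gt_zero)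
  then obtain f a where f: "x = abs_lsq f" "sq_int lebesgue f" "sq_int (time \<tau>) a" "AE t in time \<tau>. f t = N a t"
    unfolding S_def by blast
  have sd: "sq_int lebesgue (\<lambda>t. f t - ext g t)" using f ext[OF g] sq_int_diff by blast
  have "(LINT t|time \<tau>. (norm (N a t - g t))\<^sup>2) = (LINT t|time \<tau>. (norm (f t - ext g t))\<^sup>2)"
  proof (rule integral_cong_AE)
    show "(\<lambda>x. (norm (N a x - g x))\<^sup>2) \<in> borel_measurable (time \<tau>)"
      using sq_int_norm2[OF sq_int_diff[OF sqN[OF f(3)] g]] by auto
    show "(\<lambda>t. (norm (f t - ext g t))\<^sup>2) \<in> borel_measurable (time \<tau>)"
      using borel_measurable_integrable[OF sq_int_norm2[OF sd]] by (rule measurable_restrict_space1)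
    show "AE t in time \<tau>. (norm (N a t - g t))\<^sup>2 = (norm (f t - ext g t))\<^sup>2"
      using f(4) AE_space by eventually_elim (simp add: ext_def)
  qed
  also have "\<dots> \<le> (LINT t|lebesgue. (norm (f t - ext g t))\<^sup>2)"
    unfolding integral_time_eq
    by (rule integral_mono[OF integrable_mult_indicator[OF _ sq_int_norm2[OF sd]] sq_int_norm2[OF sd]])
      (auto simp: indicator_def)
  also have "\<dots> = (norm (x - abs_lsq (ext g)))\<^sup>2"
    unfolding f(1) abs_lsq_diff[OF f(2) ext[OF g]] by (rule norm2_abs_lsq[OF sd, symmetric])
  also have "\<dots> < e"
    using x(2) e power_strict_mono[of "norm (x - abs_lsq (ext g))" "sqrt e" 2] by (simp add: dist_norm)
  finally show ?thesis unfolding N_def using f(3) by blast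
qed

text \<open>If \<open>u\<close> has the mean square derivative \<open>a\<close>, then it solves the equation for the right-hand side
  \<open>T a + \<nu> u\<close>, and the energy equality is the product rule for \<open>\<bar>i u\<bar>\<^sup>2\<close>.\<close>

lemma regular_energy:
  fixes a :: "real \<Rightarrow> 'v" and b :: 'v
  defines "u \<equiv> \<lambda>t. b + vint a t"
  defines "r \<equiv> \<lambda>t. T (a t) + \<nu> *\<^sub>R u t"
  assumes a: "sq_int (time \<tau>) a"
  shows "sq_int (time \<tau>) u" "sq_int (time \<tau>) r" "continuous_on {0..\<tau>} u"
    and "\<And>t. t \<in> {0..\<tau>} \<Longrightarrow> (norm (i (u t)))\<^sup>2 + 2 * \<nu> * (LINT s|time t. (norm (u s))\<^sup>2)
           = (norm (i b))\<^sup>2 + 2 * (LINT s|time t. r s \<bullet> u s)"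
    and "\<And>t c. t \<in> {0..\<tau>} \<Longrightarrow> i (u t) \<bullet> i c = i b \<bullet> i c + (LINT s|time t. (r s - \<nu> *\<^sub>R u s) \<bullet> c)"
proof -
  note ai = sq_int_integrable_time[OF a]
  show cu: "continuous_on {0..\<tau>} u" unfolding u_def by (intro continuous_intros continuous_vint ai)
  then show su: "sq_int (time \<tau>) u" by (rule continuous_on_sq_int_time)
  show sr: "sq_int (time \<tau>) r" unfolding r_def by (intro sq_int_add sq_int_T a sq_int_scaleR su)
  fix t assume t: "t \<in> {0..\<tau>}"
  have tl: "t \<le> \<tau>" using t by simp
  note at = sq_int_time_mono[OF a tl] and ut = sq_int_time_mono[OF su tl] and rt = sq_int_time_mono[OF sr tl]
  have iu: "i (u s) = i b + vint (\<lambda>s. i (a s)) s" if "s \<in> {0..t}" for s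
    using vint_bounded_linear[OF bl integrable_time_mono[OF ai, of s]] that tl by (simp add: u_def i_add)
  have "(norm (i (u t)))\<^sup>2 = (norm (i b))\<^sup>2 + 2 * (LINT s|time t. (i b + vint (\<lambda>s. i (a s)) s) \<bullet> i (a s))"
    using iu[of t] t norm_square_plus_vint[OF sq_int_integrable_time[OF sq_int_i[OF at]], of "i b"] by simp
  also have "(LINT s|time t. (i b + vint (\<lambda>s. i (a s)) s) \<bullet> i (a s)) = (LINT s|time t. r s \<bullet> u s - \<nu> * (norm (u s))\<^sup>2)"
  proof (rule Bochner_Integration.integral_cong)
    fix s assume "s \<in> space (time t)"
    then have "(i b + vint (\<lambda>s. i (a s)) s) \<bullet> i (a s) = i (u s) \<bullet> i (a s)" using iu by simp
    then have "(i b + vint (\<lambda>s. i (a s)) s) \<bullet> i (a s) = T (a s) \<bullet> u s"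
      using T_inner[of "a s" "u s"] by (simp add: inner_commute)
    then show "(i b + vint (\<lambda>s. i (a s)) s) \<bullet> i (a s) = r s \<bullet> u s - \<nu> * (norm (u s))\<^sup>2"
      by (simp add: r_def inner_simps power2_norm_eq_inner)
  qed simp
  also have "\<dots> = (LINT s|time t. r s \<bullet> u s) - \<nu> * (LINT s|time t. (norm (u s))\<^sup>2)"
    using integrable_inner_sq_int[OF rt ut] sq_int_norm2[OF ut] by simp
  finally show "(norm (i (u t)))\<^sup>2 + 2 * \<nu> * (LINT s|time t. (norm (u s))\<^sup>2)
           = (norm (i b))\<^sup>2 + 2 * (LINT s|time t. r s \<bullet> u s)" by simp
  fix c
  have "i (u t) \<bullet> i c = i b \<bullet> i c + vint a t \<bullet> T c"
    by (simp add: u_def i_add inner_simps T_sym)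
  also have "vint a t \<bullet> T c = (LINT s|time t. a s \<bullet> T c)"
    unfolding vint_def using sq_int_integrable_time[OF at] by simp
  also have "\<dots> = (LINT s|time t. (r s - \<nu> *\<^sub>R u s) \<bullet> c)" by (simp add: r_def T_sym T_inner)
  finally show "i (u t) \<bullet> i c = i b \<bullet> i c + (LINT s|time t. (r s - \<nu> *\<^sub>R u s) \<bullet> c)" .
qed

lemma two_inner_le_young:
  fixes r u :: "'b::real_inner"
  shows "2 * (r \<bullet> u) \<le> \<nu> * (norm u)\<^sup>2 + (1/\<nu>) * (norm r)\<^sup>2"
proof -
  have "0 \<le> (norm (r - \<nu> *\<^sub>R u))\<^sup>2" by simp
  also have "\<dots> = (norm r)\<^sup>2 - 2 * \<nu> * (r \<bullet> u) + \<nu>\<^sup>2 * (norm u)\<^sup>2"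
    unfolding power2_norm_eq_inner by (simp add: inner_simps inner_commute power2_eq_square algebra_simps)
  finally have "0 \<le> (1/\<nu>) * ((norm r)\<^sup>2 - 2 * \<nu> * (r \<bullet> u) + \<nu>\<^sup>2 * (norm u)\<^sup>2)" using \<nu> by simp
  also have "\<dots> = (1/\<nu>) * (norm r)\<^sup>2 - 2 * (r \<bullet> u) + \<nu> * (norm u)\<^sup>2"
    using \<nu> by (simp add: field_simps power2_eq_square)
  finally show ?thesis by simp
qed

lemma energy_imp_estimate:
  assumes r: "sq_int (time t) r" and u: "sq_int (time t) u"
    and e: "E + 2 * \<nu> * (LINT s|time t. (norm (u s))\<^sup>2) = E0 + 2 * (LINT s|time t. r s \<bullet> u s)"
  shows "E + \<nu> * (LINT s|time t. (norm (u s))\<^sup>2) \<le> E0 + (1/\<nu>) * (LINT s|time t. (norm (r s))\<^sup>2)"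
proof -
  have "2 * (LINT s|time t. r s \<bullet> u s) = (LINT s|time t. 2 * (r s \<bullet> u s))" by simp
  also have "\<dots> \<le> (LINT s|time t. \<nu> * (norm (u s))\<^sup>2 + (1/\<nu>) * (norm (r s))\<^sup>2)"
    by (rule integral_mono) (use two_inner_le_young integrable_inner_sq_int[OF r u] sq_int_norm2[OF r] sq_int_norm2[OF u] in auto)
  also have "\<dots> = \<nu> * (LINT s|time t. (norm (u s))\<^sup>2) + (1/\<nu>) * (LINT s|time t. (norm (r s))\<^sup>2)"
    using sq_int_norm2[OF r] sq_int_norm2[OF u] by simp
  finally show ?thesis using e by simp
qed

text \<open>The equation \<open>(i u)' = g - \<nu> u\<close>, integrated in time. As \<open>u\<close> is determined for almost all times only, the
  continuous function \<open>w\<close> that represents \<open>i u\<close> is part of the solution; it carries the initial value.\<close>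

definition lin_sol :: "real \<Rightarrow> 'h \<Rightarrow> (real \<Rightarrow> 'v) \<Rightarrow> (real \<Rightarrow> 'v) \<Rightarrow> (real \<Rightarrow> 'h) \<Rightarrow> bool" where
  "lin_sol \<tau> x0 g u w \<longleftrightarrow> sq_int (time \<tau>) g \<and> sq_int (time \<tau>) u \<and> continuous_on {0..\<tau>} w \<and>
     (AE t in time \<tau>. i (u t) = w t) \<and>
     (\<forall>t\<in>{0..\<tau>}. \<forall>c. w t \<bullet> i c = x0 \<bullet> i c + (LINT s|time t. (g s - \<nu> *\<^sub>R u s) \<bullet> c))"

definition energy_eq :: "real \<Rightarrow> 'h \<Rightarrow> (real \<Rightarrow> 'v) \<Rightarrow> (real \<Rightarrow> 'v) \<Rightarrow> (real \<Rightarrow> 'h) \<Rightarrow> bool" where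
  "energy_eq t x0 g u w \<longleftrightarrow> (norm (w t))\<^sup>2 + 2 * \<nu> * (LINT s|time t. (norm (u s))\<^sup>2)
       = (norm x0)\<^sup>2 + 2 * (LINT s|time t. g s \<bullet> u s)"

text \<open>The right-hand side \<open>g\<close> and the initial value are approximated by those for which a regular solution
  is known. The energy estimate for differences makes the regular solutions converge in mean square,
  and uniformly after application of \<open>i\<close>, so that the energy equality survives the limit.\<close>

lemma lin_sol_exists:
  assumes x0: "x0 \<in> closure (range i)" and g: "sq_int (time \<tau>) g" and \<tau>: "\<tau> > 0"
  obtains u w where "lin_sol \<tau> x0 g u w" "w 0 = x0"
    "\<And>t. t \<in> {0..\<tau>} \<Longrightarrow> energy_eq t x0 g u w \<and> w t \<in> closure (range i)"
proof -
  obtain y where y: "\<And>n. y n \<in> range i" "y \<longlonglongrightarrow> x0" using x0 unfolding closure_sequential by blast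
  have "\<forall>n. \<exists>b. y n = i b" using y(1) by blast
  then obtain b where "\<And>n. y n = i (b n)" by metis
  then have "y = (\<lambda>n. i (b n))" by (rule ext)
  then have b: "(\<lambda>n. i (b n)) \<longlonglongrightarrow> x0" using y(2) by simp
  have cst: "sq_int (time t) (\<lambda>_. c)" for c :: 'v and t
    by (rule continuous_on_sq_int_time) (rule continuous_on_const)
  define Q where "Q n a \<longleftrightarrow> sq_int (time \<tau>) a \<and>
      (LINT t|time \<tau>. (norm (T (a t) + \<nu> *\<^sub>R vint a t - (g t - \<nu> *\<^sub>R b n)))\<^sup>2) < inverse (real (Suc n))" for n a
  have "\<exists>a. Q n a" for n
    unfolding Q_def by (rule dense_range_T_vint[OF sq_int_diff[OF g cst] \<tau>]) simp
  then obtain a where Qa: "\<And>n. Q n (a n)" by metis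
  have a: "\<And>n. sq_int (time \<tau>) (a n)"
    and ae: "\<And>n. (LINT t|time \<tau>. (norm (T (a n t) + \<nu> *\<^sub>R vint (a n) t - (g t - \<nu> *\<^sub>R b n)))\<^sup>2) < inverse (real (Suc n))"
    using Qa unfolding Q_def by blast+
  define U where "U n t = b n + vint (a n) t" for n t
  define R where "R n t = T (a n t) + \<nu> *\<^sub>R U n t" for n t
  have sU: "sq_int (time \<tau>) (U n)" and sR: "sq_int (time \<tau>) (R n)" and cU: "continuous_on {0..\<tau>} (U n)" for n
    unfolding U_def[abs_def] R_def[abs_def] by (rule regular_energy(1-3)[OF a])+
  have eU: "(norm (i (U n t)))\<^sup>2 + 2 * \<nu> * (LINT s|time t. (norm (U n s))\<^sup>2) = (norm (i (b n)))\<^sup>2 + 2 * (LINT s|time t. R n s \<bullet> U n s)"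
    if "t \<in> {0..\<tau>}" for n t unfolding U_def[abs_def] R_def[abs_def] by (rule regular_energy(4)[OF a that])
  have wU: "i (U n t) \<bullet> i c = i (b n) \<bullet> i c + (LINT s|time t. (R n s - \<nu> *\<^sub>R U n s) \<bullet> c)"
    if "t \<in> {0..\<tau>}" for n t c unfolding U_def[abs_def] R_def[abs_def] by (rule regular_energy(5)[OF a that])
  have Rg0: "(LINT t|time \<tau>. (norm (R n t - g t))\<^sup>2) < inverse (real (Suc n))" for n
  proof -
    have "R n t - g t = T (a n t) + \<nu> *\<^sub>R vint (a n) t - (g t - \<nu> *\<^sub>R b n)" for t
      by (simp add: R_def U_def algebra_simps)
    then show ?thesis using ae[of n] by (simp only:)
  qed
  have Rg: "(\<lambda>n. LINT t|time \<tau>. (norm (R n t - g t))\<^sup>2) \<longlonglongrightarrow> 0"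
    by (rule Lim_null_comparison[OF always_eventually LIMSEQ_inverse_real_of_nat])
       (use Rg0 in \<open>auto intro: less_imp_le\<close>)
  define \<gamma> where "\<gamma> n = 2 * (norm (i (b n) - x0))\<^sup>2 + (1/\<nu>) * (2 * (LINT t|time \<tau>. (norm (R n t - g t))\<^sup>2))" for n
  have "\<gamma> \<longlonglongrightarrow> 2 * (norm (x0 - x0))\<^sup>2 + (1/\<nu>) * (2 * 0)"
    unfolding \<gamma>_def[abs_def] by (intro tendsto_intros b Rg)
  then have \<gamma>: "\<gamma> \<longlonglongrightarrow> 0" by simp
  have est: "(norm (i (U m t) - i (U n t)))\<^sup>2 + \<nu> * (LINT s|time t. (norm (U m s - U n s))\<^sup>2) \<le> \<gamma> m + \<gamma> n"
    if t: "t \<in> {0..\<tau>}" for m n t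
  proof -
    have tl: "t \<le> \<tau>" using t by simp
    have sa: "sq_int (time \<tau>) (\<lambda>t. a m t - a n t)" by (rule sq_int_diff[OF a a])
    have v: "vint (\<lambda>t. a m t - a n t) s = vint (a m) s - vint (a n) s" if "s \<in> {0..\<tau>}" for s
      using that integrable_time_mono[OF sq_int_integrable_time[OF a]] by (intro vint_diff) auto
    have Ud: "(b m - b n) + vint (\<lambda>t. a m t - a n t) s = U m s - U n s" if "s \<in> {0..\<tau>}" for s
      using v[OF that] by (simp add: U_def)
    have Rd: "T (a m s - a n s) + \<nu> *\<^sub>R ((b m - b n) + vint (\<lambda>t. a m t - a n t) s) = R m s - R n s" if "s \<in> {0..\<tau>}" for s
      unfolding Ud[OF that] using bounded_linear_T by (simp add: R_def linear_simps algebra_simps)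
    note r = regular_energy[OF sa, where b="b m - b n"]
    have e: "(norm (i (U m t - U n t)))\<^sup>2 + 2 * \<nu> * (LINT s|time t. (norm (U m s - U n s))\<^sup>2)
           = (norm (i (b m - b n)))\<^sup>2 + 2 * (LINT s|time t. (R m s - R n s) \<bullet> (U m s - U n s))"
    proof -
      have 1: "(LINT s|time t. (norm (b m - b n + vint (\<lambda>t. a m t - a n t) s))\<^sup>2) = (LINT s|time t. (norm (U m s - U n s))\<^sup>2)"
        by (rule Bochner_Integration.integral_cong) (use Ud tl in auto)
      have 2: "(LINT s|time t. (T (a m s - a n s) + \<nu> *\<^sub>R (b m - b n + vint (\<lambda>t. a m t - a n t) s)) \<bullet>
              (b m - b n + vint (\<lambda>t. a m t - a n t) s)) = (LINT s|time t. (R m s - R n s) \<bullet> (U m s - U n s))"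
        by (rule Bochner_Integration.integral_cong) (use Ud Rd tl in auto)
      show ?thesis using r(4)[OF t] unfolding 1 2 Ud[OF t] .
    qed
    have "(norm (i (U m t - U n t)))\<^sup>2 + \<nu> * (LINT s|time t. (norm (U m s - U n s))\<^sup>2)
        \<le> (norm (i (b m - b n)))\<^sup>2 + (1/\<nu>) * (LINT s|time t. (norm (R m s - R n s))\<^sup>2)"
      by (rule energy_imp_estimate[OF _ _ e]) (intro sq_int_diff sq_int_time_mono[OF sU tl] sq_int_time_mono[OF sR tl])+
    also have "(LINT s|time t. (norm (R m s - R n s))\<^sup>2) \<le> (LINT s|time \<tau>. (norm (R m s - R n s))\<^sup>2)"
      by (rule integral_time_mono[OF sq_int_norm2[OF sq_int_diff[OF sR sR]] tl]) simp
    also have "\<dots> \<le> 2 * (LINT s|time \<tau>. (norm (R m s - g s))\<^sup>2) + 2 * (LINT s|time \<tau>. (norm (g s - R n s))\<^sup>2)"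
      by (rule integral_square_norm_diff_le[OF sR g sR])
    also have "(norm (i (b m - b n)))\<^sup>2 \<le> 2 * (norm (i (b m) - x0))\<^sup>2 + 2 * (norm (x0 - i (b n)))\<^sup>2"
      unfolding i_diff by (rule square_norm_diff_le)
    finally show ?thesis using \<nu>
      unfolding \<gamma>_def i_diff norm_minus_commute[of x0] norm_minus_commute[of "g _"]
      by (simp add: algebra_simps divide_right_mono)
  qed
  have \<gamma>small: "\<exists>N. \<forall>m\<ge>N. \<forall>n\<ge>N. \<gamma> m + \<gamma> n < e" if "e > 0" for e
  proof -
    have "\<forall>\<^sub>F n in sequentially. \<gamma> n < e/2" using \<gamma> that by (intro order_tendstoD) auto
    then obtain N where "\<forall>n\<ge>N. \<gamma> n < e/2" unfolding eventually_sequentially by blast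
    then have "\<gamma> m + \<gamma> n < e" if "m \<ge> N" "n \<ge> N" for m n
      using that add_strict_mono[of "\<gamma> m" "e/2" "\<gamma> n" "e/2"] by simp
    then show ?thesis by blast
  qed
  obtain u where u: "sq_int (time \<tau>) u" and Uu: "(\<lambda>n. LINT s|time \<tau>. (norm (U n s - u s))\<^sup>2) \<longlonglongrightarrow> 0"
  proof (rule riesz_fischer[of "time \<tau>" U, OF sU])
    fix e :: real assume "e > 0"
    then obtain N where N: "\<forall>m\<ge>N. \<forall>n\<ge>N. \<gamma> m + \<gamma> n < \<nu> * e" using \<gamma>small[of "\<nu> * e"] \<nu> by auto
    have "(LINT s|time \<tau>. (norm (U m s - U n s))\<^sup>2) < e" if "m \<ge> N" "n \<ge> N" for m n
    proof -
      have "\<nu> * (LINT s|time \<tau>. (norm (U m s - U n s))\<^sup>2) \<le> \<gamma> m + \<gamma> n"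
        using est[OF atLeastAtMost_iff[THEN iffD2, OF conjI[OF less_imp_le[OF \<tau>] order_refl]], of m n]
          zero_le_power2[of "norm (i (U m \<tau>) - i (U n \<tau>))"] by linarith
      also have "\<dots> < \<nu> * e" using N that by blast
      finally show ?thesis using \<nu> by simp
    qed
    then show "\<exists>N. \<forall>m\<ge>N. \<forall>n\<ge>N. (LINT s|time \<tau>. (norm (U m s - U n s))\<^sup>2) < e" by blast
  qed
  have pt: "(norm (i (U m t) - i (U n t)))\<^sup>2 \<le> \<gamma> m + \<gamma> n" if "t \<in> {0..\<tau>}" for m n t
  proof -
    have "0 \<le> \<nu> * (LINT s|time t. (norm (U m s - U n s))\<^sup>2)" using \<nu> by simp
    then show ?thesis using est[OF that, of m n] by linarith
  qed
  have "uniformly_Cauchy_on {0..\<tau>} (\<lambda>n t. i (U n t))"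
  proof (rule uniformly_Cauchy_onI)
    fix e :: real assume "e > 0"
    then obtain N where N: "\<forall>m\<ge>N. \<forall>n\<ge>N. \<gamma> m + \<gamma> n < e\<^sup>2" using \<gamma>small[of "e\<^sup>2"] by auto
    have "dist (i (U m t)) (i (U n t)) < e" if "t \<in> {0..\<tau>}" "m \<ge> N" "n \<ge> N" for t m n
    proof -
      have "(norm (i (U m t) - i (U n t)))\<^sup>2 < e\<^sup>2" using pt[OF that(1), of m n] N that by force
      then show ?thesis using \<open>e > 0\<close> by (simp add: dist_norm power_less_imp_less_base)
    qed
    then show "\<exists>M. \<forall>x\<in>{0..\<tau>}. \<forall>m\<ge>M. \<forall>n\<ge>M. dist (i (U m x)) (i (U n x)) < e" by blast
  qed
  then obtain w where w: "uniform_limit {0..\<tau>} (\<lambda>n t. i (U n t)) w sequentially"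
    using Cauchy_uniformly_convergent unfolding uniformly_convergent_on_def by blast
  have ciU: "continuous_on {0..\<tau>} (\<lambda>t. i (U n t))" for n
    using bounded_linear.continuous_on[OF bl cU] .
  have cw: "continuous_on {0..\<tau>} w"
    by (rule uniform_limit_theorem[OF _ w]) (auto simp: ciU)
  have wl: "(\<lambda>n. i (U n t)) \<longlonglongrightarrow> w t" if "t \<in> {0..\<tau>}" for t using tendsto_uniform_limitI[OF w that] .
  have ptw: "(norm (i (U n t) - w t))\<^sup>2 \<le> \<gamma> n" if t: "t \<in> {0..\<tau>}" for n t
  proof -
    have 1: "(\<lambda>m. (norm (i (U n t) - i (U m t)))\<^sup>2) \<longlonglongrightarrow> (norm (i (U n t) - w t))\<^sup>2"
      by (intro tendsto_intros wl t)
    have 2: "(\<lambda>m. \<gamma> n + \<gamma> m) \<longlonglongrightarrow> \<gamma> n + 0" by (intro tendsto_intros \<gamma>)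
    show ?thesis using LIMSEQ_le[OF 1 2] pt[OF t] by auto
  qed
  have sw: "sq_int (time \<tau>) w" by (rule continuous_on_sq_int_time[OF cw])
  have sd: "sq_int (time \<tau>) (\<lambda>t. i (U n t) - w t)" for n
    by (rule sq_int_diff[OF sq_int_i[OF sU] sw])
  have iuw: "AE t in time \<tau>. i (u t) = w t"
  proof (rule AE_eq_if_integral_square_zero[OF sq_int_i[OF u] sw])
    obtain K where K: "\<And>x. norm (i x) \<le> norm x * K" "K \<ge> 0" using bounded_linear.nonneg_bounded[OF bl] by blast
    have le: "(LINT t|time \<tau>. (norm (i (u t) - w t))\<^sup>2) \<le> 2 * (K\<^sup>2 * (LINT t|time \<tau>. (norm (U n t - u t))\<^sup>2)) + 2 * (\<gamma> n * measure (time \<tau>) {0..\<tau>})" for n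
    proof -
      have "(LINT t|time \<tau>. (norm (i (u t) - w t))\<^sup>2) \<le> 2 * (LINT t|time \<tau>. (norm (i (u t) - i (U n t)))\<^sup>2) + 2 * (LINT t|time \<tau>. (norm (i (U n t) - w t))\<^sup>2)"
        by (rule integral_square_norm_diff_le[OF sq_int_i[OF u] sq_int_i[OF sU] sw])
      also have "(LINT t|time \<tau>. (norm (i (U n t) - w t))\<^sup>2) \<le> (LINT t|time \<tau>. \<gamma> n)"
        by (rule integral_mono) (use sq_int_norm2[OF sd] ptw finite_measure.integrable_const[OF finite_measure_time] in auto)
      also have "(LINT t|time \<tau>. \<gamma> n) = \<gamma> n * measure (time \<tau>) {0..\<tau>}" by simp
      also have "(LINT t|time \<tau>. (norm (i (u t) - i (U n t)))\<^sup>2) \<le> (LINT t|time \<tau>. K\<^sup>2 * (norm (U n t - u t))\<^sup>2)"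
      proof (rule integral_mono)
        show "integrable (time \<tau>) (\<lambda>t. (norm (i (u t) - i (U n t)))\<^sup>2)"
          using sq_int_norm2[OF sq_int_diff[OF sq_int_i[OF u] sq_int_i[OF sU]]] .
        show "integrable (time \<tau>) (\<lambda>t. K\<^sup>2 * (norm (U n t - u t))\<^sup>2)"
          using sq_int_norm2[OF sq_int_diff[OF sU u]] by simp
        show "(norm (i (u t) - i (U n t)))\<^sup>2 \<le> K\<^sup>2 * (norm (U n t - u t))\<^sup>2" for t
          using power_mono[OF K(1)[of "u t - U n t"], of 2]
          by (simp add: i_diff power_mult_distrib mult.commute norm_minus_commute)
      qed
      finally show ?thesis by simp
    qed
    have "(\<lambda>n. 2 * (K\<^sup>2 * (LINT t|time \<tau>. (norm (U n t - u t))\<^sup>2)) + 2 * (\<gamma> n * measure (time \<tau>) {0..\<tau>})) \<longlonglongrightarrow> 2 * (K\<^sup>2 * 0) + 2 * (0 * measure (time \<tau>) {0..\<tau>})"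
      by (intro tendsto_intros Uu \<gamma>)
    then have "(LINT t|time \<tau>. (norm (i (u t) - w t))\<^sup>2) \<le> 2 * (K\<^sup>2 * 0) + 2 * (0 * measure (time \<tau>) {0..\<tau>})"
      by (rule LIMSEQ_le_const) (use le in blast)
    then show "(LINT t|time \<tau>. (norm (i (u t) - w t))\<^sup>2) = 0" by (simp add: antisym)
  qed
  have conv: "(\<lambda>n. LINT s|time t. (norm (U n s - u s))\<^sup>2) \<longlonglongrightarrow> 0" "(\<lambda>n. LINT s|time t. (norm (R n s - g s))\<^sup>2) \<longlonglongrightarrow> 0"
    and sqt: "sq_int (time t) (U n)" "sq_int (time t) (R n)" "sq_int (time t) u" "sq_int (time t) g"
    if t: "t \<in> {0..\<tau>}" for t n
    using t tendsto_integral_time_mono[OF sU u _ Uu, of t] tendsto_integral_time_mono[OF sR g _ Rg, of t]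
      sq_int_time_mono[OF sU, of t] sq_int_time_mono[OF sR, of t] sq_int_time_mono[OF u, of t] sq_int_time_mono[OF g, of t] by auto
  have weak: "w t \<bullet> i c = x0 \<bullet> i c + (LINT s|time t. (g s - \<nu> *\<^sub>R u s) \<bullet> c)" if t: "t \<in> {0..\<tau>}" for t c
  proof -
    note s = sqt[OF t]
    have 1: "(\<lambda>n. i (U n t) \<bullet> i c) \<longlonglongrightarrow> w t \<bullet> i c" by (intro tendsto_intros wl t)
    have R1: "(\<lambda>n. LINT s|time t. R n s \<bullet> c) \<longlonglongrightarrow> (LINT s|time t. g s \<bullet> c)"
      by (rule tendsto_integral_inner[OF s(2,4) cst cst conv(2)[OF t]]) simp
    have U1: "(\<lambda>n. LINT s|time t. U n s \<bullet> c) \<longlonglongrightarrow> (LINT s|time t. u s \<bullet> c)"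
      by (rule tendsto_integral_inner[OF s(1,3) cst cst conv(1)[OF t]]) simp
    have split: "(LINT s|time t. (p s - \<nu> *\<^sub>R q s) \<bullet> c) = (LINT s|time t. p s \<bullet> c) - \<nu> * (LINT s|time t. q s \<bullet> c)"
      if "sq_int (time t) p" "sq_int (time t) q" for p q :: "real \<Rightarrow> 'v"
      using integrable_inner_sq_int[OF that(1) cst[of t c]] integrable_inner_sq_int[OF that(2) cst[of t c]] by (simp add: inner_simps)
    have "(\<lambda>n. i (b n) \<bullet> i c + ((LINT s|time t. R n s \<bullet> c) - \<nu> * (LINT s|time t. U n s \<bullet> c))) \<longlonglongrightarrow>
        x0 \<bullet> i c + ((LINT s|time t. g s \<bullet> c) - \<nu> * (LINT s|time t. u s \<bullet> c))"
      by (intro tendsto_intros b R1 U1)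
    then have "(\<lambda>n. i (U n t) \<bullet> i c) \<longlonglongrightarrow> x0 \<bullet> i c + (LINT s|time t. (g s - \<nu> *\<^sub>R u s) \<bullet> c)"
      by (simp add: wU[OF t] split s)
    with 1 show ?thesis using LIMSEQ_unique by blast
  qed
  have en: "energy_eq t x0 g u w" if t: "t \<in> {0..\<tau>}" for t
  proof -
    note s = sqt[OF t]
    have U2: "(\<lambda>n. LINT s|time t. (norm (U n s))\<^sup>2) \<longlonglongrightarrow> (LINT s|time t. (norm (u s))\<^sup>2)"
      unfolding power2_norm_eq_inner by (rule tendsto_integral_inner[OF s(1,3,1,3) conv(1)[OF t] conv(1)[OF t]])
    have RU: "(\<lambda>n. LINT s|time t. R n s \<bullet> U n s) \<longlonglongrightarrow> (LINT s|time t. g s \<bullet> u s)"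
      by (rule tendsto_integral_inner[OF s(2,4,1,3) conv(2)[OF t] conv(1)[OF t]])
    have 1: "(\<lambda>n. (norm (i (U n t)))\<^sup>2 + 2 * \<nu> * (LINT s|time t. (norm (U n s))\<^sup>2)) \<longlonglongrightarrow>
       (norm (w t))\<^sup>2 + 2 * \<nu> * (LINT s|time t. (norm (u s))\<^sup>2)"
      by (intro tendsto_intros wl t U2)
    have 2: "(\<lambda>n. (norm (i (b n)))\<^sup>2 + 2 * (LINT s|time t. R n s \<bullet> U n s)) \<longlonglongrightarrow> (norm x0)\<^sup>2 + 2 * (LINT s|time t. g s \<bullet> u s)"
      by (intro tendsto_intros b RU)
    show ?thesis unfolding energy_eq_def using LIMSEQ_unique[OF 1] 2 eU[OF t] by simp
  qed
  show ?thesis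
  proof (rule that[of u w])
    show "lin_sol \<tau> x0 g u w" unfolding lin_sol_def using g u cw iuw weak by blast
    have "(\<lambda>n. i (b n)) \<longlonglongrightarrow> w 0" using wl[of 0] \<tau> by (simp add: U_def)
    then show "w 0 = x0" using b LIMSEQ_unique by blast
    show "energy_eq t x0 g u w \<and> w t \<in> closure (range i)" if "t \<in> {0..\<tau>}" for t
    proof
      show "w t \<in> closure (range i)" unfolding closure_sequential
        by (rule exI[of _ "\<lambda>n. i (U n t)"]) (use wl[OF that] in simp)
    qed (rule en[OF that])
  qed
qed

lemma lin_sol_diff:
  assumes "lin_sol \<tau> x0 g u w" "lin_sol \<tau> x0' g' u' w'"
  shows "lin_sol \<tau> (x0 - x0') (\<lambda>t. g t - g' t) (\<lambda>t. u t - u' t) (\<lambda>t. w t - w' t)"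
proof -
  have s: "sq_int (time \<tau>) g" "sq_int (time \<tau>) u" "sq_int (time \<tau>) g'" "sq_int (time \<tau>) u'"
    using assms by (auto simp: lin_sol_def)
  have ae: "AE t in time \<tau>. i (u t - u' t) = w t - w' t"
  proof -
    have "AE t in time \<tau>. i (u t) = w t" "AE t in time \<tau>. i (u' t) = w' t" using assms by (auto simp: lin_sol_def)
    then show ?thesis by eventually_elim (simp add: i_diff)
  qed
  have "(w t - w' t) \<bullet> i c = (x0 - x0') \<bullet> i c + (LINT s|time t. (g s - g' s - \<nu> *\<^sub>R (u s - u' s)) \<bullet> c)"
    if t: "t \<in> {0..\<tau>}" for t c
  proof -
    have st: "sq_int (time t) (\<lambda>s. g s - \<nu> *\<^sub>R u s)" "sq_int (time t) (\<lambda>s. g' s - \<nu> *\<^sub>R u' s)"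
      using s t by (auto intro!: sq_int_diff sq_int_scaleR intro: sq_int_time_mono)
    have c: "sq_int (time t) (\<lambda>_. c)" by (rule continuous_on_sq_int_time) (rule continuous_on_const)
    have "(LINT s|time t. (g s - g' s - \<nu> *\<^sub>R (u s - u' s)) \<bullet> c) = (LINT s|time t. (g s - \<nu> *\<^sub>R u s) \<bullet> c - (g' s - \<nu> *\<^sub>R u' s) \<bullet> c)"
      by (simp add: inner_simps algebra_simps)
    also have "\<dots> = (LINT s|time t. (g s - \<nu> *\<^sub>R u s) \<bullet> c) - (LINT s|time t. (g' s - \<nu> *\<^sub>R u' s) \<bullet> c)"
      by (rule Bochner_Integration.integral_diff) (intro integrable_inner_sq_int[OF _ c] st)+
    finally have "(LINT s|time t. (g s - g' s - \<nu> *\<^sub>R (u s - u' s)) \<bullet> c)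
       = (LINT s|time t. (g s - \<nu> *\<^sub>R u s) \<bullet> c) - (LINT s|time t. (g' s - \<nu> *\<^sub>R u' s) \<bullet> c)" .
    moreover have "w t \<bullet> i c = x0 \<bullet> i c + (LINT s|time t. (g s - \<nu> *\<^sub>R u s) \<bullet> c)"
      "w' t \<bullet> i c = x0' \<bullet> i c + (LINT s|time t. (g' s - \<nu> *\<^sub>R u' s) \<bullet> c)"
      using assms t by (auto simp: lin_sol_def)
    ultimately show ?thesis by (simp add: inner_diff_left)
  qed
  then show ?thesis unfolding lin_sol_def using assms ae s
    by (auto simp: lin_sol_def intro!: sq_int_diff continuous_intros)
qed

text \<open>The integrated equation says \<open>T u + \<nu> \<integral>\<^sub>0\<^sup>t u = 0\<close>; testing it with \<open>u\<close> gives \<open>i u = 0\<close>, and then the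
  integral vanishes for all \<open>t\<close>.\<close>

lemma lin_sol_zero_unique:
  assumes sol: "lin_sol \<tau> 0 (\<lambda>_. 0) u w" and \<tau>: "\<tau> > 0"
  shows "AE t in time \<tau>. u t = 0" "t \<in> {0..\<tau>} \<Longrightarrow> w t = 0"
proof -
  have u: "sq_int (time \<tau>) u" and cw: "continuous_on {0..\<tau>} w" and iw: "AE t in time \<tau>. i (u t) = w t"
    and weak: "\<And>t c. t \<in> {0..\<tau>} \<Longrightarrow> w t \<bullet> i c = (LINT s|time t. (- \<nu> *\<^sub>R u s) \<bullet> c)"
    using sol by (auto simp: lin_sol_def)
  note ui = sq_int_integrable_time[OF u]
  have wv: "w t \<bullet> i c = - \<nu> * (vint u t \<bullet> c)" if "t \<in> {0..\<tau>}" for t c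
    using weak[OF that, of c] integrable_time_mono[OF ui, of t] that by (simp add: vint_def)
  have eq: "AE t in time \<tau>. T (u t) + \<nu> *\<^sub>R vint u t = 0"
    using iw AE_space
  proof eventually_elim
    fix t assume *: "i (u t) = w t" and "t \<in> space (time \<tau>)"
    then have t: "t \<in> {0..\<tau>}" by simp
    show "T (u t) + \<nu> *\<^sub>R vint u t = 0"
      by (rule inner_ext) (use wv[OF t] * in \<open>simp add: inner_simps T_inner\<close>)
  qed
  have "(LINT t|time \<tau>. u t \<bullet> (T (u t) + \<nu> *\<^sub>R vint u t)) = 0"
    by (rule integral_eq_zero_AE) (use eq in \<open>eventually_elim, simp\<close>)
  from AE_zero_if_Tvint_zero_weak(1)[OF u _ this] \<tau> have iu0: "AE t in time \<tau>. i (u t) = 0" by simp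
  have "AE t in time \<tau>. vint u t = 0"
    using eq iu0
  proof eventually_elim
    fix t assume *: "T (u t) + \<nu> *\<^sub>R vint u t = 0" "i (u t) = 0"
    have "T (u t) = 0" by (rule inner_ext) (simp add: T_inner *)
    with * \<nu> show "vint u t = 0" by simp
  qed
  then have "vint u t = 0" if "t \<in> {0..\<tau>}" for t
    by (rule continuous_AE_eq_imp_eq[OF continuous_vint[OF ui] continuous_on_const \<tau> _ that])
  then show "AE t in time \<tau>. u t = 0"
    by (intro AE_zero_if_vint_zero ui) (use \<tau> in auto)
  have "AE t in time \<tau>. w t = 0" using iw iu0 by eventually_elim simp
  then show "w t = 0" if "t \<in> {0..\<tau>}"
    by (rule continuous_AE_eq_imp_eq[OF cw continuous_on_const \<tau> _ that])
qed

lemma lin_sol_unique: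
  assumes "lin_sol \<tau> x0 g u w" "lin_sol \<tau> x0 g' u' w'" "AE t in time \<tau>. g t = g' t" and \<tau>: "\<tau> > 0"
  shows "AE t in time \<tau>. u t = u' t" "t \<in> {0..\<tau>} \<Longrightarrow> w t = w' t"
proof -
  note d = lin_sol_diff[OF assms(1,2)]
  have s: "sq_int (time \<tau>) g" "sq_int (time \<tau>) u" "sq_int (time \<tau>) g'" "sq_int (time \<tau>) u'"
    using assms by (auto simp: lin_sol_def)
  have "lin_sol \<tau> 0 (\<lambda>_. 0) (\<lambda>t. u t - u' t) (\<lambda>t. w t - w' t)"
    unfolding lin_sol_def
  proof (intro conjI ballI allI)
    fix t c assume t: "t \<in> {0..\<tau>}"
    have tl: "t \<le> \<tau>" using t by simp
    have m: "sq_int (time t) (\<lambda>s. g s - g' s - \<nu> *\<^sub>R (u s - u' s))" "sq_int (time t) (\<lambda>s. 0 - \<nu> *\<^sub>R (u s - u' s))"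
      using s tl by (auto intro!: sq_int_diff sq_int_scaleR sq_int_minus intro: sq_int_time_mono)
    have "(w t - w' t) \<bullet> i c = (LINT s|time t. (g s - g' s - \<nu> *\<^sub>R (u s - u' s)) \<bullet> c)"
      using d t by (simp add: lin_sol_def)
    also have "\<dots> = (LINT s|time t. (0 - \<nu> *\<^sub>R (u s - u' s)) \<bullet> c)"
    proof (rule integral_cong_AE)
      show "AE s in time t. (g s - g' s - \<nu> *\<^sub>R (u s - u' s)) \<bullet> c = (0 - \<nu> *\<^sub>R (u s - u' s)) \<bullet> c"
        using AE_time_mono[OF assms(3) tl] by eventually_elim simp
    qed (intro borel_measurable_inner borel_measurable_const m[THEN sq_int_measurable])+
    finally show "(w t - w' t) \<bullet> i c = 0 \<bullet> i c + (LINT s|time t. (0 - \<nu> *\<^sub>R (u s - u' s)) \<bullet> c)" by simp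
  qed (use d in \<open>auto simp: lin_sol_def\<close>)
  from lin_sol_zero_unique[OF this \<tau>]
  show "AE t in time \<tau>. u t = u' t" "t \<in> {0..\<tau>} \<Longrightarrow> w t = w' t" by auto
qed

text \<open>By uniqueness every solution is the one obtained by approximation, for which the energy equality is
  known.\<close>

lemma lin_sol_energy:
  assumes "lin_sol \<tau> x0 g u w" "x0 \<in> closure (range i)" "\<tau> > 0" "t \<in> {0..\<tau>}"
  shows "energy_eq t x0 g u w" "w t \<in> closure (range i)" "w 0 = x0"
proof -
  have g: "sq_int (time \<tau>) g" using assms by (simp add: lin_sol_def)
  obtain u' w' where s: "lin_sol \<tau> x0 g u' w'" "w' 0 = x0"
    "\<And>t. t \<in> {0..\<tau>} \<Longrightarrow> energy_eq t x0 g u' w' \<and> w' t \<in> closure (range i)"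
    using lin_sol_exists[OF assms(2) g assms(3)] by blast
  have w: "w s = w' s" if "s \<in> {0..\<tau>}" for s
    by (rule lin_sol_unique(2)[OF assms(1) s(1) _ assms(3) that]) simp
  have uu: "AE s in time \<tau>. u s = u' s"
    by (rule lin_sol_unique(1)[OF assms(1) s(1) _ assms(3)]) simp
  have tl: "t \<le> \<tau>" using assms by simp
  have q: "sq_int (time t) u" "sq_int (time t) u'" "sq_int (time t) g"
    using assms(1) s(1) tl by (auto simp: lin_sol_def intro: sq_int_time_mono)
  note ae = AE_time_mono[OF uu tl]
  have 1: "(LINT s|time t. (norm (u s))\<^sup>2) = (LINT s|time t. (norm (u' s))\<^sup>2)"
    by (rule integral_cong_AE) (use q[THEN sq_int_norm2] ae in auto)
  have 2: "(LINT s|time t. g s \<bullet> u s) = (LINT s|time t. g s \<bullet> u' s)"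
    by (rule integral_cong_AE)
      (use integrable_inner_sq_int[OF q(3,1)] integrable_inner_sq_int[OF q(3,2)] ae in auto)
  show "energy_eq t x0 g u w" "w t \<in> closure (range i)" "w 0 = x0"
    using s(2) s(3)[OF assms(4)] w[OF assms(4)] w[of 0] assms(3) 1 2 by (auto simp: energy_eq_def)
qed

lemma lin_sol_estimate:
  assumes "lin_sol \<tau> 0 g u w" "\<tau> > 0" "t \<in> {0..\<tau>}"
  shows "(norm (w t))\<^sup>2 + \<nu> * (LINT s|time t. (norm (u s))\<^sup>2) \<le> (1/\<nu>) * (LINT s|time t. (norm (g s))\<^sup>2)"
proof -
  have "0 = i 0" using i_scaleR[of 0 0] by simp
  then have "0 \<in> range i" by (rule range_eqI)
  then have "0 \<in> closure (range i)" by (rule subsetD[OF closure_subset])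
  from lin_sol_energy(1)[OF assms(1) this assms(2,3)] have e: "energy_eq t 0 g u w" .
  have "sq_int (time t) g" "sq_int (time t) u"
    using assms by (auto simp: lin_sol_def intro: sq_int_time_mono)
  from energy_imp_estimate[OF this e[unfolded energy_eq_def]] show ?thesis by simp
qed

end

section \<open>The evolution equation with a Lipschitz nonlinearity\<close>

text \<open>Lebesgue measure is complete.\<close>

lemma measurable_lebesgue_on_AE:
  fixes f g :: "'a::euclidean_space \<Rightarrow> 'b::topological_space"
  assumes S: "S \<in> sets lebesgue" and f: "f \<in> borel_measurable (lebesgue_on S)"
    and ae: "AE x in lebesgue_on S. f x = g x"
  shows "g \<in> borel_measurable (lebesgue_on S)"
proof (rule measurableI)
  have "AE x in lebesgue. x \<in> S \<longrightarrow> f x = g x" using ae S by (simp add: AE_restrict_space_iff)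
  then obtain N where N: "N \<in> null_sets lebesgue" "{x. \<not> (x \<in> S \<longrightarrow> f x = g x)} \<subseteq> N"
    by (auto simp: eventually_ae_filter)
  fix A :: "'b set" assume A: "A \<in> sets borel"
  have "f -` A \<inter> space (lebesgue_on S) \<in> sets (lebesgue_on S)" using f A by (rule measurable_sets)
  then have 1: "f -` A \<inter> S \<in> sets lebesgue" using S by (simp add: sets_restrict_space_iff)
  have 2: "g -` A \<inter> S \<inter> N \<in> sets lebesgue"
    using N(1) by (metis inf_le2 negligible_iff_null_sets negligible_imp_sets negligible_subset)
  have "g -` A \<inter> S = (f -` A \<inter> S - N) \<union> (g -` A \<inter> S \<inter> N)" using N(2) by auto
  also have "\<dots> \<in> sets lebesgue" using 1 2 N(1) by auto
  finally show "g -` A \<inter> space (lebesgue_on S) \<in> sets (lebesgue_on S)"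
    using S by (simp add: sets_restrict_space_iff)
qed simp

lemma sq_int_time_AE_cong:
  "sq_int (time \<tau>) f \<Longrightarrow> AE t in time \<tau>. f t = g t \<Longrightarrow> sq_int (time \<tau>) g"
  by (rule sq_int_AE_cong) (auto intro: measurable_lebesgue_on_AE dest: sq_int_measurable)

lemma integral_exp_le:
  assumes "\<kappa> > 0" "t \<ge> 0"
  shows "(LINT s|time t. exp (\<kappa> * s)) \<le> exp (\<kappa> * t) / \<kappa>"
proof -
  have c: "continuous_on {0..t} (\<lambda>s. exp (\<kappa> * s))" by (intro continuous_intros)
  have "((\<lambda>s. exp (\<kappa> * s)) has_integral (exp (\<kappa> * t) / \<kappa> - exp (\<kappa> * 0) / \<kappa>)) {0..t}"
    by (rule fundamental_theorem_of_calculus[OF assms(2)])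
      (use assms(1) in \<open>auto intro!: derivative_eq_intros simp: has_real_derivative_iff_has_vector_derivative[symmetric]\<close>)
  then have "integral {0..t} (\<lambda>s. exp (\<kappa> * s)) = exp (\<kappa> * t) / \<kappa> - 1 / \<kappa>" by (simp add: integral_unique)
  moreover have "(LINT s|time t. exp (\<kappa> * s)) = integral {0..t} (\<lambda>s. exp (\<kappa> * s))"
    by (rule lebesgue_integral_eq_integral) (use continuous_imp_integrable_real[OF c] in auto)
  ultimately show ?thesis using assms by simp
qed

context evolution
begin

lemma lin_sol_cong:
  assumes "lin_sol \<tau> x0 g u w" "AE t in time \<tau>. g t = g' t" "AE t in time \<tau>. u t = u' t"
    "\<And>t. t \<in> {0..\<tau>} \<Longrightarrow> w t = w' t"
  shows "lin_sol \<tau> x0 g' u' w'"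
proof -
  have s: "sq_int (time \<tau>) g" "sq_int (time \<tau>) u" and c: "continuous_on {0..\<tau>} w"
    and ae: "AE t in time \<tau>. i (u t) = w t" using assms by (auto simp: lin_sol_def)
  have s': "sq_int (time \<tau>) g'" "sq_int (time \<tau>) u'" using sq_int_time_AE_cong s assms(2,3) by blast+
  have "AE t in time \<tau>. i (u' t) = w' t" using ae assms(3) AE_space
    by eventually_elim (use assms(4) in auto)
  moreover have "w' t \<bullet> i c = x0 \<bullet> i c + (LINT s|time t. (g' s - \<nu> *\<^sub>R u' s) \<bullet> c)" if t: "t \<in> {0..\<tau>}" for t c
  proof -
    have tl: "t \<le> \<tau>" using t by simp
    have m: "sq_int (time t) (\<lambda>s. g s - \<nu> *\<^sub>R u s)" "sq_int (time t) (\<lambda>s. g' s - \<nu> *\<^sub>R u' s)"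
      using s s' tl by (auto intro!: sq_int_diff sq_int_scaleR intro: sq_int_time_mono)
    have "(LINT s|time t. (g s - \<nu> *\<^sub>R u s) \<bullet> c) = (LINT s|time t. (g' s - \<nu> *\<^sub>R u' s) \<bullet> c)"
    proof (rule integral_cong_AE)
      show "AE s in time t. (g s - \<nu> *\<^sub>R u s) \<bullet> c = (g' s - \<nu> *\<^sub>R u' s) \<bullet> c"
        using AE_time_mono[OF assms(2) tl] AE_time_mono[OF assms(3) tl] by eventually_elim simp
    qed (intro borel_measurable_inner borel_measurable_const m[THEN sq_int_measurable])+
    then show ?thesis using assms(1,4) t by (simp add: lin_sol_def)
  qed
  moreover have "continuous_on {0..\<tau>} w'" using c by (rule continuous_on_eq) (use assms(4) in auto)
  ultimately show ?thesis using s' by (auto simp: lin_sol_def)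
qed

lemma lin_sol_mono:
  assumes "lin_sol \<tau> x0 g u w" "t \<le> \<tau>" shows "lin_sol t x0 g u w"
  using assms unfolding lin_sol_def
  by (auto intro: sq_int_time_mono AE_time_mono continuous_on_subset)

end

text \<open>The last assumption bounds \<open>\<Phi>\<close> by an arbitrarily small multiple of the norm of the energy space at the
  price of a large multiple of the weaker norm.\<close>

locale semilinear_evolution = evolution i \<nu>
  for i :: "'v::{real_inner,banach,second_countable_topology} \<Rightarrow> 'h::{real_inner,banach,second_countable_topology}"
    and \<nu> :: real +
  fixes \<Phi> :: "real \<Rightarrow> 'v \<Rightarrow> 'v"
  assumes \<Phi>_measurable: "\<And>\<tau> u. u \<in> borel_measurable (time \<tau>) \<Longrightarrow> (\<lambda>t. \<Phi> t (u t)) \<in> borel_measurable (time \<tau>)"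
    and \<Phi>_zero: "\<And>\<tau>. \<tau> > 0 \<Longrightarrow> sq_int (time \<tau>) (\<lambda>t. \<Phi> t 0)"
    and \<Phi>_Lipschitz: "\<And>e. e > 0 \<Longrightarrow> \<exists>C\<ge>0. \<forall>t a b. norm (\<Phi> t a - \<Phi> t b) \<le> e * norm (a - b) + C * norm (i (a - b))"
begin

definition sol :: "real \<Rightarrow> 'h \<Rightarrow> (real \<Rightarrow> 'v) \<Rightarrow> (real \<Rightarrow> 'h) \<Rightarrow> bool" where
  "sol \<tau> x0 u w \<longleftrightarrow> lin_sol \<tau> x0 (\<lambda>t. \<Phi> t (u t)) u w"

definition size_sq :: "(real \<Rightarrow> 'v) \<Rightarrow> (real \<Rightarrow> 'h) \<Rightarrow> real \<Rightarrow> real" where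
  "size_sq u w t = (norm (w t))\<^sup>2 + \<nu> * (LINT s|time t. (norm (u s))\<^sup>2)"

lemma \<Phi>_Lipschitz': obtains K where "K \<ge> 0" "\<And>t a b. norm (\<Phi> t a - \<Phi> t b) \<le> K * norm (a - b)"
proof -
  obtain C where C: "C \<ge> 0" "\<And>t a b. norm (\<Phi> t a - \<Phi> t b) \<le> 1 * norm (a - b) + C * norm (i (a - b))"
    using \<Phi>_Lipschitz[of 1] by auto
  obtain K where K: "\<And>x. norm (i x) \<le> norm x * K" "K \<ge> 0" using bounded_linear.nonneg_bounded[OF bl] by blast
  have "norm (\<Phi> t a - \<Phi> t b) \<le> (1 + C * K) * norm (a - b)" for t a b
    using C(2)[of t a b] mult_left_mono[OF K(1)[of "a - b"] C(1)] by (simp add: algebra_simps)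
  then show ?thesis using that[of "1 + C * K"] C K by simp
qed

lemma sq_int_\<Phi>_diff:
  assumes "u \<in> borel_measurable (time \<tau>)" "v \<in> borel_measurable (time \<tau>)" "sq_int (time \<tau>) (\<lambda>t. u t - v t)"
  shows "sq_int (time \<tau>) (\<lambda>t. \<Phi> t (u t) - \<Phi> t (v t))"
proof -
  obtain K where K: "K \<ge> 0" "\<And>t a b. norm (\<Phi> t a - \<Phi> t b) \<le> K * norm (a - b)" using \<Phi>_Lipschitz' by blast
  show ?thesis
  proof (rule sq_int_bound)
    show "(\<lambda>t. \<Phi> t (u t) - \<Phi> t (v t)) \<in> borel_measurable (time \<tau>)"
      using \<Phi>_measurable assms by (intro borel_measurable_diff) auto
    show "integrable (time \<tau>) (\<lambda>t. K\<^sup>2 * (norm (u t - v t))\<^sup>2)" using sq_int_norm2[OF assms(3)] by simp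
    show "(norm (\<Phi> t (u t) - \<Phi> t (v t)))\<^sup>2 \<le> K\<^sup>2 * (norm (u t - v t))\<^sup>2" for t
      using power_mono[OF K(2)[of t "u t" "v t"], of 2] by (simp add: power_mult_distrib)
  qed
qed

lemma sq_int_\<Phi>:
  assumes "sq_int (time \<tau>) u" "\<tau> > 0" shows "sq_int (time \<tau>) (\<lambda>t. \<Phi> t (u t))"
proof -
  have "sq_int (time \<tau>) (\<lambda>t. (\<Phi> t (u t) - \<Phi> t 0) + \<Phi> t 0)"
    by (intro sq_int_add sq_int_\<Phi>_diff \<Phi>_zero assms) (use assms in \<open>auto dest: sq_int_measurable\<close>)
  then show ?thesis by simp
qed

text \<open>Passing from \<open>p\<close> and \<open>q\<close> to the solutions of the linear equation with right-hand sides \<open>\<Phi> p\<close> and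
  \<open>\<Phi> q\<close> divides the energy of the difference by four, in the supremum with the weight \<open>exp (- \<kappa> t)\<close>.\<close>

definition contracts :: "real \<Rightarrow> bool" where
  "contracts \<kappa> \<longleftrightarrow> (\<forall>\<tau> p q v u w B t. \<tau> > 0 \<longrightarrow> sq_int (time \<tau>) p \<longrightarrow> sq_int (time \<tau>) q \<longrightarrow> continuous_on {0..\<tau>} v \<longrightarrow>
      (AE t in time \<tau>. i (p t - q t) = v t) \<longrightarrow> lin_sol \<tau> 0 (\<lambda>t. \<Phi> t (p t) - \<Phi> t (q t)) u w \<longrightarrow>
      (\<forall>s\<in>{0..\<tau>}. size_sq (\<lambda>t. p t - q t) v s \<le> B * exp (\<kappa> * s)) \<longrightarrow>
      t \<in> {0..\<tau>} \<longrightarrow> size_sq u w t \<le> (B / 4) * exp (\<kappa> * t))"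

lemma contractsD:
  "contracts \<kappa> \<Longrightarrow> \<tau> > 0 \<Longrightarrow> sq_int (time \<tau>) p \<Longrightarrow> sq_int (time \<tau>) q \<Longrightarrow> continuous_on {0..\<tau>} v \<Longrightarrow>
      AE t in time \<tau>. i (p t - q t) = v t \<Longrightarrow> lin_sol \<tau> 0 (\<lambda>t. \<Phi> t (p t) - \<Phi> t (q t)) u w \<Longrightarrow>
      (\<And>s. s \<in> {0..\<tau>} \<Longrightarrow> size_sq (\<lambda>t. p t - q t) v s \<le> B * exp (\<kappa> * s)) \<Longrightarrow>
      t \<in> {0..\<tau>} \<Longrightarrow> size_sq u w t \<le> (B / 4) * exp (\<kappa> * t)"
  unfolding contracts_def by blast

text \<open>The smallness of the factor in front of the stronger norm is what makes the solution operator a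
  contraction for the exponentially weighted supremum of the energy.\<close>

lemma contraction: "\<exists>\<kappa>>0. contracts \<kappa>"
proof -
  obtain C where C: "C \<ge> 0" "\<And>t a b. norm (\<Phi> t a - \<Phi> t b) \<le> \<nu> / 4 * norm (a - b) + C * norm (i (a - b))"
    using \<Phi>_Lipschitz[of "\<nu> / 4"] \<nu> by auto
  \<comment> \<open>Chosen so that each of the two parts of the Lipschitz bound contributes at most B / 8.\<close>
  define \<kappa> where "\<kappa> = 16 * C\<^sup>2 / \<nu> + 1"
  have \<kappa>: "\<kappa> > 0" using \<nu> by (simp add: \<kappa>_def add_nonneg_pos)
  have \<kappa>C: "2 * C\<^sup>2 / \<nu> \<le> \<kappa> / 8" using \<nu> by (simp add: \<kappa>_def)
  show ?thesis
    unfolding contracts_def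
  proof (intro exI[of _ \<kappa>] conjI allI impI \<kappa>)
    fix \<tau> p q v u w B t
    assume \<tau>: "\<tau> > 0" and p: "sq_int (time \<tau>) p" and q: "sq_int (time \<tau>) q" and v: "continuous_on {0..\<tau>} v"
      and iv: "AE t in time \<tau>. i (p t - q t) = v t"
      and sol: "lin_sol \<tau> 0 (\<lambda>t. \<Phi> t (p t) - \<Phi> t (q t)) u w"
      and "\<forall>s\<in>{0..\<tau>}. size_sq (\<lambda>t. p t - q t) v s \<le> B * exp (\<kappa> * s)" and t: "t \<in> {0..\<tau>}"
    then have B: "size_sq (\<lambda>t. p t - q t) v s \<le> B * exp (\<kappa> * s)" if "s \<in> {0..\<tau>}" for s using that by blast
    have tl: "t \<le> \<tau>" "t \<ge> 0" using t by auto
    have pq: "sq_int (time t) (\<lambda>t. p t - q t)" using sq_int_diff[OF p q] sq_int_time_mono tl by blast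
    have sv: "sq_int (time t) v" using continuous_on_sq_int_time[OF v] sq_int_time_mono tl by blast
    have vB: "(norm (v s))\<^sup>2 \<le> B * exp (\<kappa> * s)" if "s \<in> {0..\<tau>}" for s
    proof -
      have "0 \<le> \<nu> * (LINT r|time s. (norm (p r - q r))\<^sup>2)" using \<nu> by simp
      then show ?thesis using B[OF that] unfolding size_sq_def by linarith
    qed
    have ce: "integrable (time t) (\<lambda>s. B * exp (\<kappa> * s))"
      by (intro continuous_imp_integrable_real continuous_intros)
    have "0 \<le> B * exp (\<kappa> * 0)" using vB[of 0] \<tau> by (smt (verit) atLeastAtMost_iff zero_le_power2)
    then have B0: "B \<ge> 0" by simp
    have dB: "(LINT s|time t. (norm (p s - q s))\<^sup>2) \<le> B * exp (\<kappa> * t) / \<nu>"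
      using B[OF t] \<nu> unfolding size_sq_def by (simp add: pos_le_divide_eq mult.commute) (smt (verit) zero_le_power2)
    have "size_sq u w t \<le> (1/\<nu>) * (LINT s|time t. (norm (\<Phi> s (p s) - \<Phi> s (q s)))\<^sup>2)"
      unfolding size_sq_def by (rule lin_sol_estimate[OF sol \<tau> t])
    also have "(LINT s|time t. (norm (\<Phi> s (p s) - \<Phi> s (q s)))\<^sup>2)
       \<le> (LINT s|time t. \<nu>\<^sup>2 / 8 * (norm (p s - q s))\<^sup>2 + 2 * C\<^sup>2 * (norm (v s))\<^sup>2)"
    proof (rule integral_mono_AE)
      have "sq_int (time \<tau>) (\<lambda>s. \<Phi> s (p s) - \<Phi> s (q s))" using sol by (simp add: lin_sol_def)
      then show "integrable (time t) (\<lambda>s. (norm (\<Phi> s (p s) - \<Phi> s (q s)))\<^sup>2)"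
        using sq_int_time_mono sq_int_norm2 tl by blast
      show "integrable (time t) (\<lambda>s. \<nu>\<^sup>2 / 8 * (norm (p s - q s))\<^sup>2 + 2 * C\<^sup>2 * (norm (v s))\<^sup>2)"
        using sq_int_norm2[OF pq] sq_int_norm2[OF sv] by simp
      show "AE s in time t. (norm (\<Phi> s (p s) - \<Phi> s (q s)))\<^sup>2 \<le> \<nu>\<^sup>2 / 8 * (norm (p s - q s))\<^sup>2 + 2 * C\<^sup>2 * (norm (v s))\<^sup>2"
        using AE_time_mono[OF iv tl(1)]
      proof eventually_elim
        fix s assume i: "i (p s - q s) = v s"
        define x where "x = \<nu> / 4 * norm (p s - q s)"
        define y where "y = C * norm (v s)"
        have "(norm (\<Phi> s (p s) - \<Phi> s (q s)))\<^sup>2 \<le> (x + y)\<^sup>2"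
          using C(2)[of s "p s" "q s"] i by (intro power_mono) (auto simp: x_def y_def)
        also have "\<dots> \<le> 2 * x\<^sup>2 + 2 * y\<^sup>2" using sum_squares_bound[of x y] by (simp add: power2_sum)
        finally show "(norm (\<Phi> s (p s) - \<Phi> s (q s)))\<^sup>2 \<le> \<nu>\<^sup>2 / 8 * (norm (p s - q s))\<^sup>2 + 2 * C\<^sup>2 * (norm (v s))\<^sup>2"
          by (simp add: x_def y_def power_mult_distrib power_divide)
      qed
    qed
    also have "\<dots> = \<nu>\<^sup>2 / 8 * (LINT s|time t. (norm (p s - q s))\<^sup>2) + 2 * C\<^sup>2 * (LINT s|time t. (norm (v s))\<^sup>2)"
      using sq_int_norm2[OF pq] sq_int_norm2[OF sv] by simp
    also have "\<dots> \<le> \<nu>\<^sup>2 / 8 * (B * exp (\<kappa> * t) / \<nu>) + 2 * C\<^sup>2 * (B * (exp (\<kappa> * t) / \<kappa>))"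
    proof (intro add_mono mult_left_mono dB)
      have "(LINT s|time t. (norm (v s))\<^sup>2) \<le> (LINT s|time t. B * exp (\<kappa> * s))"
        by (rule integral_mono[OF sq_int_norm2[OF sv] ce]) (use vB tl in auto)
      also have "\<dots> = B * (LINT s|time t. exp (\<kappa> * s))" by simp
      also have "\<dots> \<le> B * (exp (\<kappa> * t) / \<kappa>)"
        by (intro mult_left_mono integral_exp_le \<kappa> tl B0)
      finally show "(LINT s|time t. (norm (v s))\<^sup>2) \<le> B * (exp (\<kappa> * t) / \<kappa>)" .
    qed (use \<nu> in auto)
    finally have "size_sq u w t \<le> (1/\<nu>) * (\<nu>\<^sup>2 / 8 * (B * exp (\<kappa> * t) / \<nu>) + 2 * C\<^sup>2 * (B * (exp (\<kappa> * t) / \<kappa>)))"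
      using \<nu> by (simp add: divide_right_mono)
    also have "\<dots> = B * exp (\<kappa> * t) / 8 + (2 * C\<^sup>2 / \<nu>) * (B * (exp (\<kappa> * t) / \<kappa>))"
      using \<nu> by (simp add: field_simps power2_eq_square)
    also have "(2 * C\<^sup>2 / \<nu>) * (B * (exp (\<kappa> * t) / \<kappa>)) \<le> \<kappa> / 8 * (B * (exp (\<kappa> * t) / \<kappa>))"
      by (intro mult_right_mono \<kappa>C) (use B0 \<kappa> in auto)
    also have "\<dots> = B * exp (\<kappa> * t) / 8" using \<kappa> by simp
    finally show "size_sq u w t \<le> (B / 4) * exp (\<kappa> * t)" by simp
  qed
qed

lemma size_sq_bounded:
  assumes u: "sq_int (time \<tau>) u" and w: "continuous_on {0..\<tau>} w" and \<kappa>: "\<kappa> > 0"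
  obtains B where "B \<ge> 0" "\<And>t. t \<in> {0..\<tau>} \<Longrightarrow> size_sq u w t \<le> B * exp (\<kappa> * t)"
proof -
  have "compact (w ` {0..\<tau>})" using w by (rule compact_continuous_image) auto
  then obtain b where b: "\<And>s. s \<in> {0..\<tau>} \<Longrightarrow> norm (w s) \<le> b"
    using bounded_iff compact_imp_bounded by (metis imageI)
  define B where "B = b\<^sup>2 + \<nu> * (LINT s|time \<tau>. (norm (u s))\<^sup>2)"
  have B0: "B \<ge> 0" using \<nu> by (simp add: B_def)
  have "size_sq u w t \<le> B * exp (\<kappa> * t)" if t: "t \<in> {0..\<tau>}" for t
  proof -
    have "size_sq u w t \<le> B" unfolding size_sq_def B_def
      by (intro add_mono mult_left_mono integral_time_mono sq_int_norm2[OF u] power_mono b)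
        (use t \<nu> in auto)
    also have "\<dots> \<le> B * exp (\<kappa> * t)" using B0 t \<kappa> by (simp add: mult_le_cancel_left1)
    finally show ?thesis .
  qed
  with B0 that show ?thesis by blast
qed

lemma sol_imp: assumes "sol \<tau> x0 u w" shows "sq_int (time \<tau>) u" "continuous_on {0..\<tau>} w" "AE t in time \<tau>. i (u t) = w t"
  using assms by (auto simp: sol_def lin_sol_def)

text \<open>The difference of two solutions is reproduced by the contraction, so the bound for its energy can be
  divided by four any number of times.\<close>

theorem sol_unique:
  assumes 1: "sol \<tau> x0 u w" and 2: "sol \<tau> x0 u' w'" and \<tau>: "\<tau> > 0"
  shows "AE t in time \<tau>. u t = u' t" "t \<in> {0..\<tau>} \<Longrightarrow> w t = w' t"
proof -
  obtain \<kappa> where \<kappa>: "\<kappa> > 0" and contr: "contracts \<kappa>" using contraction by blast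
  note con = contractsD[OF contr]
  have d: "lin_sol \<tau> 0 (\<lambda>t. \<Phi> t (u t) - \<Phi> t (u' t)) (\<lambda>t. u t - u' t) (\<lambda>t. w t - w' t)"
    using lin_sol_diff[OF 1[unfolded sol_def] 2[unfolded sol_def]] by simp
  note s1 = sol_imp[OF 1] and s2 = sol_imp[OF 2]
  have iw: "AE t in time \<tau>. i (u t - u' t) = w t - w' t" using d by (simp add: lin_sol_def)
  have cw: "continuous_on {0..\<tau>} (\<lambda>t. w t - w' t)" by (intro continuous_intros s1 s2)
  have su: "sq_int (time \<tau>) (\<lambda>t. u t - u' t)" by (rule sq_int_diff[OF s1(1) s2(1)])
  obtain B where B: "B \<ge> 0" "\<And>t. t \<in> {0..\<tau>} \<Longrightarrow> size_sq (\<lambda>t. u t - u' t) (\<lambda>t. w t - w' t) t \<le> B * exp (\<kappa> * t)"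
    using size_sq_bounded[OF su cw \<kappa>] by blast
  have it: "\<forall>t\<in>{0..\<tau>}. size_sq (\<lambda>t. u t - u' t) (\<lambda>t. w t - w' t) t \<le> (B * (1/4)^n) * exp (\<kappa> * t)" for n
  proof (induction n)
    case 0 then show ?case using B(2) by simp
  next
    case (Suc n)
    show ?case
    proof
      fix t assume t: "t \<in> {0..\<tau>}"
      have "size_sq (\<lambda>t. u t - u' t) (\<lambda>t. w t - w' t) t \<le> (B * (1/4)^n / 4) * exp (\<kappa> * t)"
        by (rule con[OF \<tau> s1(1) s2(1) cw iw d _ t]) (use Suc in blast)
      then show "size_sq (\<lambda>t. u t - u' t) (\<lambda>t. w t - w' t) t \<le> (B * (1/4)^Suc n) * exp (\<kappa> * t)" by simp
    qed
  qed
  have z: "size_sq (\<lambda>t. u t - u' t) (\<lambda>t. w t - w' t) t \<le> 0" if t: "t \<in> {0..\<tau>}" for t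
  proof -
    have "(\<lambda>n. (B * (1/4)^n) * exp (\<kappa> * t)) \<longlonglongrightarrow> (B * 0) * exp (\<kappa> * t)"
      by (intro tendsto_intros LIMSEQ_power_zero) simp
    then have "size_sq (\<lambda>t. u t - u' t) (\<lambda>t. w t - w' t) t \<le> (B * 0) * exp (\<kappa> * t)"
      by (rule LIMSEQ_le_const) (use it t in blast)
    then show ?thesis by simp
  qed
  have nn: "0 \<le> \<nu> * (LINT s|time t. (norm (u s - u' s))\<^sup>2)" for t using \<nu> by simp
  show "w t = w' t" if "t \<in> {0..\<tau>}"
  proof -
    have "(norm (w t - w' t))\<^sup>2 \<le> 0" using z[OF that] nn[of t] unfolding size_sq_def by linarith
    then show ?thesis by simp
  qed
  have "\<tau> \<in> {0..\<tau>}" using \<tau> by simp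
  from z[OF this] have "\<nu> * (LINT s|time \<tau>. (norm (u s - u' s))\<^sup>2) \<le> 0"
    unfolding size_sq_def using zero_le_power2[of "norm (w \<tau> - w' \<tau>)"] by linarith
  with \<nu> have "(LINT s|time \<tau>. (norm (u s - u' s))\<^sup>2) \<le> 0" by (simp add: mult_le_0_iff)
  then have "(LINT s|time \<tau>. (norm (u s - u' s))\<^sup>2) = 0" by (rule antisym) simp
  then show "AE t in time \<tau>. u t = u' t" by (rule AE_eq_if_integral_square_zero[OF s1(1) s2(1)])
qed

lemma size_sq_triangle:
  assumes "sq_int (time t) p" "sq_int (time t) q" "sq_int (time t) r"
  shows "size_sq (\<lambda>s. p s - r s) (\<lambda>s. x s - z s) t
    \<le> 2 * size_sq (\<lambda>s. p s - q s) (\<lambda>s. x s - y s) t + 2 * size_sq (\<lambda>s. q s - r s) (\<lambda>s. y s - z s) t"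
proof -
  have "\<nu> * (LINT s|time t. (norm (p s - r s))\<^sup>2)
      \<le> \<nu> * (2 * (LINT s|time t. (norm (p s - q s))\<^sup>2) + 2 * (LINT s|time t. (norm (q s - r s))\<^sup>2))"
    by (intro mult_left_mono integral_square_norm_diff_le assms) (use \<nu> in simp)
  then show ?thesis using square_norm_diff_le[of "x t" "z t" "y t"]
    unfolding size_sq_def by (simp add: algebra_simps)
qed

text \<open>Picard iteration: the energy of the difference of the iterates \<open>n\<close> and \<open>m + n\<close> is bounded by a multiple
  of \<open>(1/4)\<^sup>n\<close> in the exponentially weighted norm.\<close>

theorem sol_exists:
  assumes x0: "x0 \<in> closure (range i)" and \<tau>: "\<tau> > 0"
  obtains u w where "sol \<tau> x0 u w"
proof -
  obtain \<kappa> where \<kappa>: "\<kappa> > 0" and contr: "contracts \<kappa>" using contraction by blast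
  note con = contractsD[OF contr]
  define adm where "adm p \<longleftrightarrow> sq_int (time \<tau>) (fst p) \<and> continuous_on {0..\<tau>} (snd p) \<and> (AE t in time \<tau>. i (fst p t) = snd p t)" for p :: "(real \<Rightarrow> 'v) \<times> (real \<Rightarrow> 'h)"
  define nxt where "nxt p p' \<longleftrightarrow> lin_sol \<tau> x0 (\<lambda>t. \<Phi> t (fst p t)) (fst p') (snd p')" for p p' :: "(real \<Rightarrow> 'v) \<times> (real \<Rightarrow> 'h)"
  have i0: "i 0 = 0" using i_scaleR[of 0 0] by simp
  have "\<exists>f. \<forall>n. adm (f n) \<and> nxt (f n) (f (Suc n))"
  proof (rule dependent_nat_choice)
    show "\<exists>x. adm x" by (rule exI[of _ "(\<lambda>_. 0, \<lambda>_. 0)"]) (simp add: adm_def i0)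
    fix p and n :: nat assume "adm p"
    then have "sq_int (time \<tau>) (\<lambda>t. \<Phi> t (fst p t))" unfolding adm_def using sq_int_\<Phi> \<tau> by blast
    from lin_sol_exists[OF x0 this \<tau>] obtain u w where "lin_sol \<tau> x0 (\<lambda>t. \<Phi> t (fst p t)) u w" by blast
    then show "\<exists>y. adm y \<and> nxt p y"
      by (intro exI[of _ "(u, w)"]) (auto simp: adm_def nxt_def lin_sol_def)
  qed
  then obtain f where f: "\<And>n. adm (f n)" "\<And>n. nxt (f n) (f (Suc n))" by blast
  define U where "U n = fst (f n)" for n
  define W where "W n = snd (f n)" for n
  have sU: "sq_int (time \<tau>) (U n)" and cW: "continuous_on {0..\<tau>} (W n)" and iUW: "AE t in time \<tau>. i (U n t) = W n t"
    and step: "lin_sol \<tau> x0 (\<lambda>t. \<Phi> t (U n t)) (U (Suc n)) (W (Suc n))" for n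
    using f[of n] by (auto simp: adm_def nxt_def U_def W_def)
  define S where "S m n t = size_sq (\<lambda>t. U m t - U n t) (\<lambda>t. W m t - W n t) t" for m n t
  have half: "S (Suc m) (Suc n) t \<le> (B / 4) * exp (\<kappa> * t)"
    if B: "\<And>s. s \<in> {0..\<tau>} \<Longrightarrow> S m n s \<le> B * exp (\<kappa> * s)" and t: "t \<in> {0..\<tau>}" for m n B t
    unfolding S_def
  proof (rule con[OF \<tau> sU[of m] sU[of n] _ _ _ _ t])
    show "continuous_on {0..\<tau>} (\<lambda>t. W m t - W n t)" by (intro continuous_intros cW)
    show "AE t in time \<tau>. i (U m t - U n t) = W m t - W n t"
      using iUW[of m] iUW[of n] by eventually_elim (simp add: i_diff)
    show "lin_sol \<tau> 0 (\<lambda>t. \<Phi> t (U m t) - \<Phi> t (U n t)) (\<lambda>t. U (Suc m) t - U (Suc n) t) (\<lambda>t. W (Suc m) t - W (Suc n) t)"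
      using lin_sol_diff[OF step step, of m n] by simp
    show "size_sq (\<lambda>t. U m t - U n t) (\<lambda>t. W m t - W n t) s \<le> B * exp (\<kappa> * s)" if "s \<in> {0..\<tau>}" for s
      using B[OF that] by (simp add: S_def)
  qed
  have tri: "S m l t \<le> 2 * S m n t + 2 * S n l t" if "t \<in> {0..\<tau>}" for m n l t
    unfolding S_def by (rule size_sq_triangle) (use sU sq_int_time_mono that in auto)
  obtain B where B: "B \<ge> 0" "\<And>t. t \<in> {0..\<tau>} \<Longrightarrow> S 1 0 t \<le> B * exp (\<kappa> * t)"
    unfolding S_def using size_sq_bounded[OF sq_int_diff[OF sU sU] continuous_on_diff[OF cW cW] \<kappa>, of 1 0 1 0] by blast
  \<comment> \<open>The triangle inequality for squares costs a factor 2 only, against the gain of a factor 4.\<close>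
  have b0: "\<forall>t\<in>{0..\<tau>}. S m 0 t \<le> (4 * B) * exp (\<kappa> * t)" for m
  proof (induction m)
    case 0
    have "S 0 0 t = 0" for t by (simp add: S_def size_sq_def)
    then show ?case using B(1) by simp
  next
    case (Suc m)
    show ?case
    proof
      fix t assume t: "t \<in> {0..\<tau>}"
      have "S (Suc m) 0 t \<le> 2 * S (Suc m) (Suc 0) t + 2 * S 1 0 t" using tri[OF t, of "Suc m" 0 1] by simp
      also have "\<dots> \<le> 2 * ((4 * B / 4) * exp (\<kappa> * t)) + 2 * (B * exp (\<kappa> * t))"
        by (intro add_mono mult_left_mono half B(2) t) (use Suc in auto)
      finally show "S (Suc m) 0 t \<le> (4 * B) * exp (\<kappa> * t)" by simp
    qed
  qed
  have bn: "\<forall>t\<in>{0..\<tau>}. S (m + n) n t \<le> (4 * B * (1/4)^n) * exp (\<kappa> * t)" for m n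
  proof (induction n)
    case 0 then show ?case using b0 by simp
  next
    case (Suc n)
    show ?case
    proof
      fix t assume t: "t \<in> {0..\<tau>}"
      have "S (Suc (m + n)) (Suc n) t \<le> ((4 * B * (1/4)^n) / 4) * exp (\<kappa> * t)"
        by (rule half[OF _ t]) (use Suc in blast)
      then show "S (m + Suc n) (Suc n) t \<le> (4 * B * (1/4)^Suc n) * exp (\<kappa> * t)" by simp
    qed
  qed
  have ib: "(LINT s|time \<tau>. (norm (U (m + n) s - U n s))\<^sup>2) \<le> (1/4)^n * (4 * B * exp (\<kappa> * \<tau>) / \<nu>)" for m n
  proof -
    have "\<tau> \<in> {0..\<tau>}" using \<tau> by simp
    then have "S (m + n) n \<tau> \<le> (4 * B * (1/4)^n) * exp (\<kappa> * \<tau>)" using bn by blast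
    then have "\<nu> * (LINT s|time \<tau>. (norm (U (m + n) s - U n s))\<^sup>2) \<le> (4 * B * (1/4)^n) * exp (\<kappa> * \<tau>)"
      unfolding S_def size_sq_def using zero_le_power2[of "norm (W (m + n) \<tau> - W n \<tau>)"] by linarith
    then show ?thesis using \<nu> by (simp add: field_simps)
  qed
  obtain u where u: "sq_int (time \<tau>) u" and Uu: "(\<lambda>n. LINT s|time \<tau>. (norm (U n s - u s))\<^sup>2) \<longlonglongrightarrow> 0"
  proof (rule riesz_fischer[of "time \<tau>" U, OF sU])
    fix e :: real assume "e > 0"
    have "(\<lambda>n. (1/4)^n * (4 * B * exp (\<kappa> * \<tau>) / \<nu>)) \<longlonglongrightarrow> 0 * (4 * B * exp (\<kappa> * \<tau>) / \<nu>)"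
      by (intro tendsto_intros LIMSEQ_power_zero) simp
    then have "\<forall>\<^sub>F n in sequentially. (1/4)^n * (4 * B * exp (\<kappa> * \<tau>) / \<nu>) < e" using \<open>e > 0\<close> by (intro order_tendstoD) auto
    then obtain N where N: "\<And>n. n \<ge> N \<Longrightarrow> (1/4)^n * (4 * B * exp (\<kappa> * \<tau>) / \<nu>) < e" unfolding eventually_sequentially by blast
    have le: "(LINT s|time \<tau>. (norm (U m s - U n s))\<^sup>2) < e" if "m \<ge> n" "n \<ge> N" for m n
      using ib[of "m - n" n] N[OF that(2)] that(1) by simp
    have "(LINT s|time \<tau>. (norm (U m s - U n s))\<^sup>2) < e" if "m \<ge> N" "n \<ge> N" for m n
      using le[of n m] le[of m n] that by (cases "m \<ge> n") (auto simp: norm_minus_commute)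
    then show "\<exists>N. \<forall>m\<ge>N. \<forall>n\<ge>N. (LINT s|time \<tau>. (norm (U m s - U n s))\<^sup>2) < e" by blast
  qed
  obtain u' w' where sol': "lin_sol \<tau> x0 (\<lambda>t. \<Phi> t (u t)) u' w'"
    using lin_sol_exists[OF x0 sq_int_\<Phi>[OF u \<tau>] \<tau>] by blast
  have su': "sq_int (time \<tau>) u'" using sol' by (simp add: lin_sol_def)
  obtain K where K: "K \<ge> 0" "\<And>t a b. norm (\<Phi> t a - \<Phi> t b) \<le> K * norm (a - b)" using \<Phi>_Lipschitz' by blast
  have le: "(LINT s|time \<tau>. (norm (U (Suc n) s - u' s))\<^sup>2) \<le> (K\<^sup>2 / \<nu>\<^sup>2) * (LINT s|time \<tau>. (norm (U n s - u s))\<^sup>2)" for n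
  proof -
    have d: "lin_sol \<tau> 0 (\<lambda>t. \<Phi> t (U n t) - \<Phi> t (u t)) (\<lambda>t. U (Suc n) t - u' t) (\<lambda>t. W (Suc n) t - w' t)"
      using lin_sol_diff[OF step sol', of n] by simp
    have "\<tau> \<in> {0..\<tau>}" using \<tau> by simp
    from lin_sol_estimate[OF d \<tau> this]
    have "\<nu> * (LINT s|time \<tau>. (norm (U (Suc n) s - u' s))\<^sup>2) \<le> (1/\<nu>) * (LINT s|time \<tau>. (norm (\<Phi> s (U n s) - \<Phi> s (u s)))\<^sup>2)"
      using zero_le_power2[of "norm (W (Suc n) \<tau> - w' \<tau>)"] by linarith
    also have "(LINT s|time \<tau>. (norm (\<Phi> s (U n s) - \<Phi> s (u s)))\<^sup>2) \<le> (LINT s|time \<tau>. K\<^sup>2 * (norm (U n s - u s))\<^sup>2)"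
    proof (rule integral_mono)
      show "integrable (time \<tau>) (\<lambda>s. (norm (\<Phi> s (U n s) - \<Phi> s (u s)))\<^sup>2)"
        using d by (auto simp: lin_sol_def intro: sq_int_norm2)
      show "integrable (time \<tau>) (\<lambda>s. K\<^sup>2 * (norm (U n s - u s))\<^sup>2)"
        using sq_int_norm2[OF sq_int_diff[OF sU u]] by simp
      show "(norm (\<Phi> s (U n s) - \<Phi> s (u s)))\<^sup>2 \<le> K\<^sup>2 * (norm (U n s - u s))\<^sup>2" for s
        using power_mono[OF K(2)[of s "U n s" "u s"], of 2] by (simp add: power_mult_distrib)
    qed
    finally show ?thesis using \<nu> by (simp add: field_simps power2_eq_square)
  qed
  have "(\<lambda>n. (K\<^sup>2 / \<nu>\<^sup>2) * (LINT s|time \<tau>. (norm (U n s - u s))\<^sup>2)) \<longlonglongrightarrow> (K\<^sup>2 / \<nu>\<^sup>2) * 0" by (intro tendsto_intros Uu)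
  then have 0: "(\<lambda>n. (K\<^sup>2 / \<nu>\<^sup>2) * (LINT s|time \<tau>. (norm (U n s - u s))\<^sup>2)) \<longlonglongrightarrow> 0" by (simp only: mult_zero_right)
  have lim1: "(\<lambda>n. LINT s|time \<tau>. (norm (U (Suc n) s - u' s))\<^sup>2) \<longlonglongrightarrow> 0"
  proof (rule Lim_null_comparison[OF always_eventually 0], rule allI)
    show "norm (LINT s|time \<tau>. (norm (U (Suc n) s - u' s))\<^sup>2) \<le> (K\<^sup>2 / \<nu>\<^sup>2) * (LINT s|time \<tau>. (norm (U n s - u s))\<^sup>2)" for n
      using le[of n] by (subst real_norm_def, subst abs_of_nonneg) auto
  qed
  have lim2: "(\<lambda>n. LINT s|time \<tau>. (norm (U (Suc n) s - u s))\<^sup>2) \<longlonglongrightarrow> 0" using LIMSEQ_Suc[OF Uu] .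
  have "AE t in time \<tau>. u t = u' t"
  proof (rule AE_eq_if_integral_square_zero[OF u su'])
    have "(\<lambda>n. 2 * (LINT s|time \<tau>. (norm (U (Suc n) s - u s))\<^sup>2) + 2 * (LINT s|time \<tau>. (norm (U (Suc n) s - u' s))\<^sup>2)) \<longlonglongrightarrow> 2 * 0 + 2 * 0"
      by (intro tendsto_intros lim1 lim2)
    then have "(LINT s|time \<tau>. (norm (u s - u' s))\<^sup>2) \<le> 2 * 0 + 2 * 0"
    proof (rule LIMSEQ_le_const, intro exI allI impI)
      fix n
      show "(LINT s|time \<tau>. (norm (u s - u' s))\<^sup>2) \<le> 2 * (LINT s|time \<tau>. (norm (U (Suc n) s - u s))\<^sup>2) + 2 * (LINT s|time \<tau>. (norm (U (Suc n) s - u' s))\<^sup>2)"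
        using integral_square_norm_diff_le[OF u sU[of "Suc n"] su'] by (simp add: norm_minus_commute)
    qed
    then show "(LINT s|time \<tau>. (norm (u s - u' s))\<^sup>2) = 0" by (simp add: antisym)
  qed
  then have "AE t in time \<tau>. \<Phi> t (u t) = \<Phi> t (u' t)" by eventually_elim simp
  from lin_sol_cong[OF sol' this] have "sol \<tau> x0 u' w'" unfolding sol_def by simp
  then show ?thesis by (rule that)
qed

lemma sol_mono: "sol \<tau> x0 u w \<Longrightarrow> t \<le> \<tau> \<Longrightarrow> sol t x0 u w"
  unfolding sol_def by (rule lin_sol_mono)

text \<open>By uniqueness the solutions on the intervals from \<open>0\<close> to \<open>n + 1\<close> agree where both are defined and can be
  glued.\<close>

theorem global_sol_exists:
  assumes x0: "x0 \<in> closure (range i)"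
  obtains u w where "\<And>\<tau>. \<tau> > 0 \<Longrightarrow> sol \<tau> x0 u w"
proof -
  have "\<exists>p. sol (real (Suc n)) x0 (fst p) (snd p)" for n
    using sol_exists[OF x0, of "real (Suc n)"] by (metis fst_conv snd_conv of_nat_0_less_iff zero_less_Suc)
  then obtain p where p: "\<And>n. sol (real (Suc n)) x0 (fst (p n)) (snd (p n))" by metis
  define u where "u t = fst (p (nat \<lceil>t\<rceil>)) t" for t
  define w where "w t = snd (p (nat \<lceil>t\<rceil>)) t" for t
  have agree: "AE t in time (real (Suc (min m n))). fst (p m) t = fst (p n) t"
     "\<And>t. t \<in> {0..real (Suc (min m n))} \<Longrightarrow> snd (p m) t = snd (p n) t" for m n
    using sol_unique[of "real (Suc (min m n))" x0 "fst (p m)" "snd (p m)" "fst (p n)" "snd (p n)"]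
      sol_mono[OF p[of m], of "real (Suc (min m n))"] sol_mono[OF p[of n], of "real (Suc (min m n))"] by auto
  have sk: "sol (real (Suc k)) x0 u w" for k
    unfolding sol_def
  proof (rule lin_sol_cong[OF p[of k, unfolded sol_def]])
    have idx: "t \<in> {0..real (Suc (min (nat \<lceil>t\<rceil>) k))}" if "t \<in> {0..real (Suc k)}" for t
    proof -
      have "t \<le> real (Suc (nat \<lceil>t\<rceil>))" using real_nat_ceiling_ge[of t] unfolding of_nat_Suc by linarith
      then show ?thesis using that by (auto simp: min_def simp del: of_nat_Suc)
    qed
    show "snd (p k) t = w t" if "t \<in> {0..real (Suc k)}" for t
      unfolding w_def using agree(2)[OF idx[OF that]] by simp
    have "AE t in lebesgue. \<forall>n. t \<in> {0..real (Suc (min n k))} \<longrightarrow> fst (p n) t = fst (p k) t"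
      using agree(1)[of _ k] by (subst AE_all_countable) (auto simp: AE_restrict_space_iff)
    then have "AE t in lebesgue. t \<in> {0..real (Suc k)} \<longrightarrow> fst (p k) t = u t"
    proof eventually_elim
      fix t assume a: "\<forall>n. t \<in> {0..real (Suc (min n k))} \<longrightarrow> fst (p n) t = fst (p k) t"
      show "t \<in> {0..real (Suc k)} \<longrightarrow> fst (p k) t = u t"
        unfolding u_def using a[rule_format, OF idx] by simp
    qed
    then show ae: "AE t in time (real (Suc k)). fst (p k) t = u t" by (simp add: AE_restrict_space_iff)
    then show "AE t in time (real (Suc k)). \<Phi> t (fst (p k) t) = \<Phi> t (u t)" by eventually_elim simp
  qed
  have "sol \<tau> x0 u w" for \<tau>
    using real_nat_ceiling_ge[of \<tau>] by (intro sol_mono[OF sk[of "nat \<lceil>\<tau>\<rceil>"]]) (simp only: of_nat_Suc)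
  then show ?thesis by (rule that)
qed

end

section \<open>Smooth functions\<close>

definition smooth :: "('a::euclidean_space \<Rightarrow> 'b::real_normed_vector) \<Rightarrow> bool" where
  "smooth f \<longleftrightarrow> (\<forall>k. Ck_on k UNIV f)"

lemma smooth_iff: "smooth f \<longleftrightarrow> (\<forall>es\<in>lists Basis. iter_partial es f differentiable_on UNIV)"
proof
  assume "smooth f"
  then show "\<forall>es\<in>lists Basis. iter_partial es f differentiable_on UNIV"
    unfolding smooth_def Ck_on_def by (metis lessI)
next
  assume *: "\<forall>es\<in>lists Basis. iter_partial es f differentiable_on UNIV"
  then show "smooth f" unfolding smooth_def Ck_on_def
    using differentiable_imp_continuous_on by blast
qed

lemma smooth_differentiable: "smooth f \<Longrightarrow> f differentiable (at x)"
  unfolding smooth_iff by (drule bspec[of _ _ "[]"]) (auto simp: differentiable_on_def)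

lemma smooth_dir_deriv: "smooth f \<Longrightarrow> e \<in> Basis \<Longrightarrow> smooth (dir_deriv e f)"
proof -
  assume f: "smooth f" and e: "e \<in> Basis"
  have "iter_partial es (dir_deriv e f) = iter_partial (es @ [e]) f" for es by (induction es) auto
  then show ?thesis using f e unfolding smooth_iff by simp
qed

lemma smooth_continuous: "smooth f \<Longrightarrow> continuous_on A f"
  by (meson continuous_at_imp_continuous_on differentiable_imp_continuous_within smooth_differentiable)

lemma has_derivative_dir_deriv:
  assumes "(f has_derivative D) (at x)" shows "dir_deriv e f x = D e"
  unfolding dir_deriv_def using frechet_derivative_at[OF assms] by simp

lemma smoothI:
  assumes "f \<in> A" and A: "\<And>g. g \<in> A \<Longrightarrow> \<exists>D. (\<forall>x. (g has_derivative D x) (at x)) \<and> (\<forall>e\<in>Basis. (\<lambda>x. D x e) \<in> A)"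
  shows "smooth f"
proof -
  have step: "dir_deriv e g \<in> A" if "g \<in> A" "e \<in> Basis" for g e
  proof -
    obtain D where D: "\<And>x. (g has_derivative D x) (at x)" "\<And>e. e \<in> Basis \<Longrightarrow> (\<lambda>x. D x e) \<in> A" using A[OF \<open>g \<in> A\<close>] by blast
    have "dir_deriv e g = (\<lambda>x. D x e)" using has_derivative_dir_deriv[OF D(1)] by (intro ext)
    then show ?thesis using D(2)[OF \<open>e \<in> Basis\<close>] by simp
  qed
  have "iter_partial es f \<in> A" if "es \<in> lists Basis" for es
    using that by (induction es) (auto intro: step assms(1))
  then show ?thesis unfolding smooth_iff differentiable_on_def differentiable_def
    using A by (metis UNIV_I)
qed

lemma dir_deriv_linear_combination:
  fixes f g :: "'a::euclidean_space \<Rightarrow> 'b::real_normed_vector"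
  assumes "f differentiable (at x)" "g differentiable (at x)"
  shows "dir_deriv e (\<lambda>x. a *\<^sub>R f x + b *\<^sub>R g x) x = a *\<^sub>R dir_deriv e f x + b *\<^sub>R dir_deriv e g x"
proof -
  obtain F G where F: "(f has_derivative F) (at x)" "(g has_derivative G) (at x)"
    using assms unfolding differentiable_def by blast
  then have "((\<lambda>x. a *\<^sub>R f x + b *\<^sub>R g x) has_derivative (\<lambda>h. a *\<^sub>R F h + b *\<^sub>R G h)) (at x)"
    by (intro derivative_intros)
  then show ?thesis using F by (simp add: has_derivative_dir_deriv)
qed

lemma smooth_linear_combination:
  fixes f g :: "'a::euclidean_space \<Rightarrow> 'b::real_normed_vector"
  assumes "smooth f" "smooth g"
  shows "smooth (\<lambda>x. a *\<^sub>R f x + b *\<^sub>R g x)"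
proof -
  define A where "A = {(\<lambda>x. a *\<^sub>R f x + b *\<^sub>R g x) | f g :: 'a \<Rightarrow> 'b. smooth f \<and> smooth g}"
  show ?thesis
  proof (rule smoothI[of _ A])
    show "(\<lambda>x. a *\<^sub>R f x + b *\<^sub>R g x) \<in> A" unfolding A_def using assms by blast
    fix h assume "h \<in> A"
    then obtain f g where h: "h = (\<lambda>x. a *\<^sub>R f x + b *\<^sub>R g x)" "smooth f" "smooth g" unfolding A_def by blast
    have d: "(f has_derivative frechet_derivative f (at x)) (at x)" "(g has_derivative frechet_derivative g (at x)) (at x)" for x
      using h smooth_differentiable frechet_derivative_works by blast+
    show "\<exists>D. (\<forall>x. (h has_derivative D x) (at x)) \<and> (\<forall>e\<in>Basis. (\<lambda>x. D x e) \<in> A)"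
    proof (intro exI[of _ "\<lambda>x y. a *\<^sub>R frechet_derivative f (at x) y + b *\<^sub>R frechet_derivative g (at x) y"] conjI allI ballI)
      show "(h has_derivative (\<lambda>y. a *\<^sub>R frechet_derivative f (at x) y + b *\<^sub>R frechet_derivative g (at x) y)) (at x)" for x
        unfolding h by (intro derivative_intros d)
      show "(\<lambda>x. a *\<^sub>R frechet_derivative f (at x) e + b *\<^sub>R frechet_derivative g (at x) e) \<in> A" if "e \<in> Basis" for e
        unfolding A_def using smooth_dir_deriv[OF h(2) that] smooth_dir_deriv[OF h(3) that]
        by (intro CollectI exI[of _ "dir_deriv e f"] exI[of _ "dir_deriv e g"]) (auto simp: dir_deriv_def)
    qed
  qed
qed

lemma Cc_infinity_iff:
  "\<phi> \<in> Cc_infinity S \<longleftrightarrow> smooth \<phi> \<and> (\<exists>K. compact K \<and> K \<subseteq> S \<and> (\<forall>x. x \<notin> K \<longrightarrow> \<phi> x = 0))"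
  by (simp add: Cc_infinity_def smooth_def)

lemma Cc_infinity_linear_combination:
  assumes "f \<in> Cc_infinity S" "g \<in> Cc_infinity S"
  shows "(\<lambda>x. a *\<^sub>R f x + b *\<^sub>R g x) \<in> Cc_infinity S"
proof -
  obtain K L where "compact K" "K \<subseteq> S" "\<forall>x. x \<notin> K \<longrightarrow> f x = 0" "compact L" "L \<subseteq> S" "\<forall>x. x \<notin> L \<longrightarrow> g x = 0"
    using assms unfolding Cc_infinity_iff by blast
  then show ?thesis using assms unfolding Cc_infinity_iff
    by (intro conjI smooth_linear_combination exI[of _ "K \<union> L"]) auto
qed

lemma dir_deriv_zero_outside:
  assumes "closed K" "\<forall>x. x \<notin> K \<longrightarrow> \<phi> x = 0" "x \<notin> K"
  shows "dir_deriv e \<phi> x = 0"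
proof -
  have "(\<phi> has_derivative (\<lambda>h. 0)) (at x)"
  proof (rule has_derivative_transform_within_open[of "\<lambda>_. 0"])
    show "open (- K)" using assms(1) by auto
  qed (use assms in auto)
  then show ?thesis by (simp add: has_derivative_dir_deriv)
qed

lemma Cc_infinity_dir_deriv:
  assumes "\<phi> \<in> Cc_infinity S" "e \<in> Basis" shows "dir_deriv e \<phi> \<in> Cc_infinity S"
proof -
  obtain K where K: "compact K" "K \<subseteq> S" "\<forall>x. x \<notin> K \<longrightarrow> \<phi> x = 0" using assms unfolding Cc_infinity_iff by blast
  have "smooth (dir_deriv e \<phi>)" using assms by (intro smooth_dir_deriv) (simp_all add: Cc_infinity_iff)
  moreover have "\<forall>x. x \<notin> K \<longrightarrow> dir_deriv e \<phi> x = 0"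
    using dir_deriv_zero_outside[OF compact_imp_closed[OF K(1)] K(3)] by blast
  ultimately show ?thesis using K unfolding Cc_infinity_iff by blast
qed

section \<open>Bump functions on boxes\<close>

text \<open>The powers of \<open>1 / t\<close> make this family closed under derivatives up to linear combinations.\<close>

definition flat :: "nat \<Rightarrow> real \<Rightarrow> real" where
  "flat k t = (if t > 0 then inverse t ^ k * exp (- inverse t) else 0)"

lemma flat_tendsto_0: "(flat k \<longlongrightarrow> 0) (at_right 0)"
proof -
  have "((\<lambda>y::real. y ^ k / exp y) \<longlongrightarrow> 0) at_top" by (rule tendsto_power_div_exp_0)
  then have "((\<lambda>t::real. inverse t ^ k / exp (inverse t)) \<longlongrightarrow> 0) (at_right 0)"
    using filterlim_compose[OF _ filterlim_inverse_at_top_right] by blast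
  moreover have "\<forall>\<^sub>F t::real in at_right 0. inverse t ^ k / exp (inverse t) = flat k t"
    unfolding eventually_at_right_field by (intro exI[of _ 1]) (auto simp: flat_def exp_minus field_simps)
  ultimately show ?thesis by (rule Lim_transform_eventually)
qed

lemma flat_has_derivative:
  "(flat k has_real_derivative (- real k * flat (Suc k) t + flat (Suc (Suc k)) t)) (at t)"
proof -
  consider "t > 0" | "t < 0" | "t = 0" by linarith
  then show ?thesis
  proof cases
    case 1
    have "((\<lambda>t. inverse t ^ k * exp (- inverse t)) has_real_derivative (- real k * flat (Suc k) t + flat (Suc (Suc k)) t)) (at t)"
      using 1 by (auto intro!: derivative_eq_intros simp: flat_def field_simps power2_eq_square)
        (cases k; simp add: field_simps)
    then show ?thesis
      by (rule has_field_derivative_transform_within_open[of _ _ _ "{0<..}"]) (use 1 in \<open>auto simp: flat_def\<close>)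
  next
    case 2
    have "((\<lambda>t. 0) has_real_derivative (- real k * flat (Suc k) t + flat (Suc (Suc k)) t)) (at t)"
      using 2 by (simp add: flat_def)
    then show ?thesis
      by (rule has_field_derivative_transform_within_open[of _ _ _ "{..<0}"]) (use 2 in \<open>auto simp: flat_def\<close>)
  next
    case 3
    have "((\<lambda>h. flat k h / h) \<longlongrightarrow> 0) (at_right 0)"
    proof (rule Lim_transform_eventually[OF flat_tendsto_0[of "Suc k"]])
      show "\<forall>\<^sub>F h in at_right 0. flat (Suc k) h = flat k h / h"
        unfolding eventually_at_right_field by (intro exI[of _ 1]) (auto simp: flat_def field_simps)
    qed
    moreover have "((\<lambda>h. flat k h / h) \<longlongrightarrow> 0) (at_left 0)"
    proof (rule Lim_transform_eventually[OF tendsto_const])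
      show "\<forall>\<^sub>F h in at_left 0. 0 = flat k h / h"
        unfolding eventually_at_left_field by (intro exI[of _ "-1"]) (auto simp: flat_def)
    qed
    ultimately have "((\<lambda>h. flat k h / h) \<longlongrightarrow> 0) (at 0)" by (simp add: filterlim_at_split)
    then show ?thesis using 3 unfolding has_field_derivative_iff by (simp add: flat_def)
  qed
qed

text \<open>A set of functions that is closed under directional derivatives consists of smooth functions. This one
  contains the bump functions below.\<close>

inductive_set flat_algebra :: "('a::euclidean_space \<Rightarrow> real) set" where
  base: "(\<lambda>x. flat k (x \<bullet> e + c)) \<in> flat_algebra"
| const: "(\<lambda>x. r) \<in> flat_algebra"
| add: "f \<in> flat_algebra \<Longrightarrow> g \<in> flat_algebra \<Longrightarrow> (\<lambda>x. f x + g x) \<in> flat_algebra"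
| mult: "f \<in> flat_algebra \<Longrightarrow> g \<in> flat_algebra \<Longrightarrow> (\<lambda>x. f x * g x) \<in> flat_algebra"

lemma flat_algebra_derivative:
  "f \<in> flat_algebra \<Longrightarrow> \<exists>D. (\<forall>x. (f has_derivative D x) (at x)) \<and> (\<forall>d. (\<lambda>x. D x d) \<in> flat_algebra)"
proof (induction rule: flat_algebra.induct)
  case (base k e c)
  define D where "D x h = (- real k * flat (Suc k) (x \<bullet> e + c) + flat (Suc (Suc k)) (x \<bullet> e + c)) * (h \<bullet> e)" for x h :: 'a
  have "((\<lambda>x. flat k (x \<bullet> e + c)) has_derivative D x) (at x)" for x
  proof -
    have 1: "((\<lambda>x. x \<bullet> e + c) has_derivative (\<lambda>h. h \<bullet> e)) (at x)" by (auto intro!: derivative_eq_intros)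
    have 2: "(flat k has_derivative (\<lambda>y. (- real k * flat (Suc k) (x \<bullet> e + c) + flat (Suc (Suc k)) (x \<bullet> e + c)) * y)) (at (x \<bullet> e + c))"
      using flat_has_derivative[of k "x \<bullet> e + c"] unfolding has_field_derivative_def .
    show ?thesis using has_derivative_compose[OF 1 2] unfolding D_def .
  qed
  moreover have "(\<lambda>x. D x d) \<in> flat_algebra" for d
    unfolding D_def by (intro flat_algebra.intros)
  ultimately show ?case by blast
next
  case (const r)
  have "((\<lambda>x. r) has_derivative (\<lambda>h. 0)) (at x)" for x :: 'a by simp
  then show ?case using flat_algebra.const by (intro exI[of _ "\<lambda>_ _. 0"]) auto
next
  case (add f g)
  then obtain F G where "\<And>x. (f has_derivative F x) (at x)" "\<And>d. (\<lambda>x. F x d) \<in> flat_algebra"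
    "\<And>x. (g has_derivative G x) (at x)" "\<And>d. (\<lambda>x. G x d) \<in> flat_algebra" by blast
  then show ?case by (intro exI[of _ "\<lambda>x h. F x h + G x h"])
      (auto intro!: derivative_intros flat_algebra.intros)
next
  case (mult f g)
  then obtain F G where "\<And>x. (f has_derivative F x) (at x)" "\<And>d. (\<lambda>x. F x d) \<in> flat_algebra"
    "\<And>x. (g has_derivative G x) (at x)" "\<And>d. (\<lambda>x. G x d) \<in> flat_algebra" by blast
  then show ?case using mult.hyps
    by (intro exI[of _ "\<lambda>x h. f x * G x h + F x h * g x"])
      (auto intro!: derivative_intros flat_algebra.intros)
qed

lemma flat_algebra_smooth: "f \<in> flat_algebra \<Longrightarrow> smooth f"
  by (rule smoothI[of f flat_algebra]) (use flat_algebra_derivative in blast)+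

text \<open>The factor \<open>n + 1\<close> makes the bumps converge to the indicator function of the open box.\<close>

definition box_bump :: "'a::euclidean_space \<Rightarrow> 'a \<Rightarrow> nat \<Rightarrow> 'a \<Rightarrow> real" where
  "box_bump a b n x = (\<Prod>i\<in>Basis. flat 0 (real (Suc n) * (x \<bullet> i - a \<bullet> i)) * flat 0 (real (Suc n) * (b \<bullet> i - x \<bullet> i)))"

lemma flat_algebra_prod: "finite I \<Longrightarrow> (\<And>i. i \<in> I \<Longrightarrow> f i \<in> flat_algebra) \<Longrightarrow> (\<lambda>x. \<Prod>i\<in>I. f i x) \<in> flat_algebra"
  by (induction I rule: finite_induct) (auto intro: flat_algebra.intros)

lemma box_bump_smooth: "smooth (box_bump a b n)"
proof (rule flat_algebra_smooth)
  have "(\<lambda>x. flat 0 (real (Suc n) * (x \<bullet> i - a \<bullet> i)) * flat 0 (real (Suc n) * (b \<bullet> i - x \<bullet> i))) \<in> flat_algebra" for i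
  proof (rule flat_algebra.mult)
    show "(\<lambda>x. flat 0 (real (Suc n) * (x \<bullet> i - a \<bullet> i))) \<in> flat_algebra"
      using flat_algebra.base[of 0 "real (Suc n) *\<^sub>R i" "- (real (Suc n) * (a \<bullet> i))"] by (simp add: algebra_simps)
    show "(\<lambda>x. flat 0 (real (Suc n) * (b \<bullet> i - x \<bullet> i))) \<in> flat_algebra"
      using flat_algebra.base[of 0 "- real (Suc n) *\<^sub>R i" "real (Suc n) * (b \<bullet> i)"] by (simp add: algebra_simps)
  qed
  then show "box_bump a b n \<in> flat_algebra" unfolding box_bump_def[abs_def] by (intro flat_algebra_prod) auto
qed

lemma flat_0_bounds: "0 \<le> flat 0 t" "flat 0 t \<le> 1" by (auto simp: flat_def)

lemma box_bump_bounds: "0 \<le> box_bump a b n x" "box_bump a b n x \<le> 1"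
  unfolding box_bump_def by (auto intro!: prod_nonneg prod_le_1 mult_nonneg_nonneg mult_le_one simp: flat_0_bounds)

lemma box_bump_outside: "x \<notin> box a b \<Longrightarrow> box_bump a b n x = 0"
proof -
  assume "x \<notin> box a b"
  then obtain i where i: "i \<in> Basis" "x \<bullet> i \<le> a \<bullet> i \<or> b \<bullet> i \<le> x \<bullet> i" by (auto simp: mem_box not_less)
  have z: "flat 0 s = 0" if "s \<le> 0" for s using that by (simp add: flat_def)
  have "real (Suc n) * (x \<bullet> i - a \<bullet> i) \<le> 0 \<or> real (Suc n) * (b \<bullet> i - x \<bullet> i) \<le> 0"
    using i(2) by (auto intro: mult_nonneg_nonpos)
  then have "flat 0 (real (Suc n) * (x \<bullet> i - a \<bullet> i)) * flat 0 (real (Suc n) * (b \<bullet> i - x \<bullet> i)) = 0" using z by auto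
  then show ?thesis unfolding box_bump_def using i(1) by (intro prod_zero) auto
qed

lemma box_bump_tendsto: "(\<lambda>n. box_bump a b n x) \<longlonglongrightarrow> indicator (box a b) x"
proof (cases "x \<in> box a b")
  case False
  then show ?thesis by (simp add: box_bump_outside)
next
  case True
  have lim: "(\<lambda>n. flat 0 (real (Suc n) * s)) \<longlonglongrightarrow> 1" if "s > 0" for s
  proof -
    have "(\<lambda>n. exp (- (inverse (real (Suc n)) * inverse s))) \<longlonglongrightarrow> exp (- (0 * inverse s))"
      by (intro tendsto_intros LIMSEQ_inverse_real_of_nat)
    then show ?thesis using that by (simp add: flat_def)
  qed
  have "(\<lambda>n. box_bump a b n x) \<longlonglongrightarrow> (\<Prod>i\<in>(Basis::'a set). 1 * 1)"
    unfolding box_bump_def by (intro tendsto_intros lim) (use True in \<open>auto simp: mem_box\<close>)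
  then show ?thesis using True by simp
qed

lemma box_bump_Cc_infinity: "cbox a b \<subseteq> S \<Longrightarrow> box_bump a b n \<in> Cc_infinity S"
  unfolding Cc_infinity_iff using box_bump_outside[of _ a b n] box_subset_cbox[of a b]
  by (intro conjI box_bump_smooth exI[of _ "cbox a b"]) auto

section \<open>The fundamental lemma of the calculus of variations\<close>

lemma loc_integrableD:
  "loc_integrable S h \<Longrightarrow> compact K \<Longrightarrow> K \<subseteq> S \<Longrightarrow> integrable lebesgue (\<lambda>x. indicator K x *\<^sub>R h x)"
  unfolding loc_integrable_def set_integrable_def by blast

lemma integrable_loc_times_compact_support:
  fixes h \<phi> :: "'a::euclidean_space \<Rightarrow> real"
  assumes h: "loc_integrable S h" and K: "compact K" "K \<subseteq> S" "\<And>x. x \<notin> K \<Longrightarrow> \<phi> x = 0"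
    and c: "continuous_on UNIV \<phi>"
  shows "integrable lebesgue (\<lambda>x. h x * \<phi> x)"
proof -
  have "compact (\<phi> ` K)" using K(1) c continuous_on_subset by (intro compact_continuous_image) auto
  then obtain B where B: "\<And>x. x \<in> K \<Longrightarrow> \<bar>\<phi> x\<bar> \<le> B" using compact_imp_bounded bounded_iff by (metis imageI real_norm_def)
  have i: "integrable lebesgue (\<lambda>x. indicator K x *\<^sub>R h x)"
    using h K unfolding loc_integrable_def set_integrable_def by blast
  have m: "\<phi> \<in> borel_measurable lebesgue"
    using borel_measurable_continuous_onI[OF c] by (simp add: measurable_completion)
  have eq: "(\<lambda>x. h x * \<phi> x) = (\<lambda>x. (indicator K x *\<^sub>R h x) * \<phi> x)" using K(3) by (auto simp: fun_eq_iff indicator_def)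
  show ?thesis
  proof (rule Bochner_Integration.integrable_bound)
    show "integrable lebesgue (\<lambda>x. B * (indicator K x *\<^sub>R h x))" using i by simp
    show "(\<lambda>x. h x * \<phi> x) \<in> borel_measurable lebesgue" unfolding eq using i m by (intro borel_measurable_times) auto
    show "AE x in lebesgue. norm (h x * \<phi> x) \<le> norm (B * (indicator K x *\<^sub>R h x))"
    proof (rule AE_I2)
      fix x show "norm (h x * \<phi> x) \<le> norm (B * (indicator K x *\<^sub>R h x))"
        using B[of x] K(3)[of x] by (cases "x \<in> K") (auto simp: abs_mult mult.commute intro!: mult_right_mono)
    qed
  qed
qed

lemma integral_lebesgue_on_support:
  fixes g :: "'a::euclidean_space \<Rightarrow> real"
  assumes "S \<in> sets lebesgue" "\<And>x. x \<notin> S \<Longrightarrow> g x = 0"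
  shows "(LINT x|lebesgue_on S. g x) = (LINT x|lebesgue. g x)"
proof -
  have "(\<lambda>x. indicator S x *\<^sub>R g x) = g" using assms(2) by (auto simp: indicator_def fun_eq_iff)
  then show ?thesis using assms(1) by (subst integral_restrict_space) auto
qed

text \<open>Bump functions converge boundedly to the indicator functions of the boxes whose closure lies in \<open>\<Omega>\<close>, and
  the rational ones among these boxes cover \<open>\<Omega>\<close> and are stable under intersection.\<close>

lemma AE_zero_if_orthogonal_to_test_functions:
  fixes h :: "'a::euclidean_space \<Rightarrow> real"
  assumes \<Omega>: "open \<Omega>" and h: "loc_integrable \<Omega> h"
    and 0: "\<And>\<phi>. \<phi> \<in> Cc_infinity \<Omega> \<Longrightarrow> (LINT x|lebesgue_on \<Omega>. h x * \<phi> x) = 0"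
  shows "AE x in lebesgue_on \<Omega>. h x = 0"
proof -
  have \<Omega>m: "\<Omega> \<in> sets lebesgue" using \<Omega> by auto
  define F where "F = {B \<in> rational_boxes. closure B \<subseteq> \<Omega>}"
  have box: "\<exists>a b. B = box a b" if "B \<in> rational_boxes" for B :: "'a set"
    using that by (auto simp: rational_boxes_def rational_box_def)
  have bi: "(LINT x|lebesgue. indicator B x * h x) = 0" if B: "B \<in> F" for B
  proof (cases "B = {}")
    case False
    from B have "\<exists>a b. B = box a b" by (intro box) (simp add: F_def)
    then obtain a b where ab: "B = box a b" by blast
    have cb: "cbox a b \<subseteq> \<Omega>" using ab B False closure_box[of a b] by (auto simp: F_def)
    have ii: "integrable lebesgue (\<lambda>x. indicator (cbox a b) x *\<^sub>R h x)"
      by (rule loc_integrableD[OF h compact_cbox cb])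
    have "(\<lambda>n. LINT x|lebesgue. h x * box_bump a b n x) \<longlonglongrightarrow> (LINT x|lebesgue. indicator B x * h x)"
    proof (rule integral_dominated_convergence[where w="\<lambda>x. norm (indicator (cbox a b) x *\<^sub>R h x)"])
      have "(\<lambda>x. indicator B x * h x) = (\<lambda>x. indicator B x *\<^sub>R (indicator (cbox a b) x *\<^sub>R h x))"
        using ab box_subset_cbox by (auto simp: indicator_def fun_eq_iff)
      then show "(\<lambda>x. indicator B x * h x) \<in> borel_measurable lebesgue"
        using integrable_mult_indicator[OF _ ii, of B] ab by auto
      show "(\<lambda>x. h x * box_bump a b n x) \<in> borel_measurable lebesgue" for n
        by (rule borel_measurable_integrable, rule integrable_loc_times_compact_support[OF h compact_cbox cb])
          (use box_bump_outside box_subset_cbox smooth_continuous[OF box_bump_smooth] in blast)+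
      show "integrable lebesgue (\<lambda>x. norm (indicator (cbox a b) x *\<^sub>R h x))" using ii by (rule integrable_norm)
      show "AE x in lebesgue. (\<lambda>n. h x * box_bump a b n x) \<longlonglongrightarrow> indicator B x * h x"
      proof (rule AE_I2)
        fix x
        have "(\<lambda>n. h x * box_bump a b n x) \<longlonglongrightarrow> h x * indicator (box a b) x"
          by (intro tendsto_mult tendsto_const box_bump_tendsto)
        then show "(\<lambda>n. h x * box_bump a b n x) \<longlonglongrightarrow> indicator B x * h x"
          by (simp only: ab mult.commute[of _ "h x"])
      qed
      show "AE x in lebesgue. norm (h x * box_bump a b n x) \<le> norm (indicator (cbox a b) x *\<^sub>R h x)" for n
      proof (rule AE_I2)
        fix x
        show "norm (h x * box_bump a b n x) \<le> norm (indicator (cbox a b) x *\<^sub>R h x)"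
        proof (cases "x \<in> cbox a b")
          case True
          have "\<bar>h x\<bar> * \<bar>box_bump a b n x\<bar> \<le> \<bar>h x\<bar> * 1"
            by (intro mult_left_mono) (use box_bump_bounds[of a b n x] in auto)
          then show ?thesis using True by (simp add: abs_mult)
        next
          case False
          then show ?thesis using box_bump_outside[of x a b n] box_subset_cbox[of a b] by auto
        qed
      qed
    qed
    moreover have "(LINT x|lebesgue. h x * box_bump a b n x) = 0" for n
    proof -
      have "(LINT x|lebesgue_on \<Omega>. h x * box_bump a b n x) = (LINT x|lebesgue. h x * box_bump a b n x)"
        by (rule integral_lebesgue_on_support[OF \<Omega>m]) (use box_bump_outside box_subset_cbox cb in fastforce)
      then show ?thesis using 0[OF box_bump_Cc_infinity[OF cb]] by simp
    qed
    ultimately have "(\<lambda>n::nat. 0) \<longlonglongrightarrow> (LINT x|lebesgue. indicator B x * h x)" by simp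
    then show ?thesis by (simp add: LIMSEQ_const_iff)
  qed simp
  have loc: "AE x in lebesgue. indicator B x * h x = 0" if B: "B \<in> F" for B
  proof (rule AE_zero_if_box_integrals_zero)
    from B have "\<exists>a b. B = box a b" by (intro box) (simp add: F_def)
    then obtain a b where ab: "B = box a b" by blast
    show "integrable lebesgue (\<lambda>x. indicator B x * h x)"
    proof (cases "B = {}")
      case False
      then have cb: "cbox a b \<subseteq> \<Omega>" using B ab closure_box[of a b] by (auto simp: F_def)
      have ii: "integrable lebesgue (\<lambda>x. indicator (cbox a b) x *\<^sub>R h x)"
        by (rule loc_integrableD[OF h compact_cbox cb])
      have "(\<lambda>x. indicator B x * h x) = (\<lambda>x. indicator B x *\<^sub>R (indicator (cbox a b) x *\<^sub>R h x))"
        using ab box_subset_cbox by (auto simp: indicator_def fun_eq_iff)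
      then show ?thesis using integrable_mult_indicator[OF _ ii, of B] ab by auto
    qed simp
    fix B' :: "'a set" assume "B' \<in> rational_boxes"
    then have "B' \<inter> B \<in> rational_boxes" using B Int_stable_rational_boxes by (auto simp: Int_stable_def F_def)
    moreover have "closure (B' \<inter> B) \<subseteq> \<Omega>" using B closure_mono[of "B' \<inter> B" B] by (auto simp: F_def)
    ultimately have "B' \<inter> B \<in> F" by (simp add: F_def)
    from bi[OF this] show "(LINT x|lebesgue. indicator B' x * (indicator B x * h x)) = 0"
      by (simp add: indicator_inter_arith mult.assoc)
  qed
  have "countable F" unfolding F_def by (rule countable_subset[OF _ countable_rational_boxes]) auto
  then have "AE x in lebesgue. \<forall>B\<in>F. indicator B x * h x = 0" using loc by (subst AE_ball_countable) auto
  then have "AE x in lebesgue. x \<in> \<Omega> \<longrightarrow> h x = 0"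
  proof eventually_elim
    fix x assume a: "\<forall>B\<in>F. indicator B x * h x = 0"
    show "x \<in> \<Omega> \<longrightarrow> h x = 0"
    proof
      assume "x \<in> \<Omega>"
      then obtain e where e: "e > 0" "cball x e \<subseteq> \<Omega>" using \<Omega> open_contains_cball by blast
      obtain B where B: "B \<in> rational_boxes" "B \<subseteq> ball x e" "x \<in> B"
      proof -
        have "x \<in> \<Union>{B \<in> rational_boxes. B \<subseteq> ball x e}"
          using open_is_Union_rational_boxes[OF open_ball, of x e] e by (metis centre_in_ball)
        then show ?thesis using that by blast
      qed
      have "closure B \<subseteq> cball x e" using closure_mono[OF B(2)] e by simp
      then have "B \<in> F" using B e by (auto simp: F_def)
      then show "h x = 0" using a B(3) by force
    qed
  qed
  then show ?thesis using \<Omega>m by (simp add: AE_restrict_space_iff)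
qed

section \<open>Weak gradients\<close>

type_synonym velocity = "real ^ 3 \<Rightarrow> real ^ 3"

lemma norm_powr_2 [simp]: "norm x powr 2 = (norm x)\<^sup>2"
  by (cases "x = 0") (auto simp: powr_numeral)

lemma Lp_space_2_iff: "u \<in> Lp_space 2 S \<longleftrightarrow> sq_int (lebesgue_on S) u"
  by (simp add: Lp_space_def sq_int_def)

lemma Lp_norm_2: "Lp_norm 2 S u = sqrt (LINT x|lebesgue_on S. (norm (u x))\<^sup>2)"
  by (simp add: Lp_norm_def powr_half_sqrt)

lemma Lp_norm_nonneg [simp]: "Lp_norm p S u \<ge> 0"
  by (simp add: Lp_norm_def)

lemma measurable_matrixI:
  fixes f :: "'a \<Rightarrow> real ^ 3 ^ 3"
  assumes "\<And>i j. (\<lambda>x. f x $ i $ j) \<in> borel_measurable M" shows "f \<in> borel_measurable M"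
proof (subst borel_measurable_euclidean_space, rule ballI)
  fix b :: "real ^ 3 ^ 3" assume "b \<in> Basis"
  then obtain i and u :: "real ^ 3" where b: "b = axis i u" "u \<in> Basis" unfolding Basis_vec_def by blast
  then obtain j and v :: real where u: "u = axis j v" "v \<in> Basis" unfolding Basis_vec_def by blast
  then have "b = axis i (axis j 1)" using b by simp
  then have "(\<lambda>x. f x \<bullet> b) = (\<lambda>x. f x $ i $ j)" by (simp add: inner_axis)
  then show "(\<lambda>x. f x \<bullet> b) \<in> borel_measurable M" using assms by simp
qed

lemma norm_matrix_square: "(norm (A :: real ^ 3 ^ 3))\<^sup>2 = (\<Sum>i\<in>UNIV. \<Sum>j\<in>UNIV. (A $ i $ j)\<^sup>2)"
  unfolding power2_norm_eq_inner by (simp add: inner_vec_def power2_eq_square)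

lemma sq_int_matrixI:
  fixes f :: "'a \<Rightarrow> real ^ 3 ^ 3"
  assumes "\<And>i j. sq_int M (\<lambda>x. f x $ i $ j)" shows "sq_int M f"
  unfolding sq_int_def
proof
  show "f \<in> borel_measurable M" using assms by (intro measurable_matrixI) (auto simp: sq_int_def)
  show "integrable M (\<lambda>x. (norm (f x))\<^sup>2)"
    unfolding norm_matrix_square using assms by (auto simp: sq_int_def)
qed

lemma sq_int_nth:
  fixes f :: "'a \<Rightarrow> ('b::euclidean_space) ^ 'n"
  shows "sq_int M f \<Longrightarrow> sq_int M (\<lambda>x. f x $ i)"
  by (rule sq_int_bounded_linear[OF bounded_linear_vec_nth])

lemma integrable_lebesgue_on:
  fixes f :: "'a::euclidean_space \<Rightarrow> 'b::{banach,second_countable_topology}"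
  assumes "S \<in> sets lebesgue" "integrable lebesgue f" shows "integrable (lebesgue_on S) f"
  using assms by (subst integrable_restrict_space) (auto intro: integrable_mult_indicator)

lemma sq_int_loc_integrable:
  assumes S: "S \<in> sets lebesgue" and h: "sq_int (lebesgue_on S) h"
  shows "loc_integrable S h"
  unfolding loc_integrable_def
proof (intro allI impI)
  fix K :: "'a set" assume K: "compact K \<and> K \<subseteq> S"
  then have Km: "K \<in> sets lebesgue" by (auto dest: compact_imp_closed)
  have "integrable lebesgue (indicator K :: 'a \<Rightarrow> real)"
    by (intro integrable_real_indicator)
      (use lmeasurable_compact[of K] K in \<open>auto simp: fmeasurable_def simp del: emeasure_completion\<close>)
  then have "integrable (lebesgue_on S) (indicator K :: 'a \<Rightarrow> real)" by (rule integrable_lebesgue_on[OF S])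
  moreover have "(\<lambda>x. (norm (indicator K x :: real))\<^sup>2) = (indicator K :: 'a \<Rightarrow> real)" by (auto simp: indicator_def)
  ultimately have "sq_int (lebesgue_on S) (indicator K :: 'a \<Rightarrow> real)" by (simp add: sq_int_def)
  from integrable_mult_sq_int[OF this h] have "integrable lebesgue (\<lambda>x. indicator S x *\<^sub>R (indicator K x * h x))"
    using S by (subst (asm) integrable_restrict_space) auto
  moreover have "(\<lambda>x. indicator S x *\<^sub>R (indicator K x * h x)) = (\<lambda>x. indicator K x *\<^sub>R h x)"
    using K by (auto simp: indicator_def fun_eq_iff)
  ultimately show "set_integrable lebesgue K h" by (simp add: set_integrable_def)
qed

lemma loc_integrable_linear_combination:
  assumes "loc_integrable S f" "loc_integrable S g"
  shows "loc_integrable S (\<lambda>x. a * f x + b * g x)"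
  using assms unfolding loc_integrable_def set_integrable_def
  by (auto simp: algebra_simps intro!: Bochner_Integration.integrable_add)

text \<open>By translation invariance the difference quotients of \<open>F\<close> have integral zero, and they converge
  boundedly to the derivative.\<close>

lemma integral_derivative_compact_support:
  fixes F :: "'a::euclidean_space \<Rightarrow> real"
  assumes D: "\<And>x. (F has_derivative D x) (at x)" and c: "continuous_on UNIV (\<lambda>x. D x e)"
    and K: "compact K" "\<And>x. x \<notin> K \<Longrightarrow> F x = 0"
  shows "(LINT x|lebesgue. D x e) = 0"
proof -
  have cF: "continuous_on UNIV F"
    using D has_derivative_continuous by (meson continuous_at_imp_continuous_on)
  have Dout: "D x e = 0" if "x \<notin> K" for x
  proof -
    have "(F has_derivative (\<lambda>h. 0)) (at x)"
    proof (rule has_derivative_transform_within_open[of "\<lambda>_. 0"])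
      show "open (- K)" using K(1) compact_imp_closed by auto
    qed (use K that in auto)
    then show ?thesis using has_derivative_unique[OF D[of x]] by metis
  qed
  have "compact ((\<lambda>x. D x e) ` K)" using K(1) c continuous_on_subset by (intro compact_continuous_image) auto
  then obtain M where M: "\<And>x. x \<in> K \<Longrightarrow> \<bar>D x e\<bar> \<le> M" using compact_imp_bounded bounded_iff by (metis imageI real_norm_def)
  define B where "B = max M 0"
  have B: "\<bar>D x e\<bar> \<le> B" for x using M[of x] Dout[of x] by (cases "x \<in> K") (auto simp: B_def)
  obtain r where r: "\<And>x. x \<in> K \<Longrightarrow> norm x \<le> r" using compact_imp_bounded[OF K(1)] bounded_iff by metis
  define K' where "K' = cball (0::'a) (\<bar>r\<bar> + norm e)"
  define q where "q n x = real (Suc n) * (F (x + (1 / real (Suc n)) *\<^sub>R e) - F x)" for n x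
  have g: "((\<lambda>s. F (x + s *\<^sub>R e)) has_real_derivative D (x + s *\<^sub>R e) e) (at s)" for x s
  proof -
    have 1: "((\<lambda>s. x + s *\<^sub>R e) has_derivative (\<lambda>h. h *\<^sub>R e)) (at s)" by (auto intro!: derivative_eq_intros)
    have "((\<lambda>s. F (x + s *\<^sub>R e)) has_derivative (\<lambda>h. D (x + s *\<^sub>R e) (h *\<^sub>R e))) (at s)"
      using has_derivative_compose[OF 1 D] .
    moreover have "D (x + s *\<^sub>R e) (h *\<^sub>R e) = D (x + s *\<^sub>R e) e * h" for h
      using linear_cmul[OF has_derivative_linear[OF D]] by (simp add: mult.commute)
    ultimately show ?thesis unfolding has_field_derivative_def by simp
  qed
  have bd: "\<bar>q n x\<bar> \<le> indicator K' x * B" for n x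
  proof -
    have pos: "0 < 1 / real (Suc n)" by simp
    from MVT2[OF pos g] obtain z where z: "0 < z" "z < 1 / real (Suc n)"
      "F (x + (1 / real (Suc n)) *\<^sub>R e) - F (x + 0 *\<^sub>R e) = (1 / real (Suc n) - 0) * D (x + z *\<^sub>R e) e"
      by metis
    then have q: "q n x = D (x + z *\<^sub>R e) e" by (simp add: q_def)
    show ?thesis
    proof (cases "x \<in> K'")
      case True then show ?thesis using B q by simp
    next
      case False
      have "1 / real (Suc n) \<le> 1" by simp
      then have "z \<le> 1" using z(2) by linarith
      then have "norm (z *\<^sub>R e) \<le> norm e" using z(1) by (simp add: mult_left_le_one_le)
      moreover have "norm x > \<bar>r\<bar> + norm e" using False by (simp add: K'_def)
      ultimately have "norm (x + z *\<^sub>R e) > \<bar>r\<bar>" using norm_triangle_ineq4[of "x + z *\<^sub>R e" "z *\<^sub>R e"] by simp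
      then have "x + z *\<^sub>R e \<notin> K" using r by fastforce
      then show ?thesis using Dout q False by simp
    qed
  qed
  have Fb: "F \<in> borel_measurable borel" by (rule borel_measurable_continuous_onI[OF cF])
  have Fm: "F \<in> borel_measurable lebesgue" using Fb by (simp add: measurable_completion)
  have cs: "continuous_on UNIV (\<lambda>x. F (x + c))" for c
    by (rule continuous_on_compose2[OF cF]) (auto intro!: continuous_intros)
  have FK: "integrable lebesgue (\<lambda>x. F (x + c))" for c
  proof -
    have "compact ((\<lambda>x. x - c) ` K)" using K(1) by (intro compact_continuous_image continuous_intros)
    then have "set_integrable lborel ((\<lambda>x. x - c) ` K) (\<lambda>x. F (x + c))"
      unfolding set_integrable_def by (intro borel_integrable_compact continuous_on_subset[OF cs]) auto
    moreover have "(\<lambda>x. indicator ((\<lambda>x. x - c) ` K) x *\<^sub>R F (x + c)) = (\<lambda>x. F (x + c))"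
    proof
      fix x show "indicator ((\<lambda>x. x - c) ` K) x *\<^sub>R F (x + c) = F (x + c)"
      proof (cases "x + c \<in> K")
        case True
        then have "x \<in> (\<lambda>x. x - c) ` K" by (intro image_eqI[of _ _ "x + c"]) auto
        then show ?thesis by simp
      qed (simp add: K(2))
    qed
    ultimately have "integrable lborel (\<lambda>x. F (x + c))" by (simp add: set_integrable_def)
    then show ?thesis using integrable_completion borel_measurable_integrable by blast
  qed
  have tr: "(LINT x|lebesgue. F (x + c)) = (LINT x|lebesgue. F x)" for c
  proof -
    have "(LINT x|lebesgue. F (x + c)) = (LINT x|lborel. F (x + c))"
      by (rule integral_completion) (use borel_measurable_continuous_onI[OF cs] in simp)
    also have "\<dots> = (LINT x|lborel. F (c + x))" by (simp add: add.commute)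
    also have "\<dots> = (LINT x|distr lborel borel ((+) c). F x)" by (rule integral_distr[symmetric]) (use Fb in auto)
    also have "\<dots> = (LINT x|lborel. F x)" by (simp add: lborel_distr_plus)
    also have "\<dots> = (LINT x|lebesgue. F x)" by (rule integral_completion[symmetric]) (use Fb in simp)
    finally show ?thesis .
  qed
  have q0: "(LINT x|lebesgue. q n x) = 0" for n
  proof -
    have "(LINT x|lebesgue. q n x) = real (Suc n) * ((LINT x|lebesgue. F (x + (1 / real (Suc n)) *\<^sub>R e)) - (LINT x|lebesgue. F x))"
      unfolding q_def using FK[of 0] FK[of "(1 / real (Suc n)) *\<^sub>R e"] by simp
    then show ?thesis using tr by simp
  qed
  have "(\<lambda>n. LINT x|lebesgue. q n x) \<longlonglongrightarrow> (LINT x|lebesgue. D x e)"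
  proof (rule integral_dominated_convergence[where w="\<lambda>x. indicator K' x * B"])
    show "(\<lambda>x. D x e) \<in> borel_measurable lebesgue"
      using borel_measurable_continuous_onI[OF c] by (simp add: measurable_completion)
    show "q n \<in> borel_measurable lebesgue" for n
      unfolding q_def using FK[of "(1 / real (Suc n)) *\<^sub>R e"] Fm by auto
    show "integrable lebesgue (\<lambda>x. indicator K' x * B)"
      using emeasure_compact_finite[of K'] by (auto simp: K'_def intro!: integrable_mult_left integrable_real_indicator)
    show "AE x in lebesgue. norm (q n x) \<le> indicator K' x * B" for n using bd by simp
    show "AE x in lebesgue. (\<lambda>n. q n x) \<longlonglongrightarrow> D x e"
    proof (rule AE_I2)
      fix x
      have "((\<lambda>s. F (x + s *\<^sub>R e)) has_real_derivative D x e) (at 0)" using g[of x 0] by simp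
      then have "((\<lambda>h. (F (x + h *\<^sub>R e) - F x) / h) \<longlongrightarrow> D x e) (at 0)" unfolding DERIV_def by simp
      moreover have "filterlim (\<lambda>n. inverse (real (Suc n))) (at 0) sequentially"
        unfolding filterlim_at using LIMSEQ_inverse_real_of_nat by auto
      ultimately have "(\<lambda>n. (F (x + inverse (real (Suc n)) *\<^sub>R e) - F x) / inverse (real (Suc n))) \<longlonglongrightarrow> D x e"
        by (rule filterlim_compose)
      then show "(\<lambda>n. q n x) \<longlonglongrightarrow> D x e" unfolding q_def by (simp add: inverse_eq_divide mult.commute)
    qed
  qed
  then show ?thesis unfolding q0 by (simp add: LIMSEQ_const_iff)
qed

definition has_weak_grad :: "(real ^ 3) set \<Rightarrow> velocity \<Rightarrow> (real ^ 3 \<Rightarrow> real ^ 3 ^ 3) \<Rightarrow> bool" where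
  "has_weak_grad \<Omega> u G \<longleftrightarrow> (\<forall>i j. has_weak_partial \<Omega> i (\<lambda>x. u x $ j) (\<lambda>x. G x $ i $ j))"

definition classical_grad :: "velocity \<Rightarrow> real ^ 3 \<Rightarrow> real ^ 3 ^ 3" where
  "classical_grad \<phi> x = (\<chi> i. dir_deriv (axis i 1) \<phi> x)"

lemma axis_Basis: "axis i (1::real) \<in> Basis" by (auto simp: Basis_vec_def)

locale domain =
  fixes \<Omega> :: "(real ^ 3) set"
  assumes open_\<Omega>: "open \<Omega>"
begin

abbreviation M\<Omega> :: "(real ^ 3) measure" where "M\<Omega> \<equiv> lebesgue_on \<Omega>"

lemma \<Omega>_sets: "\<Omega> \<in> sets lebesgue" using open_\<Omega> by auto

lemma integrable_loc_times_test:
  assumes "loc_integrable \<Omega> h" "\<phi> \<in> Cc_infinity \<Omega>"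
  shows "integrable M\<Omega> (\<lambda>x. h x * \<phi> x)"
proof -
  obtain K where "compact K" "K \<subseteq> \<Omega>" "\<forall>x. x \<notin> K \<longrightarrow> \<phi> x = 0" using assms unfolding Cc_infinity_iff by blast
  moreover have "continuous_on UNIV \<phi>" using assms(2) by (intro smooth_continuous) (simp add: Cc_infinity_iff)
  ultimately show ?thesis
    using integrable_loc_times_compact_support[OF assms(1)] by (intro integrable_lebesgue_on \<Omega>_sets) blast
qed

lemma has_weak_partial_linear_combination:
  assumes "has_weak_partial \<Omega> i g h" "has_weak_partial \<Omega> i g' h'"
  shows "has_weak_partial \<Omega> i (\<lambda>x. a * g x + b * g' x) (\<lambda>x. a * h x + b * h' x)"
  unfolding has_weak_partial_def
proof (intro conjI ballI)
  have l: "loc_integrable \<Omega> g" "loc_integrable \<Omega> g'" "loc_integrable \<Omega> h" "loc_integrable \<Omega> h'"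
    using assms by (auto simp: has_weak_partial_def)
  show "loc_integrable \<Omega> (\<lambda>x. a * g x + b * g' x)" "loc_integrable \<Omega> (\<lambda>x. a * h x + b * h' x)"
    using l by (auto intro: loc_integrable_linear_combination)
  fix \<phi> :: "real ^ 3 \<Rightarrow> real" assume \<phi>: "\<phi> \<in> Cc_infinity \<Omega>"
  then have d\<phi>: "dir_deriv (axis i 1) \<phi> \<in> Cc_infinity \<Omega>" by (rule Cc_infinity_dir_deriv) (rule axis_Basis)
  have lin: "(LINT x|M\<Omega>. (a * p x + b * q x) * \<eta> x) = a * (LINT x|M\<Omega>. p x * \<eta> x) + b * (LINT x|M\<Omega>. q x * \<eta> x)"
    if "loc_integrable \<Omega> p" "loc_integrable \<Omega> q" "\<eta> \<in> Cc_infinity \<Omega>" for p q \<eta>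
  proof -
    have "(LINT x|M\<Omega>. (a * p x + b * q x) * \<eta> x) = (LINT x|M\<Omega>. a * (p x * \<eta> x) + b * (q x * \<eta> x))"
      by (simp add: algebra_simps)
    also have "\<dots> = a * (LINT x|M\<Omega>. p x * \<eta> x) + b * (LINT x|M\<Omega>. q x * \<eta> x)"
      using integrable_loc_times_test[OF that(1,3)] integrable_loc_times_test[OF that(2,3)] by simp
    finally show ?thesis .
  qed
  show "(LINT x|M\<Omega>. (a * g x + b * g' x) * dir_deriv (axis i 1) \<phi> x) = - (LINT x|M\<Omega>. (a * h x + b * h' x) * \<phi> x)"
    using assms \<phi> lin[OF l(1,2) d\<phi>] lin[OF l(3,4) \<phi>] by (simp add: has_weak_partial_def)
qed

lemma has_weak_partial_unique:
  assumes "has_weak_partial \<Omega> i g h" "has_weak_partial \<Omega> i g h'"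
  shows "AE x in M\<Omega>. h x = h' x"
proof -
  have l: "loc_integrable \<Omega> h" "loc_integrable \<Omega> h'" using assms by (auto simp: has_weak_partial_def)
  have "AE x in M\<Omega>. 1 * h x + (-1) * h' x = 0"
  proof (rule AE_zero_if_orthogonal_to_test_functions[OF open_\<Omega> loc_integrable_linear_combination[OF l]])
    fix \<phi> :: "real ^ 3 \<Rightarrow> real" assume \<phi>: "\<phi> \<in> Cc_infinity \<Omega>"
    have "(LINT x|M\<Omega>. (1 * h x + (-1) * h' x) * \<phi> x) = (LINT x|M\<Omega>. h x * \<phi> x - h' x * \<phi> x)"
      by (simp add: algebra_simps)
    also have "\<dots> = (LINT x|M\<Omega>. h x * \<phi> x) - (LINT x|M\<Omega>. h' x * \<phi> x)"
      using integrable_loc_times_test[OF l(1) \<phi>] integrable_loc_times_test[OF l(2) \<phi>] by simp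
    also have "\<dots> = 0"
      using assms \<phi> unfolding has_weak_partial_def by (metis (no_types, lifting) diff_self neg_equal_iff_equal)
    finally show "(LINT x|M\<Omega>. (1 * h x + (-1) * h' x) * \<phi> x) = 0" .
  qed
  then show ?thesis by eventually_elim simp
qed

lemma weak_grad_eq:
  assumes "has_weak_grad \<Omega> u G" shows "AE x in M\<Omega>. weak_grad \<Omega> u x = G x"
proof -
  have "AE x in M\<Omega>. weak_partial \<Omega> i (\<lambda>y. u y $ j) x = G x $ i $ j" for i j
  proof (rule has_weak_partial_unique)
    show 1: "has_weak_partial \<Omega> i (\<lambda>y. u y $ j) (\<lambda>x. G x $ i $ j)" using assms by (simp add: has_weak_grad_def)
    show "has_weak_partial \<Omega> i (\<lambda>y. u y $ j) (weak_partial \<Omega> i (\<lambda>y. u y $ j))"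
      unfolding weak_partial_def using 1 someI_ex[of "has_weak_partial \<Omega> i (\<lambda>y. u y $ j)"] by blast
  qed
  then have "AE x in M\<Omega>. \<forall>i\<in>UNIV. \<forall>j\<in>UNIV. weak_partial \<Omega> i (\<lambda>y. u y $ j) x = G x $ i $ j"
    by (intro AE_finite_allI) auto
  then show ?thesis by eventually_elim (simp add: weak_grad_def vec_eq_iff)
qed

lemma has_weak_grad_linear_combination:
  assumes "has_weak_grad \<Omega> u G" "has_weak_grad \<Omega> w H"
  shows "has_weak_grad \<Omega> (\<lambda>x. a *\<^sub>R u x + b *\<^sub>R w x) (\<lambda>x. a *\<^sub>R G x + b *\<^sub>R H x)"
  using assms has_weak_partial_linear_combination unfolding has_weak_grad_def by simp

lemma H1_space_iff:
  "u \<in> H1_space \<Omega> \<longleftrightarrow> sq_int M\<Omega> u \<and> (\<exists>G. sq_int M\<Omega> G \<and> has_weak_grad \<Omega> u G)"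
proof
  assume u: "u \<in> H1_space \<Omega>"
  then have "\<forall>i j. \<exists>h. sq_int M\<Omega> h \<and> has_weak_partial \<Omega> i (\<lambda>x. u x $ j) h"
    by (simp add: H1_space_def Lp_space_2_iff Bex_def)
  then obtain h where h: "\<And>i j. sq_int M\<Omega> (h i j)" "\<And>i j. has_weak_partial \<Omega> i (\<lambda>x. u x $ j) (h i j)" by metis
  define G :: "real ^ 3 \<Rightarrow> real ^ 3 ^ 3" where "G x = (\<chi> i j. h i j x)" for x
  have "sq_int M\<Omega> G" by (rule sq_int_matrixI) (simp add: G_def h)
  moreover have "has_weak_grad \<Omega> u G" by (simp add: has_weak_grad_def G_def h)
  ultimately show "sq_int M\<Omega> u \<and> (\<exists>G. sq_int M\<Omega> G \<and> has_weak_grad \<Omega> u G)"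
    using u by (auto simp: H1_space_def Lp_space_2_iff)
next
  assume "sq_int M\<Omega> u \<and> (\<exists>G. sq_int M\<Omega> G \<and> has_weak_grad \<Omega> u G)"
  then obtain G where G: "sq_int M\<Omega> u" "sq_int M\<Omega> G" "has_weak_grad \<Omega> u G" by blast
  have "\<exists>h\<in>Lp_space 2 \<Omega>. has_weak_partial \<Omega> i (\<lambda>x. u x $ j) h" for i j
    using G(3) sq_int_nth[OF sq_int_nth[OF G(2)]] unfolding has_weak_grad_def
    by (intro bexI[of _ "\<lambda>x. G x $ i $ j"]) (auto simp: Lp_space_2_iff)
  then show "u \<in> H1_space \<Omega>" using G(1) by (auto simp: H1_space_def Lp_space_2_iff)
qed

lemma classical_grad_component:
  assumes "\<phi> \<in> Cc_infinity S"
  shows "((\<lambda>y. \<phi> y $ j) has_derivative (\<lambda>h. frechet_derivative \<phi> (at x) h $ j)) (at x)"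
    "classical_grad \<phi> x $ i $ j = frechet_derivative \<phi> (at x) (axis i 1) $ j"
    "continuous_on UNIV (\<lambda>x. classical_grad \<phi> x $ i $ j)"
    "continuous_on UNIV (\<lambda>x. \<phi> x $ j)"
proof -
  have s: "smooth \<phi>" using assms by (simp add: Cc_infinity_iff)
  have "(\<phi> has_derivative frechet_derivative \<phi> (at x)) (at x)"
    using smooth_differentiable[OF s] frechet_derivative_works by blast
  then show "((\<lambda>y. \<phi> y $ j) has_derivative (\<lambda>h. frechet_derivative \<phi> (at x) h $ j)) (at x)"
    by (rule bounded_linear.has_derivative[OF bounded_linear_vec_nth])
  show "classical_grad \<phi> x $ i $ j = frechet_derivative \<phi> (at x) (axis i 1) $ j"
    by (simp add: classical_grad_def dir_deriv_def)
  have "continuous_on UNIV (dir_deriv (axis i 1) \<phi>)"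
    by (intro smooth_continuous smooth_dir_deriv s axis_Basis)
  then show "continuous_on UNIV (\<lambda>x. classical_grad \<phi> x $ i $ j)"
    unfolding classical_grad_def by (simp add: continuous_on_component)
  show "continuous_on UNIV (\<lambda>x. \<phi> x $ j)"
    using smooth_continuous[OF s] by (simp add: continuous_on_component)
qed

lemma sq_int_continuous_compact_support:
  fixes f :: "real ^ 3 \<Rightarrow> 'b::euclidean_space"
  assumes c: "continuous_on UNIV f" and K: "compact K" "\<And>x. x \<notin> K \<Longrightarrow> f x = 0"
  shows "sq_int M\<Omega> f"
proof -
  have m: "f \<in> borel_measurable lebesgue"
    using borel_measurable_continuous_onI[OF c] by (simp add: measurable_completion)
  have "integrable lborel (\<lambda>x. indicator K x *\<^sub>R (norm (f x))\<^sup>2)"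
    using c continuous_on_subset by (intro borel_integrable_compact K continuous_intros) auto
  moreover have "(\<lambda>x. indicator K x *\<^sub>R (norm (f x))\<^sup>2) = (\<lambda>x. (norm (f x))\<^sup>2)"
    using K(2) by (auto simp: indicator_def fun_eq_iff)
  ultimately have "integrable lebesgue (\<lambda>x. (norm (f x))\<^sup>2)"
    using integrable_completion borel_measurable_integrable by metis
  then show ?thesis unfolding sq_int_def
    using integrable_lebesgue_on[OF \<Omega>_sets] measurable_restrict_space1[OF m] by blast
qed

lemma test_function_grad:
  assumes \<phi>: "\<phi> \<in> Cc_infinity \<Omega>"
  shows "sq_int M\<Omega> \<phi>" "sq_int M\<Omega> (classical_grad \<phi>)" "has_weak_grad \<Omega> \<phi> (classical_grad \<phi>)"
proof -
  obtain K where K: "compact K" "K \<subseteq> \<Omega>" "\<forall>x. x \<notin> K \<longrightarrow> \<phi> x = 0" using \<phi> unfolding Cc_infinity_iff by blast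
  have s: "smooth \<phi>" using \<phi> by (simp add: Cc_infinity_iff)
  show s1: "sq_int M\<Omega> \<phi>" by (rule sq_int_continuous_compact_support[OF smooth_continuous[OF s] K(1)]) (use K in auto)
  have out: "classical_grad \<phi> x = 0" if "x \<notin> K" for x
    using dir_deriv_zero_outside[OF compact_imp_closed[OF K(1)] K(3) that] by (simp add: classical_grad_def vec_eq_iff)
  show s2: "sq_int M\<Omega> (classical_grad \<phi>)"
    by (intro sq_int_matrixI sq_int_continuous_compact_support[OF _ K(1)] classical_grad_component(3)[OF \<phi>]) (simp add: out)
  show "has_weak_grad \<Omega> \<phi> (classical_grad \<phi>)"
    unfolding has_weak_grad_def has_weak_partial_def
  proof (intro allI conjI ballI)
    fix i j
    show "loc_integrable \<Omega> (\<lambda>x. \<phi> x $ j)" "loc_integrable \<Omega> (\<lambda>x. classical_grad \<phi> x $ i $ j)"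
      using s1 s2 by (auto intro!: sq_int_loc_integrable \<Omega>_sets sq_int_nth)
    fix \<eta> :: "real ^ 3 \<Rightarrow> real" assume \<eta>: "\<eta> \<in> Cc_infinity \<Omega>"
    then have s\<eta>: "smooth \<eta>" by (simp add: Cc_infinity_iff)
    have d\<eta>: "dir_deriv (axis i 1) \<eta> \<in> Cc_infinity \<Omega>" using \<eta> by (rule Cc_infinity_dir_deriv) (rule axis_Basis)
    have D\<eta>: "(\<eta> has_derivative frechet_derivative \<eta> (at x)) (at x)" for x
      using smooth_differentiable[OF s\<eta>] frechet_derivative_works by blast
    define D where "D x h = \<phi> x $ j * frechet_derivative \<eta> (at x) h + frechet_derivative \<phi> (at x) h $ j * \<eta> x" for x h
    have De: "D x (axis i 1) = \<phi> x $ j * dir_deriv (axis i 1) \<eta> x + classical_grad \<phi> x $ i $ j * \<eta> x" for x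
      by (simp add: D_def dir_deriv_def classical_grad_component(2)[OF \<phi>])
    have "(LINT x|lebesgue. D x (axis i 1)) = 0"
    proof (rule integral_derivative_compact_support[of "\<lambda>x. \<phi> x $ j * \<eta> x" D _ K])
      show "((\<lambda>x. \<phi> x $ j * \<eta> x) has_derivative D x) (at x)" for x
        unfolding D_def by (rule has_derivative_mult[OF classical_grad_component(1)[OF \<phi>] D\<eta>])
      show "continuous_on UNIV (\<lambda>x. D x (axis i 1))" unfolding De
        by (intro continuous_intros classical_grad_component(3,4)[OF \<phi>] smooth_continuous[OF s\<eta>]
            smooth_continuous[OF smooth_dir_deriv[OF s\<eta> axis_Basis]])
    qed (use K in auto)
    moreover have "(LINT x|M\<Omega>. D x (axis i 1)) = (LINT x|lebesgue. D x (axis i 1))"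
    proof (rule integral_lebesgue_on_support[OF \<Omega>_sets])
      fix x assume "x \<notin> \<Omega>"
      then have "x \<notin> K" using K by blast
      then show "D x (axis i 1) = 0" using K(3) out by (simp add: De)
    qed
    ultimately have 0: "(LINT x|M\<Omega>. \<phi> x $ j * dir_deriv (axis i 1) \<eta> x + classical_grad \<phi> x $ i $ j * \<eta> x) = 0"
      unfolding De by simp
    have "integrable M\<Omega> (\<lambda>x. \<phi> x $ j * dir_deriv (axis i 1) \<eta> x)" "integrable M\<Omega> (\<lambda>x. classical_grad \<phi> x $ i $ j * \<eta> x)"
      using s1 s2 d\<eta> \<eta> by (auto intro!: integrable_loc_times_test sq_int_loc_integrable \<Omega>_sets sq_int_nth)
    with 0 show "(LINT x|M\<Omega>. \<phi> x $ j * dir_deriv (axis i 1) \<eta> x) = - (LINT x|M\<Omega>. classical_grad \<phi> x $ i $ j * \<eta> x)"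
      by (simp add: eq_neg_iff_add_eq_0)
  qed
qed

lemma tendsto_nth_square_integral:
  fixes f :: "nat \<Rightarrow> 'a \<Rightarrow> ('b::euclidean_space) ^ 'n"
  assumes "\<And>n. sq_int M (f n)" "sq_int M g" "(\<lambda>n. LINT x|M. (norm (f n x - g x))\<^sup>2) \<longlonglongrightarrow> 0"
  shows "(\<lambda>n. LINT x|M. (norm (f n x $ j - g x $ j))\<^sup>2) \<longlonglongrightarrow> 0"
proof (rule Lim_null_comparison[OF always_eventually assms(3)], rule allI)
  fix n
  have d: "sq_int M (\<lambda>x. f n x - g x)" using assms by (auto intro: sq_int_diff)
  have "(LINT x|M. (norm (f n x $ j - g x $ j))\<^sup>2) \<le> (LINT x|M. (norm (f n x - g x))\<^sup>2)"
  proof (rule integral_mono)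
    show "integrable M (\<lambda>x. (norm (f n x $ j - g x $ j))\<^sup>2)" using sq_int_norm2[OF sq_int_nth[OF d, of j]] by simp
    show "(norm (f n x $ j - g x $ j))\<^sup>2 \<le> (norm (f n x - g x))\<^sup>2" for x
      using power_mono[OF Finite_Cartesian_Product.norm_nth_le[where x="f n x - g x" and i=j], of 2] by simp
  qed (rule sq_int_norm2[OF d])
  then show "norm (LINT x|M. (norm (f n x $ j - g x $ j))\<^sup>2) \<le> (LINT x|M. (norm (f n x - g x))\<^sup>2)" by simp
qed

text \<open>Both sides of the equation that defines weak derivatives are continuous with respect to convergence in
  mean square.\<close>

lemma has_weak_grad_closed:
  assumes w: "\<And>n. has_weak_grad \<Omega> (u n) (G n)"
    and s: "\<And>n. sq_int M\<Omega> (u n)" "\<And>n. sq_int M\<Omega> (G n)" "sq_int M\<Omega> u'" "sq_int M\<Omega> G'"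
    and l: "(\<lambda>n. LINT x|M\<Omega>. (norm (u n x - u' x))\<^sup>2) \<longlonglongrightarrow> 0" "(\<lambda>n. LINT x|M\<Omega>. (norm (G n x - G' x))\<^sup>2) \<longlonglongrightarrow> 0"
  shows "has_weak_grad \<Omega> u' G'"
  unfolding has_weak_grad_def has_weak_partial_def
proof (intro allI conjI ballI)
  fix i j
  show "loc_integrable \<Omega> (\<lambda>x. u' x $ j)" "loc_integrable \<Omega> (\<lambda>x. G' x $ i $ j)"
    using s by (auto intro!: sq_int_loc_integrable \<Omega>_sets sq_int_nth)
  fix \<eta> :: "real ^ 3 \<Rightarrow> real" assume \<eta>: "\<eta> \<in> Cc_infinity \<Omega>"
  have d\<eta>: "dir_deriv (axis i 1) \<eta> \<in> Cc_infinity \<Omega>" using \<eta> by (rule Cc_infinity_dir_deriv) (rule axis_Basis)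
  have sq: "sq_int M\<Omega> \<theta>" if "\<theta> \<in> Cc_infinity \<Omega>" for \<theta> :: "real ^ 3 \<Rightarrow> real"
    using that smooth_continuous sq_int_continuous_compact_support unfolding Cc_infinity_iff by blast
  have 1: "(\<lambda>n. LINT x|M\<Omega>. u n x $ j \<bullet> dir_deriv (axis i 1) \<eta> x) \<longlonglongrightarrow> (LINT x|M\<Omega>. u' x $ j \<bullet> dir_deriv (axis i 1) \<eta> x)"
    by (rule tendsto_integral_inner[OF sq_int_nth[OF s(1)] sq_int_nth[OF s(3)] sq[OF d\<eta>] sq[OF d\<eta>]
        tendsto_nth_square_integral[OF s(1,3) l(1)]]) simp
  have 2: "(\<lambda>n. LINT x|M\<Omega>. G n x $ i $ j \<bullet> \<eta> x) \<longlonglongrightarrow> (LINT x|M\<Omega>. G' x $ i $ j \<bullet> \<eta> x)"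
    by (rule tendsto_integral_inner[OF sq_int_nth[OF sq_int_nth[OF s(2)]] sq_int_nth[OF sq_int_nth[OF s(4)]] sq[OF \<eta>] sq[OF \<eta>]
        tendsto_nth_square_integral[OF sq_int_nth[OF s(2)] sq_int_nth[OF s(4)] tendsto_nth_square_integral[OF s(2,4) l(2)]]]) simp
  have "(LINT x|M\<Omega>. u n x $ j \<bullet> dir_deriv (axis i 1) \<eta> x) = - (LINT x|M\<Omega>. G n x $ i $ j \<bullet> \<eta> x)" for n
    using w[of n] \<eta> by (simp add: has_weak_grad_def has_weak_partial_def)
  then have "(\<lambda>n. LINT x|M\<Omega>. u n x $ j \<bullet> dir_deriv (axis i 1) \<eta> x) \<longlonglongrightarrow> - (LINT x|M\<Omega>. G' x $ i $ j \<bullet> \<eta> x)"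
    using tendsto_minus[OF 2] by simp
  from LIMSEQ_unique[OF 1 this]
  show "(LINT x|M\<Omega>. u' x $ j * dir_deriv (axis i 1) \<eta> x) = - (LINT x|M\<Omega>. G' x $ i $ j * \<eta> x)" by simp
qed

end

section \<open>Ladyzhenskaya's inequality\<close>

text \<open>The fundamental theorem of calculus for \<open>\<bar>g\<bar>\<^sup>2\<close>, starting from a point to the left of the support.\<close>

lemma norm_square_le_nn_integral:
  fixes g :: "real \<Rightarrow> 'a::euclidean_space"
  assumes g: "\<And>t. (g has_vector_derivative g' t) (at t)" and c: "continuous_on UNIV g'"
    and z: "\<And>t. \<bar>t\<bar> > r \<Longrightarrow> g t = 0"
  shows "(ennreal (norm (g t)))\<^sup>2 \<le> (\<integral>\<^sup>+s. ennreal (norm (g s)) * ennreal (2 * norm (g' s)) \<partial>lborel)"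
proof -
  define a where "a = min t (- \<bar>r\<bar> - 1)"
  have a: "a \<le> t" "g a = 0" unfolding a_def by (auto intro!: z simp: min_def)
  have cg: "continuous_on UNIV g"
    using g by (meson continuous_at_imp_continuous_on has_vector_derivative_continuous)
  define h where "h s = 2 * (g s \<bullet> g' s)" for s
  have ch: "continuous_on A h" for A
    unfolding h_def using c cg continuous_on_subset by (intro continuous_intros) auto
  have d: "((\<lambda>s. g s \<bullet> g s) has_vector_derivative h s) (at s within {a..t})" for s
  proof -
    have "((\<lambda>s. g s \<bullet> g s) has_derivative (\<lambda>x. g s \<bullet> (x *\<^sub>R g' s) + (x *\<^sub>R g' s) \<bullet> g s)) (at s)"
      using g[of s] unfolding has_vector_derivative_def by (intro has_derivative_inner)
    moreover have "(\<lambda>x. g s \<bullet> (x *\<^sub>R g' s) + (x *\<^sub>R g' s) \<bullet> g s) = (\<lambda>x. x *\<^sub>R h s)"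
      by (auto simp: h_def inner_commute algebra_simps)
    ultimately show ?thesis unfolding has_vector_derivative_def using has_derivative_at_withinI by metis
  qed
  have "(h has_integral (g t \<bullet> g t - g a \<bullet> g a)) {a..t}"
    by (rule fundamental_theorem_of_calculus[OF a(1) d])
  then have "(norm (g t))\<^sup>2 = integral {a..t} h" using a by (simp add: integral_unique power2_norm_eq_inner)
  also have "\<dots> \<le> integral {a..t} (\<lambda>s. \<bar>h s\<bar>)"
    by (rule integral_le) (auto intro!: integrable_continuous_interval continuous_intros ch)
  finally have le: "(norm (g t))\<^sup>2 \<le> integral {a..t} (\<lambda>s. \<bar>h s\<bar>)" .
  have "(\<lambda>s. \<bar>h s\<bar>) \<in> borel_measurable borel"
    by (intro borel_measurable_continuous_onI continuous_intros ch)
  then have hm: "(\<lambda>s. indicator {a..t} s * \<bar>h s\<bar>) \<in> borel_measurable borel" by measurable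
  have "((\<lambda>s. \<bar>h s\<bar>) has_integral integral {a..t} (\<lambda>s. \<bar>h s\<bar>)) {a..t}"
    by (intro integrable_integral integrable_continuous_interval continuous_intros ch)
  then have "((\<lambda>s. if s \<in> {a..t} then \<bar>h s\<bar> else 0) has_integral integral {a..t} (\<lambda>s. \<bar>h s\<bar>)) UNIV"
    by (subst has_integral_restrict_UNIV)
  moreover have "(\<lambda>s. if s \<in> {a..t} then \<bar>h s\<bar> else 0) = (\<lambda>s. indicator {a..t} s * \<bar>h s\<bar>)"
    by (auto simp: indicator_def fun_eq_iff)
  ultimately have hi: "((\<lambda>s. indicator {a..t} s * \<bar>h s\<bar>) has_integral integral {a..t} (\<lambda>s. \<bar>h s\<bar>)) UNIV" by simp
  have "(ennreal (norm (g t)))\<^sup>2 = ennreal ((norm (g t))\<^sup>2)" by (simp add: ennreal_power)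
  also have "\<dots> \<le> ennreal (integral {a..t} (\<lambda>s. \<bar>h s\<bar>))" by (rule ennreal_leI[OF le])
  also have "\<dots> = (\<integral>\<^sup>+s. indicator {a..t} s * \<bar>h s\<bar> \<partial>lborel)"
    using nn_integral_has_integral_lborel[OF hm _ hi] by simp
  also have "\<dots> \<le> (\<integral>\<^sup>+s. ennreal (norm (g s)) * ennreal (2 * norm (g' s)) \<partial>lborel)"
  proof (rule nn_integral_mono)
    fix s
    have "\<bar>h s\<bar> \<le> norm (g s) * (2 * norm (g' s))"
      using Cauchy_Schwarz_ineq2[of "g s" "g' s"] by (simp add: h_def abs_mult)
    then have "ennreal (indicator {a..t} s * \<bar>h s\<bar>) \<le> ennreal (norm (g s) * (2 * norm (g' s)))"
      by (intro ennreal_leI) (auto simp: indicator_def)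
    then show "ennreal (indicator {a..t} s * \<bar>h s\<bar>) \<le> ennreal (norm (g s)) * ennreal (2 * norm (g' s))"
      by (simp add: ennreal_mult)
  qed
  finally show ?thesis .
qed

text \<open>On each plane \<open>z = const\<close> the first two assumptions bound \<open>F\<^sup>4 = F\<^sup>2 F\<^sup>2\<close> by a product of two functions
  of one variable each, both with integral \<open>\<integral> F D\<close> over the plane. The Cauchy--Schwarz inequality in
  the plane leaves the factor \<open>\<integral> F\<^sup>2\<close>, which the third assumption bounds by \<open>S\<close>.\<close>

lemma nn_integral_power4_bound:
  fixes F D :: "real \<times> real \<times> real \<Rightarrow> ennreal"
  assumes F [measurable]: "F \<in> borel_measurable borel" and D [measurable]: "D \<in> borel_measurable borel"
    and 1: "\<And>z x y. (F (z, x, y))\<^sup>2 \<le> (\<integral>\<^sup>+s. F (z, s, y) * D (z, s, y) \<partial>lborel)"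
    and 2: "\<And>z x y. (F (z, x, y))\<^sup>2 \<le> (\<integral>\<^sup>+s. F (z, x, s) * D (z, x, s) \<partial>lborel)"
    and 3: "\<And>z x y. (F (z, x, y))\<^sup>2 \<le> (\<integral>\<^sup>+s. F (s, x, y) * D (s, x, y) \<partial>lborel)"
  defines "S \<equiv> (\<integral>\<^sup>+p. F p * D p \<partial>lborel)"
  shows "(\<integral>\<^sup>+p. F p ^ 4 \<partial>lborel) \<le> S * (\<integral>\<^sup>+p. (D p)\<^sup>2 \<partial>lborel)"
    and "S\<^sup>2 \<le> (\<integral>\<^sup>+p. (F p)\<^sup>2 \<partial>lborel) * (\<integral>\<^sup>+p. (D p)\<^sup>2 \<partial>lborel)"
proof -
  show "S\<^sup>2 \<le> (\<integral>\<^sup>+p. (F p)\<^sup>2 \<partial>lborel) * (\<integral>\<^sup>+p. (D p)\<^sup>2 \<partial>lborel)"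
    unfolding S_def by (rule Cauchy_Schwarz_nn_integral) measurable
  have Fm: "(\<lambda>p. F (z, p)) \<in> borel_measurable borel" "(\<lambda>p. D (z, p)) \<in> borel_measurable borel" for z
    by (rule measurable_compose[OF _ F] measurable_compose[OF _ D];
        simp add: borel_measurable_continuous_onI continuous_intros)+
  note [measurable] = Fm
  have fub3: "(\<integral>\<^sup>+p. H p \<partial>lborel) = (\<integral>\<^sup>+z. \<integral>\<^sup>+q. H (z, q) \<partial>lborel \<partial>lborel)"
    and fub3': "(\<integral>\<^sup>+p. H p \<partial>lborel) = (\<integral>\<^sup>+q. \<integral>\<^sup>+z. H (z, q) \<partial>lborel \<partial>lborel)"
    and meas3: "(\<lambda>z. \<integral>\<^sup>+q. H (z, q) \<partial>lborel) \<in> borel_measurable borel"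
    if "H \<in> borel_measurable borel" for H :: "real \<times> real \<times> real \<Rightarrow> ennreal"
  proof -
    have m: "H \<in> borel_measurable (lborel \<Otimes>\<^sub>M (lborel :: (real \<times> real) measure))" using that by (simp add: lborel_prod)
    show "(\<integral>\<^sup>+p. H p \<partial>lborel) = (\<integral>\<^sup>+z. \<integral>\<^sup>+q. H (z, q) \<partial>lborel \<partial>lborel)"
      using lborel.nn_integral_fst[OF m] by (simp add: lborel_prod)
    show "(\<integral>\<^sup>+p. H p \<partial>lborel) = (\<integral>\<^sup>+q. \<integral>\<^sup>+z. H (z, q) \<partial>lborel \<partial>lborel)"
      using lborel_pair.nn_integral_snd[OF m] by (simp add: lborel_prod)
    show "(\<lambda>z. \<integral>\<^sup>+q. H (z, q) \<partial>lborel) \<in> borel_measurable borel"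
      using lborel.borel_measurable_nn_integral_fst[OF m] by simp
  qed
  have fub2: "(\<integral>\<^sup>+p. H p \<partial>lborel) = (\<integral>\<^sup>+x. \<integral>\<^sup>+y. H (x, y) \<partial>lborel \<partial>lborel)"
    and fub2': "(\<integral>\<^sup>+p. H p \<partial>lborel) = (\<integral>\<^sup>+y. \<integral>\<^sup>+x. H (x, y) \<partial>lborel \<partial>lborel)"
    and meas2: "(\<lambda>x. \<integral>\<^sup>+y. H (x, y) \<partial>lborel) \<in> borel_measurable borel" "(\<lambda>y. \<integral>\<^sup>+x. H (x, y) \<partial>lborel) \<in> borel_measurable borel"
    if "H \<in> borel_measurable borel" for H :: "real \<times> real \<Rightarrow> ennreal"
  proof -
    have m: "H \<in> borel_measurable (lborel \<Otimes>\<^sub>M (lborel :: real measure))" using that by (simp add: lborel_prod)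
    show "(\<integral>\<^sup>+p. H p \<partial>lborel) = (\<integral>\<^sup>+x. \<integral>\<^sup>+y. H (x, y) \<partial>lborel \<partial>lborel)"
      using lborel.nn_integral_fst[OF m] by (simp add: lborel_prod)
    show "(\<integral>\<^sup>+p. H p \<partial>lborel) = (\<integral>\<^sup>+y. \<integral>\<^sup>+x. H (x, y) \<partial>lborel \<partial>lborel)"
      using lborel_pair.nn_integral_snd[OF m] by (simp add: lborel_prod)
    show "(\<lambda>x. \<integral>\<^sup>+y. H (x, y) \<partial>lborel) \<in> borel_measurable borel"
      using lborel.borel_measurable_nn_integral_fst[OF m] by simp
    have "(\<lambda>p. H (snd p, fst p)) \<in> borel_measurable (borel :: (real \<times> real) measure)"
      by (rule measurable_compose[OF _ that]) (intro borel_measurable_continuous_onI continuous_intros)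
    then have "(\<lambda>p. H (snd p, fst p)) \<in> borel_measurable (lborel \<Otimes>\<^sub>M (lborel :: real measure))" by (simp add: lborel_prod)
    from lborel.borel_measurable_nn_integral_fst[OF this]
    show "(\<lambda>y. \<integral>\<^sup>+x. H (x, y) \<partial>lborel) \<in> borel_measurable borel" by simp
  qed
  define a where "a z = (\<integral>\<^sup>+q. F (z, q) * D (z, q) \<partial>lborel)" for z
  define g where "g z = (\<integral>\<^sup>+q. (D (z, q))\<^sup>2 \<partial>lborel)" for z
  have plane: "(\<integral>\<^sup>+q. F (z, q) ^ 4 \<partial>lborel) \<le> a z * a z" for z
  proof -
    have mm: "(\<lambda>q. F (z, q) * D (z, q)) \<in> borel_measurable borel" by measurable
    have "(\<integral>\<^sup>+q. F (z, q) ^ 4 \<partial>lborel)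
      \<le> (\<integral>\<^sup>+q. (\<integral>\<^sup>+s. F (z, s, snd q) * D (z, s, snd q) \<partial>lborel) * (\<integral>\<^sup>+s. F (z, fst q, s) * D (z, fst q, s) \<partial>lborel) \<partial>lborel)"
    proof (rule nn_integral_mono)
      fix q :: "real \<times> real"
      have "F (z, q) ^ 4 = (F (z, fst q, snd q))\<^sup>2 * (F (z, fst q, snd q))\<^sup>2" by (simp add: power_add[symmetric])
      also have "\<dots> \<le> (\<integral>\<^sup>+s. F (z, s, snd q) * D (z, s, snd q) \<partial>lborel) * (\<integral>\<^sup>+s. F (z, fst q, s) * D (z, fst q, s) \<partial>lborel)"
        by (intro mult_mono 1 2) auto
      finally show "F (z, q) ^ 4 \<le> (\<integral>\<^sup>+s. F (z, s, snd q) * D (z, s, snd q) \<partial>lborel) * (\<integral>\<^sup>+s. F (z, fst q, s) * D (z, fst q, s) \<partial>lborel)" .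
    qed
    also have "\<dots> = (\<integral>\<^sup>+y. \<integral>\<^sup>+x. (\<integral>\<^sup>+s. F (z, s, y) * D (z, s, y) \<partial>lborel) * (\<integral>\<^sup>+s. F (z, x, s) * D (z, x, s) \<partial>lborel) \<partial>lborel \<partial>lborel)"
    proof (subst fub2')
      have "(\<lambda>q::real \<times> real. \<integral>\<^sup>+s. F (z, s, snd q) * D (z, s, snd q) \<partial>lborel) \<in> borel_measurable borel"
        using measurable_compose[OF _ meas2(2)[OF mm], of snd borel] by (simp add: borel_measurable_continuous_onI continuous_intros)
      moreover have "(\<lambda>q::real \<times> real. \<integral>\<^sup>+s. F (z, fst q, s) * D (z, fst q, s) \<partial>lborel) \<in> borel_measurable borel"
        using measurable_compose[OF _ meas2(1)[OF mm], of fst borel] by (simp add: borel_measurable_continuous_onI continuous_intros)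
      ultimately show "(\<lambda>q::real \<times> real. (\<integral>\<^sup>+s. F (z, s, snd q) * D (z, s, snd q) \<partial>lborel) * (\<integral>\<^sup>+s. F (z, fst q, s) * D (z, fst q, s) \<partial>lborel)) \<in> borel_measurable borel"
        by (rule borel_measurable_times_ennreal)
    qed simp
    also have "\<dots> = (\<integral>\<^sup>+y. (\<integral>\<^sup>+s. F (z, s, y) * D (z, s, y) \<partial>lborel) * (\<integral>\<^sup>+x. \<integral>\<^sup>+s. F (z, x, s) * D (z, x, s) \<partial>lborel \<partial>lborel) \<partial>lborel)"
      using meas2(1)[OF mm] by (subst nn_integral_cmult) auto
    also have "\<dots> = (\<integral>\<^sup>+y. \<integral>\<^sup>+s. F (z, s, y) * D (z, s, y) \<partial>lborel \<partial>lborel) * (\<integral>\<^sup>+x. \<integral>\<^sup>+s. F (z, x, s) * D (z, x, s) \<partial>lborel \<partial>lborel)"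
      using meas2(2)[OF mm] by (subst nn_integral_multc) auto
    also have "\<dots> = a z * a z" unfolding a_def using fub2[OF mm] fub2'[OF mm] by simp
    finally show ?thesis .
  qed
  have cs: "a z * a z \<le> S * g z" for z
  proof -
    have "a z * a z \<le> (\<integral>\<^sup>+q. (F (z, q))\<^sup>2 \<partial>lborel) * g z"
      using Cauchy_Schwarz_nn_integral[of "\<lambda>q. F (z, q)" lborel "\<lambda>q. D (z, q)"] unfolding a_def g_def
      by (simp add: power2_eq_square Fm)
    also have "(\<integral>\<^sup>+q. (F (z, q))\<^sup>2 \<partial>lborel) \<le> (\<integral>\<^sup>+q. \<integral>\<^sup>+s. F (s, q) * D (s, q) \<partial>lborel \<partial>lborel)"
      by (rule nn_integral_mono) (use 3 in \<open>auto\<close>)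
    also have "\<dots> = S" unfolding S_def by (rule fub3'[symmetric]) measurable
    finally show ?thesis by (simp add: mult_right_mono)
  qed
  have "(\<integral>\<^sup>+p. F p ^ 4 \<partial>lborel) = (\<integral>\<^sup>+z. \<integral>\<^sup>+q. F (z, q) ^ 4 \<partial>lborel \<partial>lborel)" by (rule fub3) measurable
  also have "\<dots> \<le> (\<integral>\<^sup>+z. S * g z \<partial>lborel)" by (rule nn_integral_mono) (use plane cs order_trans in blast)
  also have "\<dots> = S * (\<integral>\<^sup>+z. g z \<partial>lborel)"
    by (rule nn_integral_cmult) (use meas3[of "\<lambda>p. (D p)\<^sup>2"] in \<open>simp add: g_def[abs_def]\<close>)
  also have "(\<integral>\<^sup>+z. g z \<partial>lborel) = (\<integral>\<^sup>+p. (D p)\<^sup>2 \<partial>lborel)"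
    unfolding g_def by (rule fub3[symmetric]) measurable
  finally show "(\<integral>\<^sup>+p. F p ^ 4 \<partial>lborel) \<le> S * (\<integral>\<^sup>+p. (D p)\<^sup>2 \<partial>lborel)" .
qed

text \<open>Nested pairs as coordinates, so that Fubini's theorem for product measures applies.\<close>

definition triple :: "real \<times> real \<times> real \<Rightarrow> real ^ 3" where
  "triple p = vector [fst p, fst (snd p), snd (snd p)]"

lemma triple_nth: "triple p $ 1 = fst p" "triple p $ 2 = fst (snd p)" "triple p $ 3 = snd (snd p)"
  by (auto simp: triple_def)

lemma triple_eq: "triple (z, x, y) = z *\<^sub>R axis 1 1 + x *\<^sub>R axis 2 1 + y *\<^sub>R axis 3 1"
  by (simp add: vec_eq_iff forall_3 triple_nth axis_def)

lemma continuous_triple: "continuous_on A triple"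
proof -
  have eq: "triple = (\<lambda>p. fst p *\<^sub>R axis 1 1 + fst (snd p) *\<^sub>R axis 2 1 + snd (snd p) *\<^sub>R axis 3 1)"
    using triple_eq by (auto simp: fun_eq_iff)
  show ?thesis unfolding eq by (intro continuous_intros)
qed

lemma prod_Basis_3: "(\<Prod>b\<in>(Basis :: (real ^ 3) set). f b) = f (axis 1 1) * f (axis 2 1) * f (axis 3 1)"
proof -
  have eq: "(Basis :: (real ^ 3) set) = (\<lambda>i. axis i 1) ` UNIV" by (auto simp: Basis_vec_def)
  have inj: "inj (\<lambda>i::3. axis i (1::real))" by (auto simp: inj_def axis_eq_axis)
  have "(\<Prod>b\<in>range (\<lambda>i::3. axis i (1::real)). f b) = (\<Prod>i\<in>(UNIV::3 set). f (axis i 1))"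
    using prod.reindex[OF inj, of f] by (simp only: comp_def)
  also have "\<dots> = f (axis 1 1) * f (axis 2 1) * f (axis 3 1)"
    unfolding UNIV_3 by (simp add: ac_simps)
  finally show ?thesis by (simp only: eq)
qed

lemma lborel_triple: "distr lborel borel triple = lborel"
proof (rule lborel_eqI[symmetric])
  have tm: "triple \<in> lborel \<rightarrow>\<^sub>M borel" using borel_measurable_continuous_onI[OF continuous_triple] by simp
  fix l u :: "real ^ 3" assume lu: "\<And>b. b \<in> Basis \<Longrightarrow> l \<bullet> b \<le> u \<bullet> b"
  have lu': "l $ i \<le> u $ i" for i using lu[of "axis i 1"] by (simp add: inner_axis axis_in_Basis_iff)
  have pre: "triple -` box l u = {l $ 1<..<u $ 1} \<times> ({l $ 2<..<u $ 2} \<times> {l $ 3<..<u $ 3})"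
    by (auto simp: mem_box_cart forall_3 triple_nth)
  have times2: "emeasure lborel (A \<times> B) = emeasure lborel A * emeasure lborel B"
    if "A \<in> sets borel" "B \<in> sets borel" for A B :: "real set"
    using lborel.emeasure_pair_measure_Times[of A lborel B] that by (simp add: lborel_prod)
  have times3: "emeasure lborel (A \<times> B) = emeasure lborel A * emeasure lborel B"
    if "A \<in> sets borel" "B \<in> sets borel" for A :: "real set" and B :: "(real \<times> real) set"
    using lborel.emeasure_pair_measure_Times[of A lborel B] that by (simp add: lborel_prod)
  have open23: "open ({l $ 2<..<u $ 2} \<times> {l $ 3<..<u $ 3})" by (intro open_Times) auto
  have "emeasure (distr lborel borel triple) (box l u) = emeasure lborel ({l $ 1<..<u $ 1} \<times> ({l $ 2<..<u $ 2} \<times> {l $ 3<..<u $ 3}))"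
    using tm pre by (subst emeasure_distr) auto
  also have "\<dots> = ennreal (u $ 1 - l $ 1) * (ennreal (u $ 2 - l $ 2) * ennreal (u $ 3 - l $ 3))"
    using open23 lu' by (subst times3, simp, simp, subst times2) auto
  also have "\<dots> = ennreal ((u $ 1 - l $ 1) * (u $ 2 - l $ 2) * (u $ 3 - l $ 3))"
    using lu' by (simp add: ennreal_mult mult.assoc)
  also have "\<dots> = ennreal (\<Prod>b\<in>Basis. (u - l) \<bullet> b)"
    by (simp add: prod_Basis_3 inner_axis)
  finally show "emeasure (distr lborel borel triple) (box l u) = ennreal (\<Prod>b\<in>Basis. (u - l) \<bullet> b)" .
qed simp

lemma nn_integral_triple:
  fixes h :: "real ^ 3 \<Rightarrow> ennreal"
  assumes "h \<in> borel_measurable borel"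
  shows "(\<integral>\<^sup>+p. h (triple p) \<partial>lborel) = (\<integral>\<^sup>+x. h x \<partial>lborel)"
proof -
  have "triple \<in> lborel \<rightarrow>\<^sub>M borel" using borel_measurable_continuous_onI[OF continuous_triple] by simp
  from nn_integral_distr[OF this, of h] show ?thesis using assms by (simp add: lborel_triple)
qed

lemma test_function_square_le_line_integral:
  fixes \<phi> :: "real ^ 3 \<Rightarrow> real ^ 3"
  assumes \<phi>: "\<phi> \<in> Cc_infinity S"
  shows "(ennreal (norm (\<phi> (x + t *\<^sub>R axis k 1))))\<^sup>2
    \<le> (\<integral>\<^sup>+s. ennreal (norm (\<phi> (x + s *\<^sub>R axis k 1))) * ennreal (2 * norm (classical_grad \<phi> (x + s *\<^sub>R axis k 1))) \<partial>lborel)"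
proof -
  have s: "smooth \<phi>" using \<phi> by (simp add: Cc_infinity_iff)
  obtain K where K: "compact K" "\<forall>x. x \<notin> K \<longrightarrow> \<phi> x = 0" using \<phi> unfolding Cc_infinity_iff by blast
  obtain r where r: "\<And>x. x \<in> K \<Longrightarrow> norm x \<le> r" using compact_imp_bounded[OF K(1)] bounded_iff by metis
  define e where "e = axis k (1::real)"
  define g' where "g' s = dir_deriv e \<phi> (x + s *\<^sub>R e)" for s
  have ne: "norm e = 1" by (simp add: e_def norm_axis_1)
  have D: "(\<phi> has_derivative frechet_derivative \<phi> (at y)) (at y)" for y
    using smooth_differentiable[OF s] frechet_derivative_works by blast
  have "(ennreal (norm (\<phi> (x + t *\<^sub>R e))))\<^sup>2
      \<le> (\<integral>\<^sup>+s. ennreal (norm (\<phi> (x + s *\<^sub>R e))) * ennreal (2 * norm (g' s)) \<partial>lborel)"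
  proof (rule norm_square_le_nn_integral[where g="\<lambda>s. \<phi> (x + s *\<^sub>R e)" and g'=g' and t=t and r="r + norm x"])
    show "((\<lambda>t. \<phi> (x + t *\<^sub>R e)) has_vector_derivative g' s) (at s)" for s
    proof -
      have 1: "((\<lambda>s. x + s *\<^sub>R e) has_derivative (\<lambda>h. h *\<^sub>R e)) (at s)" by (auto intro!: derivative_eq_intros)
      have "((\<lambda>s. \<phi> (x + s *\<^sub>R e)) has_derivative (\<lambda>h. frechet_derivative \<phi> (at (x + s *\<^sub>R e)) (h *\<^sub>R e))) (at s)"
        using has_derivative_compose[OF 1 D] .
      moreover have "frechet_derivative \<phi> (at (x + s *\<^sub>R e)) (h *\<^sub>R e) = h *\<^sub>R g' s" for h
        using linear_cmul[OF has_derivative_linear[OF D]] by (simp add: g'_def dir_deriv_def)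
      ultimately show ?thesis unfolding has_vector_derivative_def by simp
    qed
    show "continuous_on UNIV g'"
      unfolding g'_def e_def
      by (rule continuous_on_compose2[OF smooth_continuous[OF smooth_dir_deriv[OF s axis_Basis], of UNIV]])
        (auto intro!: continuous_intros)
    show "\<phi> (x + t *\<^sub>R e) = 0" if "\<bar>t\<bar> > r + norm x" for t
    proof -
      have "norm (t *\<^sub>R e) \<le> norm (x + t *\<^sub>R e) + norm x"
        using norm_triangle_ineq4[of "x + t *\<^sub>R e" x] by simp
      then have "norm (x + t *\<^sub>R e) > r" using that ne by simp
      then show ?thesis using r K(2) by (metis not_le)
    qed
  qed
  also have "\<dots> \<le> (\<integral>\<^sup>+s. ennreal (norm (\<phi> (x + s *\<^sub>R e))) * ennreal (2 * norm (classical_grad \<phi> (x + s *\<^sub>R e))) \<partial>lborel)"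
  proof (intro nn_integral_mono mult_left_mono ennreal_leI)
    fix s
    have "norm (classical_grad \<phi> (x + s *\<^sub>R e) $ k) \<le> norm (classical_grad \<phi> (x + s *\<^sub>R e))"
      by (rule Finite_Cartesian_Product.norm_nth_le)
    then show "norm (g' s) \<le> norm (classical_grad \<phi> (x + s *\<^sub>R e))"
      by (simp add: classical_grad_def g'_def e_def)
  qed auto
  finally show ?thesis unfolding e_def .
qed

context domain
begin

text \<open>With \<open>F = \<bar>\<phi>\<bar>\<close> and \<open>D = 2 \<bar>\<nabla>\<phi>\<bar>\<close> the two bounds for \<open>S = \<integral> F D\<close> combine to
  \<open>(\<integral> F\<^sup>4)\<^sup>2 \<le> S\<^sup>2 (\<integral> D\<^sup>2)\<^sup>2 \<le> (\<integral> F\<^sup>2) (\<integral> D\<^sup>2)\<^sup>3\<close>; the constant is \<open>64 = 4\<^sup>3\<close>.\<close>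

lemma ladyzhenskaya_test_function:
  assumes \<phi>: "\<phi> \<in> Cc_infinity \<Omega>"
  shows "integrable M\<Omega> (\<lambda>x. norm (\<phi> x) ^ 4)"
    and "(LINT x|M\<Omega>. norm (\<phi> x) ^ 4)\<^sup>2
       \<le> 64 * (LINT x|M\<Omega>. (norm (\<phi> x))\<^sup>2) * (LINT x|M\<Omega>. (norm (classical_grad \<phi> x))\<^sup>2) ^ 3"
proof -
  obtain K where K: "compact K" "K \<subseteq> \<Omega>" "\<forall>x. x \<notin> K \<longrightarrow> \<phi> x = 0" using \<phi> unfolding Cc_infinity_iff by blast
  have s: "smooth \<phi>" using \<phi> by (simp add: Cc_infinity_iff)
  have out: "classical_grad \<phi> x = 0" if "x \<notin> K" for x
    using dir_deriv_zero_outside[OF compact_imp_closed[OF K(1)] K(3) that] by (simp add: classical_grad_def vec_eq_iff)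
  have c\<phi>: "continuous_on UNIV \<phi>" by (rule smooth_continuous[OF s])
  have cg: "continuous_on UNIV (classical_grad \<phi>)"
    unfolding classical_grad_def
    by (intro continuous_on_vec_lambda smooth_continuous smooth_dir_deriv s axis_Basis)
  have conv: "integrable lborel h" "integrable M\<Omega> h" "(LINT x|M\<Omega>. h x) = (LINT x|lborel. h x)"
      "(\<integral>\<^sup>+x. ennreal (h x) \<partial>lborel) = ennreal (LINT x|lborel. h x)"
    if c: "continuous_on UNIV h" and o: "\<forall>x. x \<notin> K \<longrightarrow> h x = 0" and n: "\<forall>x. h x \<ge> 0" for h :: "real ^ 3 \<Rightarrow> real"
  proof -
    have m: "h \<in> borel_measurable borel" by (rule borel_measurable_continuous_onI[OF c])
    have "integrable lborel (\<lambda>x. indicator K x *\<^sub>R h x)"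
      by (intro borel_integrable_compact K(1) continuous_on_subset[OF c]) auto
    moreover have "(\<lambda>x. indicator K x *\<^sub>R h x) = h" using o by (auto simp: indicator_def fun_eq_iff)
    ultimately show i: "integrable lborel h" by simp
    then have il: "integrable lebesgue h" using integrable_completion[of h lborel] m by simp
    show "integrable M\<Omega> h" by (rule integrable_lebesgue_on[OF \<Omega>_sets il])
    have "(LINT x|M\<Omega>. h x) = (LINT x|lebesgue. h x)"
      by (rule integral_lebesgue_on_support[OF \<Omega>_sets]) (use K(2) o in blast)
    also have "\<dots> = (LINT x|lborel. h x)" by (rule integral_completion) (use m in simp)
    finally show "(LINT x|M\<Omega>. h x) = (LINT x|lborel. h x)" .
    show "(\<integral>\<^sup>+x. ennreal (h x) \<partial>lborel) = ennreal (LINT x|lborel. h x)"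
      by (rule nn_integral_eq_integral[OF i]) (use n in auto)
  qed
  have Q: "continuous_on UNIV (\<lambda>x. norm (\<phi> x) ^ 4)" "\<forall>x. x \<notin> K \<longrightarrow> norm (\<phi> x) ^ 4 = 0" "\<forall>x. norm (\<phi> x) ^ 4 \<ge> 0"
    using K(3) by (auto intro!: continuous_intros c\<phi>)
  have L: "continuous_on UNIV (\<lambda>x. (norm (\<phi> x))\<^sup>2)" "\<forall>x. x \<notin> K \<longrightarrow> (norm (\<phi> x))\<^sup>2 = 0" "\<forall>x. (norm (\<phi> x))\<^sup>2 \<ge> 0"
    using K(3) by (auto intro!: continuous_intros c\<phi>)
  have G: "continuous_on UNIV (\<lambda>x. (norm (classical_grad \<phi> x))\<^sup>2)" "\<forall>x. x \<notin> K \<longrightarrow> (norm (classical_grad \<phi> x))\<^sup>2 = 0"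
      "\<forall>x. (norm (classical_grad \<phi> x))\<^sup>2 \<ge> 0"
    using out by (auto intro!: continuous_intros cg)
  show "integrable M\<Omega> (\<lambda>x. norm (\<phi> x) ^ 4)" by (rule conv(2)[OF Q])
  define q where "q = (LINT x|lborel. norm (\<phi> x) ^ 4)"
  define l where "l = (LINT x|lborel. (norm (\<phi> x))\<^sup>2)"
  define g where "g = (LINT x|lborel. (norm (classical_grad \<phi> x))\<^sup>2)"
  have nn: "q \<ge> 0" "l \<ge> 0" "g \<ge> 0" by (auto simp: q_def l_def g_def)
  define F where "F p = ennreal (norm (\<phi> (triple p)))" for p
  define D where "D p = ennreal (2 * norm (classical_grad \<phi> (triple p)))" for p
  define S where "S = (\<integral>\<^sup>+p. F p * D p \<partial>lborel)"
  have Fm: "F \<in> borel_measurable borel" unfolding F_def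
    by (intro measurable_compose[OF _ measurable_ennreal] borel_measurable_continuous_onI continuous_intros
        continuous_on_compose2[OF c\<phi> continuous_triple]) auto
  have Dm: "D \<in> borel_measurable borel" unfolding D_def
    by (intro measurable_compose[OF _ measurable_ennreal] borel_measurable_continuous_onI continuous_intros
        continuous_on_compose2[OF cg continuous_triple]) auto
  have b1: "(F (z, x, y))\<^sup>2 \<le> (\<integral>\<^sup>+s. F (z, s, y) * D (z, s, y) \<partial>lborel)" for z x y
    using test_function_square_le_line_integral[OF \<phi>, of "z *\<^sub>R axis 1 1 + y *\<^sub>R axis 3 1" x 2]
    unfolding F_def D_def triple_eq by (simp add: algebra_simps)
  have b2: "(F (z, x, y))\<^sup>2 \<le> (\<integral>\<^sup>+s. F (z, x, s) * D (z, x, s) \<partial>lborel)" for z x y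
    using test_function_square_le_line_integral[OF \<phi>, of "z *\<^sub>R axis 1 1 + x *\<^sub>R axis 2 1" y 3]
    unfolding F_def D_def triple_eq by (simp add: algebra_simps)
  have b3: "(F (z, x, y))\<^sup>2 \<le> (\<integral>\<^sup>+s. F (s, x, y) * D (s, x, y) \<partial>lborel)" for z x y
    using test_function_square_le_line_integral[OF \<phi>, of "x *\<^sub>R axis 2 1 + y *\<^sub>R axis 3 1" z 1]
    unfolding F_def D_def triple_eq by (simp add: algebra_simps)
  note B = nn_integral_power4_bound[OF Fm Dm b1 b2 b3]
  have IQ: "(\<integral>\<^sup>+p. F p ^ 4 \<partial>lborel) = ennreal q"
  proof -
    have "(\<integral>\<^sup>+p. F p ^ 4 \<partial>lborel) = (\<integral>\<^sup>+p. (\<lambda>x. ennreal (norm (\<phi> x) ^ 4)) (triple p) \<partial>lborel)"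
      by (simp add: F_def ennreal_power)
    also have "\<dots> = (\<integral>\<^sup>+x. ennreal (norm (\<phi> x) ^ 4) \<partial>lborel)"
      by (rule nn_integral_triple) (intro measurable_compose[OF _ measurable_ennreal] borel_measurable_continuous_onI Q)
    finally show ?thesis using conv(4)[OF Q] by (simp add: q_def)
  qed
  have IL: "(\<integral>\<^sup>+p. (F p)\<^sup>2 \<partial>lborel) = ennreal l"
  proof -
    have "(\<integral>\<^sup>+p. (F p)\<^sup>2 \<partial>lborel) = (\<integral>\<^sup>+p. (\<lambda>x. ennreal ((norm (\<phi> x))\<^sup>2)) (triple p) \<partial>lborel)"
      by (simp add: F_def ennreal_power)
    also have "\<dots> = (\<integral>\<^sup>+x. ennreal ((norm (\<phi> x))\<^sup>2) \<partial>lborel)"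
      by (rule nn_integral_triple) (intro measurable_compose[OF _ measurable_ennreal] borel_measurable_continuous_onI L)
    finally show ?thesis using conv(4)[OF L] by (simp add: l_def)
  qed
  have ID: "(\<integral>\<^sup>+p. (D p)\<^sup>2 \<partial>lborel) = ennreal (4 * g)"
  proof -
    have "(\<integral>\<^sup>+p. (D p)\<^sup>2 \<partial>lborel) = (\<integral>\<^sup>+p. 4 * (\<lambda>x. ennreal ((norm (classical_grad \<phi> x))\<^sup>2)) (triple p) \<partial>lborel)"
    proof (rule nn_integral_cong)
      fix p
      have "(D p)\<^sup>2 = ennreal ((2 * norm (classical_grad \<phi> (triple p)))\<^sup>2)" by (simp only: D_def ennreal_power[OF mult_nonneg_nonneg[OF _ norm_ge_zero]] zero_le_numeral)
      also have "\<dots> = ennreal (4 * (norm (classical_grad \<phi> (triple p)))\<^sup>2)" by (simp add: power_mult_distrib)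
      also have "\<dots> = 4 * ennreal ((norm (classical_grad \<phi> (triple p)))\<^sup>2)" by (simp add: ennreal_mult)
      finally show "(D p)\<^sup>2 = 4 * ennreal ((norm (classical_grad \<phi> (triple p)))\<^sup>2)" .
    qed
    also have "\<dots> = (\<integral>\<^sup>+x. 4 * ennreal ((norm (classical_grad \<phi> x))\<^sup>2) \<partial>lborel)"
    proof -
      have "(\<lambda>x. 4 * ennreal ((norm (classical_grad \<phi> x))\<^sup>2)) \<in> borel_measurable borel"
        by (intro borel_measurable_times_ennreal borel_measurable_const measurable_compose[OF _ measurable_ennreal] borel_measurable_continuous_onI G)
      from nn_integral_triple[OF this] show ?thesis .
    qed
    also have "\<dots> = 4 * (\<integral>\<^sup>+x. ennreal ((norm (classical_grad \<phi> x))\<^sup>2) \<partial>lborel)"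
      by (rule nn_integral_cmult) (use measurable_compose[OF borel_measurable_continuous_onI[OF G(1)] measurable_ennreal] in simp)
    finally show ?thesis using conv(4)[OF G] nn by (simp add: g_def ennreal_mult)
  qed
  have S2: "S\<^sup>2 \<le> ennreal l * ennreal (4 * g)" using B(2) unfolding S_def IL ID .
  have "S \<noteq> \<infinity>"
  proof
    assume "S = \<infinity>"
    then have "S\<^sup>2 = \<infinity>" by (simp add: power2_eq_square)
    then show False using S2 nn by (simp add: ennreal_mult[symmetric] top_unique)
  qed
  then obtain t where t: "S = ennreal t" "t \<ge> 0" by (cases S) auto
  have "ennreal (t\<^sup>2) \<le> ennreal (l * (4 * g))" using S2 t nn by (simp add: ennreal_power ennreal_mult)
  then have t2: "t\<^sup>2 \<le> l * (4 * g)" using nn by (subst (asm) ennreal_le_iff) auto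
  have "ennreal q \<le> ennreal (t * (4 * g))" using B(1) t nn unfolding S_def[symmetric] IQ ID by (simp add: ennreal_mult)
  then have "q \<le> t * (4 * g)" using nn t by (subst (asm) ennreal_le_iff) auto
  then have "q\<^sup>2 \<le> (t * (4 * g))\<^sup>2" using nn by (intro power_mono) auto
  also have "\<dots> = t\<^sup>2 * (4 * g)\<^sup>2" by (rule power_mult_distrib)
  also have "\<dots> \<le> (l * (4 * g)) * (4 * g)\<^sup>2" by (intro mult_right_mono t2) simp
  also have "\<dots> = 64 * l * g ^ 3" by (simp add: power2_eq_square power3_eq_cube)
  finally show "(LINT x|M\<Omega>. norm (\<phi> x) ^ 4)\<^sup>2
       \<le> 64 * (LINT x|M\<Omega>. (norm (\<phi> x))\<^sup>2) * (LINT x|M\<Omega>. (norm (classical_grad \<phi> x))\<^sup>2) ^ 3"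
    unfolding conv(3)[OF Q] conv(3)[OF L] conv(3)[OF G] q_def l_def g_def .
qed

end

section \<open>The solenoidal spaces as subsets of Hilbert spaces\<close>

type_synonym vector_lsq = "(real ^ 3, real ^ 3) lsq"
type_synonym matrix_lsq = "(real ^ 3, real ^ 3 ^ 3) lsq"

context domain
begin

text \<open>The element of \<open>L\<^sup>2\<close> of the whole space that \<open>f\<close> defines on \<open>\<Omega>\<close>: values outside \<open>\<Omega>\<close> do not matter, and
  different domains share one Hilbert space type.\<close>

definition emb :: "(real ^ 3 \<Rightarrow> 'b::{real_inner,banach,second_countable_topology}) \<Rightarrow> (real ^ 3, 'b) lsq" where
  "emb f = abs_lsq (\<lambda>x. indicator \<Omega> x *\<^sub>R f x)"

lemma sq_int_ext:
  fixes f :: "real ^ 3 \<Rightarrow> 'b::{real_inner,banach,second_countable_topology}"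
  assumes "sq_int M\<Omega> f" shows "sq_int lebesgue (\<lambda>x. indicator \<Omega> x *\<^sub>R f x)"
proof -
  have "(\<lambda>x. (norm (indicator \<Omega> x *\<^sub>R f x))\<^sup>2) = (\<lambda>x. indicator \<Omega> x *\<^sub>R (norm (f x))\<^sup>2)"
    by (auto simp: indicator_def fun_eq_iff)
  moreover have "(\<lambda>x. indicator \<Omega> x *\<^sub>R f x) \<in> borel_measurable lebesgue"
    using sq_int_measurable[OF assms] \<Omega>_sets by (subst (asm) borel_measurable_restrict_space_iff) auto
  moreover have "integrable lebesgue (\<lambda>x. indicator \<Omega> x *\<^sub>R (norm (f x))\<^sup>2)"
    using sq_int_norm2[OF assms] \<Omega>_sets by (subst (asm) integrable_restrict_space) auto
  ultimately show ?thesis by (simp add: sq_int_def)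
qed

lemma inner_emb:
  assumes "sq_int M\<Omega> f" "sq_int M\<Omega> g" shows "emb f \<bullet> emb g = (LINT x|M\<Omega>. f x \<bullet> g x)"
proof -
  have "emb f \<bullet> emb g = (LINT x|lebesgue. (indicator \<Omega> x *\<^sub>R f x) \<bullet> (indicator \<Omega> x *\<^sub>R g x))"
    unfolding emb_def by (rule inner_abs_lsq[OF sq_int_ext[OF assms(1)] sq_int_ext[OF assms(2)]])
  also have "\<dots> = (LINT x|lebesgue. indicator \<Omega> x *\<^sub>R (f x \<bullet> g x))"
    by (rule Bochner_Integration.integral_cong) (auto simp: indicator_def)
  also have "\<dots> = (LINT x|M\<Omega>. f x \<bullet> g x)" using \<Omega>_sets by (subst integral_restrict_space) auto
  finally show ?thesis .
qed

lemma norm_emb: "sq_int M\<Omega> f \<Longrightarrow> (norm (emb f))\<^sup>2 = (LINT x|M\<Omega>. (norm (f x))\<^sup>2)"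
  by (simp add: power2_norm_eq_inner inner_emb)

lemma emb_lin:
  assumes "sq_int M\<Omega> f" "sq_int M\<Omega> g"
  shows "emb (\<lambda>x. a *\<^sub>R f x + b *\<^sub>R g x) = a *\<^sub>R emb f + b *\<^sub>R emb g"
proof -
  note s = sq_int_ext[OF assms(1)] sq_int_ext[OF assms(2)]
  have "(\<lambda>x. indicator \<Omega> x *\<^sub>R (a *\<^sub>R f x + b *\<^sub>R g x))
      = (\<lambda>x. a *\<^sub>R (indicator \<Omega> x *\<^sub>R f x) + b *\<^sub>R (indicator \<Omega> x *\<^sub>R g x))"
    by (auto simp: indicator_def fun_eq_iff)
  then show ?thesis
    unfolding emb_def abs_lsq_scaleR[OF s(1)] abs_lsq_scaleR[OF s(2)]
    by (simp only: abs_lsq_add[OF sq_int_scaleR[OF s(1)] sq_int_scaleR[OF s(2)]])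
qed

lemma emb_diff:
  assumes "sq_int M\<Omega> f" "sq_int M\<Omega> g" shows "emb (\<lambda>x. f x - g x) = emb f - emb g"
  using emb_lin[OF assms, of 1 "-1"] by simp

lemma emb_cong_AE:
  assumes "sq_int M\<Omega> f" "sq_int M\<Omega> g" "AE x in M\<Omega>. f x = g x" shows "emb f = emb g"
proof -
  have "(norm (emb f - emb g))\<^sup>2 = (LINT x|M\<Omega>. (norm (f x - g x))\<^sup>2)"
    using assms by (simp add: emb_diff[symmetric] norm_emb sq_int_diff)
  also have "\<dots> = 0" by (rule integral_eq_zero_AE) (use assms(3) in \<open>eventually_elim, simp\<close>)
  finally show ?thesis by simp
qed

lemma AE_eq_if_emb_eq:
  assumes "sq_int M\<Omega> f" "sq_int M\<Omega> g" "emb f = emb g" shows "AE x in M\<Omega>. f x = g x"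
proof (rule AE_eq_if_integral_square_zero[OF assms(1,2)])
  show "(LINT x|M\<Omega>. (norm (f x - g x))\<^sup>2) = 0"
    using norm_emb[OF sq_int_diff[OF assms(1,2)]] assms by (simp add: emb_diff)
qed

lemma Lp_norm_2_emb: "sq_int M\<Omega> f \<Longrightarrow> Lp_norm 2 \<Omega> f = norm (emb f)"
  for f :: "real ^ 3 \<Rightarrow> 'b::euclidean_space"
  by (simp add: Lp_norm_2 norm_emb[symmetric])

lemma sq_int_rep_on: "sq_int M\<Omega> (rep_lsq a)"
proof -
  have "sq_int lebesgue (rep_lsq a)" by simp
  then show ?thesis unfolding sq_int_def
    using integrable_lebesgue_on[OF \<Omega>_sets] measurable_restrict_space1 by blast
qed

text \<open>The map \<open>a \<mapsto> emb (rep_lsq a)\<close> is multiplication by the indicator function of \<open>\<Omega>\<close>, a projection.\<close>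

lemma emb_rep_le:
  assumes "sq_int M\<Omega> f" shows "norm (emb (rep_lsq a) - emb f) \<le> norm (a - emb f)"
proof -
  have s: "sq_int lebesgue (\<lambda>x. rep_lsq a x - indicator \<Omega> x *\<^sub>R f x)"
    by (intro sq_int_diff sq_int_ext assms) simp
  have "(norm (emb (rep_lsq a) - emb f))\<^sup>2 = (LINT x|M\<Omega>. (norm (rep_lsq a x - f x))\<^sup>2)"
    by (simp add: emb_diff[symmetric] norm_emb sq_int_diff sq_int_rep_on assms)
  also have "\<dots> = (LINT x|lebesgue. indicator \<Omega> x *\<^sub>R (norm (rep_lsq a x - indicator \<Omega> x *\<^sub>R f x))\<^sup>2)"
    using \<Omega>_sets by (subst integral_restrict_space) (auto intro!: Bochner_Integration.integral_cong simp: indicator_def)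
  also have "\<dots> \<le> (LINT x|lebesgue. (norm (rep_lsq a x - indicator \<Omega> x *\<^sub>R f x))\<^sup>2)"
    by (rule integral_mono[OF integrable_mult_indicator[OF \<Omega>_sets sq_int_norm2[OF s]] sq_int_norm2[OF s]])
       (auto simp: indicator_def)
  also have "\<dots> = (norm (a - emb f))\<^sup>2"
  proof -
    have "a - emb f = abs_lsq (\<lambda>x. rep_lsq a x - indicator \<Omega> x *\<^sub>R f x)"
      unfolding emb_def using abs_lsq_diff[of "rep_lsq a", OF _ sq_int_ext[OF assms]] by simp
    then show ?thesis by (simp add: norm2_abs_lsq s)
  qed
  finally show ?thesis by (rule power2_le_imp_le) simp
qed

lemma emb_rep:
  assumes "\<And>n. sq_int M\<Omega> (f n)" "(\<lambda>n. emb (f n)) \<longlonglongrightarrow> a" shows "emb (rep_lsq a) = a"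
proof -
  have "(\<lambda>n. norm (a - emb (f n))) \<longlonglongrightarrow> norm (a - a)" by (intro tendsto_intros assms)
  then have "(\<lambda>n. norm (a - emb (f n))) \<longlonglongrightarrow> 0" by simp
  then have "(\<lambda>n. emb (rep_lsq a) - emb (f n)) \<longlonglongrightarrow> 0"
    by (rule Lim_null_comparison[rotated]) (use emb_rep_le assms(1) in \<open>auto intro!: always_eventually\<close>)
  from tendsto_add[OF this assms(2)] have "(\<lambda>n::nat. emb (rep_lsq a)) \<longlonglongrightarrow> 0 + a" by simp
  then show ?thesis by (simp add: LIMSEQ_const_iff)
qed

lemma H1_spaceD:
  assumes "u \<in> H1_space \<Omega>"
  shows "sq_int M\<Omega> u" "sq_int M\<Omega> (weak_grad \<Omega> u)" "has_weak_grad \<Omega> u (weak_grad \<Omega> u)"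
proof -
  obtain G where G: "sq_int M\<Omega> u" "sq_int M\<Omega> G" "has_weak_grad \<Omega> u G" using assms unfolding H1_space_iff by blast
  show "sq_int M\<Omega> u" by fact
  have ae: "AE x in M\<Omega>. G x = weak_grad \<Omega> u x" using weak_grad_eq[OF G(3)] by eventually_elim simp
  show "sq_int M\<Omega> (weak_grad \<Omega> u)"
    by (rule sq_int_AE_cong[OF G(2) measurable_lebesgue_on_AE[OF \<Omega>_sets sq_int_measurable[OF G(2)] ae] ae])
  have "has_weak_partial \<Omega> i (\<lambda>y. u y $ j) (weak_partial \<Omega> i (\<lambda>y. u y $ j))" for i j
    unfolding weak_partial_def using G(3) someI_ex[of "has_weak_partial \<Omega> i (\<lambda>y. u y $ j)"]
    by (auto simp: has_weak_grad_def)
  then show "has_weak_grad \<Omega> u (weak_grad \<Omega> u)" by (simp add: has_weak_grad_def weak_grad_def)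
qed

lemma H1_spaceI: "sq_int M\<Omega> u \<Longrightarrow> sq_int M\<Omega> G \<Longrightarrow> has_weak_grad \<Omega> u G \<Longrightarrow> u \<in> H1_space \<Omega>"
  unfolding H1_space_iff by blast

definition grad_emb :: "velocity \<Rightarrow> matrix_lsq" where
  "grad_emb u = emb (weak_grad \<Omega> u)"

lemma grad_emb_eq:
  assumes "sq_int M\<Omega> u" "sq_int M\<Omega> G" "has_weak_grad \<Omega> u G" shows "grad_emb u = emb G"
  unfolding grad_emb_def
  by (rule emb_cong_AE) (use assms H1_spaceD(2)[OF H1_spaceI[OF assms]] weak_grad_eq in auto)

lemma H1_space_lin:
  assumes u: "u \<in> H1_space \<Omega>" and w: "w \<in> H1_space \<Omega>"
  shows "(\<lambda>x. a *\<^sub>R u x + b *\<^sub>R w x) \<in> H1_space \<Omega>"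
    "grad_emb (\<lambda>x. a *\<^sub>R u x + b *\<^sub>R w x) = a *\<^sub>R grad_emb u + b *\<^sub>R grad_emb w"
proof -
  note U = H1_spaceD[OF u] and W = H1_spaceD[OF w]
  have s: "sq_int M\<Omega> (\<lambda>x. a *\<^sub>R u x + b *\<^sub>R w x)" "sq_int M\<Omega> (\<lambda>x. a *\<^sub>R weak_grad \<Omega> u x + b *\<^sub>R weak_grad \<Omega> w x)"
    using U W by (auto intro!: sq_int_add sq_int_scaleR)
  note h = has_weak_grad_linear_combination[OF U(3) W(3), of a b]
  show "(\<lambda>x. a *\<^sub>R u x + b *\<^sub>R w x) \<in> H1_space \<Omega>" by (rule H1_spaceI[OF s h])
  show "grad_emb (\<lambda>x. a *\<^sub>R u x + b *\<^sub>R w x) = a *\<^sub>R grad_emb u + b *\<^sub>R grad_emb w"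
    unfolding grad_emb_eq[OF s h] unfolding grad_emb_def by (rule emb_lin[OF U(2) W(2)])
qed

lemma H1_norm_emb:
  assumes "u \<in> H1_space \<Omega>" shows "H1_norm \<Omega> u = norm (emb u, grad_emb u)"
  using H1_spaceD[OF assms] by (simp add: H1_norm_def norm_prod_def grad_emb_def Lp_norm_2_emb)

lemma test_H1: "\<phi> \<in> Cc_infinity \<Omega> \<Longrightarrow> \<phi> \<in> H1_space \<Omega>"
  "\<phi> \<in> Cc_infinity \<Omega> \<Longrightarrow> grad_emb \<phi> = emb (classical_grad \<phi>)"
  using test_function_grad H1_spaceI grad_emb_eq by blast+

lemma H1_norm_diff_test:
  assumes u: "u \<in> H1_space \<Omega>" and \<phi>: "\<phi> \<in> Cc_infinity \<Omega>"
  shows "H1_norm \<Omega> (\<lambda>x. u x - \<phi> x) = dist (emb \<phi>, grad_emb \<phi>) (emb u, grad_emb u)"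
proof -
  note l = H1_space_lin[OF u test_H1(1)[OF \<phi>], of 1 "-1"]
  have s: "emb (\<lambda>x. u x - \<phi> x) = emb u - emb \<phi>"
    by (rule emb_diff) (use H1_spaceD[OF u] test_function_grad[OF \<phi>] in auto)
  have "H1_norm \<Omega> (\<lambda>x. u x - \<phi> x) = norm (emb u - emb \<phi>, grad_emb u - grad_emb \<phi>)"
    using H1_norm_emb[OF l(1)] l(2) s by simp
  also have "\<dots> = dist (emb \<phi>, grad_emb \<phi>) (emb u, grad_emb u)"
    by (subst dist_commute) (simp add: dist_norm)
  finally show ?thesis .
qed

text \<open>The norm of \<open>H\<^sup>1\<close> is the norm of the pair of a function and its gradient, so \<open>V\<close> corresponds to the
  closure of this set in a product of Hilbert spaces.\<close>

definition sol_pairs :: "(vector_lsq \<times> matrix_lsq) set" where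
  "sol_pairs = (\<lambda>\<phi>. (emb \<phi>, grad_emb \<phi>)) ` solenoidal_test \<Omega>"

lemma solenoidal_Cc: "\<phi> \<in> solenoidal_test \<Omega> \<Longrightarrow> \<phi> \<in> Cc_infinity \<Omega>" by (simp add: solenoidal_test_def)

lemma V_space_iff: "u \<in> V_space \<Omega> \<longleftrightarrow> u \<in> H1_space \<Omega> \<and> (emb u, grad_emb u) \<in> closure sol_pairs"
proof
  assume "u \<in> V_space \<Omega>"
  then have u: "u \<in> H1_space \<Omega>" and a: "\<And>e. e > 0 \<Longrightarrow> \<exists>\<phi>\<in>solenoidal_test \<Omega>. H1_norm \<Omega> (\<lambda>x. u x - \<phi> x) < e"
    by (auto simp: V_space_def H10_space_def)
  show "u \<in> H1_space \<Omega> \<and> (emb u, grad_emb u) \<in> closure sol_pairs"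
    unfolding closure_approachable sol_pairs_def
    using u a H1_norm_diff_test[OF u solenoidal_Cc] by fastforce
next
  assume *: "u \<in> H1_space \<Omega> \<and> (emb u, grad_emb u) \<in> closure sol_pairs"
  then have u: "u \<in> H1_space \<Omega>" by simp
  have a: "\<exists>\<phi>\<in>solenoidal_test \<Omega>. H1_norm \<Omega> (\<lambda>x. u x - \<phi> x) < e" if "e > 0" for e
    using * that H1_norm_diff_test[OF u solenoidal_Cc] unfolding closure_approachable sol_pairs_def by fastforce
  then show "u \<in> V_space \<Omega>" using u solenoidal_Cc by (fastforce simp: V_space_def H10_space_def)
qed

lemma V_space_H10: "u \<in> V_space \<Omega> \<Longrightarrow> u \<in> H10_space \<Omega>" by (simp add: V_space_def)

lemma V_spaceD:
  assumes "u \<in> V_space \<Omega>"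
  shows "u \<in> H1_space \<Omega>" "sq_int M\<Omega> u" "sq_int M\<Omega> (weak_grad \<Omega> u)" "has_weak_grad \<Omega> u (weak_grad \<Omega> u)"
  using assms H1_spaceD by (auto simp: V_space_iff)

lemma H_space_iff: "u \<in> H_space \<Omega> \<longleftrightarrow> sq_int M\<Omega> u \<and> emb u \<in> closure (emb ` solenoidal_test \<Omega>)"
proof -
  have "Lp_norm 2 \<Omega> (\<lambda>x. u x - \<phi> x) = dist (emb \<phi>) (emb u)" if "sq_int M\<Omega> u" "\<phi> \<in> solenoidal_test \<Omega>" for \<phi>
  proof -
    have "sq_int M\<Omega> \<phi>" using test_function_grad[OF solenoidal_Cc[OF that(2)]] by simp
    then show ?thesis using that
      by (subst dist_commute) (simp add: Lp_norm_2_emb sq_int_diff emb_diff dist_norm)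
  qed
  then show ?thesis unfolding H_space_def Lp_space_2_iff closure_approachable by auto
qed

lemma solenoidal_lin:
  assumes "\<phi> \<in> solenoidal_test \<Omega>" "\<psi> \<in> solenoidal_test \<Omega>"
  shows "(\<lambda>x. a *\<^sub>R \<phi> x + b *\<^sub>R \<psi> x) \<in> solenoidal_test \<Omega>"
  unfolding solenoidal_test_def
proof (intro CollectI conjI allI)
  note c = solenoidal_Cc[OF assms(1)] solenoidal_Cc[OF assms(2)]
  show "(\<lambda>x. a *\<^sub>R \<phi> x + b *\<^sub>R \<psi> x) \<in> Cc_infinity \<Omega>" by (rule Cc_infinity_linear_combination[OF c])
  fix x
  have "dir_deriv (axis i 1) (\<lambda>y. (a *\<^sub>R \<phi> y + b *\<^sub>R \<psi> y) $ i) x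
      = a * dir_deriv (axis i 1) (\<lambda>y. \<phi> y $ i) x + b * dir_deriv (axis i 1) (\<lambda>y. \<psi> y $ i) x" for i
  proof -
    have "(\<lambda>y. \<phi> y $ i) differentiable (at x)" "(\<lambda>y. \<psi> y $ i) differentiable (at x)"
      using classical_grad_component(1)[OF c(1)] classical_grad_component(1)[OF c(2)] unfolding differentiable_def by blast+
    from dir_deriv_linear_combination[OF this, of "axis i 1" a b] show ?thesis by simp
  qed
  then have "(\<Sum>i\<in>UNIV. dir_deriv (axis i 1) (\<lambda>y. (a *\<^sub>R \<phi> y + b *\<^sub>R \<psi> y) $ i) x)
     = a * (\<Sum>i\<in>UNIV. dir_deriv (axis i 1) (\<lambda>y. \<phi> y $ i) x) + b * (\<Sum>i\<in>UNIV. dir_deriv (axis i 1) (\<lambda>y. \<psi> y $ i) x)"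
    by (simp add: sum.distrib sum_distrib_left)
  also have "\<dots> = 0" using assms by (simp add: solenoidal_test_def)
  finally show "(\<Sum>i\<in>UNIV. dir_deriv (axis i 1) (\<lambda>y. (a *\<^sub>R \<phi> y + b *\<^sub>R \<psi> y) $ i) x) = 0" .
qed

lemma zero_solenoidal: "(\<lambda>x. 0) \<in> solenoidal_test \<Omega>"
proof -
  have s: "smooth (\<lambda>x::real ^ 3. 0 :: real ^ 3)"
    by (rule smoothI[of _ "{\<lambda>x. 0}"]) (auto intro!: exI[of _ "\<lambda>_ _. 0"])
  have "dir_deriv (axis i 1) (\<lambda>y. 0 :: real) x = 0" for i and x :: "real ^ 3"
    by (rule has_derivative_dir_deriv[of _ "\<lambda>_. 0"]) simp
  then show ?thesis using s by (auto simp: solenoidal_test_def Cc_infinity_iff)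
qed

lemma subspace_sol_pairs: "subspace sol_pairs"
proof -
  have lin: "a *\<^sub>R p + b *\<^sub>R q \<in> sol_pairs" if pq: "p \<in> sol_pairs" "q \<in> sol_pairs" for a b p q
  proof -
    obtain \<phi> \<psi> where f: "\<phi> \<in> solenoidal_test \<Omega>" "p = (emb \<phi>, grad_emb \<phi>)" "\<psi> \<in> solenoidal_test \<Omega>" "q = (emb \<psi>, grad_emb \<psi>)"
      using pq unfolding sol_pairs_def by blast
    note h = test_H1(1)[OF solenoidal_Cc[OF f(1)]] test_H1(1)[OF solenoidal_Cc[OF f(3)]]
    have "a *\<^sub>R p + b *\<^sub>R q = (emb (\<lambda>x. a *\<^sub>R \<phi> x + b *\<^sub>R \<psi> x), grad_emb (\<lambda>x. a *\<^sub>R \<phi> x + b *\<^sub>R \<psi> x))"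
      using f H1_space_lin(2)[OF h] emb_lin[OF H1_spaceD(1)[OF h(1)] H1_spaceD(1)[OF h(2)]] by simp
    then show ?thesis unfolding sol_pairs_def using solenoidal_lin[OF f(1,3)] by blast
  qed
  have "(emb (\<lambda>x. 0), grad_emb (\<lambda>x. 0)) \<in> sol_pairs" unfolding sol_pairs_def using zero_solenoidal by blast
  from lin[OF this this, of 0 0] have "0 \<in> sol_pairs" by (simp add: zero_prod_def)
  then show ?thesis using lin[of _ _ 1 1] lin[of _ _ _ 0] by (auto simp: subspace_def)
qed

lemma V_space_lin:
  assumes u: "u \<in> V_space \<Omega>" and w: "w \<in> V_space \<Omega>"
  shows "(\<lambda>x. a *\<^sub>R u x + b *\<^sub>R w x) \<in> V_space \<Omega>"
    "emb (\<lambda>x. a *\<^sub>R u x + b *\<^sub>R w x) = a *\<^sub>R emb u + b *\<^sub>R emb w"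
    "grad_emb (\<lambda>x. a *\<^sub>R u x + b *\<^sub>R w x) = a *\<^sub>R grad_emb u + b *\<^sub>R grad_emb w"
proof -
  note U = V_spaceD[OF u] and W = V_spaceD[OF w]
  show e: "emb (\<lambda>x. a *\<^sub>R u x + b *\<^sub>R w x) = a *\<^sub>R emb u + b *\<^sub>R emb w" by (rule emb_lin[OF U(2) W(2)])
  show g: "grad_emb (\<lambda>x. a *\<^sub>R u x + b *\<^sub>R w x) = a *\<^sub>R grad_emb u + b *\<^sub>R grad_emb w"
    by (rule H1_space_lin(2)[OF U(1) W(1)])
  have "a *\<^sub>R (emb u, grad_emb u) + b *\<^sub>R (emb w, grad_emb w) \<in> closure sol_pairs"
    using u w by (intro subspace_add subspace_scale subspace_closure subspace_sol_pairs) (auto simp: V_space_iff)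
  then show "(\<lambda>x. a *\<^sub>R u x + b *\<^sub>R w x) \<in> V_space \<Omega>"
    using H1_space_lin(1)[OF U(1) W(1)] by (simp add: V_space_iff e g)
qed

lemma V_space_diff:
  assumes "u \<in> V_space \<Omega>" "w \<in> V_space \<Omega>"
  shows "(\<lambda>x. u x - w x) \<in> V_space \<Omega>" "emb (\<lambda>x. u x - w x) = emb u - emb w"
    "grad_emb (\<lambda>x. u x - w x) = grad_emb u - grad_emb w"
  using V_space_lin[OF assms, of 1 "-1"] by auto

lemma V_norm_grad_emb: "u \<in> V_space \<Omega> \<Longrightarrow> V_norm \<Omega> u = norm (grad_emb u)"
  unfolding V_norm_def grad_emb_def by (rule Lp_norm_2_emb) (rule V_spaceD)

lemma stokes_grad_emb: "u \<in> V_space \<Omega> \<Longrightarrow> w \<in> V_space \<Omega> \<Longrightarrow> stokes \<Omega> u w = grad_emb u \<bullet> grad_emb w"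
  unfolding stokes_def grad_emb_def by (simp add: inner_emb V_spaceD)

lemma L2_inner_emb: "sq_int M\<Omega> u \<Longrightarrow> sq_int M\<Omega> w \<Longrightarrow> L2_inner \<Omega> u w = emb u \<bullet> emb w"
  for u w :: "real ^ 3 \<Rightarrow> real ^ 3"
  by (simp add: L2_inner_def inner_emb)

text \<open>Completeness of \<open>V\<close>: weak gradients are preserved under limits in mean square.\<close>

lemma closure_sol_pairs_V_space:
  assumes "(a, G) \<in> closure sol_pairs"
  obtains u where "u \<in> V_space \<Omega>" "emb u = a" "grad_emb u = G"
proof -
  obtain p where p: "\<And>n. p n \<in> sol_pairs" "p \<longlonglongrightarrow> (a, G)" using assms unfolding closure_sequential by blast
  have "\<forall>n. \<exists>\<phi>. \<phi> \<in> solenoidal_test \<Omega> \<and> p n = (emb \<phi>, grad_emb \<phi>)" using p(1) unfolding sol_pairs_def by blast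
  then obtain \<phi> where \<phi>: "\<And>n. \<phi> n \<in> solenoidal_test \<Omega>" and p\<phi>: "\<And>n. p n = (emb (\<phi> n), grad_emb (\<phi> n))" by metis
  note c = solenoidal_Cc[OF \<phi>]
  have la: "(\<lambda>n. emb (\<phi> n)) \<longlonglongrightarrow> a" using tendsto_fst[OF p(2)] by (simp add: p\<phi>)
  have lG: "(\<lambda>n. emb (classical_grad (\<phi> n))) \<longlonglongrightarrow> G" using tendsto_snd[OF p(2)] by (simp add: p\<phi> test_H1(2)[OF c])
  note t = test_function_grad[OF c]
  have ea: "emb (rep_lsq a) = a" by (rule emb_rep[OF t(1) la])
  have eG: "emb (rep_lsq G) = G" by (rule emb_rep[OF t(2) lG])
  have l2: "(\<lambda>n. LINT x|M\<Omega>. (norm (f n x - rep_lsq b x))\<^sup>2) \<longlonglongrightarrow> 0"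
    if f: "\<And>n. sq_int M\<Omega> (f n)" "(\<lambda>n. emb (f n)) \<longlonglongrightarrow> b" "emb (rep_lsq b) = b"
    for f :: "nat \<Rightarrow> real ^ 3 \<Rightarrow> 'b::{real_inner,banach,second_countable_topology}" and b
  proof -
    have "(LINT x|M\<Omega>. (norm (f n x - rep_lsq b x))\<^sup>2) = (norm (emb (f n) - b))\<^sup>2" for n
      using norm_emb[OF sq_int_diff[OF f(1) sq_int_rep_on]] emb_diff[OF f(1) sq_int_rep_on] f(3) by metis
    moreover have "(\<lambda>n. (norm (emb (f n) - b))\<^sup>2) \<longlonglongrightarrow> (norm (b - b))\<^sup>2" by (intro tendsto_intros f(2))
    ultimately show ?thesis by simp
  qed
  have w: "has_weak_grad \<Omega> (rep_lsq a) (rep_lsq G)"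
    by (rule has_weak_grad_closed[OF t(3) t(1) t(2) sq_int_rep_on sq_int_rep_on l2[OF t(1) la ea] l2[OF t(2) lG eG]])
  have g: "grad_emb (rep_lsq a) = G" using grad_emb_eq[OF sq_int_rep_on sq_int_rep_on w] eG by simp
  have "rep_lsq a \<in> V_space \<Omega>"
    using H1_spaceI[OF sq_int_rep_on sq_int_rep_on w] assms by (simp add: V_space_iff ea g)
  then show ?thesis using that ea g by blast
qed

lemma closure_sol_H_space:
  assumes "a \<in> closure (emb ` solenoidal_test \<Omega>)"
  obtains u where "u \<in> H_space \<Omega>" "emb u = a"
proof -
  obtain p where p: "\<And>n. p n \<in> emb ` solenoidal_test \<Omega>" "p \<longlonglongrightarrow> a" using assms unfolding closure_sequential by blast
  have "\<forall>n. \<exists>\<phi>. \<phi> \<in> solenoidal_test \<Omega> \<and> p n = emb \<phi>" using p(1) by blast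
  then obtain \<phi> where \<phi>: "\<And>n. \<phi> n \<in> solenoidal_test \<Omega>" "\<And>n. p n = emb (\<phi> n)" by metis
  have e: "emb (rep_lsq a) = a"
    by (rule emb_rep[of \<phi>]) (use p(2) \<phi> test_function_grad[OF solenoidal_Cc[OF \<phi>(1)]] in \<open>simp_all add: \<phi>(2)[symmetric]\<close>)
  have "rep_lsq a \<in> H_space \<Omega>" using assms by (simp add: H_space_iff sq_int_rep_on e)
  then show ?thesis using e by (rule that)
qed

end

locale poincare_domain = domain +
  assumes poincare: "\<exists>l>0. \<forall>\<psi> \<in> H10_space \<Omega>.
           l * (LINT x|lebesgue_on \<Omega>. (norm (\<psi> x))\<^sup>2)
             \<le> (LINT x|lebesgue_on \<Omega>. (norm (weak_grad \<Omega> \<psi> x))\<^sup>2)"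
begin

lemma poincare_emb: obtains C where "C \<ge> 0" "\<And>u. u \<in> V_space \<Omega> \<Longrightarrow> norm (emb u) \<le> C * norm (grad_emb u)"
proof -
  obtain l where l: "l > 0" "\<And>\<psi>. \<psi> \<in> H10_space \<Omega> \<Longrightarrow> l * (LINT x|M\<Omega>. (norm (\<psi> x))\<^sup>2) \<le> (LINT x|M\<Omega>. (norm (weak_grad \<Omega> \<psi> x))\<^sup>2)"
    using poincare by blast
  have "norm (emb u) \<le> (1 / sqrt l) * norm (grad_emb u)" if u: "u \<in> V_space \<Omega>" for u
  proof -
    have "l * (norm (emb u))\<^sup>2 \<le> (norm (grad_emb u))\<^sup>2"
      using l(2)[OF V_space_H10[OF u]] V_spaceD[OF u] by (simp add: norm_emb grad_emb_def)
    then have "sqrt (l * (norm (emb u))\<^sup>2) \<le> sqrt ((norm (grad_emb u))\<^sup>2)" by (rule real_sqrt_le_mono)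
    then show ?thesis using l(1) by (simp add: real_sqrt_mult field_simps)
  qed
  then show ?thesis using that[of "1 / sqrt l"] l(1) by simp
qed

text \<open>The space \<open>V\<close>, seen through the gradient.\<close>

definition W :: "matrix_lsq set" where "W = grad_emb ` V_space \<Omega>"

lemma zero_V_space: "(\<lambda>x. 0) \<in> V_space \<Omega>" "emb (\<lambda>x. 0 :: real ^ 3) = 0" "grad_emb (\<lambda>x. 0) = 0"
proof -
  have "(emb (\<lambda>x. 0), grad_emb (\<lambda>x. 0)) \<in> closure sol_pairs"
    unfolding sol_pairs_def by (rule subsetD[OF closure_subset]) (use zero_solenoidal in blast)
  then show z: "(\<lambda>x. 0) \<in> V_space \<Omega>" using test_H1(1)[OF solenoidal_Cc[OF zero_solenoidal]] by (simp add: V_space_iff)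
  show "emb (\<lambda>x. 0 :: real ^ 3) = 0" "grad_emb (\<lambda>x. 0) = 0" using V_space_lin(2,3)[OF z z, of 0 0] by auto
qed

lemma subspace_W: "subspace W"
  unfolding W_def
proof (rule subspaceI)
  show "0 \<in> grad_emb ` V_space \<Omega>" using zero_V_space by (intro image_eqI[of _ _ "\<lambda>x. 0"]) auto
  show "x + y \<in> grad_emb ` V_space \<Omega>" if xy: "x \<in> grad_emb ` V_space \<Omega>" "y \<in> grad_emb ` V_space \<Omega>" for x y
  proof -
    obtain u w where "u \<in> V_space \<Omega>" "x = grad_emb u" "w \<in> V_space \<Omega>" "y = grad_emb w" using xy by blast
    then show ?thesis using V_space_lin[of u w 1 1] by (intro image_eqI[of _ _ "\<lambda>x. 1 *\<^sub>R u x + 1 *\<^sub>R w x"]) auto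
  qed
  show "r *\<^sub>R x \<in> grad_emb ` V_space \<Omega>" if x: "x \<in> grad_emb ` V_space \<Omega>" for r x
  proof -
    obtain u where "u \<in> V_space \<Omega>" "x = grad_emb u" using x by blast
    then show ?thesis using V_space_lin[of u u r 0] by (intro image_eqI[of _ _ "\<lambda>x. r *\<^sub>R u x + 0 *\<^sub>R u x"]) auto
  qed
qed

text \<open>By the Poincare inequality convergence of the gradients implies convergence of the functions.\<close>

lemma closed_W: "closed W"
proof -
  obtain C where C: "C \<ge> 0" "\<And>u. u \<in> V_space \<Omega> \<Longrightarrow> norm (emb u) \<le> C * norm (grad_emb u)" using poincare_emb by blast
  have "G \<in> W" if f: "\<forall>n. f n \<in> W" "f \<longlonglongrightarrow> G" for f G
  proof -
    have "\<forall>n. \<exists>u. u \<in> V_space \<Omega> \<and> f n = grad_emb u" using f(1) unfolding W_def by blast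
    then obtain u where u: "\<And>n. u n \<in> V_space \<Omega>" "\<And>n. f n = grad_emb (u n)" by metis
    have "Cauchy (\<lambda>n. emb (u n))"
    proof (rule metric_CauchyI)
      fix e :: real assume "e > 0"
      have "e / (C + 1) > 0" using C \<open>e > 0\<close> by simp
      moreover have "Cauchy f" using f(2) LIMSEQ_imp_Cauchy by blast
      ultimately obtain M where M: "\<forall>m\<ge>M. \<forall>n\<ge>M. dist (f m) (f n) < e / (C + 1)" unfolding Cauchy_def by meson
      have "dist (emb (u m)) (emb (u n)) < e" if "m \<ge> M" "n \<ge> M" for m n
      proof -
        have "dist (emb (u m)) (emb (u n)) \<le> C * dist (f m) (f n)"
          using C(2)[OF V_space_diff(1)[OF u(1)[of m] u(1)[of n]]] V_space_diff[OF u(1)[of m] u(1)[of n]] by (simp add: dist_norm u(2))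
        also have "\<dots> \<le> (C + 1) * dist (f m) (f n)" by (simp add: mult_right_mono)
        also have "\<dots> < (C + 1) * (e / (C + 1))" using M that C by (intro mult_strict_left_mono) auto
        also have "\<dots> = e" using C by simp
        finally show ?thesis .
      qed
      then show "\<exists>M. \<forall>m\<ge>M. \<forall>n\<ge>M. dist (emb (u m)) (emb (u n)) < e" by blast
    qed
    then obtain a where a: "(\<lambda>n. emb (u n)) \<longlonglongrightarrow> a" using Cauchy_convergent convergent_def by blast
    have l: "(\<lambda>n. (emb (u n), f n)) \<longlonglongrightarrow> (a, G)" by (intro tendsto_Pair a f(2))
    have m: "(emb (u n), f n) \<in> closure sol_pairs" for n using u V_space_iff by auto
    have "(a, G) \<in> closure sol_pairs" by (rule closed_sequentially[OF closed_closure m l])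
    then show "G \<in> W" using closure_sol_pairs_V_space unfolding W_def by blast
  qed
  then show ?thesis unfolding closed_sequential_limits by blast
qed

abbreviation P :: "matrix_lsq \<Rightarrow> matrix_lsq" where "P \<equiv> proj W"

text \<open>A velocity field in \<open>V\<close> for every matrix field, inverse to the gradient on \<open>W\<close>. Composition with the
  projection makes it defined on the whole Hilbert space, so that \<open>W\<close> need not be turned into a type.\<close>

definition R :: "matrix_lsq \<Rightarrow> real ^ 3 \<Rightarrow> real ^ 3" where
  "R a = (SOME u. u \<in> V_space \<Omega> \<and> grad_emb u = P a)"

lemma R_V: "R a \<in> V_space \<Omega>" and grad_R: "grad_emb (R a) = P a"
proof -
  have "P a \<in> W" by (rule proj_in[OF subspace_W closed_W])
  then have "\<exists>u. u \<in> V_space \<Omega> \<and> grad_emb u = P a" unfolding W_def by auto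
  then have "R a \<in> V_space \<Omega> \<and> grad_emb (R a) = P a" unfolding R_def by (rule someI_ex)
  then show "R a \<in> V_space \<Omega>" "grad_emb (R a) = P a" by auto
qed

lemma emb_eq_if_grad_eq:
  assumes "u \<in> V_space \<Omega>" "w \<in> V_space \<Omega>" "grad_emb u = grad_emb w" shows "emb u = emb w"
proof -
  obtain C where C: "C \<ge> 0" "\<And>u. u \<in> V_space \<Omega> \<Longrightarrow> norm (emb u) \<le> C * norm (grad_emb u)" using poincare_emb by blast
  show ?thesis using C(2)[OF V_space_diff(1)[OF assms(1,2)]] V_space_diff[OF assms(1,2)] assms(3) by simp
qed

text \<open>The embedding of \<open>V\<close> into \<open>H\<close> in terms of gradients.\<close>

definition incl :: "matrix_lsq \<Rightarrow> vector_lsq" where "incl a = emb (R a)"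

lemma P_grad_emb: "u \<in> V_space \<Omega> \<Longrightarrow> P (grad_emb u) = grad_emb u"
  by (rule proj_id[OF subspace_W closed_W]) (simp add: W_def)

lemma incl_grad_emb: "u \<in> V_space \<Omega> \<Longrightarrow> incl (grad_emb u) = emb u"
  unfolding incl_def by (rule emb_eq_if_grad_eq[OF R_V]) (auto simp: grad_R P_grad_emb)

lemma incl_P: "incl (P a) = incl a"
  unfolding incl_def by (rule emb_eq_if_grad_eq[OF R_V R_V])
    (simp add: grad_R proj_id[OF subspace_W closed_W] proj_in[OF subspace_W closed_W])

lemma bounded_linear_P: "bounded_linear P" by (rule bounded_linear_proj[OF subspace_W closed_W])

lemma bounded_linear_incl: "bounded_linear incl"
proof -
  obtain C where C: "C \<ge> 0" "\<And>u. u \<in> V_space \<Omega> \<Longrightarrow> norm (emb u) \<le> C * norm (grad_emb u)" using poincare_emb by blast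
  have lin: "incl (a *\<^sub>R x + b *\<^sub>R y) = a *\<^sub>R incl x + b *\<^sub>R incl y" for a b x y
  proof -
    note l = V_space_lin[OF R_V[of x] R_V[of y], of a b]
    have "grad_emb (\<lambda>z. a *\<^sub>R R x z + b *\<^sub>R R y z) = grad_emb (R (a *\<^sub>R x + b *\<^sub>R y))"
      using l(3) bounded_linear_P by (simp add: grad_R linear_simps)
    from emb_eq_if_grad_eq[OF l(1) R_V this] show ?thesis using l(2) by (simp add: incl_def)
  qed
  show ?thesis
  proof (rule bounded_linear_intro[where K=C])
    show "incl (x + y) = incl x + incl y" for x y using lin[of 1 x 1 y] by simp
    show "incl (r *\<^sub>R x) = r *\<^sub>R incl x" for r x using lin[of r x 0 x] by simp
    show "norm (incl x) \<le> norm x * C" for x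
    proof -
      have "norm (incl x) \<le> C * norm (P x)" using C(2)[OF R_V[of x]] by (simp add: incl_def grad_R)
      also have "\<dots> \<le> C * norm x" by (intro mult_left_mono norm_proj_le[OF subspace_W closed_W] C)
      finally show ?thesis by (simp add: mult.commute)
    qed
  qed
qed

lemma H_space_closure_range: "u \<in> H_space \<Omega> \<Longrightarrow> emb u \<in> closure (range incl)"
proof -
  assume u: "u \<in> H_space \<Omega>"
  have sub: "emb ` solenoidal_test \<Omega> \<subseteq> range incl"
  proof
    fix y assume "y \<in> emb ` solenoidal_test \<Omega>"
    then obtain \<phi> where \<phi>: "\<phi> \<in> solenoidal_test \<Omega>" "y = emb \<phi>" by blast
    have "(emb \<phi>, grad_emb \<phi>) \<in> closure sol_pairs"
      unfolding sol_pairs_def by (rule subsetD[OF closure_subset]) (use \<phi> in blast)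
    then have "\<phi> \<in> V_space \<Omega>" using test_H1(1)[OF solenoidal_Cc[OF \<phi>(1)]] by (simp add: V_space_iff)
    then show "y \<in> range incl" using incl_grad_emb \<phi>(2) by (metis rangeI)
  qed
  show ?thesis using u subsetD[OF closure_mono[OF sub]] by (simp add: H_space_iff)
qed

lemma range_incl_closure: "closure (range incl) \<subseteq> closure (emb ` solenoidal_test \<Omega>)"
proof -
  have "incl a \<in> closure (emb ` solenoidal_test \<Omega>)" for a
  proof -
    have "(emb (R a), grad_emb (R a)) \<in> closure sol_pairs" using R_V V_space_iff by blast
    then obtain p where p: "\<And>n. p n \<in> sol_pairs" "p \<longlonglongrightarrow> (emb (R a), grad_emb (R a))" unfolding closure_sequential by blast
    have "fst (p n) \<in> emb ` solenoidal_test \<Omega>" for n using p(1)[of n] by (auto simp: sol_pairs_def)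
    moreover have "(\<lambda>n. fst (p n)) \<longlonglongrightarrow> incl a" using tendsto_fst[OF p(2)] by (simp add: incl_def)
    ultimately show ?thesis unfolding closure_sequential by (intro exI[of _ "\<lambda>n. fst (p n)"]) auto
  qed
  then show ?thesis by (intro closure_minimal) auto
qed

lemma V_space_H_space: "u \<in> V_space \<Omega> \<Longrightarrow> u \<in> H_space \<Omega>"
  using range_incl_closure closure_subset[of "range incl"] incl_grad_emb[of u] V_spaceD(2)[of u]
  unfolding H_space_iff by (metis rangeI subsetD)

end

section \<open>The space \<open>L\<^sup>4\<close> and the truncated convection term\<close>

lemma norm_powr_4 [simp]: "norm x powr 4 = norm x ^ 4"
  by (cases "x = 0") (auto simp: powr_numeral)

lemma square_convex:
  fixes x y l m :: real
  assumes "l \<ge> 0" "m \<ge> 0" "l + m = 1" shows "(l * x + m * y)\<^sup>2 \<le> l * x\<^sup>2 + m * y\<^sup>2"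
proof -
  have m: "m = 1 - l" using assms by simp
  have "l * x\<^sup>2 + m * y\<^sup>2 - (l * x + m * y)\<^sup>2 = l * m * (x - y)\<^sup>2"
    unfolding m by (simp add: power2_eq_square algebra_simps)
  moreover have "0 \<le> l * m * (x - y)\<^sup>2" using assms by simp
  ultimately show ?thesis by linarith
qed

lemma power4_convex:
  fixes x y l m :: real
  assumes "l \<ge> 0" "m \<ge> 0" "l + m = 1"
  shows "(l * x + m * y) ^ 4 \<le> l * x ^ 4 + m * y ^ 4"
proof -
  have "(l * x + m * y) ^ 4 = ((l * x + m * y)\<^sup>2)\<^sup>2" by simp
  also have "\<dots> \<le> (l * x\<^sup>2 + m * y\<^sup>2)\<^sup>2" by (intro power_mono square_convex assms) simp
  also have "\<dots> \<le> l * (x\<^sup>2)\<^sup>2 + m * (y\<^sup>2)\<^sup>2" by (rule square_convex[OF assms])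
  finally show ?thesis by simp
qed

lemma power4_le_imp_le:
  fixes x y :: real
  assumes "x ^ 4 \<le> y ^ 4" "y \<ge> 0" shows "x \<le> y"
proof (rule ccontr)
  assume "\<not> x \<le> y"
  then have "y ^ 4 < x ^ 4" using assms(2) by (intro power_strict_mono) auto
  then show False using assms(1) by simp
qed

lemma F_trunc_bounds:
  assumes "N > 0" "r \<ge> 0" shows "0 \<le> F_trunc N r" "F_trunc N r \<le> 1" "F_trunc N r * r \<le> N"
  using assms by (auto simp: F_trunc_def min_def field_simps)

lemma F_trunc_diff:
  assumes N: "N > 0" and r: "0 \<le> s" "s \<le> r"
  shows "\<bar>F_trunc N r - F_trunc N s\<bar> * s\<^sup>2 \<le> N * (r - s)"
proof -
  consider "r \<le> N" | "s \<le> N" "N < r" | "N < s" by linarith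
  then show ?thesis
  proof cases
    case 1
    then have "F_trunc N r = 1" "F_trunc N s = 1" using r N by (auto simp: F_trunc_def min_def field_simps)
    then show ?thesis using r N by simp
  next
    case 2
    then have F: "F_trunc N r = N / r" "F_trunc N s = 1" using r N by (auto simp: F_trunc_def min_def field_simps)
    have "\<bar>F_trunc N r - F_trunc N s\<bar> = (r - N) / r" unfolding F using 2 N by (simp add: field_simps abs_if)
    also have "(r - N) / r * s\<^sup>2 = (r - N) * (s * (s / r))" by (simp add: power2_eq_square)
    also have "\<dots> \<le> (r - s) * (N * 1)"
      using 2 r N by (intro mult_mono) (auto simp: field_simps)
    finally show ?thesis by (simp add: mult.commute)
  next
    case 3
    then have F: "F_trunc N r = N / r" "F_trunc N s = N / s" using r N by (auto simp: F_trunc_def min_def field_simps)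
    have "N / r \<le> N / s" using 3 N r by (intro divide_left_mono) auto
    then have "\<bar>F_trunc N r - F_trunc N s\<bar> = N / s - N / r" unfolding F by linarith
    also have "(N / s - N / r) * s\<^sup>2 = N * (r - s) * (s / r)" using 3 N r by (simp add: field_simps power2_eq_square)
    also have "\<dots> \<le> N * (r - s) * 1" using 3 N r by (intro mult_left_mono) auto
    finally show ?thesis by simp
  qed
qed

definition tensor :: "velocity \<Rightarrow> velocity \<Rightarrow> real ^ 3 \<Rightarrow> real ^ 3 ^ 3" where
  "tensor u w x = (\<chi> i j. u x $ i * w x $ j)"

lemma norm_tensor_square: "(norm (tensor u w x))\<^sup>2 = (norm (u x))\<^sup>2 * (norm (w x))\<^sup>2"
proof -
  have "(norm (tensor u w x))\<^sup>2 = (\<Sum>i\<in>UNIV. \<Sum>j\<in>UNIV. (u x $ i)\<^sup>2 * (w x $ j)\<^sup>2)"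
    unfolding norm_matrix_square by (simp add: tensor_def power_mult_distrib)
  also have "\<dots> = (\<Sum>i\<in>UNIV. (u x $ i)\<^sup>2) * (\<Sum>j\<in>UNIV. (w x $ j)\<^sup>2)" by (simp add: sum_product)
  finally show ?thesis unfolding power2_norm_eq_inner[of "u x"] power2_norm_eq_inner[of "w x"]
    by (simp add: inner_vec_def power2_eq_square)
qed

context domain
begin

abbreviation L4 :: "velocity set" where "L4 \<equiv> Lp_space 4 \<Omega>"
abbreviation n4 :: "velocity \<Rightarrow> real" where "n4 \<equiv> Lp_norm 4 \<Omega>"

lemma L4_iff: "u \<in> L4 \<longleftrightarrow> u \<in> borel_measurable M\<Omega> \<and> integrable M\<Omega> (\<lambda>x. norm (u x) ^ 4)"
  by (simp add: Lp_space_def)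

lemma n4_power4: "n4 u ^ 4 = (LINT x|M\<Omega>. norm (u x) ^ 4)"
proof -
  have "(LINT x|M\<Omega>. norm (u x) ^ 4) \<ge> 0" by simp
  then show ?thesis unfolding Lp_norm_def by (cases "(LINT x|M\<Omega>. norm (u x) ^ 4) = 0")
     (auto simp: powr_power)
qed

text \<open>Minkowski's inequality: the fourth power is convex, and \<open>\<alpha>\<close>, \<open>\<beta>\<close> are slightly larger than the two norms.\<close>

lemma L4_add:
  assumes u: "u \<in> L4" and w: "w \<in> L4"
  shows "(\<lambda>x. u x + w x) \<in> L4" "n4 (\<lambda>x. u x + w x) \<le> n4 u + n4 w"
proof -
  have [measurable]: "u \<in> borel_measurable M\<Omega>" "w \<in> borel_measurable M\<Omega>" using u w by (auto simp: L4_iff)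
  have iu: "integrable M\<Omega> (\<lambda>x. norm (u x) ^ 4)" and iw: "integrable M\<Omega> (\<lambda>x. norm (w x) ^ 4)" using u w by (auto simp: L4_iff)
  have pw: "norm (u x + w x) ^ 4 \<le> (\<alpha> + \<beta>) ^ 4 * (\<alpha> / (\<alpha> + \<beta>) * (norm (u x) ^ 4 / \<alpha> ^ 4) + \<beta> / (\<alpha> + \<beta>) * (norm (w x) ^ 4 / \<beta> ^ 4))"
    if ab: "\<alpha> > 0" "\<beta> > 0" for \<alpha> \<beta> x
  proof -
    have "norm (u x + w x) \<le> norm (u x) + norm (w x)" by (rule norm_triangle_ineq)
    also have "\<dots> = (\<alpha> + \<beta>) * (\<alpha> / (\<alpha> + \<beta>) * (norm (u x) / \<alpha>) + \<beta> / (\<alpha> + \<beta>) * (norm (w x) / \<beta>))"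
    proof -
      have "\<alpha> / (\<alpha> + \<beta>) * (norm (u x) / \<alpha>) = norm (u x) / (\<alpha> + \<beta>)"
        "\<beta> / (\<alpha> + \<beta>) * (norm (w x) / \<beta>) = norm (w x) / (\<alpha> + \<beta>)" using ab by simp_all
      then show ?thesis using ab by (simp add: add_divide_distrib[symmetric])
    qed
    finally have "norm (u x + w x) ^ 4 \<le> ((\<alpha> + \<beta>) * (\<alpha> / (\<alpha> + \<beta>) * (norm (u x) / \<alpha>) + \<beta> / (\<alpha> + \<beta>) * (norm (w x) / \<beta>))) ^ 4"
      by (intro power_mono) auto
    also have "\<dots> = (\<alpha> + \<beta>) ^ 4 * (\<alpha> / (\<alpha> + \<beta>) * (norm (u x) / \<alpha>) + \<beta> / (\<alpha> + \<beta>) * (norm (w x) / \<beta>)) ^ 4"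
      by (rule power_mult_distrib)
    also have "\<dots> \<le> (\<alpha> + \<beta>) ^ 4 * (\<alpha> / (\<alpha> + \<beta>) * (norm (u x) / \<alpha>) ^ 4 + \<beta> / (\<alpha> + \<beta>) * (norm (w x) / \<beta>) ^ 4)"
      using ab by (intro mult_left_mono power4_convex) (auto simp: add_divide_distrib[symmetric])
    finally show ?thesis by (simp add: power_divide)
  qed
  have i: "integrable M\<Omega> (\<lambda>x. norm (u x + w x) ^ 4)"
  proof (rule Bochner_Integration.integrable_bound)
    show "integrable M\<Omega> (\<lambda>x. (1 + 1) ^ 4 * (1 / (1 + 1) * (norm (u x) ^ 4 / 1 ^ 4) + 1 / (1 + 1) * (norm (w x) ^ 4 / 1 ^ 4)))"
      using iu iw by simp
    show "AE x in M\<Omega>. norm (norm (u x + w x) ^ 4) \<le> norm ((1 + 1) ^ 4 * (1 / (1 + 1) * (norm (u x) ^ 4 / 1 ^ 4) + 1 / (1 + 1) * (norm (w x) ^ 4 / 1 ^ 4)))"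
    proof (rule AE_I2)
      fix x show "norm (norm (u x + w x) ^ 4) \<le> norm ((1 + 1) ^ 4 * (1 / (1 + 1) * (norm (u x) ^ 4 / 1 ^ 4) + 1 / (1 + 1) * (norm (w x) ^ 4 / 1 ^ 4)))"
        using pw[of 1 1 x] by simp
    qed
  qed measurable
  then show "(\<lambda>x. u x + w x) \<in> L4" by (simp add: L4_iff)
  have key: "n4 (\<lambda>x. u x + w x) \<le> \<alpha> + \<beta>" if ab: "\<alpha> > n4 u" "\<beta> > n4 w" for \<alpha> \<beta>
  proof -
    have a0: "\<alpha> > 0" "\<beta> > 0" using ab Lp_norm_nonneg[of 4 \<Omega> u] Lp_norm_nonneg[of 4 \<Omega> w] by linarith+
    have "(LINT x|M\<Omega>. norm (u x + w x) ^ 4) \<le> (LINT x|M\<Omega>. (\<alpha> + \<beta>) ^ 4 * (\<alpha> / (\<alpha> + \<beta>) * (norm (u x) ^ 4 / \<alpha> ^ 4) + \<beta> / (\<alpha> + \<beta>) * (norm (w x) ^ 4 / \<beta> ^ 4)))"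
      by (rule integral_mono[OF i _ pw[OF a0]]) (use iu iw in auto)
    also have "\<dots> = (\<alpha> + \<beta>) ^ 4 * (\<alpha> / (\<alpha> + \<beta>) * (n4 u ^ 4 / \<alpha> ^ 4) + \<beta> / (\<alpha> + \<beta>) * (n4 w ^ 4 / \<beta> ^ 4))"
      using iu iw by (simp add: n4_power4)
    also have "\<dots> \<le> (\<alpha> + \<beta>) ^ 4 * (\<alpha> / (\<alpha> + \<beta>) * 1 + \<beta> / (\<alpha> + \<beta>) * 1)"
      using a0 ab by (intro mult_left_mono add_mono) (auto intro!: power_mono)
    also have "\<dots> = (\<alpha> + \<beta>) ^ 4" using a0 by (simp add: add_divide_distrib[symmetric])
    finally have "n4 (\<lambda>x. u x + w x) ^ 4 \<le> (\<alpha> + \<beta>) ^ 4" by (simp add: n4_power4)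
    then show ?thesis by (rule power4_le_imp_le) (use a0 in simp)
  qed
  show "n4 (\<lambda>x. u x + w x) \<le> n4 u + n4 w"
  proof (rule field_le_epsilon)
    fix e :: real assume "e > 0"
    then show "n4 (\<lambda>x. u x + w x) \<le> n4 u + n4 w + e" using key[of "n4 u + e/2" "n4 w + e/2"] by simp
  qed
qed

lemma L4_minus: "u \<in> L4 \<Longrightarrow> (\<lambda>x. - u x) \<in> L4" "n4 (\<lambda>x. - u x) = n4 u"
  by (auto simp: L4_iff Lp_norm_def)

lemma L4_diff: "u \<in> L4 \<Longrightarrow> w \<in> L4 \<Longrightarrow> (\<lambda>x. u x - w x) \<in> L4"
  using L4_add(1)[OF _ L4_minus(1), of u w] by simp

lemma n4_diff_ge:
  assumes "u \<in> L4" "w \<in> L4" shows "n4 u - n4 w \<le> n4 (\<lambda>x. u x - w x)"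
  using L4_add(2)[OF L4_diff[OF assms] assms(2)] by simp

lemma n4_minus_commute: "n4 (\<lambda>x. u x - w x) = n4 (\<lambda>x. w x - u x)"
  by (simp add: Lp_norm_def norm_minus_commute)

lemma sq_int_tensor:
  assumes u: "u \<in> L4" and w: "w \<in> L4"
  shows "sq_int M\<Omega> (tensor u w)" "norm (emb (tensor u w)) \<le> n4 u * n4 w"
proof -
  have [measurable]: "u \<in> borel_measurable M\<Omega>" "w \<in> borel_measurable M\<Omega>" using u w by (auto simp: L4_iff)
  have s: "sq_int M\<Omega> (\<lambda>x. (norm (u x))\<^sup>2)" "sq_int M\<Omega> (\<lambda>x. (norm (w x))\<^sup>2)"
    using u w by (auto simp: sq_int_def L4_iff)
  have nth: "(\<lambda>x. v x $ i) \<in> borel_measurable M\<Omega>" if "v \<in> borel_measurable M\<Omega>" for v :: "real ^ 3 \<Rightarrow> real ^ 3" and i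
    using measurable_compose[OF that borel_measurable_continuous_onI[OF linear_continuous_on[OF bounded_linear_vec_nth]]] .
  have m: "tensor u w \<in> borel_measurable M\<Omega>"
    by (rule measurable_matrixI) (use nth[of u] nth[of w] in \<open>auto simp: tensor_def\<close>)
  show t: "sq_int M\<Omega> (tensor u w)"
    unfolding sq_int_def norm_tensor_square using m integrable_mult_sq_int[OF s] by blast
  have "(norm (emb (tensor u w)))\<^sup>2 = (LINT x|M\<Omega>. (norm (u x))\<^sup>2 * (norm (w x))\<^sup>2)"
    by (simp add: norm_emb[OF t] norm_tensor_square)
  also have "\<dots> \<le> sqrt (LINT x|M\<Omega>. norm (u x) ^ 4) * sqrt (LINT x|M\<Omega>. norm (w x) ^ 4)"
    using Cauchy_Schwarz_integral_real[OF s] by simp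
  also have "\<dots> = sqrt (((n4 u)\<^sup>2)\<^sup>2) * sqrt (((n4 w)\<^sup>2)\<^sup>2)" by (simp add: n4_power4[symmetric])
  also have "\<dots> = (n4 u * n4 w)\<^sup>2" by (simp only: real_sqrt_abs abs_power2 power_mult_distrib)
  finally show "norm (emb (tensor u w)) \<le> n4 u * n4 w" by (rule power2_le_imp_le) simp
qed

lemma trilinear_emb:
  assumes u: "u \<in> L4" and w: "w \<in> L4" and \<psi>: "sq_int M\<Omega> (weak_grad \<Omega> \<psi>)"
  shows "trilinear \<Omega> u \<psi> w = emb (tensor u w) \<bullet> grad_emb \<psi>"
proof -
  note t = sq_int_tensor(1)[OF u w]
  have i: "integrable M\<Omega> (\<lambda>x. u x $ i * weak_grad \<Omega> \<psi> x $ i $ j * w x $ j)" for i j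
    using integrable_mult_sq_int[OF sq_int_nth[OF sq_int_nth[OF t]] sq_int_nth[OF sq_int_nth[OF \<psi>]], of i j i j]
    by (simp add: tensor_def mult_ac)
  have "emb (tensor u w) \<bullet> grad_emb \<psi> = (LINT x|M\<Omega>. tensor u w x \<bullet> weak_grad \<Omega> \<psi> x)"
    unfolding grad_emb_def by (rule inner_emb[OF t \<psi>])
  also have "\<dots> = (LINT x|M\<Omega>. (\<Sum>i\<in>UNIV. \<Sum>j\<in>UNIV. u x $ i * weak_grad \<Omega> \<psi> x $ i $ j * w x $ j))"
    by (rule Bochner_Integration.integral_cong) (auto simp: inner_vec_def tensor_def mult_ac)
  also have "\<dots> = trilinear \<Omega> u \<psi> w"
    unfolding trilinear_def using i by simp
  finally show ?thesis by simp
qed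

text \<open>The matrix field that represents \<open>- B\<^sub>N(u)\<close> as a functional of the gradient of the test function.\<close>

definition conv :: "real \<Rightarrow> velocity \<Rightarrow> matrix_lsq" where
  "conv N u = F_trunc N (n4 u) *\<^sub>R emb (tensor u u)"

lemma B_trunc_conv: "u \<in> L4 \<Longrightarrow> sq_int M\<Omega> (weak_grad \<Omega> \<psi>) \<Longrightarrow> B_trunc \<Omega> N u \<psi> = - (conv N u \<bullet> grad_emb \<psi>)"
  by (simp add: B_trunc_def conv_def trilinear_emb)

text \<open>Outside the ball of radius \<open>N\<close> the truncation turns the quadratic growth of \<open>u \<otimes> u\<close> into linear
  growth; writing the difference with the smaller of the two functions in the last term keeps all
  three terms below \<open>N * n4 (u - w)\<close>.\<close>

lemma conv_Lipschitz:
  assumes N: "N > 0" and u: "u \<in> L4" and w: "w \<in> L4"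
  shows "norm (conv N u - conv N w) \<le> 3 * N * n4 (\<lambda>x. u x - w x)"
proof -
  have main: "norm (conv N u - conv N w) \<le> 3 * N * n4 (\<lambda>x. u x - w x)"
    if u: "u \<in> L4" and w: "w \<in> L4" and le: "n4 w \<le> n4 u" for u w
  proof -
    define d where "d x = u x - w x" for x
    have d: "d \<in> L4" unfolding d_def using L4_diff[OF u w] .
    define a where "a = F_trunc N (n4 u)"
    define b where "b = F_trunc N (n4 w)"
    note s = sq_int_tensor(1)[OF u d] sq_int_tensor(1)[OF d w] sq_int_tensor(1)[OF w w]
    have "tensor u u = (\<lambda>x. (tensor u d x + tensor d w x) + tensor w w x)"
      by (auto simp: fun_eq_iff tensor_def vec_eq_iff d_def algebra_simps)
    then have "emb (tensor u u) = emb (tensor u d) + emb (tensor d w) + emb (tensor w w)"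
      using emb_lin[OF s(1,2), of 1 1] emb_lin[OF sq_int_add[OF s(1,2)] s(3), of 1 1] by simp
    then have eq: "conv N u - conv N w = a *\<^sub>R emb (tensor u d) + a *\<^sub>R emb (tensor d w) + (a - b) *\<^sub>R emb (tensor w w)"
      by (simp add: conv_def a_def b_def algebra_simps)
    note nn = Lp_norm_nonneg[of 4 \<Omega> u] Lp_norm_nonneg[of 4 \<Omega> w] Lp_norm_nonneg[of 4 \<Omega> d]
    note F = F_trunc_bounds[OF N nn(1)]
    have 1: "norm (a *\<^sub>R emb (tensor u d)) \<le> N * n4 d"
    proof -
      have "norm (a *\<^sub>R emb (tensor u d)) \<le> a * (n4 u * n4 d)" using F sq_int_tensor(2)[OF u d] by (simp add: a_def mult_left_mono)
      also have "\<dots> = (a * n4 u) * n4 d" by simp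
      also have "\<dots> \<le> N * n4 d" using F nn by (intro mult_right_mono) (auto simp: a_def)
      finally show ?thesis .
    qed
    have 2: "norm (a *\<^sub>R emb (tensor d w)) \<le> N * n4 d"
    proof -
      have "norm (a *\<^sub>R emb (tensor d w)) \<le> a * (n4 d * n4 w)" using F sq_int_tensor(2)[OF d w] by (simp add: a_def mult_left_mono)
      also have "\<dots> \<le> a * (n4 d * n4 u)" using F nn le by (intro mult_left_mono) (auto simp: a_def)
      also have "\<dots> = (a * n4 u) * n4 d" by simp
      also have "\<dots> \<le> N * n4 d" using F nn by (intro mult_right_mono) (auto simp: a_def)
      finally show ?thesis .
    qed
    have 3: "norm ((a - b) *\<^sub>R emb (tensor w w)) \<le> N * n4 d"
    proof -
      have "norm ((a - b) *\<^sub>R emb (tensor w w)) \<le> \<bar>a - b\<bar> * (n4 w)\<^sup>2"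
        using sq_int_tensor(2)[OF w w] by (simp add: mult_left_mono power2_eq_square)
      also have "\<dots> \<le> N * (n4 u - n4 w)" unfolding a_def b_def by (rule F_trunc_diff[OF N nn(2) le])
      also have "\<dots> \<le> N * n4 d" using N n4_diff_ge[OF u w] by (simp add: d_def[abs_def])
      finally show ?thesis .
    qed
    have "norm (conv N u - conv N w) \<le> norm (a *\<^sub>R emb (tensor u d)) + norm (a *\<^sub>R emb (tensor d w)) + norm ((a - b) *\<^sub>R emb (tensor w w))"
      unfolding eq by (rule order_trans[OF norm_triangle_ineq add_right_mono[OF norm_triangle_ineq]])
    then show ?thesis using 1 2 3 unfolding d_def[abs_def] by simp
  qed
  show ?thesis
  proof (cases "n4 w \<le> n4 u")
    case True then show ?thesis by (rule main[OF u w])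
  next
    case False
    then have "norm (conv N w - conv N u) \<le> 3 * N * n4 (\<lambda>x. w x - u x)" by (intro main[OF w u]) simp
    then show ?thesis by (simp add: norm_minus_commute n4_minus_commute[of u w])
  qed
qed

text \<open>Fatou's lemma extends Ladyzhenskaya's inequality from test functions to their closure.\<close>

lemma V_space_L4:
  assumes u: "u \<in> V_space \<Omega>"
  shows "u \<in> L4" "n4 u ^ 4 \<le> 8 * norm (emb u) * norm (grad_emb u) ^ 3"
proof -
  obtain p where p: "\<And>n. p n \<in> sol_pairs" "p \<longlonglongrightarrow> (emb u, grad_emb u)" using u unfolding V_space_iff closure_sequential by blast
  have "\<forall>n. \<exists>\<phi>. \<phi> \<in> solenoidal_test \<Omega> \<and> p n = (emb \<phi>, grad_emb \<phi>)" using p(1) unfolding sol_pairs_def by blast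
  then obtain \<phi> where \<phi>: "\<And>n. \<phi> n \<in> solenoidal_test \<Omega>" and p\<phi>: "\<And>n. p n = (emb (\<phi> n), grad_emb (\<phi> n))" by metis
  note c = solenoidal_Cc[OF \<phi>] and t = test_function_grad[OF solenoidal_Cc[OF \<phi>]]
  note U = V_spaceD[OF u]
  have l1: "(\<lambda>n. emb (\<phi> n)) \<longlonglongrightarrow> emb u" using tendsto_fst[OF p(2)] by (simp add: p\<phi>)
  have l2: "(\<lambda>n. grad_emb (\<phi> n)) \<longlonglongrightarrow> grad_emb u" using tendsto_snd[OF p(2)] by (simp add: p\<phi>)
  have sd: "sq_int M\<Omega> (\<lambda>x. \<phi> n x - u x)" for n by (rule sq_int_diff[OF t(1) U(2)])
  have "(LINT x|M\<Omega>. norm ((norm (\<phi> n x - u x))\<^sup>2)) = (norm (emb (\<phi> n) - emb u))\<^sup>2" for n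
    using norm_emb[OF sd] emb_diff[OF t(1) U(2)] by simp
  moreover have "(\<lambda>n. (norm (emb (\<phi> n) - emb u))\<^sup>2) \<longlonglongrightarrow> (norm (emb u - emb u))\<^sup>2" by (intro tendsto_intros l1)
  ultimately have "(\<lambda>n. LINT x|M\<Omega>. norm ((norm (\<phi> n x - u x))\<^sup>2)) \<longlonglongrightarrow> 0" by simp
  then obtain r where r: "strict_mono r" "AE x in M\<Omega>. (\<lambda>n. (norm (\<phi> (r n) x - u x))\<^sup>2) \<longlonglongrightarrow> 0"
    using tendsto_L1_AE_subseq[of M\<Omega> "\<lambda>n x. (norm (\<phi> n x - u x))\<^sup>2"] sq_int_norm2[OF sd] by blast
  define cn where "cn n = 8 * norm (emb (\<phi> n)) * norm (grad_emb (\<phi> n)) ^ 3" for n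
  define c0 where "c0 = 8 * norm (emb u) * norm (grad_emb u) ^ 3"
  have cnl: "(\<lambda>n. cn (r n)) \<longlonglongrightarrow> c0"
    using LIMSEQ_subseq_LIMSEQ[OF _ r(1), of cn c0] unfolding cn_def[abs_def] c0_def comp_def
    by (simp add: tendsto_intros l1 l2)
  have qn: "(LINT x|M\<Omega>. norm (\<phi> n x) ^ 4) \<le> cn n" for n
  proof (rule power2_le_imp_le)
    have "(LINT x|M\<Omega>. norm (\<phi> n x) ^ 4)\<^sup>2 \<le> 64 * (norm (emb (\<phi> n)))\<^sup>2 * ((norm (grad_emb (\<phi> n)))\<^sup>2) ^ 3"
      using ladyzhenskaya_test_function(2)[OF c] t by (simp add: norm_emb test_H1(2)[OF c])
    also have "\<dots> = (cn n)\<^sup>2" by (simp add: cn_def power_mult_distrib flip: power_mult)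
    finally show "(LINT x|M\<Omega>. norm (\<phi> n x) ^ 4)\<^sup>2 \<le> (cn n)\<^sup>2" .
  qed (simp add: cn_def)
  have um [measurable]: "u \<in> borel_measurable M\<Omega>" using U(2) by (rule sq_int_measurable)
  have [measurable]: "\<phi> n \<in> borel_measurable M\<Omega>" for n using t(1) by (rule sq_int_measurable)
  have "(\<integral>\<^sup>+x. ennreal (norm (u x) ^ 4) \<partial>M\<Omega>) = (\<integral>\<^sup>+x. liminf (\<lambda>n. ennreal (norm (\<phi> (r n) x) ^ 4)) \<partial>M\<Omega>)"
  proof (rule nn_integral_cong_AE, use r(2) in eventually_elim)
    fix x assume "(\<lambda>n. (norm (\<phi> (r n) x - u x))\<^sup>2) \<longlonglongrightarrow> 0"
    then have "(\<lambda>n. sqrt ((norm (\<phi> (r n) x - u x))\<^sup>2)) \<longlonglongrightarrow> sqrt 0" by (intro tendsto_intros)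
    then have "(\<lambda>n. \<phi> (r n) x) \<longlonglongrightarrow> u x" by (simp add: tendsto_norm_zero_iff LIM_zero_iff)
    then have "(\<lambda>n. ennreal (norm (\<phi> (r n) x) ^ 4)) \<longlonglongrightarrow> ennreal (norm (u x) ^ 4)" by (intro tendsto_intros)
    then show "ennreal (norm (u x) ^ 4) = liminf (\<lambda>n. ennreal (norm (\<phi> (r n) x) ^ 4))"
      by (metis lim_imp_Liminf trivial_limit_sequentially)
  qed
  also have "\<dots> \<le> liminf (\<lambda>n. \<integral>\<^sup>+x. ennreal (norm (\<phi> (r n) x) ^ 4) \<partial>M\<Omega>)" by (rule nn_integral_liminf) measurable
  also have "\<dots> \<le> liminf (\<lambda>n. ennreal (cn (r n)))"
  proof (rule Liminf_mono, rule always_eventually, rule allI)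
    fix n
    have "(\<integral>\<^sup>+x. ennreal (norm (\<phi> (r n) x) ^ 4) \<partial>M\<Omega>) = ennreal (LINT x|M\<Omega>. norm (\<phi> (r n) x) ^ 4)"
      by (rule nn_integral_eq_integral[OF ladyzhenskaya_test_function(1)[OF c]]) simp
    also have "\<dots> \<le> ennreal (cn (r n))" by (rule ennreal_leI[OF qn])
    finally show "(\<integral>\<^sup>+x. ennreal (norm (\<phi> (r n) x) ^ 4) \<partial>M\<Omega>) \<le> ennreal (cn (r n))" .
  qed
  also have "\<dots> = ennreal c0"
    by (rule lim_imp_Liminf) (use tendsto_ennrealI[OF cnl] in auto)
  finally have fin: "(\<integral>\<^sup>+x. ennreal (norm (u x) ^ 4) \<partial>M\<Omega>) \<le> ennreal c0" .
  have i: "integrable M\<Omega> (\<lambda>x. norm (u x) ^ 4)"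
    by (rule integrableI_bounded) (use fin in \<open>auto simp: less_top[symmetric] top_unique\<close>)
  then show "u \<in> L4" by (simp add: L4_iff)
  have "ennreal (LINT x|M\<Omega>. norm (u x) ^ 4) \<le> ennreal c0"
    using fin nn_integral_eq_integral[OF i] by simp
  then show "n4 u ^ 4 \<le> 8 * norm (emb u) * norm (grad_emb u) ^ 3"
    unfolding n4_power4 c0_def by (subst (asm) ennreal_le_iff) auto
qed

text \<open>If \<open>\<parallel>u\<parallel> \<le> \<delta> \<parallel>\<nabla>u\<parallel>\<close> with \<open>8 \<delta> = e\<^sup>4\<close>, the gradient term alone suffices in Ladyzhenskaya's inequality;
  otherwise \<open>\<parallel>\<nabla>u\<parallel> < \<parallel>u\<parallel> / \<delta>\<close>, and the other term does.\<close>

lemma n4_interpolation: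
  assumes e: "e > 0"
  obtains C where "C \<ge> 0" "\<And>u. u \<in> V_space \<Omega> \<Longrightarrow> n4 u \<le> e * norm (grad_emb u) + C * norm (emb u)"
proof -
  define \<delta> where "\<delta> = e ^ 4 / 8"
  have \<delta>: "\<delta> > 0" using e by (simp add: \<delta>_def)
  define C where "C = 1 + 8 / \<delta> ^ 3"
  have C1: "C \<ge> 1" using \<delta> by (simp add: C_def)
  have C4: "8 / \<delta> ^ 3 \<le> C ^ 4"
  proof -
    have "8 / \<delta> ^ 3 \<le> C" by (simp add: C_def)
    also have "C ^ 1 \<le> C ^ 4" using C1 by (intro power_increasing) auto
    finally show ?thesis by simp
  qed
  have "n4 u \<le> e * norm (grad_emb u) + C * norm (emb u)" if u: "u \<in> V_space \<Omega>" for u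
  proof -
    define a where "a = norm (emb u)"
    define b where "b = norm (grad_emb u)"
    have nn: "a \<ge> 0" "b \<ge> 0" by (auto simp: a_def b_def)
    have "8 * a * b ^ 3 \<le> (e * b + C * a) ^ 4"
    proof (cases "a \<le> \<delta> * b")
      case True
      then have "8 * a * b ^ 3 \<le> 8 * (\<delta> * b) * b ^ 3" using nn by (intro mult_right_mono mult_left_mono) auto
      also have "\<dots> = (e * b) ^ 4" by (simp add: \<delta>_def power_mult_distrib eval_nat_numeral)
      also have "\<dots> \<le> (e * b + C * a) ^ 4" using nn e C1 by (intro power_mono) auto
      finally show ?thesis .
    next
      case False
      then have "b \<le> a / \<delta>" using \<delta> by (simp add: field_simps)
      then have "8 * a * b ^ 3 \<le> 8 * a * (a / \<delta>) ^ 3" using nn by (intro mult_left_mono power_mono) auto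
      also have "\<dots> = (8 / \<delta> ^ 3) * a ^ 4" by (simp add: power_divide eval_nat_numeral)
      also have "\<dots> \<le> C ^ 4 * a ^ 4" by (intro mult_right_mono C4) simp
      also have "\<dots> = (C * a) ^ 4" by (simp add: power_mult_distrib)
      also have "\<dots> \<le> (e * b + C * a) ^ 4" using nn e C1 by (intro power_mono) auto
      finally show ?thesis .
    qed
    then have "n4 u ^ 4 \<le> (e * b + C * a) ^ 4" using V_space_L4(2)[OF u] by (simp add: a_def b_def)
    then have "n4 u \<le> e * b + C * a"
      by (rule power4_le_imp_le) (use nn e C1 in auto)
    then show ?thesis by (simp add: a_def b_def)
  qed
  then show ?thesis using that[of C] C1 by simp
qed

end

section \<open>Measurability of functions with values in a function space\<close>

lemma measurable_time_AE:
  fixes f g :: "real \<Rightarrow> 'b::topological_space"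
  assumes "f \<in> borel_measurable (time \<tau>)" "AE t in time \<tau>. f t = g t"
  shows "g \<in> borel_measurable (time \<tau>)"
  by (rule measurable_lebesgue_on_AE[OF _ assms]) auto

lemma measurable_time_AE_lim:
  fixes f :: "nat \<Rightarrow> real \<Rightarrow> 'b::{banach,second_countable_topology}"
  assumes "\<And>n. f n \<in> borel_measurable (time \<tau>)" "AE t in time \<tau>. (\<lambda>n. f n t) \<longlonglongrightarrow> g t"
  shows "g \<in> borel_measurable (time \<tau>)"
proof (rule measurable_time_AE)
  show "(\<lambda>t. lim (\<lambda>n. f n t)) \<in> borel_measurable (time \<tau>)"
    by (rule borel_measurable_lim_metric) (rule assms)
  show "AE t in time \<tau>. lim (\<lambda>n. f n t) = g t"
    using assms(2) by eventually_elim (rule limI)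
qed

lemma integral_time_AE:
  fixes f g :: "real \<Rightarrow> real"
  assumes "integrable (time \<tau>) f" "AE t in time \<tau>. f t = g t"
  shows "integrable (time \<tau>) g" "(LINT t|time \<tau>. g t) = (LINT t|time \<tau>. f t)"
proof -
  have m: "f \<in> borel_measurable (time \<tau>)" "g \<in> borel_measurable (time \<tau>)"
    using assms(1) measurable_time_AE[OF _ assms(2)] by auto
  show "integrable (time \<tau>) g" by (rule integrable_cong_AE_imp[OF assms(1) m(2)]) (use assms(2) in auto)
  show "(LINT t|time \<tau>. g t) = (LINT t|time \<tau>. f t)"
    by (rule integral_cong_AE[OF m(2) m(1)]) (use assms(2) in auto)
qed

lemma continuous_on_half_line:
  fixes w :: "real \<Rightarrow> 'b::topological_space"
  assumes "\<And>\<tau>. \<tau> > 0 \<Longrightarrow> continuous_on {0..\<tau>} w" shows "continuous_on {0..} w"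
  unfolding continuous_on_eq_continuous_within
proof
  fix t :: real assume t: "t \<in> {0..}"
  have "continuous (at t within {0..t + 1}) w"
    using assms[of "t + 1"] t unfolding continuous_on_eq_continuous_within by simp
  moreover have "at t within {0..} = at t within {0..t + 1}"
    by (rule at_within_nhd[of t "{..<t + 1}"]) auto
  ultimately show "continuous (at t within {0..}) w" by simp
qed

lemma AE_half_line:
  assumes "\<And>\<tau>. \<tau> > 0 \<Longrightarrow> AE t in time \<tau>. Q t"
  shows "AE t in lebesgue_on {0..}. Q t"
proof -
  have "AE t in lebesgue. \<forall>n. t \<in> {0..real (Suc n)} \<longrightarrow> Q t"
    using assms[of "real (Suc _)"] by (subst AE_all_countable) (auto simp: AE_restrict_space_iff)
  then have "AE t in lebesgue. t \<in> {0..} \<longrightarrow> Q t"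
  proof eventually_elim
    fix t :: real assume a: "\<forall>n. t \<in> {0..real (Suc n)} \<longrightarrow> Q t"
    show "t \<in> {0..} \<longrightarrow> Q t"
    proof
      assume "t \<in> {0..}"
      moreover have "t \<le> real (Suc (nat \<lceil>t\<rceil>))"
        using real_nat_ceiling_ge[of t] unfolding of_nat_Suc by linarith
      ultimately have "t \<in> {0..real (Suc (nat \<lceil>t\<rceil>))}" by (simp del: of_nat_Suc)
      then show "Q t" using a by blast
    qed
  qed
  then show ?thesis by (simp add: AE_restrict_space_iff)
qed

lemma AE_half_line_time:
  assumes "AE t in lebesgue_on {0..}. Q t" shows "AE t in time \<tau>. Q t"
  using assms by (auto simp: AE_restrict_space_iff elim!: eventually_mono)

section \<open>The distributional time derivative\<close>

lemma test_function_time: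
  assumes \<eta>: "\<eta> \<in> Cc_infinity {0::real<..}"
  shows "(\<eta> has_real_derivative deriv \<eta> t) (at t)" "continuous_on A (deriv \<eta>)" "smooth (deriv \<eta>)"
    "\<exists>\<tau>>0. \<forall>t. t \<notin> {0<..<\<tau>} \<longrightarrow> \<eta> t = 0 \<and> deriv \<eta> t = 0"
proof -
  have s: "smooth \<eta>" using \<eta> by (simp add: Cc_infinity_iff)
  have d: "(\<eta> has_real_derivative dir_deriv 1 \<eta> t) (at t)" for t
  proof -
    have "(\<eta> has_derivative frechet_derivative \<eta> (at t)) (at t)"
      using smooth_differentiable[OF s] frechet_derivative_works by blast
    then obtain D where D: "(\<eta> has_real_derivative D) (at t)"
      using frechet_derivative_works differentiable_def real_differentiable_def
      by (metis has_real_derivative_iff)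
    have "dir_deriv 1 \<eta> t = D" using has_derivative_dir_deriv[OF D[unfolded has_field_derivative_def], of 1] by simp
    then show ?thesis using D by simp
  qed
  have de: "deriv \<eta> = dir_deriv 1 \<eta>" using DERIV_imp_deriv[OF d] by (rule ext)
  show "(\<eta> has_real_derivative deriv \<eta> t) (at t)" using d by (simp add: de)
  show sm: "smooth (deriv \<eta>)" unfolding de by (rule smooth_dir_deriv[OF s]) simp
  then show "continuous_on A (deriv \<eta>)" by (rule smooth_continuous)
  obtain K where K: "compact K" "K \<subseteq> {0<..}" "\<forall>x. x \<notin> K \<longrightarrow> \<eta> x = 0" using \<eta> unfolding Cc_infinity_iff by blast
  obtain B where B: "\<And>x. x \<in> K \<Longrightarrow> norm x \<le> B" using compact_imp_bounded[OF K(1)] bounded_iff by metis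
  define \<tau> where "\<tau> = \<bar>B\<bar> + 1"
  have "t \<notin> K" if "t \<notin> {0<..<\<tau>}" for t
  proof
    assume "t \<in> K"
    then show False using B[of t] K(2) that by (auto simp: \<tau>_def)
  qed
  then show "\<exists>\<tau>>0. \<forall>t. t \<notin> {0<..<\<tau>} \<longrightarrow> \<eta> t = 0 \<and> deriv \<eta> t = 0"
    using K(3) dir_deriv_zero_outside[OF compact_imp_closed[OF K(1)] K(3)]
    by (intro exI[of _ \<tau>]) (auto simp: de \<tau>_def)
qed

lemma integral_positive_half_line:
  fixes g :: "real \<Rightarrow> real"
  assumes "\<And>t. t \<notin> {0<..<\<tau>} \<Longrightarrow> g t = 0"
  shows "(LINT t|lebesgue_on {0<..}. g t) = (LINT t|time \<tau>. g t)"
proof -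
  have "(LINT t|lebesgue_on {0<..}. g t) = (LINT t|lebesgue. g t)"
    by (rule integral_lebesgue_on_support) (use assms in auto)
  also have "\<dots> = (LINT t|time \<tau>. g t)"
    by (rule integral_lebesgue_on_support[symmetric]) (use assms in auto)
  finally show ?thesis .
qed

lemma vint_deriv_test:
  assumes \<eta>: "\<eta> \<in> Cc_infinity {0::real<..}" and t: "t \<ge> 0"
  shows "integrable (time t) (deriv \<eta>)" "vint (deriv \<eta>) t = \<eta> t"
proof -
  note T = test_function_time[OF \<eta>]
  show i: "integrable (time t) (deriv \<eta>)" by (rule continuous_imp_integrable_real[OF T(2)])
  have "\<eta> 0 = 0" using T(4) by auto
  have "vint (deriv \<eta>) t = integral {0..t} (deriv \<eta>)"
    unfolding vint_def by (rule lebesgue_integral_eq_integral[OF i]) auto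
  also have "(deriv \<eta> has_integral (\<eta> t - \<eta> 0)) {0..t}"
    by (rule fundamental_theorem_of_calculus[OF t])
      (use T(1) in \<open>auto simp: has_real_derivative_iff_has_vector_derivative intro: has_vector_derivative_at_within\<close>)
  then have "integral {0..t} (deriv \<eta>) = \<eta> t" using \<open>\<eta> 0 = 0\<close> by (simp add: integral_unique)
  finally show "vint (deriv \<eta>) t = \<eta> t" .
qed

lemma test_integration_by_parts:
  fixes h :: "real \<Rightarrow> real"
  assumes \<eta>: "\<eta> \<in> Cc_infinity {0::real<..}" and h: "\<And>\<tau>. \<tau> > 0 \<Longrightarrow> integrable (time \<tau>) h"
    and y: "\<And>t. t \<ge> 0 \<Longrightarrow> y t = y0 + vint h t"
  shows "(LINT t|lebesgue_on {0<..}. deriv \<eta> t * y t) = - (LINT t|lebesgue_on {0<..}. \<eta> t * h t)"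
proof -
  note T = test_function_time[OF \<eta>]
  obtain \<tau> where \<tau>: "\<tau> > 0" "\<And>t. t \<notin> {0<..<\<tau>} \<Longrightarrow> \<eta> t = 0 \<and> deriv \<eta> t = 0" using T(4) by blast
  note V = vint_deriv_test[OF \<eta>] and hi = h[OF \<tau>(1)]
  have z: "vint (deriv \<eta>) \<tau> = 0" using V(2)[of \<tau>] \<tau> by simp
  have "(LINT t|lebesgue_on {0<..}. deriv \<eta> t * y t) = (LINT t|time \<tau>. deriv \<eta> t * y t)"
    by (rule integral_positive_half_line) (use \<tau> in simp)
  also have "\<dots> = (LINT t|time \<tau>. deriv \<eta> t * y0 + deriv \<eta> t \<bullet> vint h t)"
    by (rule Bochner_Integration.integral_cong) (use y in \<open>auto simp: algebra_simps\<close>)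
  also have "\<dots> = vint (deriv \<eta>) \<tau> * y0 + (LINT t|time \<tau>. deriv \<eta> t \<bullet> vint h t)"
    using V(1)[of \<tau>] \<tau> integrable_continuous_inner(2)[OF continuous_vint[OF hi] V(1)]
    by (subst Bochner_Integration.integral_add) (auto simp: vint_def)
  also have "\<dots> = - (LINT t|time \<tau>. vint (deriv \<eta>) t \<bullet> h t)"
    using vint_product_rule[OF V(1) hi] z \<tau>(1) by simp
  also have "(LINT t|time \<tau>. vint (deriv \<eta>) t \<bullet> h t) = (LINT t|time \<tau>. \<eta> t * h t)"
    by (rule Bochner_Integration.integral_cong) (use V(2) in auto)
  also have "\<dots> = (LINT t|lebesgue_on {0<..}. \<eta> t * h t)"
    by (rule integral_positive_half_line[symmetric]) (use \<tau> in simp)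
  finally show ?thesis .
qed

text \<open>The primitive vanishes to the left of the support of \<open>\<sigma>\<close>, and to the right because \<open>\<sigma>\<close> has mean zero.\<close>

lemma antiderivative_test:
  fixes \<sigma> :: "real \<Rightarrow> real"
  assumes \<sigma>: "\<sigma> \<in> Cc_infinity {0<..}" and z: "(LINT t|lebesgue_on {0<..}. \<sigma> t) = 0"
  obtains \<eta> where "\<eta> \<in> Cc_infinity {0<..}" "deriv \<eta> = \<sigma>"
proof -
  have s: "smooth \<sigma>" using \<sigma> by (simp add: Cc_infinity_iff)
  obtain K where K: "compact K" "K \<subseteq> {0<..}" "\<forall>x. x \<notin> K \<longrightarrow> \<sigma> x = 0" using \<sigma> unfolding Cc_infinity_iff by blast
  obtain B where B: "\<And>x. x \<in> K \<Longrightarrow> norm x \<le> B" using compact_imp_bounded[OF K(1)] bounded_iff by metis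
  obtain \<alpha> where \<alpha>: "\<alpha> > 0" "\<And>x. x \<in> K \<Longrightarrow> \<alpha> \<le> x"
  proof (cases "K = {}")
    case True then show ?thesis using that[of 1] by simp
  next
    case False
    obtain m where m: "m \<in> K" "\<forall>x\<in>K. m \<le> x" using compact_attains_inf[OF K(1) False] by blast
    then show ?thesis using that[of m] K(2) by auto
  qed
  define b where "b = \<bar>B\<bar> + \<alpha> + 1"
  have out: "\<sigma> t = 0" if "t < \<alpha> \<or> t > b" for t
    using K(3) \<alpha> B[of t] that by (force simp: b_def)
  have c: "continuous_on A \<sigma>" for A by (rule smooth_continuous[OF s])
  have int: "\<sigma> integrable_on {p..q}" for p q by (rule integrable_continuous_interval[OF c])
  define \<eta> where "\<eta> t = integral {-1..t} \<sigma>" for t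
  have low: "\<eta> t = 0" if "t < \<alpha>" for t
  proof -
    have "\<eta> t = integral {-1..t} (\<lambda>_. 0)" unfolding \<eta>_def by (rule integral_cong) (use out that in auto)
    then show ?thesis by simp
  qed
  have hi0: "integral {-1..b} \<sigma> = 0"
  proof -
    have "0 = (LINT t|lebesgue. \<sigma> t)" using z integral_lebesgue_on_support[of "{0<..}" \<sigma>] out \<alpha> by force
    also have "\<dots> = (LINT t|lebesgue_on {-1..b}. \<sigma> t)"
      by (rule integral_lebesgue_on_support[symmetric]) (use out \<alpha>(1) in force)+
    also have "\<dots> = integral {-1..b} \<sigma>"
      by (rule lebesgue_integral_eq_integral) (use continuous_imp_integrable_real[OF c] in auto)
    finally show ?thesis by simp
  qed
  have high: "\<eta> t = 0" if "t > b" for t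
  proof -
    have "\<eta> t = integral {-1..b} \<sigma> + integral {b..t} \<sigma>"
      unfolding \<eta>_def by (rule Henstock_Kurzweil_Integration.integral_combine[symmetric]) (use that \<alpha>(1) int in \<open>auto simp: b_def\<close>)
    moreover have "integral {b..t} \<sigma> = integral {b..t} (\<lambda>_. 0)"
    proof (rule integral_spike[of "{b}"])
      show "negligible {b}" by simp
    qed (use out in auto)
    ultimately show ?thesis using hi0 by simp
  qed
  have D: "(\<eta> has_real_derivative \<sigma> t) (at t)" for t
  proof (cases "t < \<alpha>")
    case True
    have "((\<lambda>_. 0) has_real_derivative \<sigma> t) (at t)" using out True by simp
    then show ?thesis
      by (rule has_field_derivative_transform_within_open[of _ _ _ "{..<\<alpha>}"]) (use True low in auto)
  next
    case False
    then have t: "t \<in> {-1..t+1}" "t > -1" using \<alpha>(1) by auto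
    have "((\<lambda>u. integral {-1..u} \<sigma>) has_real_derivative \<sigma> t) (at t within {-1..t+1})"
      by (rule integral_has_real_derivative[OF c t(1)])
    moreover have "at t within {-1..t+1} = at t" by (rule at_within_interior) (use t in auto)
    ultimately show ?thesis unfolding \<eta>_def[abs_def] by simp
  qed
  have "smooth \<eta>"
  proof (rule smoothI[of \<eta> "insert \<eta> {g. smooth g}"])
    fix g assume "g \<in> insert \<eta> {g. smooth g}"
    then consider "g = \<eta>" | "smooth g" by blast
    then show "\<exists>D. (\<forall>x. (g has_derivative D x) (at x)) \<and> (\<forall>e\<in>Basis. (\<lambda>x. D x e) \<in> insert \<eta> {g. smooth g})"
    proof cases
      case 1
      then show ?thesis using D s unfolding has_field_derivative_def
        by (intro exI[of _ "\<lambda>x h. \<sigma> x * h"]) auto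
    next
      case 2
      have "(g has_derivative frechet_derivative g (at x)) (at x)" for x
        using smooth_differentiable[OF 2] frechet_derivative_works by blast
      moreover have "smooth (\<lambda>x. frechet_derivative g (at x) e)" if "e \<in> Basis" for e
        using smooth_dir_deriv[OF 2 that] unfolding dir_deriv_def[abs_def] .
      ultimately show ?thesis by (intro exI[of _ "\<lambda>x. frechet_derivative g (at x)"]) auto
    qed
  qed simp
  then have "\<eta> \<in> Cc_infinity {0<..}" unfolding Cc_infinity_iff
    using low high \<alpha>(1) by (intro conjI exI[of _ "{\<alpha>..b}"]) (auto simp: not_le)
  moreover have "deriv \<eta> = \<sigma>" using DERIV_imp_deriv[OF D] by (rule ext)
  ultimately show ?thesis by (rule that)
qed

lemma loc_integrable_const: "loc_integrable S (\<lambda>_::'a::euclidean_space. r)"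
  unfolding loc_integrable_def set_integrable_def
proof (intro allI impI)
  fix K :: "'a set" assume "compact K \<and> K \<subseteq> S"
  then have i: "integrable lborel (\<lambda>x. indicator K x *\<^sub>R r)" by (intro borel_integrable_compact) auto
  then show "integrable lebesgue (\<lambda>x. indicator K x *\<^sub>R r)"
    using integrable_completion[of "\<lambda>x. indicator K x *\<^sub>R r" lborel] by auto
qed

text \<open>A continuous function whose distributional derivative vanishes is constant: subtracting a
  multiple of a fixed bump makes every test function the derivative of a test function.\<close>

lemma constant_if_weak_derivative_zero:
  fixes z :: "real \<Rightarrow> real"
  assumes c: "continuous_on {0..} z"
    and 0: "\<And>\<eta>. \<eta> \<in> Cc_infinity {0<..} \<Longrightarrow> (LINT t|lebesgue_on {0<..}. deriv \<eta> t * z t) = 0"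
    and t: "t \<ge> 0"
  shows "z t = z 0"
proof -
  define I where "I g = (LINT t|lebesgue_on {0<..}. g t)" for g :: "real \<Rightarrow> real"
  define \<theta> where "\<theta> = box_bump 1 (2::real) 0"
  have \<theta>: "\<theta> \<in> Cc_infinity {0<..}" unfolding \<theta>_def by (rule box_bump_Cc_infinity) auto
  have loc: "loc_integrable {0<..} z"
    unfolding loc_integrable_def set_integrable_def
  proof (intro allI impI)
    fix K :: "real set" assume K: "compact K \<and> K \<subseteq> {0<..}"
    have "continuous_on K z" by (rule continuous_on_subset[OF c]) (use K in auto)
    then have i: "integrable lborel (\<lambda>x. indicator K x *\<^sub>R z x)" using K by (intro borel_integrable_compact) auto
    then show "integrable lebesgue (\<lambda>x. indicator K x *\<^sub>R z x)"
      using integrable_completion[of "\<lambda>x. indicator K x *\<^sub>R z x" lborel] by auto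
  qed
  have int: "integrable (lebesgue_on {0<..}) (\<lambda>t. z t * \<phi> t)" "integrable (lebesgue_on {0<..}) \<phi>"
    if \<phi>: "\<phi> \<in> Cc_infinity {0<..}" for \<phi>
  proof -
    obtain K where K: "compact K" "K \<subseteq> {0<..}" "\<forall>x. x \<notin> K \<longrightarrow> \<phi> x = 0" using \<phi> unfolding Cc_infinity_iff by blast
    have cp: "continuous_on UNIV \<phi>" using \<phi> by (intro smooth_continuous) (simp add: Cc_infinity_iff)
    show "integrable (lebesgue_on {0<..}) (\<lambda>t. z t * \<phi> t)"
      by (rule integrable_lebesgue_on[OF _ integrable_loc_times_compact_support[OF loc K(1,2) _ cp]]) (use K in auto)
    have "loc_integrable {0<..} (\<lambda>_::real. 1)" by (rule loc_integrable_const)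
    from integrable_lebesgue_on[OF _ integrable_loc_times_compact_support[OF this K(1,2) _ cp]]
    show "integrable (lebesgue_on {0<..}) \<phi>" using K by auto
  qed
  have I\<theta>: "I \<theta> > 0"
  proof -
    have nn: "\<theta> t \<ge> 0" for t by (simp add: \<theta>_def box_bump_bounds)
    have "I \<theta> \<noteq> 0"
    proof
      assume "I \<theta> = 0"
      then have "AE t in lebesgue_on {0<..}. \<theta> t = 0"
        using integral_nonneg_eq_0_iff_AE[OF int(2)[OF \<theta>]] nn by (simp add: I_def)
      then have "AE t in lebesgue. t \<in> {0<..} \<longrightarrow> \<theta> t = 0" by (simp add: AE_restrict_space_iff)
      then have "AE t in time 2. \<theta> t = 0" by (auto simp: AE_restrict_space_iff \<theta>_def box_bump_outside elim!: eventually_mono)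
      moreover have "continuous_on {0..2} \<theta>" unfolding \<theta>_def by (rule smooth_continuous[OF box_bump_smooth])
      ultimately have "\<theta> (3/2) = 0" using continuous_AE_eq_imp_eq[of 2 \<theta> "\<lambda>_. 0" "3/2"] by simp
      then show False by (simp add: \<theta>_def box_bump_def flat_def)
    qed
    moreover have "I \<theta> \<ge> 0" unfolding I_def using nn by simp
    ultimately show ?thesis by simp
  qed
  \<comment> \<open>The mean value of z with respect to the bump is the only possible value of the constant.\<close>
  define k where "k = I (\<lambda>t. z t * \<theta> t) / I \<theta>"
  have ae: "AE t in lebesgue_on {0<..}. z t - k = 0"
  proof (rule AE_zero_if_orthogonal_to_test_functions)
    show "open {0::real<..}" by simp
    have "loc_integrable {0<..} (\<lambda>_::real. k)" by (rule loc_integrable_const)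
    from loc_integrable_linear_combination[OF loc this, of 1 "-1"]
    show "loc_integrable {0<..} (\<lambda>t. z t - k)" by simp
    fix \<phi> :: "real \<Rightarrow> real" assume \<phi>: "\<phi> \<in> Cc_infinity {0<..}"
    define m where "m = I \<phi> / I \<theta>"
    have \<sigma>: "(\<lambda>t. 1 *\<^sub>R \<phi> t + (- m) *\<^sub>R \<theta> t) \<in> Cc_infinity {0<..}" by (rule Cc_infinity_linear_combination[OF \<phi> \<theta>])
    have "(LINT t|lebesgue_on {0<..}. 1 *\<^sub>R \<phi> t + (- m) *\<^sub>R \<theta> t) = I \<phi> - m * I \<theta>"
      using int(2)[OF \<phi>] int(2)[OF \<theta>] by (simp add: I_def)
    also have "\<dots> = 0" using I\<theta> by (simp add: m_def)
    finally obtain \<eta> where "\<eta> \<in> Cc_infinity {0<..}" "deriv \<eta> = (\<lambda>t. 1 *\<^sub>R \<phi> t + (- m) *\<^sub>R \<theta> t)"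
      using antiderivative_test[OF \<sigma>] by blast
    from 0[OF this(1), unfolded this(2)]
    have "0 = (LINT t|lebesgue_on {0<..}. z t * \<phi> t - m * (z t * \<theta> t))" by (simp add: algebra_simps)
    also have "\<dots> = I (\<lambda>t. z t * \<phi> t) - m * I (\<lambda>t. z t * \<theta> t)"
      using int(1)[OF \<phi>] int(1)[OF \<theta>] by (simp add: I_def)
    also have "m * I (\<lambda>t. z t * \<theta> t) = k * I \<phi>" by (simp add: m_def k_def)
    also have "I (\<lambda>t. z t * \<phi> t) - k * I \<phi> = (LINT t|lebesgue_on {0<..}. z t * \<phi> t - k * \<phi> t)"
      using int[OF \<phi>] by (simp add: I_def)
    finally show "(LINT x|lebesgue_on {0<..}. (z x - k) * \<phi> x) = 0" by (simp add: algebra_simps)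
  qed
  have ae': "AE s in time (t + 1). z s = k"
  proof -
    have "AE s in lebesgue. s \<noteq> (0::real)"
      by (rule AE_I'[of "{0}"]) (auto simp: negligible_iff_null_sets[symmetric])
    moreover have "AE s in lebesgue. s \<in> {0<..} \<longrightarrow> z s - k = 0" using ae by (simp add: AE_restrict_space_iff)
    ultimately have "AE s in lebesgue. s \<in> {0..t+1} \<longrightarrow> z s = k" by eventually_elim auto
    then show ?thesis by (simp add: AE_restrict_space_iff)
  qed
  have "z s = k" if "s \<in> {0..t+1}" for s
    by (rule continuous_AE_eq_imp_eq[OF continuous_on_subset[OF c] continuous_on_const _ ae' that]) (use t in auto)
  then show ?thesis using t by simp
qed

lemma integral_form_if_weak_derivative:
  fixes y h :: "real \<Rightarrow> real"
  assumes c: "continuous_on {0..} y" and h: "\<And>\<tau>. \<tau> > 0 \<Longrightarrow> integrable (time \<tau>) h"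
    and w: "\<And>\<eta>. \<eta> \<in> Cc_infinity {0<..} \<Longrightarrow>
      (LINT t|lebesgue_on {0<..}. deriv \<eta> t * y t) = - (LINT t|lebesgue_on {0<..}. \<eta> t * h t)"
    and t: "t \<ge> 0"
  shows "y t = y 0 + vint h t"
proof -
  define z where "z t = y t - vint h t" for t
  have cv: "continuous_on {0..} (vint h)" by (rule continuous_on_half_line[OF continuous_vint[OF h]])
  have "z t = z 0"
  proof (rule constant_if_weak_derivative_zero[OF _ _ t])
    show cz: "continuous_on {0..} z" unfolding z_def by (intro continuous_intros c cv)
    fix \<eta> :: "real \<Rightarrow> real" assume \<eta>: "\<eta> \<in> Cc_infinity {0<..}"
    note T = test_function_time[OF \<eta>]
    obtain \<tau> where \<tau>: "\<tau> > 0" "\<And>t. t \<notin> {0<..<\<tau>} \<Longrightarrow> \<eta> t = 0 \<and> deriv \<eta> t = 0" using T(4) by blast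
    have V: "(LINT t|lebesgue_on {0<..}. deriv \<eta> t * vint h t) = - (LINT t|lebesgue_on {0<..}. \<eta> t * h t)"
      by (rule test_integration_by_parts[OF \<eta> h, of "vint h" 0]) auto
    have i: "integrable (time \<tau>) (\<lambda>t. deriv \<eta> t * g t)" if "continuous_on {0..} g" for g
      by (intro continuous_imp_integrable_real continuous_intros T(2) continuous_on_subset[OF that]) auto
    have half: "(LINT t|lebesgue_on {0<..}. deriv \<eta> t * g t) = (LINT t|time \<tau>. deriv \<eta> t * g t)" for g
      by (rule integral_positive_half_line) (use \<tau> in simp)
    have "(LINT t|lebesgue_on {0<..}. deriv \<eta> t * z t) = (LINT t|time \<tau>. deriv \<eta> t * y t - deriv \<eta> t * vint h t)"
      unfolding half by (simp add: z_def right_diff_distrib)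
    also have "\<dots> = (LINT t|time \<tau>. deriv \<eta> t * y t) - (LINT t|time \<tau>. deriv \<eta> t * vint h t)"
      by (rule Bochner_Integration.integral_diff[OF i[OF c] i[OF cv]])
    also have "\<dots> = 0" using w[OF \<eta>] V unfolding half by simp
    finally show "(LINT t|lebesgue_on {0<..}. deriv \<eta> t * z t) = 0" .
  qed
  then show ?thesis by (simp add: z_def)
qed

section \<open>The Navier--Stokes nonlinearity as a semilinear perturbation\<close>

lemma measurable_time_nonpos:
  fixes f :: "real \<Rightarrow> 'b::topological_space"
  assumes "\<tau> \<le> 0" shows "f \<in> borel_measurable (time \<tau>)"
proof (rule measurable_time_AE)
  show "(\<lambda>t. f 0) \<in> borel_measurable (time \<tau>)" by simp
  show "AE t in time \<tau>. f 0 = f t"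
  proof (rule AE_I2)
    fix t assume "t \<in> space (time \<tau>)"
    then have "t = 0" using assms by simp
    then show "f 0 = f t" by simp
  qed
qed

locale truncated_navier_stokes = poincare_domain +
  fixes \<nu> N c :: real
    and v0 :: "real ^ 3 \<Rightarrow> real ^ 3"
    and f :: "velocity \<Rightarrow> real"
    and Z :: "real \<Rightarrow> real ^ 3 \<Rightarrow> real ^ 3"
  assumes \<nu>: "\<nu> > 0" and N: "N > 0" and v0: "v0 \<in> H_space \<Omega>" and f: "f \<in> Hm1_space \<Omega>"
    and Z: "Z \<in> L2_loc (H_space \<Omega> \<inter> L4) (HL4_norm \<Omega>)"
begin

lemma P_P: "P (P a) = P a"
  by (rule proj_id[OF subspace_W closed_W proj_in[OF subspace_W closed_W]])

lemma P_R_cong: "conv N (\<lambda>x. R (P a) x + z x) = conv N (\<lambda>x. R a x + z x)"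
  unfolding R_def P_P by (rule refl)

text \<open>By the Poincare inequality the \<open>H\<^sup>1\<close> norm on \<open>V\<close> is equivalent to the norm of the gradient, so \<open>f\<close> is a bounded
  functional of the gradient.\<close>

lemma exists_force: "\<exists>z. P z = z \<and> (\<forall>u\<in>V_space \<Omega>. f u = z \<bullet> grad_emb u)"
proof -
  have lin: "f (\<lambda>x. a *\<^sub>R u x + b *\<^sub>R w x) = a * f u + b * f w"
    if "u \<in> V_space \<Omega>" "w \<in> V_space \<Omega>" for u w a b
    using f V_space_H10[OF that(1)] V_space_H10[OF that(2)] unfolding dual_space_def by blast
  obtain C0 where C0: "\<And>u. u \<in> H10_space \<Omega> \<Longrightarrow> \<bar>f u\<bar> \<le> C0 * H1_norm \<Omega> u"
    using f unfolding dual_space_def by blast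
  define C where "C = \<bar>C0\<bar>"
  have bd: "\<bar>f u\<bar> \<le> C * norm (emb u, grad_emb u)" if u: "u \<in> V_space \<Omega>" for u
  proof -
    have "\<bar>f u\<bar> \<le> C0 * norm (emb u, grad_emb u)"
      using C0[OF V_space_H10[OF u]] H1_norm_emb[OF V_spaceD(1)[OF u]] by simp
    also have "\<dots> \<le> C * norm (emb u, grad_emb u)"
      unfolding C_def by (rule mult_right_mono) auto
    finally show ?thesis .
  qed
  have cong: "f u = f w" if uw: "u \<in> V_space \<Omega>" "w \<in> V_space \<Omega>" "grad_emb u = grad_emb w" for u w
  proof -
    note l = V_space_lin[OF uw(1,2), of 1 "-1"]
    have "emb u = emb w" by (rule emb_eq_if_grad_eq[OF uw])
    then have "(emb (\<lambda>x. 1 *\<^sub>R u x + (-1) *\<^sub>R w x), grad_emb (\<lambda>x. 1 *\<^sub>R u x + (-1) *\<^sub>R w x)) = 0"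
      using l(2,3) uw(3) by (simp add: zero_prod_def)
    then have "\<bar>f (\<lambda>x. 1 *\<^sub>R u x + (-1) *\<^sub>R w x)\<bar> \<le> 0" using bd[OF l(1)] by simp
    then show ?thesis using lin[OF uw(1,2), of 1 "-1"] by simp
  qed
  obtain K where K: "K \<ge> 0" "\<And>a. norm (incl a) \<le> norm a * K"
    using bounded_linear.nonneg_bounded[OF bounded_linear_incl] by blast
  have "bounded_linear (\<lambda>a. f (R a))"
  proof (rule bounded_linear_intro[where K="C * (K + 1)"])
    have comb: "f (R (a *\<^sub>R x + b *\<^sub>R y)) = a * f (R x) + b * f (R y)" for a b x y
    proof -
      note l = V_space_lin[OF R_V[of x] R_V[of y], of a b]
      have "f (R (a *\<^sub>R x + b *\<^sub>R y)) = f (\<lambda>z. a *\<^sub>R R x z + b *\<^sub>R R y z)"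
        by (rule cong[OF R_V l(1)]) (use l(3) bounded_linear_P in \<open>simp add: grad_R linear_simps\<close>)
      then show ?thesis using lin[OF R_V R_V] by simp
    qed
    show "f (R (x + y)) = f (R x) + f (R y)" for x y using comb[of 1 x 1 y] by simp
    show "f (R (r *\<^sub>R x)) = r *\<^sub>R f (R x)" for r x using comb[of r x 0 x] by simp
    show "norm (f (R x)) \<le> norm x * (C * (K + 1))" for x
    proof -
      have "norm (emb (R x), grad_emb (R x)) \<le> norm (incl x) + norm (P x)"
        unfolding incl_def[symmetric] grad_R by (rule norm_Pair_le)
      also have "\<dots> \<le> norm x * (K + 1)"
        using K(2)[of x] norm_proj_le[OF subspace_W closed_W, of x] by (simp add: algebra_simps)
      finally have "C * norm (emb (R x), grad_emb (R x)) \<le> C * (norm x * (K + 1))"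
        unfolding C_def by (rule mult_left_mono) simp
      then show ?thesis using bd[OF R_V[of x]] by (simp add: algebra_simps)
    qed
  qed
  then obtain z where z: "\<And>a. f (R a) = z \<bullet> a" using riesz_representation by blast
  have "f u = P z \<bullet> grad_emb u" if u: "u \<in> V_space \<Omega>" for u
  proof -
    have "f u = f (R (grad_emb u))" by (rule cong[OF u R_V]) (simp add: grad_R P_grad_emb u)
    also have "\<dots> = z \<bullet> P (grad_emb u)" by (simp add: z P_grad_emb u)
    also have "\<dots> = P z \<bullet> grad_emb u" by (rule proj_symmetric[OF subspace_W closed_W, symmetric])
    finally show ?thesis .
  qed
  then show ?thesis using P_P by blast
qed

definition force :: "matrix_lsq" where
  "force = (SOME z. P z = z \<and> (\<forall>u\<in>V_space \<Omega>. f u = z \<bullet> grad_emb u))"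

lemma P_force: "P force = force" and f_force: "u \<in> V_space \<Omega> \<Longrightarrow> f u = force \<bullet> grad_emb u"
  using someI_ex[OF exists_force] unfolding force_def by auto

text \<open>Redefined on the null set of exceptional times, so that the estimates below hold at all times.\<close>

definition Z' :: "real \<Rightarrow> real ^ 3 \<Rightarrow> real ^ 3" where
  "Z' t = (if Z t \<in> H_space \<Omega> \<inter> L4 then Z t else (\<lambda>x. 0))"

lemma Z'_in: "Z' t \<in> H_space \<Omega>" "Z' t \<in> L4" "sq_int M\<Omega> (Z' t)"
proof -
  show 1: "Z' t \<in> H_space \<Omega>" and "Z' t \<in> L4"
    using V_space_H_space[OF zero_V_space(1)] V_space_L4(1)[OF zero_V_space(1)] by (auto simp: Z'_def)
  then show "sq_int M\<Omega> (Z' t)" using H_space_iff by blast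
qed

lemma Z'_AE: assumes "\<tau> > 0" shows "AE t in time \<tau>. Z' t = Z t"
proof -
  have "AE t in time \<tau>. Z t \<in> H_space \<Omega> \<inter> L4"
    using Z assms unfolding L2_loc_def strongly_measurable_def by blast
  then show ?thesis by eventually_elim (simp add: Z'_def)
qed

lemma Z'_approximation:
  assumes "\<tau> > 0"
  obtains s where "\<And>n. simple_function (time \<tau>) (s n)"
    "\<And>n t. t \<in> {0..\<tau>} \<Longrightarrow> s n t \<in> H_space \<Omega> \<and> s n t \<in> L4"
    "AE t in time \<tau>. (\<lambda>n. HL4_norm \<Omega> (\<lambda>x. s n t x - Z' t x)) \<longlonglongrightarrow> 0"
proof -
  obtain s where s: "\<And>n. simple_function (time \<tau>) (s n)" "\<And>n. s n ` {0..\<tau>} \<subseteq> H_space \<Omega> \<inter> L4"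
    "AE t in time \<tau>. (\<lambda>n. HL4_norm \<Omega> (\<lambda>x. s n t x - Z t x)) \<longlonglongrightarrow> 0"
    using Z assms unfolding L2_loc_def strongly_measurable_def by blast
  have "AE t in time \<tau>. (\<lambda>n. HL4_norm \<Omega> (\<lambda>x. s n t x - Z' t x)) \<longlonglongrightarrow> 0"
    using s(3) Z'_AE[OF assms] by eventually_elim simp
  with s show ?thesis using that by blast
qed

lemma emb_Z'_measurable: "(\<lambda>t. emb (Z' t)) \<in> borel_measurable (time \<tau>)"
proof (cases "\<tau> > 0")
  case True
  obtain s where s: "\<And>n. simple_function (time \<tau>) (s n)"
    "\<And>n t. t \<in> {0..\<tau>} \<Longrightarrow> s n t \<in> H_space \<Omega> \<and> s n t \<in> L4"
    "AE t in time \<tau>. (\<lambda>n. HL4_norm \<Omega> (\<lambda>x. s n t x - Z' t x)) \<longlonglongrightarrow> 0"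
    using Z'_approximation[OF True] by blast
  show ?thesis
  proof (rule measurable_time_AE_lim)
    show "(\<lambda>t. emb (s n t)) \<in> borel_measurable (time \<tau>)" for n
      by (rule borel_measurable_simple_function[OF simple_function_compose1[OF s(1)]])
    have "AE t in time \<tau>. t \<in> {0..\<tau>}" by (rule AE_I2) simp
    with s(3) show "AE t in time \<tau>. (\<lambda>n. emb (s n t)) \<longlonglongrightarrow> emb (Z' t)"
    proof eventually_elim
      case (elim t)
      have sq: "sq_int M\<Omega> (s n t)" for n using s(2)[OF elim(2), of n] by (simp add: H_space_iff)
      have le: "norm (emb (s n t) - emb (Z' t)) \<le> HL4_norm \<Omega> (\<lambda>x. s n t x - Z' t x)" for n
        using Lp_norm_2_emb[OF sq_int_diff[OF sq Z'_in(3)], of n t] emb_diff[OF sq Z'_in(3), of n t]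
        by (simp add: HL4_norm_def)
      have "(\<lambda>n. emb (s n t) - emb (Z' t)) \<longlonglongrightarrow> 0"
        by (rule Lim_null_comparison[OF _ elim(1)]) (use le in auto)
      then show ?case by (rule LIM_zero_cancel)
    qed
  qed
qed (simp add: measurable_time_nonpos)

lemma HL4_Z'_sq: assumes "\<tau> > 0" shows "sq_int (time \<tau>) (\<lambda>t. HL4_norm \<Omega> (Z' t))"
proof -
  have i: "integrable (time \<tau>) (\<lambda>t. (HL4_norm \<Omega> (Z t))\<^sup>2)" using Z assms unfolding L2_loc_def by blast
  have "AE t in time \<tau>. (HL4_norm \<Omega> (Z t))\<^sup>2 = (HL4_norm \<Omega> (Z' t))\<^sup>2"
    using Z'_AE[OF assms] by eventually_elim simp
  from integral_time_AE(1)[OF i this] have i: "integrable (time \<tau>) (\<lambda>t. (HL4_norm \<Omega> (Z' t))\<^sup>2)" .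
  have "(\<lambda>t. sqrt ((HL4_norm \<Omega> (Z' t))\<^sup>2)) \<in> borel_measurable (time \<tau>)" using borel_measurable_integrable[OF i] by measurable
  then have "(\<lambda>t. HL4_norm \<Omega> (Z' t)) \<in> borel_measurable (time \<tau>)" by (simp add: HL4_norm_def)
  then show ?thesis using i by (simp add: sq_int_def)
qed

lemma emb_Z'_sq: assumes "\<tau> > 0" shows "sq_int (time \<tau>) (\<lambda>t. emb (Z' t))"
proof (rule sq_int_bound[OF emb_Z'_measurable sq_int_norm2[OF HL4_Z'_sq[OF assms]]])
  fix t
  have "norm (emb (Z' t)) \<le> HL4_norm \<Omega> (Z' t)" using Lp_norm_2_emb[OF Z'_in(3)[of t]] by (simp add: HL4_norm_def)
  then have "(norm (emb (Z' t)))\<^sup>2 \<le> (HL4_norm \<Omega> (Z' t))\<^sup>2" by (rule power_mono) simp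
  then show "(norm (emb (Z' t)))\<^sup>2 \<le> (norm (HL4_norm \<Omega> (Z' t)))\<^sup>2" by simp
qed

lemma n4_R_diff:
  assumes "e > 0" shows "\<exists>C\<ge>0. \<forall>a b. n4 (\<lambda>x. R a x - R b x) \<le> e * norm (a - b) + C * norm (incl (a - b))"
proof -
  obtain C where C: "C \<ge> 0" "\<And>u. u \<in> V_space \<Omega> \<Longrightarrow> n4 u \<le> e * norm (grad_emb u) + C * norm (emb u)"
    using n4_interpolation[OF assms] by blast
  have "n4 (\<lambda>x. R a x - R b x) \<le> e * norm (a - b) + C * norm (incl (a - b))" for a b
  proof -
    note d = V_space_diff[OF R_V[of a] R_V[of b]]
    have "grad_emb (\<lambda>x. R a x - R b x) = P (a - b)" using d(3) bounded_linear_P by (simp add: grad_R linear_simps)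
    then have 1: "norm (grad_emb (\<lambda>x. R a x - R b x)) \<le> norm (a - b)" using norm_proj_le[OF subspace_W closed_W] by simp
    have 2: "emb (\<lambda>x. R a x - R b x) = incl (a - b)"
      using d(2) bounded_linear_incl by (simp add: incl_def[symmetric] linear_simps)
    show ?thesis using C(2)[OF d(1)] mult_left_mono[OF 1, of e] assms unfolding 2 by linarith
  qed
  then show ?thesis using C(1) by blast
qed

lemma conv_add_diff:
  assumes "u \<in> L4" "w \<in> L4" "z \<in> L4" "z' \<in> L4"
  shows "norm (conv N (\<lambda>x. u x + z x) - conv N (\<lambda>x. w x + z' x))
    \<le> 3 * N * (n4 (\<lambda>x. u x - w x) + n4 (\<lambda>x. z x - z' x))"
proof -
  have L: "(\<lambda>x. u x + z x) \<in> L4" "(\<lambda>x. w x + z' x) \<in> L4"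
    using L4_add(1) assms by auto
  have e: "(\<lambda>x. (u x + z x) - (w x + z' x)) = (\<lambda>x. (u x - w x) + (z x - z' x))" by auto
  have "n4 (\<lambda>x. (u x + z x) - (w x + z' x)) \<le> n4 (\<lambda>x. u x - w x) + n4 (\<lambda>x. z x - z' x)"
    unfolding e by (rule L4_add(2)[OF L4_diff[OF assms(1,2)] L4_diff[OF assms(3,4)]])
  from mult_left_mono[OF this, of "3 * N"] conv_Lipschitz[OF N L] N show ?thesis by linarith
qed

lemma norm_conv_le: assumes "u \<in> L4" shows "norm (conv N u) \<le> N * n4 u"
proof -
  note F = F_trunc_bounds[OF N Lp_norm_nonneg[of 4 \<Omega> u]]
  have "norm (conv N u) \<le> F_trunc N (n4 u) * (n4 u * n4 u)"
    unfolding conv_def using F(1) sq_int_tensor(2)[OF assms assms] by (simp add: mult_left_mono)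
  also have "\<dots> \<le> N * n4 u" using mult_right_mono[OF F(3) Lp_norm_nonneg[of 4 \<Omega> u]] by (simp add: mult.assoc)
  finally show ?thesis .
qed

definition \<Phi>conv :: "real \<Rightarrow> matrix_lsq \<Rightarrow> matrix_lsq" where
  "\<Phi>conv t a = conv N (\<lambda>x. R a x + Z' t x)"

text \<open>The right-hand side of the equation without the viscous term. The adjoint of the embedding turns the
  inner product with \<open>Z t\<close> in \<open>H\<close> into an inner product of gradients.\<close>

definition \<Phi> :: "real \<Rightarrow> matrix_lsq \<Rightarrow> matrix_lsq" where
  "\<Phi> t a = P (\<Phi>conv t a) + c *\<^sub>R P (adjoint incl (emb (Z' t))) + force"

text \<open>With simple functions in the place of \<open>u\<close> and \<open>Z'\<close> the convection term is a simple function, and the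
  Lipschitz estimate transfers the convergence almost everywhere.\<close>

lemma \<Phi>conv_measurable:
  assumes u: "u \<in> borel_measurable (time \<tau>)" shows "(\<lambda>t. \<Phi>conv t (u t)) \<in> borel_measurable (time \<tau>)"
proof (cases "\<tau> > 0")
  case True
  obtain s where s: "\<And>n. simple_function (time \<tau>) (s n)"
    "\<And>n t. t \<in> {0..\<tau>} \<Longrightarrow> s n t \<in> H_space \<Omega> \<and> s n t \<in> L4"
    "AE t in time \<tau>. (\<lambda>n. HL4_norm \<Omega> (\<lambda>x. s n t x - Z' t x)) \<longlonglongrightarrow> 0"
    using Z'_approximation[OF True] by blast
  obtain p where p: "\<And>n. simple_function (time \<tau>) (p n)"
    "\<And>t. t \<in> {0..\<tau>} \<Longrightarrow> (\<lambda>n. p n t) \<longlonglongrightarrow> u t"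
    using borel_measurable_implies_sequence_metric[OF u, of 0] by (metis space_time)
  obtain C where C: "C \<ge> 0" "\<And>a b. n4 (\<lambda>x. R a x - R b x) \<le> 1 * norm (a - b) + C * norm (incl (a - b))"
    using n4_R_diff[of 1] by force
  show ?thesis
  proof (rule measurable_time_AE_lim)
    show "(\<lambda>t. conv N (\<lambda>x. R (p n t) x + s n t x)) \<in> borel_measurable (time \<tau>)" for n
      by (rule borel_measurable_simple_function[OF simple_function_compose2[OF p(1) s(1)]])
    have "AE t in time \<tau>. t \<in> {0..\<tau>}" by (rule AE_I2) simp
    with s(3) show "AE t in time \<tau>. (\<lambda>n. conv N (\<lambda>x. R (p n t) x + s n t x)) \<longlonglongrightarrow> \<Phi>conv t (u t)"
    proof eventually_elim
      case (elim t)
      define B where "B n = 3 * N * ((1 * norm (p n t - u t) + C * norm (incl (p n t - u t))) + HL4_norm \<Omega> (\<lambda>x. s n t x - Z' t x))" for n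
      have le: "norm (conv N (\<lambda>x. R (p n t) x + s n t x) - \<Phi>conv t (u t)) \<le> B n" for n
      proof -
        have "s n t \<in> L4" using s(2)[OF elim(2)] by blast
        note k = conv_add_diff[OF V_space_L4(1)[OF R_V] V_space_L4(1)[OF R_V] this Z'_in(2), of "p n t" "u t" t]
        have "n4 (\<lambda>x. s n t x - Z' t x) \<le> HL4_norm \<Omega> (\<lambda>x. s n t x - Z' t x)" by (simp add: HL4_norm_def)
        with C(2)[of "p n t" "u t"]
        have "n4 (\<lambda>x. R (p n t) x - R (u t) x) + n4 (\<lambda>x. s n t x - Z' t x)
          \<le> (1 * norm (p n t - u t) + C * norm (incl (p n t - u t))) + HL4_norm \<Omega> (\<lambda>x. s n t x - Z' t x)" by (rule add_mono)
        from mult_left_mono[OF this, of "3 * N"] N k show ?thesis unfolding B_def \<Phi>conv_def by linarith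
      qed
      have pu: "(\<lambda>n. p n t - u t) \<longlonglongrightarrow> 0" by (rule LIM_zero[OF p(2)[OF elim(2)]])
      have "(\<lambda>n. incl (p n t - u t)) \<longlonglongrightarrow> 0" by (rule bounded_linear.tendsto_zero[OF bounded_linear_incl pu])
      from tendsto_norm_zero[OF this] tendsto_norm_zero[OF pu] elim(1)
      have "B \<longlonglongrightarrow> 3 * N * ((1 * 0 + C * 0) + 0)" unfolding B_def by (intro tendsto_intros)
      then have "B \<longlonglongrightarrow> 0" by simp
      then have "(\<lambda>n. conv N (\<lambda>x. R (p n t) x + s n t x) - \<Phi>conv t (u t)) \<longlonglongrightarrow> 0"
        by (rule Lim_null_comparison[rotated]) (use le in auto)
      then show ?case by (rule LIM_zero_cancel)
    qed
  qed
qed (simp add: measurable_time_nonpos)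

lemma \<Phi>conv_sq:
  assumes u: "sq_int (time \<tau>) u" and \<tau>: "\<tau> > 0" shows "sq_int (time \<tau>) (\<lambda>t. \<Phi>conv t (u t))"
proof -
  obtain C where C: "C \<ge> 0" "\<And>u. u \<in> V_space \<Omega> \<Longrightarrow> n4 u \<le> 1 * norm (grad_emb u) + C * norm (emb u)"
    using n4_interpolation[OF zero_less_one] by blast
  define B where "B t = N *\<^sub>R (norm (P (u t)) + (norm (C *\<^sub>R incl (u t)) + HL4_norm \<Omega> (Z' t)))" for t
  note sq_P = sq_int_norm[OF sq_int_bounded_linear[OF bounded_linear_P u]]
    and sq_incl = sq_int_norm[OF sq_int_scaleR[OF sq_int_bounded_linear[OF bounded_linear_incl u]]]
  have B: "sq_int (time \<tau>) B"
    unfolding B_def by (rule sq_int_scaleR[OF sq_int_add[OF sq_P sq_int_add[OF sq_incl HL4_Z'_sq[OF \<tau>]]]])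
  show ?thesis
  proof (rule sq_int_bound[OF \<Phi>conv_measurable[OF sq_int_measurable[OF u]] sq_int_norm2[OF B]])
    fix t
    have "norm (\<Phi>conv t (u t)) \<le> N * n4 (\<lambda>x. R (u t) x + Z' t x)"
      unfolding \<Phi>conv_def by (rule norm_conv_le[OF L4_add(1)[OF V_space_L4(1)[OF R_V] Z'_in(2)]])
    also have "\<dots> \<le> B t"
    proof -
      have "n4 (\<lambda>x. R (u t) x + Z' t x) \<le> n4 (R (u t)) + n4 (Z' t)"
        by (rule L4_add(2)[OF V_space_L4(1)[OF R_V] Z'_in(2)])
      moreover have "n4 (R (u t)) \<le> norm (P (u t)) + norm (C *\<^sub>R incl (u t))"
        using C(2)[OF R_V[of "u t"]] C(1) by (simp add: grad_R incl_def)
      moreover have "n4 (Z' t) \<le> HL4_norm \<Omega> (Z' t)" by (simp add: HL4_norm_def)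
      ultimately show ?thesis unfolding B_def real_scaleR_def using N by (intro mult_left_mono) linarith+
    qed
    finally have "(norm (\<Phi>conv t (u t)))\<^sup>2 \<le> (B t)\<^sup>2" by (rule power_mono) simp
    then show "(norm (\<Phi>conv t (u t)))\<^sup>2 \<le> (norm (B t))\<^sup>2" by simp
  qed
qed

lemma linear_part_sq:
  assumes "\<tau> > 0" shows "sq_int (time \<tau>) (\<lambda>t. c *\<^sub>R P (adjoint incl (emb (Z' t))) + force)"
proof (intro sq_int_add)
  show "sq_int (time \<tau>) (\<lambda>t. c *\<^sub>R P (adjoint incl (emb (Z' t))))"
    by (rule sq_int_scaleR[OF sq_int_bounded_linear[OF bounded_linear_P
      sq_int_bounded_linear[OF bounded_linear_adjoint[OF bounded_linear_incl] emb_Z'_sq[OF assms]]]])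
  show "sq_int (time \<tau>) (\<lambda>t. force)" by (rule continuous_on_sq_int_time) simp
qed

lemma \<Phi>_sq:
  assumes "sq_int (time \<tau>) u" "\<tau> > 0" shows "sq_int (time \<tau>) (\<lambda>t. \<Phi> t (u t))"
  unfolding \<Phi>_def add.assoc
  by (rule sq_int_add[OF sq_int_bounded_linear[OF bounded_linear_P \<Phi>conv_sq[OF assms]] linear_part_sq[OF assms(2)]])

lemma \<Phi>_measurable_time:
  assumes u: "u \<in> borel_measurable (time \<tau>)" shows "(\<lambda>t. \<Phi> t (u t)) \<in> borel_measurable (time \<tau>)"
proof (cases "\<tau> > 0")
  case True
  have "(\<lambda>t. P (\<Phi>conv t (u t))) \<in> borel_measurable (time \<tau>)"
    using borel_measurable_continuous_onI[OF linear_continuous_on[OF bounded_linear_P]] \<Phi>conv_measurable[OF u]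
    by (rule measurable_compose_rev)
  then show ?thesis unfolding \<Phi>_def add.assoc
    by (rule borel_measurable_add) (rule sq_int_measurable[OF linear_part_sq[OF True]])
qed (simp add: measurable_time_nonpos)

lemma \<Phi>_Lipschitz_small:
  assumes e: "e > 0"
  shows "\<exists>C\<ge>0. \<forall>t a b. norm (\<Phi> t a - \<Phi> t b) \<le> e * norm (a - b) + C * norm (incl (a - b))"
proof -
  have e': "e / (3 * N) > 0" using e N by simp
  obtain C where C: "C \<ge> 0"
    "\<And>a b. n4 (\<lambda>x. R a x - R b x) \<le> e / (3 * N) * norm (a - b) + C * norm (incl (a - b))"
    using n4_R_diff[OF e'] by blast
  have "norm (\<Phi> t a - \<Phi> t b) \<le> e * norm (a - b) + (3 * N * C) * norm (incl (a - b))" for t a b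
  proof -
    have z: "n4 (\<lambda>x. Z' t x - Z' t x) = 0" by (simp add: Lp_norm_def)
    have "\<Phi> t a - \<Phi> t b = P (\<Phi>conv t a - \<Phi>conv t b)"
      using bounded_linear_P by (simp add: \<Phi>_def linear_simps)
    then have "norm (\<Phi> t a - \<Phi> t b) \<le> norm (\<Phi>conv t a - \<Phi>conv t b)"
      using norm_proj_le[OF subspace_W closed_W] by simp
    also have "\<dots> \<le> 3 * N * (n4 (\<lambda>x. R a x - R b x) + 0)"
      using conv_add_diff[OF V_space_L4(1)[OF R_V] V_space_L4(1)[OF R_V] Z'_in(2) Z'_in(2), of a t b t]
      unfolding \<Phi>conv_def z .
    also have "\<dots> \<le> 3 * N * (e / (3 * N) * norm (a - b) + C * norm (incl (a - b)))"
      using C(2)[of a b] N by (intro mult_left_mono) simp_all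
    also have "\<dots> = e * norm (a - b) + (3 * N * C) * norm (incl (a - b))"
      using N by (simp add: field_simps)
    finally show ?thesis .
  qed
  then show ?thesis using C(1) N by (intro exI[of _ "3 * N * C"]) auto
qed

sublocale semilinear_evolution incl \<nu> \<Phi>
proof (rule semilinear_evolution.intro)
  show "evolution incl \<nu>" by (rule evolution.intro[OF bounded_linear_incl \<nu>])
  show "semilinear_evolution_axioms incl \<Phi>"
    by (rule semilinear_evolution_axioms.intro)
      (use \<Phi>_measurable_time \<Phi>_sq[OF sq_int_zero] \<Phi>_Lipschitz_small in auto)
qed

lemma P_\<Phi>: "P (\<Phi> t a) = \<Phi> t a"
  using bounded_linear_P by (simp add: \<Phi>_def linear_simps P_P P_force)

lemma \<Phi>_P: "\<Phi> t (P a) = \<Phi> t a"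
  by (simp add: \<Phi>_def \<Phi>conv_def P_R_cong)

lemma inner_P_grad_emb: "\<psi> \<in> V_space \<Omega> \<Longrightarrow> P a \<bullet> grad_emb \<psi> = a \<bullet> grad_emb \<psi>"
  by (simp add: proj_symmetric[OF subspace_W closed_W] P_grad_emb)

lemma \<Phi>conv_grad_emb:
  assumes v: "v \<in> V_space \<Omega>" shows "\<Phi>conv t (grad_emb v) = conv N (\<lambda>x. v x + Z' t x)"
proof -
  define d where "d x = R (grad_emb v) x - v x" for x
  note l = V_space_diff[OF R_V[of "grad_emb v"] v, folded d_def]
  have g: "grad_emb d = 0" using l(3) by (simp add: grad_R P_grad_emb v)
  have "n4 d ^ 4 \<le> 0" using V_space_L4(2)[OF l(1)] by (simp add: g)
  then have "n4 d = 0" by (metis Lp_norm_nonneg antisym power_eq_0_iff zero_le_power)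
  moreover have "n4 (\<lambda>x. Z' t x - Z' t x) = 0" by (simp add: Lp_norm_def)
  ultimately show ?thesis
    using conv_add_diff[OF V_space_L4(1)[OF R_V[of "grad_emb v"]] V_space_L4(1)[OF v] Z'_in(2) Z'_in(2), of t t]
    unfolding \<Phi>conv_def d_def[abs_def] by simp
qed

lemma B_trunc_eq:
  assumes "v \<in> V_space \<Omega>" "\<psi> \<in> V_space \<Omega>"
  shows "B_trunc \<Omega> N (\<lambda>x. v x + Z' t x) \<psi> = - (\<Phi>conv t (grad_emb v) \<bullet> grad_emb \<psi>)"
  unfolding \<Phi>conv_grad_emb[OF assms(1)]
  by (rule B_trunc_conv[OF L4_add(1)[OF V_space_L4(1)[OF assms(1)] Z'_in(2)] V_spaceD(3)[OF assms(2)]])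

lemma L2_inner_Z':
  assumes "\<psi> \<in> V_space \<Omega>"
  shows "P (adjoint incl (emb (Z' t))) \<bullet> grad_emb \<psi> = L2_inner \<Omega> (Z' t) \<psi>"
  using bounded_linear_adjoint_works[OF bounded_linear_incl, of "emb (Z' t)" "grad_emb \<psi>"]
  by (simp add: inner_P_grad_emb assms incl_grad_emb L2_inner_emb[OF Z'_in(3) V_spaceD(2)[OF assms]])

lemma \<Phi>_inner_grad_emb:
  assumes "v \<in> V_space \<Omega>" "\<psi> \<in> V_space \<Omega>"
  shows "\<Phi> t (grad_emb v) \<bullet> grad_emb \<psi>
    = - B_trunc \<Omega> N (\<lambda>x. v x + Z' t x) \<psi> + c * L2_inner \<Omega> (Z' t) \<psi> + f \<psi>"
  unfolding \<Phi>_def inner_add_left inner_scaleR_left inner_P_grad_emb[OF assms(2), of "\<Phi>conv _ _"]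
    L2_inner_Z'[OF assms(2)] f_force[OF assms(2)] B_trunc_eq[OF assms] by simp

lemma right_hand_side_eq:
  assumes "v \<in> V_space \<Omega>" "\<psi> \<in> V_space \<Omega>"
  shows "(\<Phi> t (grad_emb v) - \<nu> *\<^sub>R grad_emb v) \<bullet> grad_emb \<psi>
    = - (\<nu> * stokes \<Omega> v \<psi> + B_trunc \<Omega> N (\<lambda>x. v x + Z' t x) \<psi> - c * L2_inner \<Omega> (Z' t) \<psi> - f \<psi>)"
  unfolding inner_diff_left \<Phi>_inner_grad_emb[OF assms] inner_scaleR_left stokes_grad_emb[OF assms] by simp

end

section \<open>Weak solutions\<close>

context truncated_navier_stokes
begin

text \<open>The projection to \<open>W\<close> of a solution is a solution with the same initial value.\<close>

lemma sol_P:
  assumes s: "sol \<tau> x0 u w" and \<tau>: "\<tau> > 0" shows "AE t in time \<tau>. P (u t) = u t"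
proof -
  note u = sol_imp[OF s]
  have "sol \<tau> x0 (\<lambda>t. P (u t)) w"
    unfolding sol_def lin_sol_def
  proof (intro conjI ballI allI)
    show "sq_int (time \<tau>) (\<lambda>t. \<Phi> t (P (u t)))" unfolding \<Phi>_P by (rule sq_int_\<Phi>[OF u(1) \<tau>])
    show "sq_int (time \<tau>) (\<lambda>t. P (u t))" by (rule sq_int_bounded_linear[OF bounded_linear_P u(1)])
    show "continuous_on {0..\<tau>} w" by (rule u(2))
    show "AE t in time \<tau>. incl (P (u t)) = w t" unfolding incl_P by (rule u(3))
    fix t d assume t: "t \<in> {0..\<tau>}"
    have "(\<Phi> s (P (u s)) - \<nu> *\<^sub>R P (u s)) \<bullet> d = (\<Phi> s (u s) - \<nu> *\<^sub>R u s) \<bullet> P d" for s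
    proof -
      have "\<Phi> s (P (u s)) - \<nu> *\<^sub>R P (u s) = P (\<Phi> s (u s) - \<nu> *\<^sub>R u s)"
        using bounded_linear_P by (simp add: \<Phi>_P P_\<Phi> linear_simps)
      then show ?thesis by (simp add: proj_symmetric[OF subspace_W closed_W])
    qed
    moreover have "w t \<bullet> incl (P d) = x0 \<bullet> incl (P d) + (LINT s|time t. (\<Phi> s (u s) - \<nu> *\<^sub>R u s) \<bullet> P d)"
      using s t unfolding sol_def lin_sol_def by blast
    ultimately show "w t \<bullet> incl d = x0 \<bullet> incl d + (LINT s|time t. (\<Phi> s (P (u s)) - \<nu> *\<^sub>R P (u s)) \<bullet> d)"
      by (simp add: incl_P)
  qed
  from sol_unique(1)[OF this s \<tau>] show ?thesis .
qed

lemma emb_v0_closure: "emb v0 \<in> closure (range incl)" by (rule H_space_closure_range[OF v0])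

lemma H_spaceD: "u \<in> H_space \<Omega> \<Longrightarrow> sq_int M\<Omega> u" by (simp add: H_space_iff)

lemma H_norm_diff: "u \<in> H_space \<Omega> \<Longrightarrow> w \<in> H_space \<Omega> \<Longrightarrow> H_norm \<Omega> (\<lambda>x. u x - w x) = norm (emb u - emb w)"
  by (simp add: Lp_norm_2_emb[OF sq_int_diff[OF H_spaceD H_spaceD]] emb_diff[OF H_spaceD H_spaceD])

lemma V_norm_diff: "u \<in> V_space \<Omega> \<Longrightarrow> w \<in> V_space \<Omega> \<Longrightarrow> V_norm \<Omega> (\<lambda>x. u x - w x) = norm (grad_emb u - grad_emb w)"
  by (simp add: V_norm_grad_emb[OF V_space_diff(1)] V_space_diff(3))

lemma functional_V_dual: "(\<lambda>\<psi>. a \<bullet> grad_emb \<psi>) \<in> V_dual \<Omega>"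
  unfolding dual_space_def
proof (intro CollectI conjI ballI allI exI)
  show "a \<bullet> grad_emb (\<lambda>x. r *\<^sub>R u x + s *\<^sub>R w x) = r * (a \<bullet> grad_emb u) + s * (a \<bullet> grad_emb w)"
    if "u \<in> V_space \<Omega>" "w \<in> V_space \<Omega>" for u w r s
    by (simp add: V_space_lin(3)[OF that] inner_simps)
  show "\<bar>a \<bullet> grad_emb u\<bar> \<le> norm a * V_norm \<Omega> u" if "u \<in> V_space \<Omega>" for u
    unfolding V_norm_grad_emb[OF that] by (rule Cauchy_Schwarz_ineq2)
qed

text \<open>The supremum is attained at the field whose gradient is the normalized projection of \<open>a\<close>.\<close>

lemma V_dual_norm_functional: "V_dual_norm \<Omega> (\<lambda>\<psi>. a \<bullet> grad_emb \<psi>) = norm (P a)"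
  unfolding dual_norm_def
proof (rule cSup_eq_maximum)
  define \<psi> where "\<psi> = R (sgn (P a))"
  have \<psi>: "\<psi> \<in> V_space \<Omega>" unfolding \<psi>_def by (rule R_V)
  have g: "grad_emb \<psi> = sgn (P a)" using bounded_linear_P by (simp add: \<psi>_def grad_R sgn_div_norm linear_simps P_P)
  have "a \<bullet> grad_emb \<psi> = P a \<bullet> sgn (P a)" using inner_P_grad_emb[OF \<psi>, of a] by (simp add: g)
  also have "\<dots> = norm (P a)" by (cases "P a = 0") (simp_all add: sgn_div_norm dot_square_norm power2_eq_square)
  finally have e: "\<bar>a \<bullet> grad_emb \<psi>\<bar> = norm (P a)" by simp
  have "V_norm \<Omega> \<psi> \<le> 1" by (simp add: V_norm_grad_emb[OF \<psi>] g norm_sgn)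
  with e \<psi> show "norm (P a) \<in> (\<lambda>u. \<bar>a \<bullet> grad_emb u\<bar>) ` {u \<in> V_space \<Omega>. V_norm \<Omega> u \<le> 1}"
    by (intro image_eqI[where x = \<psi>]) simp_all
next
  fix r assume "r \<in> (\<lambda>u. \<bar>a \<bullet> grad_emb u\<bar>) ` {u \<in> V_space \<Omega>. V_norm \<Omega> u \<le> 1}"
  then obtain u where u: "u \<in> V_space \<Omega>" "V_norm \<Omega> u \<le> 1" "r = \<bar>P a \<bullet> grad_emb u\<bar>" by (auto simp: inner_P_grad_emb)
  have "r \<le> norm (P a) * norm (grad_emb u)" unfolding u(3) by (rule Cauchy_Schwarz_ineq2)
  also have "\<dots> \<le> norm (P a) * 1" using u(2) by (intro mult_left_mono) (simp_all add: V_norm_grad_emb[OF u(1)])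
  finally show "r \<le> norm (P a)" by simp
qed

context
  fixes u :: "real \<Rightarrow> matrix_lsq" and w :: "real \<Rightarrow> vector_lsq"
  assumes uw: "\<And>\<tau>. \<tau> > 0 \<Longrightarrow> sol \<tau> (emb v0) u w"
begin

text \<open>At almost every time the field with gradient \<open>u t\<close>. At the other times \<open>w t\<close> need not have a gradient,
  and any representative of \<open>w t\<close> in \<open>H\<close> is taken, so that the result is continuous in \<open>H\<close> at all times.\<close>

definition realisation :: "real \<Rightarrow> real ^ 3 \<Rightarrow> real ^ 3" where
  "realisation t = (if incl (u t) = w t \<and> P (u t) = u t then R (u t) else (SOME h. h \<in> H_space \<Omega> \<and> emb h = w t))"

definition rate :: "real \<Rightarrow> matrix_lsq" where
  "rate t = \<Phi> t (u t) - \<nu> *\<^sub>R u t"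

lemma u_sq: "\<tau> > 0 \<Longrightarrow> sq_int (time \<tau>) u" by (rule sol_imp(1)[OF uw])

lemma rate_sq: "\<tau> > 0 \<Longrightarrow> sq_int (time \<tau>) rate"
  unfolding rate_def by (intro sq_int_diff sq_int_\<Phi> sq_int_scaleR u_sq)

lemma w_continuous: "continuous_on {0..} w" by (rule continuous_on_half_line[OF sol_imp(2)[OF uw]])

lemma w_integral:
  assumes "t \<ge> 0" shows "w t \<bullet> incl d = emb v0 \<bullet> incl d + vint (\<lambda>s. rate s \<bullet> d) t"
  using uw[of "t + 1"] assms unfolding sol_def lin_sol_def vint_def rate_def by simp

lemma w_closure: assumes "t \<ge> 0" shows "w t \<in> closure (range incl)"
  using lin_sol_energy(2)[OF uw[of "t + 1", unfolded sol_def] emb_v0_closure, of t] assms by simp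

lemma w_0: "w 0 = emb v0"
  using lin_sol_energy(3)[OF uw[of 1, unfolded sol_def] emb_v0_closure, of 0] by simp

lemma realisation_H: assumes "t \<ge> 0" shows "realisation t \<in> H_space \<Omega>" "emb (realisation t) = w t"
proof -
  have "realisation t \<in> H_space \<Omega> \<and> emb (realisation t) = w t"
  proof (cases "incl (u t) = w t \<and> P (u t) = u t")
    case True
    then show ?thesis using V_space_H_space[OF R_V[of "u t"]] by (simp add: realisation_def incl_def)
  next
    case False
    obtain h where "h \<in> H_space \<Omega>" "emb h = w t"
      using closure_sol_H_space[OF subsetD[OF range_incl_closure w_closure[OF assms]]] by blast
    then have "\<exists>h. h \<in> H_space \<Omega> \<and> emb h = w t" by blast
    then have "(SOME h. h \<in> H_space \<Omega> \<and> emb h = w t) \<in> H_space \<Omega> \<and> emb (SOME h. h \<in> H_space \<Omega> \<and> emb h = w t) = w t"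
      by (rule someI_ex)
    moreover have "realisation t = (SOME h. h \<in> H_space \<Omega> \<and> emb h = w t)"
      unfolding realisation_def by (rule if_not_P[OF False])
    ultimately show ?thesis by simp
  qed
  then show "realisation t \<in> H_space \<Omega>" "emb (realisation t) = w t" by auto
qed

lemma realisation_V:
  assumes "\<tau> > 0" shows "AE t in time \<tau>. realisation t \<in> V_space \<Omega> \<and> grad_emb (realisation t) = u t"
  using sol_imp(3)[OF uw[OF assms]] sol_P[OF uw[OF assms] assms]
proof eventually_elim
  case (elim t)
  then have "realisation t = R (u t)" by (simp add: realisation_def)
  then show ?case using R_V[of "u t"] grad_R[of "u t"] elim by simp
qed

lemma realisation_C: "realisation \<in> C_space (H_space \<Omega>) (H_norm \<Omega>)"
  unfolding C_space_def
proof (intro CollectI allI impI conjI)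
  fix t :: real assume t: "t \<ge> 0"
  show "realisation t \<in> H_space \<Omega>" by (rule realisation_H[OF t])
  have "(w \<longlongrightarrow> w t) (at t within {0..})" using w_continuous t by (simp add: continuous_on_def)
  then have l: "((\<lambda>s. norm (w s - w t)) \<longlongrightarrow> 0) (at t within {0..})"
    by (intro tendsto_norm_zero LIM_zero)
  have e: "norm (w s - w t) = H_norm \<Omega> (\<lambda>x. realisation s x - realisation t x)" if "s \<in> {0..}" for s
    using H_norm_diff[OF realisation_H(1) realisation_H(1), of s t] realisation_H(2)[of s] realisation_H(2)[OF t] that t by simp
  show "((\<lambda>s. H_norm \<Omega> (\<lambda>x. realisation s x - realisation t x)) \<longlongrightarrow> 0) (at t within {0..})"
    by (rule Lim_transform_eventually[OF l]) (use e in \<open>auto simp: eventually_at_filter\<close>)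
qed

lemma realisation_L2: "realisation \<in> L2_loc (V_space \<Omega>) (V_norm \<Omega>)"
  unfolding L2_loc_def strongly_measurable_def
proof (intro CollectI allI impI conjI)
  fix \<tau> :: real assume \<tau>: "\<tau> > 0"
  show "AE t in time \<tau>. realisation t \<in> V_space \<Omega>" using realisation_V[OF \<tau>] by eventually_elim blast
  obtain p where p: "\<And>n. simple_function (time \<tau>) (p n)"
    "\<And>t. t \<in> {0..\<tau>} \<Longrightarrow> (\<lambda>n. p n t) \<longlonglongrightarrow> u t"
    using borel_measurable_implies_sequence_metric[OF sq_int_measurable[OF u_sq[OF \<tau>]], of 0] by (metis space_time)
  show "\<exists>s. (\<forall>n. simple_function (time \<tau>) (s n) \<and> s n ` {0..\<tau>} \<subseteq> V_space \<Omega>) \<and>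
     (AE t in time \<tau>. (\<lambda>n. V_norm \<Omega> (\<lambda>x. s n t x - realisation t x)) \<longlonglongrightarrow> 0)"
  proof (intro exI conjI allI)
    show "simple_function (time \<tau>) (\<lambda>t. R (p n t))" for n by (rule simple_function_compose1[OF p(1)])
    show "(\<lambda>t. R (p n t)) ` {0..\<tau>} \<subseteq> V_space \<Omega>" for n using R_V by blast
    have "AE t in time \<tau>. t \<in> {0..\<tau>}" by (rule AE_I2) simp
    with realisation_V[OF \<tau>] show "AE t in time \<tau>. (\<lambda>n. V_norm \<Omega> (\<lambda>x. R (p n t) x - realisation t x)) \<longlonglongrightarrow> 0"
    proof eventually_elim
      case (elim t)
      then have r: "realisation t \<in> V_space \<Omega>" "grad_emb (realisation t) = u t" by auto
      have "(\<lambda>n. P (p n t)) \<longlonglongrightarrow> P (u t)" by (rule bounded_linear.tendsto[OF bounded_linear_P p(2)[OF elim(2)]])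
      then have "(\<lambda>n. norm (P (p n t) - P (u t))) \<longlonglongrightarrow> 0" by (intro tendsto_norm_zero LIM_zero)
      moreover have "P (u t) = u t" using P_grad_emb[OF r(1)] by (simp add: r(2))
      ultimately show ?case by (simp add: V_norm_diff[OF R_V r(1)] grad_R r(2))
    qed
  qed
  have "AE t in time \<tau>. (norm (u t))\<^sup>2 = (V_norm \<Omega> (realisation t))\<^sup>2"
    using realisation_V[OF \<tau>] by eventually_elim (auto simp: V_norm_grad_emb)
  from integral_time_AE(1)[OF sq_int_norm2[OF u_sq[OF \<tau>]] this]
  show "integrable (time \<tau>) (\<lambda>t. (V_norm \<Omega> (realisation t))\<^sup>2)" .
qed

lemma rate_L2: "(\<lambda>t \<psi>. rate t \<bullet> grad_emb \<psi>) \<in> L2_loc (V_dual \<Omega>) (V_dual_norm \<Omega>)"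
  unfolding L2_loc_def strongly_measurable_def
proof (intro CollectI allI impI conjI)
  fix \<tau> :: real assume \<tau>: "\<tau> > 0"
  show "AE t in time \<tau>. (\<lambda>\<psi>. rate t \<bullet> grad_emb \<psi>) \<in> V_dual \<Omega>" by (rule AE_I2) (rule functional_V_dual)
  obtain p where p: "\<And>n. simple_function (time \<tau>) (p n)"
    "\<And>t. t \<in> {0..\<tau>} \<Longrightarrow> (\<lambda>n. p n t) \<longlonglongrightarrow> rate t"
    using borel_measurable_implies_sequence_metric[OF sq_int_measurable[OF rate_sq[OF \<tau>]], of 0] by (metis space_time)
  show "\<exists>s. (\<forall>n. simple_function (time \<tau>) (s n) \<and> s n ` {0..\<tau>} \<subseteq> V_dual \<Omega>) \<and>
     (AE t in time \<tau>. (\<lambda>n. V_dual_norm \<Omega> (\<lambda>x. s n t x - rate t \<bullet> grad_emb x)) \<longlonglongrightarrow> 0)"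
  proof (intro exI conjI allI)
    show "simple_function (time \<tau>) (\<lambda>t \<psi>. p n t \<bullet> grad_emb \<psi>)" for n
      by (rule simple_function_compose1[OF p(1)])
    show "(\<lambda>t \<psi>. p n t \<bullet> grad_emb \<psi>) ` {0..\<tau>} \<subseteq> V_dual \<Omega>" for n using functional_V_dual by blast
    show "AE t in time \<tau>. (\<lambda>n. V_dual_norm \<Omega> (\<lambda>x. p n t \<bullet> grad_emb x - rate t \<bullet> grad_emb x)) \<longlonglongrightarrow> 0"
    proof (rule AE_I2)
      fix t assume "t \<in> space (time \<tau>)"
      then have "(\<lambda>n. p n t - rate t) \<longlonglongrightarrow> 0" by (intro LIM_zero p(2)) simp
      then have "(\<lambda>n. norm (P (p n t - rate t))) \<longlonglongrightarrow> 0"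
        by (intro tendsto_norm_zero bounded_linear.tendsto_zero[OF bounded_linear_P])
      then show "(\<lambda>n. V_dual_norm \<Omega> (\<lambda>x. p n t \<bullet> grad_emb x - rate t \<bullet> grad_emb x)) \<longlonglongrightarrow> 0"
        unfolding inner_diff_left[symmetric] V_dual_norm_functional .
    qed
  qed
  show "integrable (time \<tau>) (\<lambda>t. (V_dual_norm \<Omega> (\<lambda>\<psi>. rate t \<bullet> grad_emb \<psi>))\<^sup>2)"
    unfolding V_dual_norm_functional by (rule sq_int_norm2[OF sq_int_bounded_linear[OF bounded_linear_P rate_sq[OF \<tau>]]])
qed

lemma realisation_time_deriv: "has_time_deriv \<Omega> realisation (\<lambda>t \<psi>. rate t \<bullet> grad_emb \<psi>)"
  unfolding has_time_deriv_def
proof (intro ballI)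
  fix \<eta> :: "real \<Rightarrow> real" and \<psi> assume \<eta>: "\<eta> \<in> Cc_infinity {0<..}" and \<psi>: "\<psi> \<in> V_space \<Omega>"
  show "(LINT t|lebesgue_on {0<..}. deriv \<eta> t * L2_inner \<Omega> (realisation t) \<psi>)
    = - (LINT t|lebesgue_on {0<..}. \<eta> t * (rate t \<bullet> grad_emb \<psi>))"
  proof (rule test_integration_by_parts[OF \<eta>])
    show "integrable (time \<tau>) (\<lambda>t. rate t \<bullet> grad_emb \<psi>)" if "\<tau> > 0" for \<tau>
      using sq_int_integrable_time[OF rate_sq[OF that]] by (rule integrable_inner_left)
    show "L2_inner \<Omega> (realisation t) \<psi> = emb v0 \<bullet> emb \<psi> + vint (\<lambda>t. rate t \<bullet> grad_emb \<psi>) t" if "t \<ge> 0" for t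
      using w_integral[OF that, of "grad_emb \<psi>"]
      by (simp add: incl_grad_emb[OF \<psi>] L2_inner_emb[OF H_spaceD[OF realisation_H(1)[OF that]] V_spaceD(2)[OF \<psi>]] realisation_H(2)[OF that])
  qed
qed

lemma realisation_equation:
  assumes \<psi>: "\<psi> \<in> V_space \<Omega>"
  shows "AE t in lebesgue_on {0..}. rate t \<bullet> grad_emb \<psi>
    = - (\<nu> * stokes \<Omega> (realisation t) \<psi> + B_trunc \<Omega> N (\<lambda>x. realisation t x + Z t x) \<psi>
         - c * L2_inner \<Omega> (Z t) \<psi> - f \<psi>)"
proof (rule AE_half_line)
  fix \<tau> :: real assume \<tau>: "\<tau> > 0"
  show "AE t in time \<tau>. rate t \<bullet> grad_emb \<psi>
    = - (\<nu> * stokes \<Omega> (realisation t) \<psi> + B_trunc \<Omega> N (\<lambda>x. realisation t x + Z t x) \<psi>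
         - c * L2_inner \<Omega> (Z t) \<psi> - f \<psi>)"
    using realisation_V[OF \<tau>] Z'_AE[OF \<tau>]
  proof eventually_elim
    case (elim t)
    then have r: "realisation t \<in> V_space \<Omega>" "grad_emb (realisation t) = u t" by auto
    show ?case using right_hand_side_eq[OF r(1) \<psi>, of t] unfolding r(2) elim(2) rate_def .
  qed
qed

lemma realisation_weak_solution: "weak_solution \<Omega> \<nu> N c f Z v0 realisation"
  unfolding weak_solution_def
proof (intro conjI bexI[of _ "\<lambda>t \<psi>. rate t \<bullet> grad_emb \<psi>"] ballI)
  show "AE x in M\<Omega>. realisation 0 x = v0 x"
    by (rule AE_eq_if_emb_eq[OF H_spaceD[OF realisation_H(1)] H_spaceD[OF v0]]) (simp_all add: realisation_H(2) w_0)
qed (fact realisation_C realisation_L2 rate_L2 realisation_time_deriv | rule realisation_equation, assumption)+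

text \<open>The energy equality of the linear equation with right-hand side \<open>\<Phi> t (u t)\<close>, whose inner product with
  \<open>u t\<close> splits into the three terms of the statement.\<close>

lemma realisation_energy:
  assumes \<tau>: "\<tau> > 0" and t: "t \<in> {0..\<tau>}"
  defines "b \<equiv> \<lambda>s. B_trunc \<Omega> N (\<lambda>x. realisation s x + Z s x) (realisation s)"
    and "l \<equiv> \<lambda>s. L2_inner \<Omega> (Z s) (realisation s)"
    and "F \<equiv> \<lambda>s. f (realisation s)"
    and "V \<equiv> \<lambda>s. (V_norm \<Omega> (realisation s))\<^sup>2"
  shows "integrable (time t) V" "integrable (time t) b" "integrable (time t) F" "integrable (time t) l"
    "(H_norm \<Omega> (realisation t))\<^sup>2 + 2 * \<nu> * (LINT s|time t. V s) + 2 * (LINT s|time t. b s)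
     = (H_norm \<Omega> v0)\<^sup>2 + 2 * (LINT s|time t. F s) + 2 * c * (LINT s|time t. l s)"
proof -
  have t\<tau>: "t \<le> \<tau>" using t by simp
  have ae: "AE s in time \<tau>. realisation s \<in> V_space \<Omega> \<and> grad_emb (realisation s) = u s \<and> Z' s = Z s \<and> s \<in> {0..\<tau>}"
    using realisation_V[OF \<tau>] Z'_AE[OF \<tau>] AE_space[of "time \<tau>"] by eventually_elim simp
  have aeV: "AE s in time \<tau>. (norm (u s))\<^sup>2 = V s"
    using ae by eventually_elim (auto simp: V_def V_norm_grad_emb)
  have aeF: "AE s in time \<tau>. force \<bullet> u s = F s"
    using ae by eventually_elim (auto simp: F_def f_force)
  have aeb: "AE s in time \<tau>. - (\<Phi>conv s (u s) \<bullet> u s) = b s"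
    using ae
  proof eventually_elim
    case (elim s)
    then show ?case using B_trunc_eq[of "realisation s" "realisation s" s] by (simp add: b_def)
  qed
  have ael: "AE s in time \<tau>. emb (Z' s) \<bullet> w s = l s"
    using ae
  proof eventually_elim
    case (elim s)
    then show ?case using L2_inner_emb[OF Z'_in(3)[of s] V_spaceD(2)[of "realisation s"]] realisation_H(2)[of s]
      by (simp add: l_def)
  qed
  have ae\<Phi>: "AE s in time \<tau>. \<Phi> s (u s) \<bullet> u s = - b s + c * l s + F s"
    using ae
  proof eventually_elim
    case (elim s)
    then show ?case using \<Phi>_inner_grad_emb[of "realisation s" "realisation s" s] by (simp add: b_def l_def F_def)
  qed
  have wsq: "sq_int (time \<tau>) w"
    by (rule continuous_on_sq_int_time[OF continuous_on_subset[OF w_continuous]]) auto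
  note iV = integral_time_AE[OF integrable_time_mono[OF sq_int_norm2[OF u_sq[OF \<tau>]] t\<tau>] AE_time_mono[OF aeV t\<tau>]]
  note ib = integral_time_AE[OF integrable_time_mono[OF integrable_minus[OF integrable_inner_sq_int[OF \<Phi>conv_sq[OF u_sq[OF \<tau>] \<tau>] u_sq[OF \<tau>]]] t\<tau>] AE_time_mono[OF aeb t\<tau>]]
  note il = integral_time_AE[OF integrable_time_mono[OF integrable_inner_sq_int[OF emb_Z'_sq[OF \<tau>] wsq] t\<tau>] AE_time_mono[OF ael t\<tau>]]
  note iF = integral_time_AE[OF integrable_time_mono[OF integrable_inner_right[OF sq_int_integrable_time[OF u_sq[OF \<tau>]]] t\<tau>] AE_time_mono[OF aeF t\<tau>]]
  note i\<Phi> = integral_time_AE[OF integrable_time_mono[OF integrable_inner_sq_int[OF sq_int_\<Phi>[OF u_sq[OF \<tau>] \<tau>] u_sq[OF \<tau>]] t\<tau>] AE_time_mono[OF ae\<Phi> t\<tau>]]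
  show "integrable (time t) V" "integrable (time t) b" "integrable (time t) F" "integrable (time t) l"
    using iV(1) ib(1) iF(1) il(1) by auto
  have "energy_eq t (emb v0) (\<lambda>s. \<Phi> s (u s)) u w"
    by (rule lin_sol_energy(1)[OF uw[OF \<tau>, unfolded sol_def] emb_v0_closure \<tau> t])
  then have E: "(norm (w t))\<^sup>2 + 2 * \<nu> * (LINT s|time t. V s)
     = (norm (emb v0))\<^sup>2 + 2 * (LINT s|time t. - b s + c * l s + F s)"
    unfolding energy_eq_def iV(2) i\<Phi>(2) .
  have S: "(LINT s|time t. - b s + c * l s + F s) = - (LINT s|time t. b s) + c * (LINT s|time t. l s) + (LINT s|time t. F s)"
    using ib(1) il(1) iF(1) by simp
  have n: "H_norm \<Omega> (realisation t) = norm (w t)" "H_norm \<Omega> v0 = norm (emb v0)"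
    using Lp_norm_2_emb[OF H_spaceD[OF realisation_H(1)]] realisation_H(2) t Lp_norm_2_emb[OF H_spaceD[OF v0]] by simp_all
  show "(H_norm \<Omega> (realisation t))\<^sup>2 + 2 * \<nu> * (LINT s|time t. V s) + 2 * (LINT s|time t. b s)
     = (H_norm \<Omega> v0)\<^sup>2 + 2 * (LINT s|time t. F s) + 2 * c * (LINT s|time t. l s)"
    using E unfolding S n by (simp add: algebra_simps)
qed

end

text \<open>Tested with the field \<open>R d\<close>, the distributional equation integrates to the abstract equation tested with
  \<open>P d\<close>. Replacing \<open>P d\<close> by \<open>d\<close> is possible since all terms of the equation lie in \<open>W\<close>.\<close>

lemma weak_solution_imp_sol:
  assumes q: "weak_solution \<Omega> \<nu> N c f Z v0 q" and \<tau>: "\<tau> > 0"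
  shows "sol \<tau> (emb v0) (\<lambda>t. grad_emb (q t)) (\<lambda>t. emb (q t))"
proof -
  obtain dv where qC: "q \<in> C_space (H_space \<Omega>) (H_norm \<Omega>)" and qL: "q \<in> L2_loc (V_space \<Omega>) (V_norm \<Omega>)"
    and q0: "AE x in M\<Omega>. q 0 x = v0 x" and dt: "has_time_deriv \<Omega> q dv"
    and eq: "\<And>\<psi>. \<psi> \<in> V_space \<Omega> \<Longrightarrow> AE t in lebesgue_on {0..}.
           dv t \<psi> = - (\<nu> * stokes \<Omega> (q t) \<psi> + B_trunc \<Omega> N (\<lambda>x. q t x + Z t x) \<psi> - c * L2_inner \<Omega> (Z t) \<psi> - f \<psi>)"
    using q unfolding weak_solution_def by blast
  have qH: "q t \<in> H_space \<Omega>" if "t \<ge> 0" for t using qC that unfolding C_space_def by blast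
  have qV: "AE t in time \<tau>. q t \<in> V_space \<Omega>" if "\<tau> > 0" for \<tau>
    using qL that unfolding L2_loc_def strongly_measurable_def by blast
  have meas: "(\<lambda>t. grad_emb (q t)) \<in> borel_measurable (time \<tau>)" if \<tau>: "\<tau> > 0" for \<tau>
  proof -
    obtain s where s: "\<And>n. simple_function (time \<tau>) (s n)" "\<And>n. s n ` {0..\<tau>} \<subseteq> V_space \<Omega>"
      "AE t in time \<tau>. (\<lambda>n. V_norm \<Omega> (\<lambda>x. s n t x - q t x)) \<longlonglongrightarrow> 0"
      using qL \<tau> unfolding L2_loc_def strongly_measurable_def by blast
    show ?thesis
    proof (rule measurable_time_AE_lim)
      show "(\<lambda>t. grad_emb (s n t)) \<in> borel_measurable (time \<tau>)" for n
        by (rule borel_measurable_simple_function[OF simple_function_compose1[OF s(1)]])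
      have "AE t in time \<tau>. t \<in> {0..\<tau>}" by (rule AE_I2) simp
      with s(3) qV[OF \<tau>] show "AE t in time \<tau>. (\<lambda>n. grad_emb (s n t)) \<longlonglongrightarrow> grad_emb (q t)"
      proof eventually_elim
        case (elim t)
        have "V_norm \<Omega> (\<lambda>x. s n t x - q t x) = norm (grad_emb (s n t) - grad_emb (q t))" for n
          by (rule V_norm_diff[OF subsetD[OF s(2) imageI[OF elim(3)]] elim(2)])
        then have "(\<lambda>n. norm (grad_emb (s n t) - grad_emb (q t))) \<longlonglongrightarrow> 0" using elim(1) by simp
        then show ?case by (rule LIM_zero_cancel[OF tendsto_norm_zero_cancel])
      qed
    qed
  qed
  have a_sq: "sq_int (time \<tau>) (\<lambda>t. grad_emb (q t))" if \<tau>: "\<tau> > 0" for \<tau>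
  proof -
    have "integrable (time \<tau>) (\<lambda>t. (V_norm \<Omega> (q t))\<^sup>2)" using qL \<tau> unfolding L2_loc_def by blast
    moreover have "AE t in time \<tau>. (V_norm \<Omega> (q t))\<^sup>2 = (norm (grad_emb (q t)))\<^sup>2"
      using qV[OF \<tau>] by eventually_elim (simp add: V_norm_grad_emb)
    ultimately have "integrable (time \<tau>) (\<lambda>t. (norm (grad_emb (q t)))\<^sup>2)" by (rule integral_time_AE(1))
    then show ?thesis using meas[OF \<tau>] by (simp add: sq_int_def)
  qed
  have cont: "continuous_on {0..} (\<lambda>t. emb (q t))"
    unfolding continuous_on_def
  proof
    fix t :: real assume t: "t \<in> {0..}"
    have l: "((\<lambda>s. H_norm \<Omega> (\<lambda>x. q s x - q t x)) \<longlongrightarrow> 0) (at t within {0..})"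
      using qC t unfolding C_space_def by simp
    have e: "H_norm \<Omega> (\<lambda>x. q s x - q t x) = norm (emb (q s) - emb (q t))" if "s \<in> {0..}" for s
      using H_norm_diff[OF qH qH, of s t] that t by simp
    have "((\<lambda>s. norm (emb (q s) - emb (q t))) \<longlongrightarrow> 0) (at t within {0..})"
      by (rule Lim_transform_eventually[OF l]) (use e in \<open>auto simp: eventually_at_filter\<close>)
    then show "((\<lambda>s. emb (q s)) \<longlongrightarrow> emb (q t)) (at t within {0..})"
      by (rule LIM_zero_cancel[OF tendsto_norm_zero_cancel])
  qed
  define h where "h t = \<Phi> t (grad_emb (q t)) - \<nu> *\<^sub>R grad_emb (q t)" for t
  have h_sq: "sq_int (time \<tau>) h" if \<tau>: "\<tau> > 0" for \<tau>
    unfolding h_def by (rule sq_int_diff[OF sq_int_\<Phi>[OF a_sq[OF \<tau>] \<tau>] sq_int_scaleR[OF a_sq[OF \<tau>]]])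
  have emb0: "emb (q 0) = emb v0"
    by (rule emb_cong_AE[OF H_spaceD[OF qH] H_spaceD[OF v0] q0]) simp
  have form: "emb (q t) \<bullet> incl d = emb v0 \<bullet> incl d + vint (\<lambda>s. h s \<bullet> P d) t" if t: "t \<ge> 0" for t d
  proof -
    have y: "L2_inner \<Omega> (q t) (R d) = emb (q t) \<bullet> incl d" if "t \<ge> 0" for t
      using L2_inner_emb[OF H_spaceD[OF qH[OF that]] V_spaceD(2)[OF R_V]] by (simp add: incl_def)
    have hd_sq: "sq_int (time \<tau>) (\<lambda>t. h t \<bullet> P d)" if "\<tau> > 0" for \<tau>
      by (rule sq_int_bounded_linear[OF bounded_linear_inner_left h_sq[OF that]])
    have "emb (q t) \<bullet> incl d = emb (q 0) \<bullet> incl d + vint (\<lambda>s. h s \<bullet> P d) t"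
    proof (rule integral_form_if_weak_derivative[OF _ _ _ t])
      show "continuous_on {0..} (\<lambda>t. emb (q t) \<bullet> incl d)" by (intro continuous_intros cont)
      show "integrable (time \<tau>) (\<lambda>s. h s \<bullet> P d)" if "\<tau> > 0" for \<tau> by (rule sq_int_integrable_time[OF hd_sq[OF that]])
      fix \<eta> :: "real \<Rightarrow> real" assume \<eta>: "\<eta> \<in> Cc_infinity {0<..}"
      obtain \<tau> where \<tau>: "\<tau> > 0" "\<And>t. t \<notin> {0<..<\<tau>} \<Longrightarrow> \<eta> t = 0 \<and> deriv \<eta> t = 0" using test_function_time(4)[OF \<eta>] by blast
      have "(LINT t|lebesgue_on {0<..}. deriv \<eta> t * (emb (q t) \<bullet> incl d)) = (LINT t|lebesgue_on {0<..}. deriv \<eta> t * L2_inner \<Omega> (q t) (R d))"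
        by (rule Bochner_Integration.integral_cong) (simp_all add: y)
      also have "\<dots> = - (LINT t|lebesgue_on {0<..}. \<eta> t * dv t (R d))"
        using dt \<eta> R_V unfolding has_time_deriv_def by blast
      also have "(LINT t|lebesgue_on {0<..}. \<eta> t * dv t (R d)) = (LINT t|time \<tau>. \<eta> t * dv t (R d))"
        by (rule integral_positive_half_line) (simp add: \<tau>(2))
      also have "\<dots> = (LINT t|time \<tau>. \<eta> t * (h t \<bullet> P d))"
      proof (rule integral_time_AE(2))
        have "continuous_on {0..\<tau>} \<eta>" using \<eta> by (auto simp: Cc_infinity_iff intro: smooth_continuous)
        then have "sq_int (time \<tau>) \<eta>" by (rule continuous_on_sq_int_time)
        then show "integrable (time \<tau>) (\<lambda>t. \<eta> t * (h t \<bullet> P d))" by (rule integrable_mult_sq_int[OF _ hd_sq[OF \<tau>(1)]])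
        show "AE t in time \<tau>. \<eta> t * (h t \<bullet> P d) = \<eta> t * dv t (R d)"
          using qV[OF \<tau>(1)] Z'_AE[OF \<tau>(1)] AE_half_line_time[OF eq[OF R_V[of d]], of \<tau>]
        proof eventually_elim
          case (elim t)
          then show ?case using right_hand_side_eq[OF elim(1) R_V[of d], of t] by (simp add: h_def grad_R)
        qed
      qed
      also have "\<dots> = (LINT t|lebesgue_on {0<..}. \<eta> t * (h t \<bullet> P d))"
        by (rule integral_positive_half_line[symmetric]) (simp add: \<tau>(2))
      finally show "(LINT t|lebesgue_on {0<..}. deriv \<eta> t * (emb (q t) \<bullet> incl d)) = - (LINT t|lebesgue_on {0<..}. \<eta> t * (h t \<bullet> P d))" .
    qed
    then show ?thesis unfolding emb0 .
  qed
  show ?thesis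
    unfolding sol_def lin_sol_def
  proof (intro conjI ballI allI)
    show "sq_int (time \<tau>) (\<lambda>t. \<Phi> t (grad_emb (q t)))" by (rule sq_int_\<Phi>[OF a_sq[OF \<tau>] \<tau>])
    show "sq_int (time \<tau>) (\<lambda>t. grad_emb (q t))" by (rule a_sq[OF \<tau>])
    show "continuous_on {0..\<tau>} (\<lambda>t. emb (q t))" by (rule continuous_on_subset[OF cont]) auto
    show "AE t in time \<tau>. incl (grad_emb (q t)) = emb (q t)"
      using qV[OF \<tau>] by eventually_elim (rule incl_grad_emb)
    fix t d assume t: "t \<in> {0..\<tau>}"
    have "(LINT s|time t. h s \<bullet> d) = vint (\<lambda>s. h s \<bullet> P d) t"
      unfolding vint_def
    proof (rule integral_time_AE(2))
      show "integrable (time t) (\<lambda>s. h s \<bullet> P d)"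
        by (rule integrable_inner_left[OF sq_int_integrable_time[OF sq_int_time_mono[OF h_sq[OF \<tau>]]]]) (use t in simp)
      have "AE s in time t. q s \<in> V_space \<Omega>" by (rule AE_time_mono[OF qV[OF \<tau>]]) (use t in simp)
      then show "AE s in time t. h s \<bullet> P d = h s \<bullet> d"
      proof eventually_elim
        case (elim s)
        have "P (h s) = h s" using bounded_linear_P by (simp add: h_def linear_simps P_\<Phi> P_grad_emb[OF elim])
        then show ?case using proj_symmetric[OF subspace_W closed_W, of "h s" d] by simp
      qed
    qed
    then show "emb (q t) \<bullet> incl d = emb v0 \<bullet> incl d + (LINT s|time t. (\<Phi> s (grad_emb (q s)) - \<nu> *\<^sub>R grad_emb (q s)) \<bullet> d)"
      using form[of t d] t by (simp add: h_def)
  qed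
qed

lemma weak_solutions_AE_equal:
  assumes q: "weak_solution \<Omega> \<nu> N c f Z v0 q" and r: "weak_solution \<Omega> \<nu> N c f Z v0 r" and t: "t \<ge> 0"
  shows "AE x in M\<Omega>. q t x = r t x"
proof (rule AE_eq_if_emb_eq)
  show "sq_int M\<Omega> (q t)" "sq_int M\<Omega> (r t)"
    using q r t unfolding weak_solution_def C_space_def by (auto intro: H_spaceD)
  show "emb (q t) = emb (r t)"
    using sol_unique(2)[OF weak_solution_imp_sol[OF q] weak_solution_imp_sol[OF r], of "t + 1"] t by simp
qed

end

text \<open>Global solvability of the abstract equation gives \<open>u\<close> and \<open>w\<close>; their realisation is the weak solution.\<close>

theorem theorem3p7:
  fixes \<Omega> :: "(real ^ 3) set"
    and \<nu> N c :: real
    and v0 :: "real ^ 3 \<Rightarrow> real ^ 3"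
    and f :: "(real ^ 3 \<Rightarrow> real ^ 3) \<Rightarrow> real"
    and Z :: "real \<Rightarrow> real ^ 3 \<Rightarrow> real ^ 3"
  assumes "open \<Omega>" and "connected \<Omega>" and "\<not> bounded \<Omega>"
    and "uniformly_Ck_boundary 3 \<Omega>"
    and "\<exists>l>0. \<forall>\<psi> \<in> H10_space \<Omega>.
           l * (LINT x|lebesgue_on \<Omega>. (norm (\<psi> x))\<^sup>2)
             \<le> (LINT x|lebesgue_on \<Omega>. (norm (weak_grad \<Omega> \<psi> x))\<^sup>2)"
    and "\<nu> > 0" and "N > 0" and "c \<ge> 0"
    and "v0 \<in> H_space \<Omega>"
    and "f \<in> Hm1_space \<Omega>"
    and "Z \<in> L2_loc (H_space \<Omega> \<inter> Lp_space 4 \<Omega>) (HL4_norm \<Omega>)"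
  shows "\<exists>v. weak_solution \<Omega> \<nu> N c f Z v0 v \<and>
             (\<forall>w. weak_solution \<Omega> \<nu> N c f Z v0 w \<longrightarrow>
                (\<forall>t\<ge>0. AE x in lebesgue_on \<Omega>. w t x = v t x)) \<and>
             (\<forall>T>0. \<forall>t \<in> {0..T}.
                integrable (lebesgue_on {0..t}) (\<lambda>s. (V_norm \<Omega> (v s))\<^sup>2) \<and>
                integrable (lebesgue_on {0..t}) (\<lambda>s. B_trunc \<Omega> N (\<lambda>x. v s x + Z s x) (v s)) \<and>
                integrable (lebesgue_on {0..t}) (\<lambda>s. f (v s)) \<and>
                integrable (lebesgue_on {0..t}) (\<lambda>s. L2_inner \<Omega> (Z s) (v s)) \<and>
                (H_norm \<Omega> (v t))\<^sup>2
                  + 2 * \<nu> * (LINT s|lebesgue_on {0..t}. (V_norm \<Omega> (v s))\<^sup>2)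
                  + 2 * (LINT s|lebesgue_on {0..t}. B_trunc \<Omega> N (\<lambda>x. v s x + Z s x) (v s))
                = (H_norm \<Omega> v0)\<^sup>2
                  + 2 * (LINT s|lebesgue_on {0..t}. f (v s))
                  + 2 * c * (LINT s|lebesgue_on {0..t}. L2_inner \<Omega> (Z s) (v s)))"
proof -
  interpret truncated_navier_stokes \<Omega> \<nu> N c v0 f Z
    by unfold_locales (fact assms)+
  obtain u w where uw: "\<And>\<tau>. \<tau> > 0 \<Longrightarrow> sol \<tau> (emb v0) u w"
    using global_sol_exists[OF emb_v0_closure] by blast
  show ?thesis
  proof (intro exI[of _ "realisation u w"] conjI allI impI ballI)
    show "weak_solution \<Omega> \<nu> N c f Z v0 (realisation u w)" by (rule realisation_weak_solution[OF uw])
    then show "AE x in M\<Omega>. q t x = realisation u w t x" if "weak_solution \<Omega> \<nu> N c f Z v0 q" "t \<ge> 0" for q t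
      by (rule weak_solutions_AE_equal[OF that(1) _ that(2)])
  qed (rule realisation_energy[OF uw]; assumption)+
qed

end
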